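(* Let $K$ be a local field of characteristic $p$ with perfect residue field $\mathbb{F}$, let $n\ge 2$, and let $L/K$ be a totally ramified $C_p^n$-extension with a single ramification break $b>0$. Let $(\beta,\vec{\omega},\vec{\epsilon})$ be Artin–Schreier data for $L/K$ such that $\omega_1=1$ and $\epsilon_1=0$. For $2\le i\le n$ set $e_i=-v_K(\epsilon_i)$, and assume that $e_n<b/p^{n-2}$ and $e_i<e_n$ for $2\le i\le n-1$. Let $$b_*=\min\{(b-e_n)p^{n-1}+b,\;bp^{n-1}\},\qquad B_1=\{b,bp,\ldots,bp^{n-2},b_*\}.$$ Then for every $k$ with $2\le k\le p$, the set of VC$_k$-refined breaks of $L/K$ is defined and equal to $B_1$, and the set of SS$_k$-refined breaks of $L/K$ is equal to $B_1$.
   Context: A local field is a complete discretely valued field; $K$ has characteristic $p$ and perfect residue field $\mathbb{F}$, so $K\cong\mathbb{F}((t))$ and we regard $\mathbb{F}\subset K$. $v_K,v_L$ are the normalized valuations ($v(0)=\infty$; so $-v_K(0)=-\infty$). $C_p$ is the cyclic group of order $p$. $L/K$ is totally ramified Galois with $G=\mathrm{Gal}(L/K)\cong C_p^n$ and a single (lower, equivalently upper) ramification break $b>0$ (then $p\nmid b$). Artin–Schreier data for $L/K$: a triple $(\beta,\vec{\omega},\vec{\epsilon})$ with $\beta\in K$, $v_K(\beta)=-b$, $\vec{\omega}=(\omega_1,\ldots,\omega_n)^T\in\mathbb{F}^n$ with $\omega_1,\ldots,\omega_n$ linearly independent over $\mathbb{F}_p$, and $\vec{\epsilon}=(\epsilon_1,\ldots,\epsilon_n)^T\in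 K^n$ with $v_K(\epsilon_i)>-b$ and, for each $i$, either $v_K(\epsilon_i)<0$ and $p\nmid v_K(\epsilon_i)$, or $\epsilon_i\in\mathbb{F}$, such that $L=K(x_1,\ldots,x_n)$ where $x_i$ in the separable closure of $K$ satisfies $x_i^p-x_i=\omega_i^{p^n}\beta+\epsilon_i$. Refined breaks. Let $R=\mathbb{F}[G]$ (acting $K$-linearly on $L$) with augmentation ideal $A$. Fix $2\le k\le p$ and set $\overline{R}=R/A^k$, $\overline{\gamma}=\gamma+A^k$. For $\gamma\in 1+A$ and $\omega\in\mathbb{F}$ define the truncated power $\gamma^{[\omega]}=\sum_{i=0}^{p-1}\binom{\omega}{i}(\gamma-1)^i$, where $\binom{\omega}{i}=\omega(\omega-1)\cdots(\omega-i+1)/i!$. The multiplicative group $(1+A)/(1+A^k)$, identified with the image of $1+A$ in $\overline{R}^\times$, is an $\mathbb{F}$-vector space with scalar multiplication $\omega\cdot\overline{\gamma}=\overline{\gamma^{[\omega]}}$; let $\overline{G}^{[\mathbb{F}]}$ be the $\mathbb{F}$-span of the image of $G$ in it. VC$_k$: a valuation criterion element is $\rho\in L$ with $v_L(\rho)\equiv b\pmod{p^n}$ (such $\rho$ generates a normal basis of $L/K$). For $\overline{\gamma}\in\overline{G}^{[\mathbb{F}]}$ put $i_\rho(\overline{\gamma})=\max\{v_L((\gamma'-1)(\rho)):\gamma'\in\overline{\gamma}\}$ and $B_{\rho,k}=\{i_\rho(\overline{\gamma})-v_L(\rho):\overline{\gamma}\in\overline{G}^{[\mathbb{F}]},\ \overline{\gamma}\ne\overline{1}\}$.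 If $B_{\rho,k}$ is the same set for all valuation criterion elements $\rho$, the VC$_k$-refined breaks of $L/K$ are said to be defined, and are the elements of this common set. SS$_k$: for $\gamma\in R$ let $\hat v_L(\gamma)=\min\{v_L(\gamma(x))-v_L(x):x\in L^\times\}$, and for $\overline{\gamma}\in\overline{R}$ let $\hat v_L(\overline{\gamma})=\max\{\hat v_L(\gamma'):\gamma'\in\overline{\gamma}\}$. For $h\ge 0$ let $\overline{G}^{[\mathbb{F}]}_h=\{\overline{\gamma}\in\overline{G}^{[\mathbb{F}]}:\hat v_L(\overline{\gamma}-\overline{1})\ge h\}$. An integer $h\ge0$ is an SS$_k$-refined break of $L/K$ if $\overline{G}^{[\mathbb{F}]}_{h+1}\ne\overline{G}^{[\mathbb{F}]}_h$. *)

theory Defs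
  imports
    Complex_Main
    "HOL-Library.Extended_Real"
    "HOL-Number_Theory.Cong"
    "HOL-Algebra.Algebra"
    "HOL-Algebra.Algebraic_Closure_Type"
begin

text \<open>
  The top field \<open>L\<close> of the extension is the whole type \<open>'a :: field\<close>; the base field \<open>K\<close> and the
  constant field \<open>F\<close> are subfields given as sets.  The roots of the Artin--Schreier equations lie
  in \<open>L\<close>, so no separable closure is needed.
\<close>

abbreviation top_field :: "'a::field ring"
  where "top_field \<equiv> ring_of_type_algebra"

section \<open>Local fields\<close>

text \<open>Only the values on \<open>K\<close> matter.  Valuations take values in \<open>ereal\<close> so that \<open>v(0) = \<infinity>\<close>.\<close>

definition normalized_valuation :: "'a::field set \<Rightarrow> ('a \<Rightarrow> ereal) \<Rightarrow> bool" where
  "normalized_valuation K v \<longleftrightarrow>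
     v 0 = \<infinity> \<and>
     (\<forall>x\<in>K. x \<noteq> 0 \<longrightarrow> (\<exists>m::int. v x = ereal (of_int m))) \<and>
     (\<exists>x\<in>K. v x = 1) \<and>
     (\<forall>x\<in>K. \<forall>y\<in>K. v (x * y) = v x + v y) \<and>
     (\<forall>x\<in>K. \<forall>y\<in>K. v (x + y) \<ge> min (v x) (v y))"

definition valuation_complete :: "'a::field set \<Rightarrow> ('a \<Rightarrow> ereal) \<Rightarrow> bool" where
  "valuation_complete K v \<longleftrightarrow>
     (\<forall>s :: nat \<Rightarrow> 'a.
        range s \<subseteq> K \<and> (\<forall>C::real. \<exists>N. \<forall>i\<ge>N. \<forall>j\<ge>N. v (s i - s j) \<ge> ereal C)
        \<longrightarrow> (\<exists>x\<in>K. \<forall>C::real. \<exists>N. \<forall>i\<ge>N. v (s i - x) \<ge> ereal C))"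

definition local_field :: "'a::field set \<Rightarrow> ('a \<Rightarrow> ereal) \<Rightarrow> bool" where
  "local_field K v \<longleftrightarrow>
     subfield K top_field \<and> normalized_valuation K v \<and> valuation_complete K v"

text \<open>
  \<open>F\<close> is a subfield of the valuation ring of \<open>K\<close> that maps isomorphically onto the residue field
  (injectivity is automatic, since nonzero elements of \<open>F\<close> are units).  For
  \<open>K = \<bbbF>((t))\<close> this is the field of constants.
\<close>

definition residue_field_in :: "'a::field set \<Rightarrow> 'a set \<Rightarrow> ('a \<Rightarrow> ereal) \<Rightarrow> bool" where
  "residue_field_in F K v \<longleftrightarrow>
     subfield F top_field \<and> F \<subseteq> K \<and>
     (\<forall>x\<in>F. v x \<ge> 0) \<and>
     (\<forall>x\<in>K. v x \<ge> 0 \<longrightarrow> (\<exists>c\<in>F. v (x - c) > 0))"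

definition perfect_char :: "nat \<Rightarrow> 'a::field set \<Rightarrow> bool" where
  "perfect_char p F \<longleftrightarrow> (\<forall>x\<in>F. \<exists>y\<in>F. y ^ p = x)"

section \<open>Galois extensions and ramification\<close>

definition Gal :: "'a::field set \<Rightarrow> ('a \<Rightarrow> 'a) monoid" where
  "Gal K = \<lparr>carrier = {\<sigma> \<in> ring_iso top_field top_field. \<forall>x\<in>K. \<sigma> x = x},
            monoid.mult = (\<circ>), one = id\<rparr>"

definition finite_galois :: "'a::field set \<Rightarrow> bool" where
  "finite_galois K \<longleftrightarrow>
     subfield K top_field \<and>
     ring.finite_dimension top_field K UNIV \<and>
     {x. \<forall>\<sigma>\<in>carrier (Gal K). \<sigma> x = x} = K"

text \<open>The ramification index of \<open>v\<^sub>L\<close> over \<open>v\<^sub>K\<close> is the degree \<open>[L : K]\<close>.\<close>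

definition totally_ramified :: "'a::field set \<Rightarrow> ('a \<Rightarrow> ereal) \<Rightarrow> ('a \<Rightarrow> ereal) \<Rightarrow> bool" where
  "totally_ramified K vK vL \<longleftrightarrow>
     (\<forall>x\<in>K. vL x = ereal (of_nat (ring.dim top_field K UNIV)) * vK x)"

definition lower_ram_group :: "'a::field set \<Rightarrow> ('a \<Rightarrow> ereal) \<Rightarrow> int \<Rightarrow> ('a \<Rightarrow> 'a) set" where
  "lower_ram_group K vL i =
     {\<sigma> \<in> carrier (Gal K). \<forall>x. vL x \<ge> 0 \<longrightarrow> vL (\<sigma> x - x) \<ge> ereal (of_int (i + 1))}"

definition lower_ram_breaks :: "'a::field set \<Rightarrow> ('a \<Rightarrow> ereal) \<Rightarrow> int set" where
  "lower_ram_breaks K vL =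
     {i. i \<ge> - 1 \<and> lower_ram_group K vL (i + 1) \<noteq> lower_ram_group K vL i}"

text \<open>
  Linear independence of the \<open>\<omega>\<^sub>i\<close> over \<open>\<bbbF>\<^sub>p\<close>: in characteristic \<open>p\<close> the set \<open>\<int>\<close> is the prime field.
\<close>

definition artin_schreier_data ::
  "nat \<Rightarrow> nat \<Rightarrow> nat \<Rightarrow> 'a::field set \<Rightarrow> 'a set \<Rightarrow> ('a \<Rightarrow> ereal) \<Rightarrow>
    'a \<Rightarrow> (nat \<Rightarrow> 'a) \<Rightarrow> (nat \<Rightarrow> 'a) \<Rightarrow> bool" where
  "artin_schreier_data p n b F K vK \<beta> \<omega> \<epsilon> \<longleftrightarrow>
     \<beta> \<in> K \<and> vK \<beta> = - ereal (of_nat b) \<and>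
     (\<forall>i\<in>{1..n}. \<omega> i \<in> F) \<and>
     (\<forall>c. (\<forall>i\<in>{1..n}. c i \<in> \<int>) \<and> (\<Sum>i=1..n. c i * \<omega> i) = 0 \<longrightarrow> (\<forall>i\<in>{1..n}. c i = 0)) \<and>
     (\<forall>i\<in>{1..n}. \<epsilon> i \<in> K \<and> vK (\<epsilon> i) > - ereal (of_nat b) \<and>
        ((\<exists>m::int. vK (\<epsilon> i) = ereal (of_int m) \<and> m < 0 \<and> \<not> int p dvd m) \<or> \<epsilon> i \<in> F)) \<and>
     (\<exists>x :: nat \<Rightarrow> 'a.
        (\<forall>i\<in>{1..n}. x i ^ p - x i = \<omega> i ^ (p ^ n) * \<beta> + \<epsilon> i) \<and>
        generate_field top_field (K \<union> x ` {1..n}) = UNIV)"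

section \<open>Group rings and truncated powers\<close>

text \<open>
  Elements of \<open>F[G]\<close> are coefficient functions on \<open>G\<close>, extended by zero outside the carrier;
  \<open>G\<close> is meant to be finite.
\<close>

definition group_ring :: "'a::field set \<Rightarrow> ('g, 'm) monoid_scheme \<Rightarrow> ('g \<Rightarrow> 'a) ring" where
  "group_ring F G =
     \<lparr>carrier = {c. (\<forall>g\<in>carrier G. c g \<in> F) \<and> (\<forall>g. g \<notin> carrier G \<longrightarrow> c g = 0)},
      monoid.mult = (\<lambda>c d g. if g \<in> carrier G
                       then (\<Sum>h\<in>carrier G. c h * d (inv\<^bsub>G\<^esub> h \<otimes>\<^bsub>G\<^esub> g)) else 0),
      one = (\<lambda>g. if g = \<one>\<^bsub>G\<^esub> then 1 else 0),
      ring.zero = (\<lambda>_. 0),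
      add = (\<lambda>c d g. c g + d g)\<rparr>"

definition group_ring_of :: "'g \<Rightarrow> 'g \<Rightarrow> 'a::field" where
  "group_ring_of g = (\<lambda>h. if h = g then 1 else 0)"

definition augmentation_ideal :: "'a::field set \<Rightarrow> ('g, 'm) monoid_scheme \<Rightarrow> ('g \<Rightarrow> 'a) set" where
  "augmentation_ideal F G = {c \<in> carrier (group_ring F G). (\<Sum>g\<in>carrier G. c g) = 0}"

definition augmentation_power ::
  "'a::field set \<Rightarrow> ('g, 'm) monoid_scheme \<Rightarrow> nat \<Rightarrow> ('g \<Rightarrow> 'a) set" where
  "augmentation_power F G k = augmentation_ideal F G [^]\<^bsub>ideals_set (group_ring F G)\<^esub> k"

text \<open>
  The library's \<open>gchoose\<close> is restricted to characteristic 0.  The division below is legitimate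
  only for \<open>i < p\<close>, which is the only range used.
\<close>

definition trunc_binomial :: "'a::field \<Rightarrow> nat \<Rightarrow> 'a" where
  "trunc_binomial \<omega> i = (\<Prod>j<i. \<omega> - of_nat j) / of_nat (fact i)"

definition trunc_power ::
  "nat \<Rightarrow> 'a::field set \<Rightarrow> ('g, 'm) monoid_scheme \<Rightarrow> ('g \<Rightarrow> 'a) \<Rightarrow> 'a \<Rightarrow> ('g \<Rightarrow> 'a)" where
  "trunc_power p F G \<gamma> \<omega> =
     (let R = group_ring F G in
      (\<lambda>g. \<Sum>i=0..p-1. trunc_binomial \<omega> i * ((\<gamma> \<ominus>\<^bsub>R\<^esub> \<one>\<^bsub>R\<^esub>) [^]\<^bsub>R\<^esub> i) g))"

abbreviation trunc_ring :: "'a::field set \<Rightarrow> ('g, 'm) monoid_scheme \<Rightarrow> nat \<Rightarrow> ('g \<Rightarrow> 'a) set ring"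
  where "trunc_ring F G k \<equiv> group_ring F G Quot augmentation_power F G k"

abbreviation trunc_class ::
  "'a::field set \<Rightarrow> ('g, 'm) monoid_scheme \<Rightarrow> nat \<Rightarrow> ('g \<Rightarrow> 'a) \<Rightarrow> ('g \<Rightarrow> 'a) set"
  where "trunc_class F G k \<gamma> \<equiv> augmentation_power F G k +>\<^bsub>group_ring F G\<^esub> \<gamma>"

text \<open>
  The \<open>F\<close>-span of the image of \<open>G\<close> in the multiplicatively written vector space
  \<open>(1 + A)/(1 + A\<^sup>k)\<close>.  Inverses and the neutral element are the scalar multiples by \<open>-1\<close> and \<open>0\<close>.
\<close>

inductive_set group_span ::
  "nat \<Rightarrow> 'a::field set \<Rightarrow> ('g, 'm) monoid_scheme \<Rightarrow> nat \<Rightarrow> ('g \<Rightarrow> 'a) set set"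
  for p F G k where
    image: "g \<in> carrier G \<Longrightarrow> trunc_class F G k (group_ring_of g) \<in> group_span p F G k"
  | prod: "\<lbrakk>a \<in> group_span p F G k; c \<in> group_span p F G k\<rbrakk>
           \<Longrightarrow> a \<otimes>\<^bsub>trunc_ring F G k\<^esub> c \<in> group_span p F G k"
  | scal: "\<lbrakk>\<gamma> \<in> carrier (group_ring F G);
            \<gamma> \<ominus>\<^bsub>group_ring F G\<^esub> \<one>\<^bsub>group_ring F G\<^esub> \<in> augmentation_ideal F G;
            trunc_class F G k \<gamma> \<in> group_span p F G k; \<omega> \<in> F\<rbrakk>
           \<Longrightarrow> trunc_class F G k (trunc_power p F G \<gamma> \<omega>) \<in> group_span p F G k"

definition group_ring_act :: "'a::field set \<Rightarrow> (('a \<Rightarrow> 'a) \<Rightarrow> 'a) \<Rightarrow> 'a \<Rightarrow> 'a" where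
  "group_ring_act K c x = (\<Sum>\<sigma>\<in>carrier (Gal K). c \<sigma> * \<sigma> x)"

section \<open>Refined breaks\<close>

text \<open>
  Maxima and minima of sets of valuations are written as \<open>SUP\<close> and \<open>INF\<close> in \<open>ereal\<close>, since \<open>Max\<close>
  and \<open>Min\<close> are meaningful only for finite sets.  In the situation considered the bounds are
  attained.
\<close>

definition vc_element :: "nat \<Rightarrow> nat \<Rightarrow> nat \<Rightarrow> ('a::field \<Rightarrow> ereal) \<Rightarrow> 'a \<Rightarrow> bool" where
  "vc_element p n b vL \<rho> \<longleftrightarrow>
     (\<exists>m::int. vL \<rho> = ereal (of_int m) \<and> [m = int b] (mod int (p ^ n)))"

definition vc_index ::
  "'a::field set \<Rightarrow> 'a set \<Rightarrow> ('a \<Rightarrow> ereal) \<Rightarrow> 'a \<Rightarrow> (('a \<Rightarrow> 'a) \<Rightarrow> 'a) set \<Rightarrow> ereal" where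
  "vc_index F K vL \<rho> a =
     (let R = group_ring F (Gal K) in
      SUP \<gamma>\<in>a. vL (group_ring_act K (\<gamma> \<ominus>\<^bsub>R\<^esub> \<one>\<^bsub>R\<^esub>) \<rho>))"

definition vc_set ::
  "nat \<Rightarrow> 'a::field set \<Rightarrow> 'a set \<Rightarrow> ('a \<Rightarrow> ereal) \<Rightarrow> nat \<Rightarrow> 'a \<Rightarrow> ereal set" where
  "vc_set p F K vL k \<rho> =
     {vc_index F K vL \<rho> a - vL \<rho> | a.
        a \<in> group_span p F (Gal K) k \<and> a \<noteq> \<one>\<^bsub>trunc_ring F (Gal K) k\<^esub>}"

definition vc_breaks_defined ::
  "nat \<Rightarrow> nat \<Rightarrow> nat \<Rightarrow> 'a::field set \<Rightarrow> 'a set \<Rightarrow> ('a \<Rightarrow> ereal) \<Rightarrow> nat \<Rightarrow> bool" where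
  "vc_breaks_defined p n b F K vL k \<longleftrightarrow>
     (\<forall>\<rho> \<rho>'. vc_element p n b vL \<rho> \<and> vc_element p n b vL \<rho>'
        \<longrightarrow> vc_set p F K vL k \<rho> = vc_set p F K vL k \<rho>')"

definition vc_breaks ::
  "nat \<Rightarrow> nat \<Rightarrow> nat \<Rightarrow> 'a::field set \<Rightarrow> 'a set \<Rightarrow> ('a \<Rightarrow> ereal) \<Rightarrow> nat \<Rightarrow> ereal set" where
  "vc_breaks p n b F K vL k =
     (THE B. \<forall>\<rho>. vc_element p n b vL \<rho> \<longrightarrow> vc_set p F K vL k \<rho> = B)"

definition op_valuation ::
  "'a::field set \<Rightarrow> ('a \<Rightarrow> ereal) \<Rightarrow> (('a \<Rightarrow> 'a) \<Rightarrow> 'a) \<Rightarrow> ereal" where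
  "op_valuation K vL \<gamma> = (INF x\<in>UNIV - {0}. vL (group_ring_act K \<gamma> x) - vL x)"

definition class_valuation ::
  "'a::field set \<Rightarrow> ('a \<Rightarrow> ereal) \<Rightarrow> (('a \<Rightarrow> 'a) \<Rightarrow> 'a) set \<Rightarrow> ereal" where
  "class_valuation K vL a = (SUP \<gamma>\<in>a. op_valuation K vL \<gamma>)"

definition ss_filtration ::
  "nat \<Rightarrow> 'a::field set \<Rightarrow> 'a set \<Rightarrow> ('a \<Rightarrow> ereal) \<Rightarrow> nat \<Rightarrow> int \<Rightarrow> (('a \<Rightarrow> 'a) \<Rightarrow> 'a) set set" where
  "ss_filtration p F K vL k h =
     (let Q = trunc_ring F (Gal K) k in
      {a \<in> group_span p F (Gal K) k.
         class_valuation K vL (a \<ominus>\<^bsub>Q\<^esub> \<one>\<^bsub>Q\<^esub>) \<ge> ereal (of_int h)})"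

definition ss_breaks ::
  "nat \<Rightarrow> 'a::field set \<Rightarrow> 'a set \<Rightarrow> ('a \<Rightarrow> ereal) \<Rightarrow> nat \<Rightarrow> int set" where
  "ss_breaks p F K vL k =
     {h. h \<ge> 0 \<and> ss_filtration p F K vL k (h + 1) \<noteq> ss_filtration p F K vL k h}"

end

theory Submission
  imports Defs "HOL-Computational_Algebra.Polynomial"
begin

text \<open>
  Eliminating the leading terms of the \<open>x\<^sub>i\<close> by means of Moore determinants gives a lower
  unitriangular matrix over \<open>F\<close> such that the combinations \<open>y\<^sub>j = \<Sum>\<^sub>i a\<^sub>j\<^sub>i x\<^sub>i\<close> have valuations \<open>- b p\<^sup>n\<^sup>-\<^sup>j\<close>; for \<open>j = n\<close>
  this is possible only after subtracting an element \<open>z\<close> of \<open>K(x\<^sub>1)\<close>, of valuation \<open>- e p\<^sup>n\<^sup>-\<^sup>1\<close>,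
  which is nonzero exactly when \<open>e p\<^sup>n\<^sup>-\<^sup>1 > b\<close>.  The monomials in the resulting elements
  \<open>Y\<^sub>1, \<dots>, Y\<^sub>n\<close> of degree less than \<open>p\<close> in each have pairwise incongruent valuations modulo \<open>p\<^sup>n\<close>,
  so they read off valuations in \<open>L\<close>.

  Truncated powers satisfy Newton's forward difference formula on polynomials of degree less than
  \<open>p\<close>.  Hence the span of \<open>G\<close> contains \<open>\<gamma>\<^sub>1, \<dots>, \<gamma>\<^sub>n\<close> dual to the \<open>y\<^sub>j\<close>, where \<open>\<gamma>\<^sub>j\<close> shifts \<open>y\<^sub>j\<close> and
  fixes the later \<open>y\<^sub>l\<close>.  It raises valuations by at least \<open>b p\<^sup>n\<^sup>-\<^sup>j\<close>; only \<open>\<gamma>\<^sub>1\<close> also moves \<open>z\<close>, and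
  that lowers its contribution to \<open>b\<^sub>*\<close>.  Conversely, an element \<open>D\<close> of the augmentation ideal with
  \<open>D y\<^sub>j \<noteq> 0\<close> and \<open>D y\<^sub>l = 0\<close> for \<open>l > j\<close> cannot raise the valuation of a valuation criterion element
  by more than that amount, as one sees by pairing with a suitable \<open>Y\<^sub>i\<close> under the trace form.  The vector
  \<open>(\<gamma> y\<^sub>j - y\<^sub>j)\<^sub>j\<close> depends only on the class of \<open>\<gamma>\<close> modulo \<open>A\<^sup>2\<close>, so the last nonzero coordinate of a
  class determines both kinds of breaks.
\<close>

section \<open>Subfields of a field\<close>

text \<open>The obstacle is the last coordinate. If e > 0, the elimination leaves in the
  \<open>p^n\<close>-th power of \<open>y\<^sub>n\<close>, besides a constant multiple of \<beta>, a
  term \<zeta>^(p^(n-1)) with \<zeta> in K of valuation -e, and this dominates \<beta> as soon as e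
  p^(n-1) > b. Subtracting a p-th root of \<zeta> would remove it, but such a root is inseparable
  over K. Now p does not divide b and the residue field is perfect, so \<zeta> can be built up from
  terms c^p \<beta>^i. Since \<open>\<omega> 1 = 1\<close> and \<open>\<epsilon> 1 = 0\<close>,
  \<beta> is the p-th power of \<open>x 1\<close> minus \<open>x 1\<close>, and c times the i-th
  power of \<open>x 1\<close> is an approximate p-th root of such a term. The bound e < b / p^(n-2)
  makes the approximation good enough. A shift of \<open>x 1\<close> by 1 moves z by about its
  derivative in \<open>x 1\<close>, whose valuation is (b - e) p^(n-1) because p does not divide e.
  Measured against the last element \<open>Y\<^sub>n\<close>, of valuation -b, this is a gain of (b
  - e) p^(n-1) + b. That p does not divide b is itself derived, from the ramification
  filtration.\<close>

lemma top_field_simps [simp]: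
  "carrier top_field = UNIV" "monoid.mult top_field x y = x * y" "monoid.one top_field = 1"
  "ring.zero top_field = 0" "ring.add top_field x y = x + y"
  by (simp_all add: ring_of_type_algebra_def)

lemma top_field_minus [simp]: "a_inv top_field (x :: 'a::field) = - x"
proof -
  interpret ring "top_field :: 'a ring" by (rule ring_from_type_algebra)
  have "x \<oplus>\<^bsub>top_field\<^esub> (- x) = \<zero>\<^bsub>top_field\<^esub>" by simp
  then show ?thesis using minus_equality[of "- x" x] by simp
qed

lemma top_field_inv: "x \<noteq> 0 \<Longrightarrow> inv\<^bsub>top_field\<^esub> (x :: 'a::field) = inverse x"
proof -
  assume x: "x \<noteq> 0"
  interpret field "top_field :: 'a ring" by (rule field_from_type_algebra)
  show ?thesis by (rule comm_inv_char) (use x in auto)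
qed

locale subfield_of_type =
  fixes K :: "'a::field set"
  assumes subfield_top: "subfield K top_field"
begin

lemma closed_0 [simp, intro]: "0 \<in> K"
  using subringE(2)[OF subfieldE(1)[OF subfield_top]] by simp

lemma closed_1 [simp, intro]: "1 \<in> K"
  using subringE(3)[OF subfieldE(1)[OF subfield_top]] by simp

lemma closed_uminus [simp, intro]: "x \<in> K \<Longrightarrow> - x \<in> K"
  using subringE(5)[OF subfieldE(1)[OF subfield_top]] by simp

lemma closed_mult [simp, intro]: "x \<in> K \<Longrightarrow> y \<in> K \<Longrightarrow> x * y \<in> K"
  using subringE(6)[OF subfieldE(1)[OF subfield_top]] by simp

lemma closed_add [simp, intro]: "x \<in> K \<Longrightarrow> y \<in> K \<Longrightarrow> x + y \<in> K"
  using subringE(7)[OF subfieldE(1)[OF subfield_top]] by simp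

lemma closed_diff [simp, intro]: "x \<in> K \<Longrightarrow> y \<in> K \<Longrightarrow> x - y \<in> K"
  using closed_add[of x "- y"] by simp

lemma closed_inverse [simp, intro]:
  assumes "x \<in> K"
  shows "inverse x \<in> K"
proof (cases "x = 0")
  case False
  interpret ring "top_field :: 'a ring" by (rule ring_from_type_algebra)
  have "inv\<^bsub>top_field\<^esub> x \<in> K"
    using subfield_m_inv(1)[OF subfield_top] assms False by simp
  then show ?thesis by (simp add: top_field_inv False)
qed simp

lemma closed_divide [simp, intro]: "x \<in> K \<Longrightarrow> y \<in> K \<Longrightarrow> x / y \<in> K"
  by (simp add: divide_inverse)

lemma closed_power [simp, intro]: "x \<in> K \<Longrightarrow> x ^ m \<in> K"
  by (induction m) auto

lemma closed_of_nat [simp, intro]: "of_nat m \<in> K"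
  by (induction m) auto

lemma closed_sum [intro]: "(\<And>i. i \<in> I \<Longrightarrow> f i \<in> K) \<Longrightarrow> (\<Sum>i\<in>I. f i) \<in> K"
  by (induction I rule: infinite_finite_induct) auto

lemma closed_prod [intro]: "(\<And>i. i \<in> I \<Longrightarrow> f i \<in> K) \<Longrightarrow> (\<Prod>i\<in>I. f i) \<in> K"
  by (induction I rule: infinite_finite_induct) auto

end

section \<open>Group rings of finite abelian groups\<close>

locale group_algebra = G: comm_group G + F: subfield_of_type F
  for G (structure) and F :: "'a::field set" +
  assumes finite_G: "finite (carrier G)"
begin

abbreviation R where "R \<equiv> group_ring F G"

lemma R_carrier_iff:
  "c \<in> carrier R \<longleftrightarrow> (\<forall>g\<in>carrier G. c g \<in> F) \<and> (\<forall>g. g \<notin> carrier G \<longrightarrow> c g = 0)"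
  by (simp add: group_ring_def)

lemma R_in_F: "c \<in> carrier R \<Longrightarrow> c g \<in> F"
  by (cases "g \<in> carrier G") (simp_all add: R_carrier_iff)

lemma R_outside: "c \<in> carrier R \<Longrightarrow> g \<notin> carrier G \<Longrightarrow> c g = 0"
  by (auto simp: R_carrier_iff)

lemma R_zero [simp]: "\<zero>\<^bsub>R\<^esub> = (\<lambda>_. 0)"
  by (simp add: group_ring_def)

lemma R_one: "\<one>\<^bsub>R\<^esub> = group_ring_of \<one>"
  by (simp add: group_ring_def group_ring_of_def)

lemma R_add: "c \<oplus>\<^bsub>R\<^esub> d = (\<lambda>g. c g + d g)"
  by (simp add: group_ring_def)

lemma R_mult:
  "c \<otimes>\<^bsub>R\<^esub> d =
    (\<lambda>g. if g \<in> carrier G then (\<Sum>h\<in>carrier G. c h * d (inv h \<otimes> g)) else 0)"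
  by (simp add: group_ring_def)

lemma inv_cancel:
  assumes "k \<in> carrier G" "h \<in> carrier G"
  shows "inv k \<otimes> (k \<otimes> h) = h" "k \<otimes> (inv k \<otimes> h) = h"
  using assms by (metis G.inv_closed G.l_inv G.l_one G.m_assoc,
    metis G.inv_closed G.r_inv G.l_one G.m_assoc)

lemma R_mult_reindex:
  assumes g: "g \<in> carrier G" and k: "k \<in> carrier G"
  shows "(\<Sum>h\<in>carrier G. c (inv k \<otimes> h) * d (inv h \<otimes> g))
       = (\<Sum>h\<in>carrier G. c h * d (inv h \<otimes> (inv k \<otimes> g)))"
proof (rule sum.reindex_bij_witness[of _ "\<lambda>h. k \<otimes> h" "\<lambda>h. inv k \<otimes> h"])
  fix h assume h: "h \<in> carrier G"
  show "k \<otimes> (inv k \<otimes> h) = h" "inv k \<otimes> (k \<otimes> h) = h" using h k by (simp_all add: inv_cancel)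
  show "inv k \<otimes> h \<in> carrier G" "k \<otimes> h \<in> carrier G" using h k by simp_all
  have "inv (inv k \<otimes> h) = inv h \<otimes> k" using h k by (simp add: G.inv_mult_group)
  then have "inv (inv k \<otimes> h) \<otimes> (inv k \<otimes> g) = inv h \<otimes> (k \<otimes> (inv k \<otimes> g))"
    using h k g by (metis G.inv_closed G.m_assoc G.m_closed)
  then show "c (inv k \<otimes> h) * d (inv (inv k \<otimes> h) \<otimes> (inv k \<otimes> g)) = c (inv k \<otimes> h) * d (inv h \<otimes> g)"
    using g k by (simp add: inv_cancel)
qed

lemma cring_R: "cring R"
proof (rule cringI)
  show "abelian_group R"
  proof (rule abelian_groupI)
    fix x assume x: "x \<in> carrier R"
    show "\<exists>y\<in>carrier R. y \<oplus>\<^bsub>R\<^esub> x = \<zero>\<^bsub>R\<^esub>"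
      by (rule bexI[of _ "\<lambda>g. - x g"]) (use x in \<open>auto simp: R_add R_carrier_iff\<close>)
  next
    fix x y assume "x \<in> carrier R" "y \<in> carrier R"
    show "x \<oplus>\<^bsub>R\<^esub> y = y \<oplus>\<^bsub>R\<^esub> x" by (simp add: R_add add.commute)
  qed (auto simp: R_add R_carrier_iff add.assoc)
  show "comm_monoid R"
  proof (rule comm_monoidI)
    fix x y z assume x: "x \<in> carrier R" and y: "y \<in> carrier R" and z: "z \<in> carrier R"
    show "x \<otimes>\<^bsub>R\<^esub> y \<in> carrier R" using x y by (auto simp: R_carrier_iff R_mult intro!: F.closed_sum)
    show "x \<otimes>\<^bsub>R\<^esub> y = y \<otimes>\<^bsub>R\<^esub> x"
    proof
      fix g
      show "(x \<otimes>\<^bsub>R\<^esub> y) g = (y \<otimes>\<^bsub>R\<^esub> x) g"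
      proof (cases "g \<in> carrier G")
        case g: True
        have "(\<Sum>h\<in>carrier G. x h * y (inv h \<otimes> g)) = (\<Sum>h\<in>carrier G. y h * x (inv h \<otimes> g))"
        proof (rule sum.reindex_bij_witness[of _ "\<lambda>h. inv h \<otimes> g" "\<lambda>h. inv h \<otimes> g"])
          fix h assume h: "h \<in> carrier G"
          show 1: "inv h \<otimes> g \<in> carrier G" using h g by simp
          show 2: "inv (inv h \<otimes> g) \<otimes> g = h"
            using g h by (simp add: G.inv_mult_group G.m_comm[of "inv g" h] G.m_assoc)
          show "y (inv h \<otimes> g) * x (inv (inv h \<otimes> g) \<otimes> g) = x h * y (inv h \<otimes> g)"
            by (simp add: 2 mult.commute)
          show "inv h \<otimes> g \<in> carrier G" "inv (inv h \<otimes> g) \<otimes> g = h" by fact+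
        qed
        then show ?thesis using g by (simp add: R_mult)
      qed (simp add: R_mult)
    qed
    show "(x \<otimes>\<^bsub>R\<^esub> y) \<otimes>\<^bsub>R\<^esub> z = x \<otimes>\<^bsub>R\<^esub> (y \<otimes>\<^bsub>R\<^esub> z)"
    proof
      fix g
      show "((x \<otimes>\<^bsub>R\<^esub> y) \<otimes>\<^bsub>R\<^esub> z) g = (x \<otimes>\<^bsub>R\<^esub> (y \<otimes>\<^bsub>R\<^esub> z)) g"
      proof (cases "g \<in> carrier G")
        case g: True
        have "((x \<otimes>\<^bsub>R\<^esub> y) \<otimes>\<^bsub>R\<^esub> z) g
            = (\<Sum>h\<in>carrier G. \<Sum>k\<in>carrier G. x k * (y (inv k \<otimes> h) * z (inv h \<otimes> g)))"
          using g by (simp add: R_mult sum_distrib_right mult.assoc)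
        also have "\<dots> = (\<Sum>k\<in>carrier G. x k * (\<Sum>h\<in>carrier G. y (inv k \<otimes> h) * z (inv h \<otimes> g)))"
          by (subst sum.swap) (simp add: sum_distrib_left)
        also have "\<dots> = (x \<otimes>\<^bsub>R\<^esub> (y \<otimes>\<^bsub>R\<^esub> z)) g"
          using g by (simp add: R_mult R_mult_reindex)
        finally show ?thesis .
      qed (simp add: R_mult)
    qed
    show "\<one>\<^bsub>R\<^esub> \<otimes>\<^bsub>R\<^esub> x = x"
    proof
      fix g
      show "(\<one>\<^bsub>R\<^esub> \<otimes>\<^bsub>R\<^esub> x) g = x g"
      proof (cases "g \<in> carrier G")
        case g: True
        have "(\<one>\<^bsub>R\<^esub> \<otimes>\<^bsub>R\<^esub> x) g = (\<Sum>h\<in>carrier G. if h = \<one> then x g else 0)"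
          using g by (auto simp: R_mult R_one group_ring_of_def intro!: sum.cong)
        also have "\<dots> = x g" using finite_G by simp
        finally show ?thesis .
      qed (simp add: R_mult R_outside[OF x])
    qed
  qed (auto simp: R_one R_carrier_iff group_ring_of_def)
  fix x y z assume x: "x \<in> carrier R" and y: "y \<in> carrier R" and z: "z \<in> carrier R"
  show "(x \<oplus>\<^bsub>R\<^esub> y) \<otimes>\<^bsub>R\<^esub> z = (x \<otimes>\<^bsub>R\<^esub> z) \<oplus>\<^bsub>R\<^esub> (y \<otimes>\<^bsub>R\<^esub> z)"
    by (auto simp: R_add R_mult algebra_simps sum.distrib)
qed

sublocale R: cring R by (rule cring_R)

lemma R_uminus: "x \<in> carrier R \<Longrightarrow> \<ominus>\<^bsub>R\<^esub> x = (\<lambda>g. - x g)"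
  by (rule R.minus_equality) (auto simp: R_add R_carrier_iff)

lemma R_minus: "x \<in> carrier R \<Longrightarrow> y \<in> carrier R \<Longrightarrow> x \<ominus>\<^bsub>R\<^esub> y = (\<lambda>g. x g - y g)"
  by (simp add: a_minus_def R_uminus R_add)

lemma group_ring_of_closed [simp, intro]: "g \<in> carrier G \<Longrightarrow> group_ring_of g \<in> carrier R"
  by (auto simp: R_carrier_iff group_ring_of_def)

lemma group_ring_of_mult:
  assumes "g \<in> carrier G" "h \<in> carrier G"
  shows "group_ring_of g \<otimes>\<^bsub>R\<^esub> group_ring_of h = group_ring_of (g \<otimes> h)"
proof
  fix x
  show "(group_ring_of g \<otimes>\<^bsub>R\<^esub> group_ring_of h) x = (group_ring_of (g \<otimes> h) x :: 'a)"
  proof (cases "x \<in> carrier G")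
    case x: True
    have eq: "inv g \<otimes> x = h \<longleftrightarrow> x = g \<otimes> h"
      using assms x by (metis G.inv_closed G.inv_solve_left')
    have "(group_ring_of g \<otimes>\<^bsub>R\<^esub> group_ring_of h) x
        = (\<Sum>k\<in>carrier G. if k = g then (if inv g \<otimes> x = h then 1 else 0) else 0 :: 'a)"
      unfolding R_mult group_ring_of_def using x by (simp only: if_True) (rule sum.cong, auto)
    also have "\<dots> = group_ring_of (g \<otimes> h) x"
      using finite_G assms by (simp add: eq group_ring_of_def)
    finally show ?thesis .
  qed (use assms in \<open>auto simp: R_mult group_ring_of_def\<close>)
qed


lemma smult_closed [intro]:
  assumes "a \<in> F" "u \<in> carrier R"
  shows "(\<lambda>g. a * u g) \<in> carrier R"
  using assms by (auto simp: R_carrier_iff)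

lemma smult_eq_mult:
  assumes "a \<in> F" "u \<in> carrier R"
  shows "(\<lambda>g. a * u g) = (\<lambda>g. a * \<one>\<^bsub>R\<^esub> g) \<otimes>\<^bsub>R\<^esub> u"
proof -
  have "(\<lambda>g. a * \<one>\<^bsub>R\<^esub> g) \<otimes>\<^bsub>R\<^esub> u = (\<lambda>g. a * (\<one>\<^bsub>R\<^esub> \<otimes>\<^bsub>R\<^esub> u) g)"
    by (rule ext) (simp add: R_mult sum_distrib_left mult.assoc del: R.l_one)
  then show ?thesis using assms by simp
qed

lemma mult_smult_left: "(\<lambda>g. a * u g) \<otimes>\<^bsub>R\<^esub> v = (\<lambda>g. a * (u \<otimes>\<^bsub>R\<^esub> v) g)"
  by (rule ext) (simp add: R_mult sum_distrib_left mult.assoc)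

lemma mult_smult_right: "u \<otimes>\<^bsub>R\<^esub> (\<lambda>g. a * v g) = (\<lambda>g. a * (u \<otimes>\<^bsub>R\<^esub> v) g)"
  by (rule ext) (simp add: R_mult sum_distrib_left mult.left_commute)

lemma mult_sum_left:
  "(\<lambda>g. \<Sum>i\<in>I. u i g) \<otimes>\<^bsub>R\<^esub> v = (\<lambda>g. \<Sum>i\<in>I. (u i \<otimes>\<^bsub>R\<^esub> v) g)"
proof
  fix g
  show "((\<lambda>g. \<Sum>i\<in>I. u i g) \<otimes>\<^bsub>R\<^esub> v) g = (\<Sum>i\<in>I. (u i \<otimes>\<^bsub>R\<^esub> v) g)"
    by (simp add: R_mult sum_distrib_right) (intro impI, rule sum.swap)
qed

lemma mult_sum_right:
  "v \<otimes>\<^bsub>R\<^esub> (\<lambda>g. \<Sum>i\<in>I. u i g) = (\<lambda>g. \<Sum>i\<in>I. (v \<otimes>\<^bsub>R\<^esub> u i) g)"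
proof
  fix g
  show "(v \<otimes>\<^bsub>R\<^esub> (\<lambda>g. \<Sum>i\<in>I. u i g)) g = (\<Sum>i\<in>I. (v \<otimes>\<^bsub>R\<^esub> u i) g)"
    by (simp add: R_mult sum_distrib_left) (intro impI, rule sum.swap)
qed

lemma sum_closed [intro]:
  "(\<And>i. i \<in> I \<Longrightarrow> u i \<in> carrier R) \<Longrightarrow> (\<lambda>g. \<Sum>i\<in>I. u i g) \<in> carrier R"
  by (auto simp: R_carrier_iff intro!: F.closed_sum)

lemma lin_comb_closed [intro]:
  "(\<And>i. i \<in> I \<Longrightarrow> a i \<in> F) \<Longrightarrow> (\<And>i. i \<in> I \<Longrightarrow> u i \<in> carrier R) \<Longrightarrow>
    (\<lambda>g. \<Sum>i\<in>I. a i * u i g) \<in> carrier R"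
  by (rule sum_closed) (rule smult_closed)

lemma minus_closed [intro]:
  assumes "u \<in> carrier R" "v \<in> carrier R" shows "(\<lambda>g. u g - v g) \<in> carrier R"
  using assms by (auto simp: R_carrier_iff)

lemma add_closed [intro]:
  assumes "u \<in> carrier R" "v \<in> carrier R" shows "(\<lambda>g. u g + v g) \<in> carrier R"
  using assms by (auto simp: R_carrier_iff)

lemma ideal_smult:
  assumes "ideal I R" "a \<in> F" "u \<in> I"
  shows "(\<lambda>g. a * u g) \<in> I"
proof -
  have u: "u \<in> carrier R" using assms(1,3) ideal.Icarr by fast
  have "(\<lambda>g. a * \<one>\<^bsub>R\<^esub> g) \<in> carrier R" using assms(2) by (intro smult_closed) auto
  then show ?thesis unfolding smult_eq_mult[OF assms(2) u] by (rule ideal.I_l_closed[OF assms(1,3)])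
qed

lemma ideal_add:
  assumes "ideal I R" "u \<in> I" "v \<in> I"
  shows "(\<lambda>g. u g + v g) \<in> I"
  using additive_subgroup.a_closed[OF ideal.axioms(1)[OF assms(1)] assms(2,3)] by (simp add: R_add)

lemma ideal_zero: "ideal I R \<Longrightarrow> (\<lambda>g. 0) \<in> I"
  using additive_subgroup.zero_closed[OF ideal.axioms(1), of I R] by simp

lemma ideal_minus:
  assumes "ideal I R" "u \<in> I" "v \<in> I"
  shows "(\<lambda>g. u g - v g) \<in> I"
  using ideal_add[OF assms(1,2) ideal_smult[OF assms(1) _ assms(3), of "- 1"]] by simp

lemma ideal_sum:
  assumes "ideal I R" "\<And>i. i \<in> S \<Longrightarrow> u i \<in> I"
  shows "(\<lambda>g. \<Sum>i\<in>S. u i g) \<in> I"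
  using assms(2)
  by (induction S rule: infinite_finite_induct)
    (auto intro: ideal_zero[OF assms(1)] ideal_add[OF assms(1)])

section \<open>Powers of the augmentation ideal\<close>

abbreviation A where "A \<equiv> augmentation_ideal F G"
abbreviation Apow where "Apow \<equiv> augmentation_power F G"

lemma A_iff: "c \<in> A \<longleftrightarrow> c \<in> carrier R \<and> (\<Sum>g\<in>carrier G. c g) = 0"
  by (simp add: augmentation_ideal_def)

text \<open>The augmentation is multiplicative because translation by \<open>h\<close> permutes
  \<open>G\<close>. Hence \<open>A\<close> is an ideal and 1 + A is closed under products.\<close>

lemma aug_mult:
  assumes "c \<in> carrier R" "d \<in> carrier R"
  shows "(\<Sum>g\<in>carrier G. (c \<otimes>\<^bsub>R\<^esub> d) g) = (\<Sum>g\<in>carrier G. c g) * (\<Sum>g\<in>carrier G. d g)"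
proof -
  have "(\<Sum>g\<in>carrier G. (c \<otimes>\<^bsub>R\<^esub> d) g) = (\<Sum>g\<in>carrier G. \<Sum>h\<in>carrier G. c h * d (inv h \<otimes> g))"
    by (simp add: R_mult)
  also have "\<dots> = (\<Sum>h\<in>carrier G. c h * (\<Sum>g\<in>carrier G. d (inv h \<otimes> g)))"
    by (subst sum.swap) (simp add: sum_distrib_left)
  also have "\<dots> = (\<Sum>h\<in>carrier G. c h * (\<Sum>g\<in>carrier G. d g))"
  proof (rule sum.cong)
    fix h assume h: "h \<in> carrier G"
    have "(\<Sum>g\<in>carrier G. d (inv h \<otimes> g)) = (\<Sum>g\<in>carrier G. d g)"
      by (rule sum.reindex_bij_witness[of _ "\<lambda>g. h \<otimes> g" "\<lambda>g. inv h \<otimes> g"])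
        (use h in \<open>auto simp: inv_cancel\<close>)
    then show "c h * (\<Sum>g\<in>carrier G. d (inv h \<otimes> g)) = c h * (\<Sum>g\<in>carrier G. d g)" by simp
  qed simp
  also have "\<dots> = (\<Sum>g\<in>carrier G. c g) * (\<Sum>g\<in>carrier G. d g)" by (simp add: sum_distrib_right)
  finally show ?thesis .
qed

lemma ideal_A: "ideal A R"
proof (rule idealI)
  show "ring R" by (rule R.ring_axioms)
  show "subgroup A (add_monoid R)"
  proof (rule R.add.subgroupI)
    show "A \<subseteq> carrier R" by (auto simp: A_iff)
    have "(\<lambda>_. 0) \<in> A" by (auto simp: A_iff R_carrier_iff)
    then show "A \<noteq> {}" by blast
    fix a assume a: "a \<in> A"
    then show "\<ominus>\<^bsub>R\<^esub> a \<in> A" by (auto simp: A_iff R_uminus R_carrier_iff sum_negf)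
    fix b assume "b \<in> A"
    then show "a \<oplus>\<^bsub>R\<^esub> b \<in> A"
      using a by (auto simp: A_iff R_add sum.distrib R_carrier_iff)
  qed
  fix a x assume "a \<in> A" "x \<in> carrier R"
  then show "x \<otimes>\<^bsub>R\<^esub> a \<in> A" "a \<otimes>\<^bsub>R\<^esub> x \<in> A" by (auto simp: A_iff aug_mult)
qed

lemma Apow_0 [simp]: "Apow 0 = carrier R"
  by (simp add: augmentation_power_def ideals_set_def)

lemma Apow_Suc: "Apow (Suc i) = ideal_prod R (Apow i) A"
  by (simp add: augmentation_power_def ideals_set_def)

lemma ideal_Apow: "ideal (Apow i) R"
proof (induction i)
  case 0
  then show ?case by (simp add: R.oneideal)
next
  case (Suc i)
  then show ?case by (simp add: Apow_Suc R.ideal_prod_is_ideal ideal_A)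
qed

lemma Apow_carrier: "u \<in> Apow i \<Longrightarrow> u \<in> carrier R"
  using ideal.Icarr[OF ideal_Apow] .

lemma Apow_Suc_subset: "Apow (Suc i) \<subseteq> Apow i"
  using R.ideal_prod_inter[OF ideal_Apow ideal_A] by (auto simp: Apow_Suc)

lemma Apow_antimono: "i \<le> j \<Longrightarrow> Apow j \<subseteq> Apow i"
  by (induction j rule: dec_induct) (use Apow_Suc_subset in auto)

lemma Apow_1: "Apow (Suc 0) \<subseteq> A"
  using R.ideal_prod_inter[OF ideal_Apow[of 0] ideal_A] by (auto simp: Apow_Suc)

lemma pow_Apow: "u \<in> A \<Longrightarrow> u [^]\<^bsub>R\<^esub> (i::nat) \<in> Apow i"
  by (induction i) (auto simp: Apow_Suc intro: ideal_prod.prod)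

lemma mult_pow_Apow:
  assumes "u \<in> A" "v \<in> Apow i"
  shows "v \<otimes>\<^bsub>R\<^esub> u [^]\<^bsub>R\<^esub> (j::nat) \<in> Apow (i + j)"
proof (induction j)
  case 0
  then show ?case using assms Apow_carrier[of v i] by simp
next
  case (Suc j)
  have c: "u \<in> carrier R" "v \<in> carrier R" using assms Apow_carrier[of v i] by (auto simp: A_iff)
  then have "v \<otimes>\<^bsub>R\<^esub> u [^]\<^bsub>R\<^esub> Suc j = v \<otimes>\<^bsub>R\<^esub> u [^]\<^bsub>R\<^esub> j \<otimes>\<^bsub>R\<^esub> u"
    by (simp add: R.m_assoc)
  then show ?case using ideal_prod.prod[OF Suc assms(1)] by (simp add: Apow_Suc)
qed

end

section \<open>Truncated powers\<close>

lemma trunc_binomial_0 [simp]: "trunc_binomial a 0 = 1"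
  by (simp add: trunc_binomial_def)

lemma trunc_binomial_Suc:
  "trunc_binomial a (Suc i) = trunc_binomial a i * (a - of_nat i) / of_nat (Suc i)"
  by (simp add: trunc_binomial_def fact_Suc algebra_simps)

lemma binomial_Suc_mult: "(m choose Suc i) * Suc i = (m choose i) * (m - i)"
proof (cases m)
  case (Suc l)
  then show ?thesis
    using Suc_times_binomial[of i l] binomial_absorb_comp[of "Suc l" i] by (simp add: mult.commute)
qed simp

section \<open>Binomials and Lagrange interpolation over the prime field\<close>

locale prime_char =
  fixes p :: nat and T :: "'a::field itself"
  assumes prime_p: "Factorial_Ring.prime p" and char_p: "CHAR('a) = p"
begin

lemma p_gt_0: "p > 0" and p_gt_1: "p > 1"
  using prime_p prime_gt_0_nat prime_gt_1_nat by auto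

lemma of_nat_eq_0_iff: "of_nat m = (0::'a) \<longleftrightarrow> p dvd m"
  using of_nat_eq_0_iff_char_dvd[where ?'a = 'a] char_p by simp

lemma of_nat_nonzero: "0 < i \<Longrightarrow> i < p \<Longrightarrow> of_nat i \<noteq> (0::'a)"
  by (auto simp: of_nat_eq_0_iff dest: dvd_imp_le)

lemma inj_of_nat: "inj_on (of_nat :: nat \<Rightarrow> 'a) {..<p}"
proof (rule linorder_inj_onI')
  fix i j assume "i \<in> {..<p}" "j \<in> {..<p}" "i < j"
  then have "of_nat (j - i) \<noteq> (0::'a)" by (intro of_nat_nonzero) auto
  then show "of_nat i \<noteq> (of_nat j :: 'a)" using \<open>i < j\<close> by (simp add: of_nat_diff)
qed

text \<open>Below p all denominators are invertible, so the recursion of the integer binomials can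
  be divided out in the field. The upper argument \<open>m\<close> may be p or larger.\<close>

lemma trunc_binomial_of_nat:
  "i < p \<Longrightarrow> trunc_binomial (of_nat m) i = (of_nat (m choose i) :: 'a)"
proof (induction i)
  case (Suc i)
  have nz: "of_nat (Suc i) \<noteq> (0::'a)" using Suc.prems by (intro of_nat_nonzero) auto
  have "(of_nat (m choose Suc i) :: 'a) * of_nat (Suc i) = of_nat ((m choose i) * (m - i))"
    by (metis binomial_Suc_mult of_nat_mult)
  also have "\<dots> = of_nat (m choose i) * (of_nat m - of_nat i)"
    by (cases "i \<le> m") (auto simp: of_nat_diff binomial_eq_0)
  finally show ?case using Suc nz by (simp add: trunc_binomial_Suc divide_simps del: of_nat_Suc)
qed simp

text \<open>The truncated binomial as a polynomial in its upper argument. Its degree bound opens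
  truncated powers to interpolation at p nodes.\<close>

definition tb_poly :: "nat \<Rightarrow> 'a poly" where
  "tb_poly i = smult (inverse (of_nat (fact i))) (\<Prod>j<i. [:- of_nat j, 1:])"

lemma poly_tb_poly: "poly (tb_poly i) a = trunc_binomial a i"
  by (simp add: tb_poly_def trunc_binomial_def poly_prod divide_inverse mult.commute)

lemma degree_tb_poly: "degree (tb_poly i) \<le> i"
proof -
  have "degree (\<Prod>j<i. [:- of_nat j, 1 :: 'a:]) \<le> i"
    using degree_prod_sum_le[of "{..<i}" "\<lambda>j. [:- of_nat j, 1 :: 'a:]"] by (simp add: o_def)
  then show ?thesis unfolding tb_poly_def using degree_smult_le order_trans by blast
qed

text \<open>The Lagrange basis polynomial of the node \<open>m\<close>, for the nodes 0, ..., p - 1,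
  evaluated at \<open>a\<close>.\<close>

definition lagr :: "nat \<Rightarrow> 'a \<Rightarrow> 'a" where
  "lagr m a = (\<Prod>l\<in>{..<p}-{m}. (a - of_nat l) / (of_nat m - of_nat l))"

lemma lagrange_interpolation:
  assumes "degree \<phi> < p"
  shows "poly \<phi> a = (\<Sum>m<p. lagr m a * poly \<phi> (of_nat m))"
proof -
  define L where "L m = (\<Prod>l\<in>{..<p}-{m}. smult (inverse (of_nat m - of_nat l)) [:- of_nat l, 1 :: 'a:])" for m
  have pL: "poly (L m) a = lagr m a" for m a
    by (simp add: L_def lagr_def poly_prod divide_inverse algebra_simps)
  have dL: "degree (L m) < p" if "m < p" for m
  proof -
    have "degree (L m) \<le> (\<Sum>l\<in>{..<p}-{m}. degree (smult (inverse (of_nat m - of_nat l)) [:- of_nat l, 1 :: 'a:]))"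
      unfolding L_def
      by (rule order_trans[OF degree_prod_sum_le]) (simp_all add: o_def del: smult_pCons)
    also have "\<dots> \<le> (\<Sum>l\<in>{..<p}-{m}. 1)" by (intro sum_mono) (auto intro: order_trans[OF degree_smult_le])
    also have "\<dots> < p" using that by simp
    finally show ?thesis .
  qed
  have L_of_nat: "lagr m (of_nat i) = (if i = m then 1 else 0)" if "m < p" "i < p" for m i
  proof (cases "i = m")
    case True
    have "lagr m (of_nat m) = (\<Prod>l\<in>{..<p}-{m}. 1)"
      unfolding lagr_def
    proof (rule prod.cong)
      fix l assume "l \<in> {..<p} - {m}"
      then have "of_nat m \<noteq> (of_nat l :: 'a)" using inj_on_contraD[OF inj_of_nat, of m l] that by auto
      then show "(of_nat m - of_nat l) / (of_nat m - of_nat l) = (1::'a)" by simp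
    qed simp
    then show ?thesis using True by simp
  next
    case False
    then show ?thesis using that by (auto simp: lagr_def prod_zero_iff intro!: bexI[of _ i])
  qed
  define \<psi> where "\<psi> = (\<Sum>m<p. smult (poly \<phi> (of_nat m)) (L m))"
  have "\<phi> = \<psi>"
  proof (rule poly_eqI_degree)
    show "poly \<phi> x = poly \<psi> x" if x: "x \<in> of_nat ` {..<p}" for x
    proof -
      obtain i where i: "i < p" "x = of_nat i" using x by auto
      have "poly \<psi> x = (\<Sum>m<p. if m = i then poly \<phi> x else 0)"
        unfolding \<psi>_def poly_sum poly_smult pL i(2)
        by (intro sum.cong refl) (use i in \<open>auto simp: L_of_nat\<close>)
      then show ?thesis using i(1) by simp
    qed
    have c: "card (of_nat ` {..<p} :: 'a set) = p" by (simp add: card_image[OF inj_of_nat])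
    show "degree \<phi> < card (of_nat ` {..<p} :: 'a set)" using assms c by simp
    have "degree \<psi> \<le> p - 1" unfolding \<psi>_def
    proof (rule degree_sum_le)
      fix m assume "m \<in> {..<p}"
      then have "degree (L m) \<le> p - 1" using dL[of m] by simp
      then show "degree (smult (poly \<phi> (of_nat m)) (L m)) \<le> p - 1"
        using degree_smult_le order_trans by blast
    qed simp
    then show "degree \<psi> < card (of_nat ` {..<p} :: 'a set)" using c p_gt_0 by simp
  qed
  then have "poly \<phi> a = poly \<psi> a" by simp
  then show ?thesis by (simp add: \<psi>_def poly_sum pL mult.commute)
qed

end

text \<open>Pascal's rule summed against a sequence, for the induction step of
  \<open>one_plus_pow\<close>. Since m < M, the coefficient of index \<open>M\<close> in the last
  sum vanishes and nothing is lost at the upper end.\<close>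

lemma pascal_sum:
  fixes a :: "nat \<Rightarrow> 'a::comm_ring_1"
  assumes "m < M"
  shows "(\<Sum>i<Suc M. of_nat (Suc m choose i) * a i) =
    (\<Sum>i<Suc M. of_nat (m choose i) * a i) + (\<Sum>i<Suc M. of_nat (m choose i) * a (Suc i))"
proof -
  have "(\<Sum>i<Suc M. of_nat (m choose i) * a (Suc i)) = (\<Sum>i<M. of_nat (m choose i) * a (Suc i))"
    using assms by (simp add: binomial_eq_0)
  moreover have "(\<Sum>i<Suc M. of_nat (Suc m choose i) * a i)
      = a 0 + (\<Sum>i<M. of_nat (m choose i) * a (Suc i)) + (\<Sum>i<M. of_nat (m choose Suc i) * a (Suc i))"
    unfolding sum.lessThan_Suc_shift by (simp add: algebra_simps sum.distrib)
  moreover have "(\<Sum>i<Suc M. of_nat (m choose i) * a i) = a 0 + (\<Sum>i<M. of_nat (m choose Suc i) * a (Suc i))"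
    unfolding sum.lessThan_Suc_shift by simp
  ultimately show ?thesis by (simp only: ac_simps)
qed

locale trunc_group_algebra = group_algebra G F + prime_char p "TYPE('a)"
  for G (structure) and F :: "'a::field set" and p :: nat +
  fixes k :: nat
  assumes k_le_p: "k \<le> p" and k_gt_0: "0 < k"
begin

abbreviation J where "J \<equiv> Apow k"

lemmas ideal_J = ideal_Apow[of k]

text \<open>The truncated power of 1 + u. With \<open>u\<close> in \<open>A\<close> as the argument,
  each term lies in a known power of \<open>A\<close>.\<close>

definition tpow :: "'a \<Rightarrow> ('b \<Rightarrow> 'a) \<Rightarrow> ('b \<Rightarrow> 'a)" where
  "tpow a u = (\<lambda>g. \<Sum>i<p. trunc_binomial a i * (u [^]\<^bsub>R\<^esub> i) g)"

lemma trunc_power_eq: "trunc_power p F G \<gamma> a = tpow a (\<gamma> \<ominus>\<^bsub>R\<^esub> \<one>\<^bsub>R\<^esub>)"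
proof -
  have "{0..p - 1} = {..<p}" using p_gt_0 by auto
  then show ?thesis by (simp add: trunc_power_def tpow_def Let_def)
qed

section \<open>Congruence modulo the k-th power of the augmentation ideal\<close>

definition cong_J :: "('b \<Rightarrow> 'a) \<Rightarrow> ('b \<Rightarrow> 'a) \<Rightarrow> bool" (infix "\<doteq>" 50) where
  "x \<doteq> y \<longleftrightarrow> x \<in> carrier R \<and> y \<in> carrier R \<and> (\<lambda>g. x g - y g) \<in> J"

lemma cong_J_refl: "x \<in> carrier R \<Longrightarrow> x \<doteq> x"
  using ideal_zero[OF ideal_J] by (simp add: cong_J_def)

lemma cong_J_sym: "x \<doteq> y \<Longrightarrow> y \<doteq> x"
  using ideal_smult[OF ideal_J, of "- 1" "\<lambda>g. x g - y g"] by (simp add: cong_J_def)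

lemma cong_J_trans [trans]: "x \<doteq> y \<Longrightarrow> y \<doteq> z \<Longrightarrow> x \<doteq> z"
  using ideal_add[OF ideal_J, of "\<lambda>g. x g - y g" "\<lambda>g. y g - z g"] by (simp add: cong_J_def)

lemma mult_minus_left:
  "x \<in> carrier R \<Longrightarrow> y \<in> carrier R \<Longrightarrow> z \<in> carrier R \<Longrightarrow>
    (\<lambda>g. x g - y g) \<otimes>\<^bsub>R\<^esub> z = (\<lambda>g. (x \<otimes>\<^bsub>R\<^esub> z) g - (y \<otimes>\<^bsub>R\<^esub> z) g)"
  by (rule ext) (simp add: R_mult algebra_simps sum_subtractf)

lemma cong_J_mult_right:
  assumes "x \<doteq> y" "z \<in> carrier R"
  shows "x \<otimes>\<^bsub>R\<^esub> z \<doteq> y \<otimes>\<^bsub>R\<^esub> z"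
  using assms ideal.I_r_closed[OF ideal_J, of "\<lambda>g. x g - y g" z]
  by (auto simp: cong_J_def mult_minus_left)

lemma cong_J_mult:
  assumes "x \<doteq> y" "z \<doteq> w"
  shows "x \<otimes>\<^bsub>R\<^esub> z \<doteq> y \<otimes>\<^bsub>R\<^esub> w"
proof -
  have c: "x \<in> carrier R" "y \<in> carrier R" "z \<in> carrier R" "w \<in> carrier R"
    using assms by (auto simp: cong_J_def)
  have "x \<otimes>\<^bsub>R\<^esub> z \<doteq> y \<otimes>\<^bsub>R\<^esub> z" by (rule cong_J_mult_right[OF assms(1) c(3)])
  also have "y \<otimes>\<^bsub>R\<^esub> z = z \<otimes>\<^bsub>R\<^esub> y" using c by (simp add: R.m_comm)
  also have "\<dots> \<doteq> w \<otimes>\<^bsub>R\<^esub> y" by (rule cong_J_mult_right[OF assms(2) c(2)])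
  also have "\<dots> = y \<otimes>\<^bsub>R\<^esub> w" using c by (simp add: R.m_comm)
  finally show ?thesis .
qed

lemma cong_J_pow: "x \<doteq> y \<Longrightarrow> x [^]\<^bsub>R\<^esub> (i::nat) \<doteq> y [^]\<^bsub>R\<^esub> i"
  by (induction i) (auto intro: cong_J_mult cong_J_refl)

lemma trunc_class_eq_iff:
  assumes "x \<in> carrier R" "y \<in> carrier R"
  shows "trunc_class F G k x = trunc_class F G k y \<longleftrightarrow> x \<doteq> y"
  using R.quotient_eq_iff_same_a_r_cos[OF ideal_J assms] assms by (simp add: cong_J_def R_minus)

lemma trunc_class_mult:
  assumes "x \<in> carrier R" "y \<in> carrier R"
  shows "trunc_class F G k x \<otimes>\<^bsub>trunc_ring F G k\<^esub> trunc_class F G k y = trunc_class F G k (x \<otimes>\<^bsub>R\<^esub> y)"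
  using ideal.rcoset_mult_add[OF ideal_J assms] by (simp add: FactRing_def)

text \<open>
  Functions \<open>F \<rightarrow> R\<close> that modulo \<open>A\<^sup>k\<close> are polynomial of degree less than \<open>p\<close>, expressed by
  interpolation at the prime field.  Two of them agree modulo \<open>A\<^sup>k\<close> as soon as they do so on
  the prime field, where truncated powers are honest powers.
\<close>

definition pmap :: "('a \<Rightarrow> 'b \<Rightarrow> 'a) \<Rightarrow> bool" where
  "pmap f \<longleftrightarrow> (\<forall>a\<in>F. f a \<in> carrier R \<and> (\<lambda>g. f a g - (\<Sum>m<p. lagr m a * f (of_nat m) g)) \<in> J)"

lemma lagr_closed [intro]: "a \<in> F \<Longrightarrow> lagr m a \<in> F"
  unfolding lagr_def by (intro F.closed_prod) auto

lemma pmap_J: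
  assumes "\<And>a. a \<in> F \<Longrightarrow> f a \<in> J"
  shows "pmap f"
  unfolding pmap_def
proof (intro ballI conjI)
  fix a assume a: "a \<in> F"
  show "f a \<in> carrier R" by (rule Apow_carrier[OF assms[OF a]])
  show "(\<lambda>g. f a g - (\<Sum>m<p. lagr m a * f (of_nat m) g)) \<in> J"
    by (intro ideal_minus[OF ideal_J] ideal_sum[OF ideal_J] ideal_smult[OF ideal_J] lagr_closed assms a) simp
qed

lemma pmap_poly:
  assumes "degree \<phi> < p" "\<And>a. a \<in> F \<Longrightarrow> poly \<phi> a \<in> F" "u \<in> carrier R"
  shows "pmap (\<lambda>a g. poly \<phi> a * u g)"
  unfolding pmap_def
proof (intro ballI conjI)
  fix a assume "a \<in> F"
  then show "(\<lambda>g. poly \<phi> a * u g) \<in> carrier R" using assms by auto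
  have "(\<lambda>g. poly \<phi> a * u g - (\<Sum>m<p. lagr m a * (poly \<phi> (of_nat m) * u g))) = (\<lambda>g. 0)"
    by (subst lagrange_interpolation[OF assms(1)]) (simp add: sum_distrib_right mult.assoc)
  then show "(\<lambda>g. poly \<phi> a * u g - (\<Sum>m<p. lagr m a * (poly \<phi> (of_nat m) * u g))) \<in> J"
    using ideal_zero[OF ideal_J] by simp
qed

lemma pmap_sum:
  assumes "\<And>i. i \<in> I \<Longrightarrow> pmap (f i)"
  shows "pmap (\<lambda>a g. \<Sum>i\<in>I. f i a g)"
  unfolding pmap_def
proof (intro ballI conjI)
  fix a assume a: "a \<in> F"
  show "(\<lambda>g. \<Sum>i\<in>I. f i a g) \<in> carrier R" using assms a by (auto simp: pmap_def)
  have "(\<lambda>g. (\<Sum>i\<in>I. f i a g) - (\<Sum>m<p. lagr m a * (\<Sum>i\<in>I. f i (of_nat m) g)))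
      = (\<lambda>g. \<Sum>i\<in>I. f i a g - (\<Sum>m<p. lagr m a * f i (of_nat m) g))"
  proof
    fix g
    have "(\<Sum>m<p. lagr m a * (\<Sum>i\<in>I. f i (of_nat m) g)) = (\<Sum>i\<in>I. \<Sum>m<p. lagr m a * f i (of_nat m) g)"
      by (simp add: sum_distrib_left) (rule sum.swap)
    then show "(\<Sum>i\<in>I. f i a g) - (\<Sum>m<p. lagr m a * (\<Sum>i\<in>I. f i (of_nat m) g))
        = (\<Sum>i\<in>I. f i a g - (\<Sum>m<p. lagr m a * f i (of_nat m) g))"
      by (simp add: sum_subtractf)
  qed
  also have "\<dots> \<in> J"
    by (intro ideal_sum[OF ideal_J]) (use assms a in \<open>auto simp: pmap_def\<close>)
  finally show "(\<lambda>g. (\<Sum>i\<in>I. f i a g) - (\<Sum>m<p. lagr m a * (\<Sum>i\<in>I. f i (of_nat m) g))) \<in> J" .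
qed

lemma pmap_mult_const:
  assumes "pmap f" "v \<in> carrier R"
  shows "pmap (\<lambda>a. f a \<otimes>\<^bsub>R\<^esub> v)"
  unfolding pmap_def
proof (intro ballI conjI)
  fix a assume a: "a \<in> F"
  then show "f a \<otimes>\<^bsub>R\<^esub> v \<in> carrier R" using assms by (auto simp: pmap_def)
  let ?s = "\<lambda>g. \<Sum>m<p. lagr m a * f (of_nat m) g"
  have s: "?s \<in> carrier R" using assms a by (intro lin_comb_closed) (auto simp: pmap_def)
  have "(\<lambda>g. f a g - ?s g) \<otimes>\<^bsub>R\<^esub> v \<in> J"
    using assms a by (intro ideal.I_r_closed[OF ideal_J]) (auto simp: pmap_def)
  moreover have "(\<lambda>g. f a g - ?s g) \<otimes>\<^bsub>R\<^esub> v = (\<lambda>g. (f a \<otimes>\<^bsub>R\<^esub> v) g - (?s \<otimes>\<^bsub>R\<^esub> v) g)"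
    using assms a s by (intro mult_minus_left) (auto simp: pmap_def)
  moreover have "?s \<otimes>\<^bsub>R\<^esub> v = (\<lambda>g. \<Sum>m<p. lagr m a * (f (of_nat m) \<otimes>\<^bsub>R\<^esub> v) g)"
    by (subst mult_sum_left) (simp add: mult_smult_left)
  ultimately show "(\<lambda>g. (f a \<otimes>\<^bsub>R\<^esub> v) g - (\<Sum>m<p. lagr m a * (f (of_nat m) \<otimes>\<^bsub>R\<^esub> v) g)) \<in> J" by simp
qed

lemma pmap_eq:
  assumes f: "pmap f" and h: "pmap h"
    and eq: "\<And>m. m < p \<Longrightarrow> f (of_nat m) \<doteq> h (of_nat m)" and a: "a \<in> F"
  shows "f a \<doteq> h a"
proof -
  let ?s = "\<lambda>f g. \<Sum>m<p. lagr m a * f (of_nat m) g"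
  have 1: "?s f \<doteq> ?s h"
  proof -
    have "(\<lambda>g. \<Sum>m<p. lagr m a * (f (of_nat m) g - h (of_nat m) g)) \<in> J"
      using eq a by (intro ideal_sum[OF ideal_J] ideal_smult[OF ideal_J]) (auto simp: cong_J_def)
    then have "(\<lambda>g. ?s f g - ?s h g) \<in> J" by (simp add: sum_subtractf algebra_simps)
    then show ?thesis using f h a by (auto simp: cong_J_def pmap_def)
  qed
  have "f a \<doteq> ?s f" "h a \<doteq> ?s h"
    using f h a by (auto simp: cong_J_def pmap_def)
  then show ?thesis using 1 cong_J_trans cong_J_sym by meson
qed

lemma trunc_binomial_closed [intro]: "a \<in> F \<Longrightarrow> trunc_binomial a i \<in> F"
  unfolding trunc_binomial_def by (intro F.closed_divide F.closed_prod) auto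

lemma A_carrier: "u \<in> A \<Longrightarrow> u \<in> carrier R"
  by (simp add: A_iff)

lemma tpow_closed [intro]: "a \<in> F \<Longrightarrow> u \<in> A \<Longrightarrow> tpow a u \<in> carrier R"
  unfolding tpow_def by (intro lin_comb_closed) (auto simp: A_carrier)

lemma tpow_minus_one:
  assumes "a \<in> F" "u \<in> A"
  shows "tpow a u \<ominus>\<^bsub>R\<^esub> \<one>\<^bsub>R\<^esub> \<in> A"
proof -
  have shift: "(\<Sum>i<p. f i) = f 0 + (\<Sum>i<p - 1. f (Suc i))" for f :: "nat \<Rightarrow> 'a"
    by (metis One_nat_def Suc_pred p_gt_0 sum.lessThan_Suc_shift)
  have "tpow a u \<ominus>\<^bsub>R\<^esub> \<one>\<^bsub>R\<^esub> = (\<lambda>g. \<Sum>i<p - 1. trunc_binomial a (Suc i) * (u [^]\<^bsub>R\<^esub> Suc i) g)"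
    using tpow_closed[OF assms] by (simp add: R_minus) (simp add: tpow_def shift)
  also have "\<dots> \<in> A"
  proof (intro ideal_sum[OF ideal_A] ideal_smult[OF ideal_A])
    fix i
    show "u [^]\<^bsub>R\<^esub> Suc i \<in> A" using pow_Apow[OF assms(2), of "Suc i"] Apow_antimono[of 1 "Suc i"] Apow_1 by auto
  qed (use assms in auto)
  finally show ?thesis .
qed

text \<open>Here k <= p enters: what truncation omits from a binomial series vanishes modulo
  \<open>A^k\<close>.\<close>

lemma pow_J: "u \<in> A \<Longrightarrow> p \<le> i \<Longrightarrow> u [^]\<^bsub>R\<^esub> (i::nat) \<in> J"
  using pow_Apow[of u i] Apow_antimono[of k i] k_le_p by auto

lemma one_plus_pow:
  assumes "u \<in> carrier R" "m < M"
  shows "(\<one>\<^bsub>R\<^esub> \<oplus>\<^bsub>R\<^esub> u) [^]\<^bsub>R\<^esub> (m::nat) = (\<lambda>g. \<Sum>i<M. of_nat (m choose i) * (u [^]\<^bsub>R\<^esub> i) g)"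
  using assms(2)
proof (induction m)
  case 0
  then obtain N where M: "M = Suc N" using gr0_implies_Suc by blast
  show ?case by (simp add: M sum.lessThan_Suc_shift del: sum.lessThan_Suc)
next
  case (Suc m)
  then obtain N where M: "M = Suc N" and m: "m < N" by (cases M) auto
  let ?b = "\<lambda>g. \<Sum>i<M. of_nat (m choose i) * (u [^]\<^bsub>R\<^esub> i) g"
  have b: "?b \<in> carrier R" using assms(1) by (intro lin_comb_closed) auto
  have "(\<one>\<^bsub>R\<^esub> \<oplus>\<^bsub>R\<^esub> u) [^]\<^bsub>R\<^esub> Suc m = ?b \<otimes>\<^bsub>R\<^esub> (\<one>\<^bsub>R\<^esub> \<oplus>\<^bsub>R\<^esub> u)"
    using Suc by simp
  also have "\<dots> = ?b \<oplus>\<^bsub>R\<^esub> ?b \<otimes>\<^bsub>R\<^esub> u"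
    using b assms(1) by (simp add: R.r_distr)
  also have "?b \<otimes>\<^bsub>R\<^esub> u = (\<lambda>g. \<Sum>i<M. of_nat (m choose i) * (u [^]\<^bsub>R\<^esub> Suc i) g)"
    by (subst mult_sum_left) (simp add: mult_smult_left)
  finally show ?case
    using pascal_sum[OF m, of "\<lambda>i. (u [^]\<^bsub>R\<^esub> i) _"] by (simp add: R_add M)
qed

text \<open>The two sides have the same terms below index p, and the remaining terms of the ordinary
  power lie in \<open>J\<close>.\<close>

lemma tpow_of_nat:
  assumes u: "u \<in> A"
  shows "tpow (of_nat m) u \<doteq> (\<one>\<^bsub>R\<^esub> \<oplus>\<^bsub>R\<^esub> u) [^]\<^bsub>R\<^esub> m"
proof -
  \<comment> \<open>Exceeds \<open>m\<close>, as \<open>one_plus_pow\<close> requires, and also p,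
    where the truncation stops.\<close>
  let ?M = "p + (m + 1)"
  have uc: "u \<in> carrier R" using u by (rule A_carrier)
  have "(\<one>\<^bsub>R\<^esub> \<oplus>\<^bsub>R\<^esub> u) [^]\<^bsub>R\<^esub> m = (\<lambda>g. \<Sum>i<?M. of_nat (m choose i) * (u [^]\<^bsub>R\<^esub> i) g)"
    by (rule one_plus_pow[OF uc]) simp
  moreover have "(\<lambda>g. tpow (of_nat m) u g - (\<Sum>i<?M. of_nat (m choose i) * (u [^]\<^bsub>R\<^esub> i) g))
     = (\<lambda>g. \<Sum>i\<in>{p..<?M}. - of_nat (m choose i) * (u [^]\<^bsub>R\<^esub> i) g)"
  proof
    fix g
    have split: "{..<?M} = {..<p} \<union> {p..<?M}" by auto
    have "(\<Sum>i<?M. of_nat (m choose i) * (u [^]\<^bsub>R\<^esub> i) g) =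
        (\<Sum>i<p. of_nat (m choose i) * (u [^]\<^bsub>R\<^esub> i) g) + (\<Sum>i\<in>{p..<?M}. of_nat (m choose i) * (u [^]\<^bsub>R\<^esub> i) g)"
      unfolding split by (rule sum.union_disjoint) auto
    moreover have "tpow (of_nat m) u g = (\<Sum>i<p. of_nat (m choose i) * (u [^]\<^bsub>R\<^esub> i) g)"
      unfolding tpow_def by (intro sum.cong) (auto simp: trunc_binomial_of_nat)
    ultimately show "tpow (of_nat m) u g - (\<Sum>i<?M. of_nat (m choose i) * (u [^]\<^bsub>R\<^esub> i) g)
        = (\<Sum>i\<in>{p..<?M}. - of_nat (m choose i) * (u [^]\<^bsub>R\<^esub> i) g)"
      by (simp add: sum_negf)
  qed
  moreover have "(\<lambda>g. \<Sum>i\<in>{p..<?M}. - of_nat (m choose i) * (u [^]\<^bsub>R\<^esub> i) g) \<in> J"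
    by (intro ideal_sum[OF ideal_J] ideal_smult[OF ideal_J] pow_J u) auto
  ultimately have "(\<lambda>g. tpow (of_nat m) u g - ((\<one>\<^bsub>R\<^esub> \<oplus>\<^bsub>R\<^esub> u) [^]\<^bsub>R\<^esub> m) g) \<in> J"
    by (simp only:)
  then show ?thesis using u uc by (auto simp: cong_J_def)
qed

text \<open>An affine substitution in the exponent keeps the degree below p. Shifts and multiples of
  the exponent are the instances used below.\<close>

lemma pmap_tpow_pcompose:
  assumes u: "u \<in> carrier R" and "degree \<phi> \<le> 1" "\<And>a. a \<in> F \<Longrightarrow> poly \<phi> a \<in> F"
  shows "pmap (\<lambda>a. tpow (poly \<phi> a) u)"
  unfolding tpow_def
proof (rule pmap_sum)
  fix i assume i: "i \<in> {..<p}"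
  have "degree (pcompose (tb_poly i) \<phi>) \<le> i * 1"
    using degree_pcompose_le[of "tb_poly i" \<phi>] mult_le_mono[OF degree_tb_poly assms(2)] order_trans by blast
  then have "pmap (\<lambda>a g. poly (pcompose (tb_poly i) \<phi>) a * (u [^]\<^bsub>R\<^esub> i) g)"
    using i u assms(3) by (intro pmap_poly) (auto simp: poly_pcompose poly_tb_poly)
  then show "pmap (\<lambda>a g. trunc_binomial (poly \<phi> a) i * (u [^]\<^bsub>R\<^esub> i) g)"
    by (simp add: poly_pcompose poly_tb_poly)
qed

lemma pmap_tpow: "u \<in> carrier R \<Longrightarrow> pmap (\<lambda>a. tpow a u)"
  using pmap_tpow_pcompose[of u "[:0, 1:]"] by simp

lemma pmap_tpow_shift: "u \<in> carrier R \<Longrightarrow> b \<in> F \<Longrightarrow> pmap (\<lambda>a. tpow (a + b) u)"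
  using pmap_tpow_pcompose[of u "[:b, 1:]"] by (simp add: add.commute)

lemma pmap_tpow_scale: "u \<in> carrier R \<Longrightarrow> a \<in> F \<Longrightarrow> pmap (\<lambda>b. tpow (a * b) u)"
  using pmap_tpow_pcompose[of u "[:0, a:]"] by (simp add: mult.commute)

text \<open>As a polynomial in \<open>a\<close> the product has degree up to 2 (p - 1). The summands
  with i + j >= p lie in \<open>A^p\<close> and so vanish modulo \<open>J\<close>; the others have
  degree below p.\<close>

lemma pmap_tpow_mult:
  assumes u: "u \<in> A" and v: "v \<in> A"
  shows "pmap (\<lambda>a. tpow a u \<otimes>\<^bsub>R\<^esub> tpow a v)"
proof -
  have uc: "u \<in> carrier R" and vc: "v \<in> carrier R" using u v by (auto intro: A_carrier)
  have "(\<lambda>a. tpow a u \<otimes>\<^bsub>R\<^esub> tpow a v) =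
    (\<lambda>a g. \<Sum>i<p. \<Sum>j<p. poly (tb_poly i * tb_poly j) a * (u [^]\<^bsub>R\<^esub> i \<otimes>\<^bsub>R\<^esub> v [^]\<^bsub>R\<^esub> j) g)"
    by (intro ext) (simp add: tpow_def mult_sum_left mult_smult_left mult_sum_right mult_smult_right
      poly_tb_poly sum_distrib_left mult.assoc)
  moreover have "pmap \<dots>"
  proof (intro pmap_sum)
    fix i j assume ij: "i \<in> {..<p}" "j \<in> {..<p}"
    show "pmap (\<lambda>a g. poly (tb_poly i * tb_poly j) a * (u [^]\<^bsub>R\<^esub> i \<otimes>\<^bsub>R\<^esub> v [^]\<^bsub>R\<^esub> j) g)"
    proof (cases "i + j < p")
      case True
      have "degree (tb_poly i * tb_poly j) \<le> i + j"
        using degree_mult_le[of "tb_poly i" "tb_poly j"] degree_tb_poly[of i] degree_tb_poly[of j] by linarith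
      then show ?thesis using True uc vc by (intro pmap_poly) (auto simp: poly_tb_poly)
    next
      case False
      then have "u [^]\<^bsub>R\<^esub> i \<otimes>\<^bsub>R\<^esub> v [^]\<^bsub>R\<^esub> j \<in> J"
        using mult_pow_Apow[OF v pow_Apow[OF u], of i j] Apow_antimono[of k "i + j"] k_le_p by auto
      then show ?thesis by (intro pmap_J ideal_smult[OF ideal_J]) (auto simp: poly_tb_poly)
    qed
  qed
  ultimately show ?thesis by simp
qed

text \<open>Interpolation in one exponent at a time: for two natural exponents the factors are
  honest powers of 1 + u, then one exponent is freed, and finally the other.\<close>

lemma tpow_add:
  assumes u: "u \<in> A" and a: "a \<in> F" and b: "b \<in> F"
  shows "tpow (a + b) u \<doteq> tpow a u \<otimes>\<^bsub>R\<^esub> tpow b u"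
proof -
  have uc: "u \<in> carrier R" using u by (rule A_carrier)
  have nat_case: "tpow (a + of_nat m) u \<doteq> tpow a u \<otimes>\<^bsub>R\<^esub> tpow (of_nat m) u" if "a \<in> F" for a m
  proof (rule pmap_eq[OF pmap_tpow_shift pmap_mult_const[OF pmap_tpow]])
    fix l
    have "tpow (of_nat l + of_nat m) u \<doteq> (\<one>\<^bsub>R\<^esub> \<oplus>\<^bsub>R\<^esub> u) [^]\<^bsub>R\<^esub> (l + m)"
      using tpow_of_nat[OF u, of "l + m"] by simp
    also have "\<dots> = (\<one>\<^bsub>R\<^esub> \<oplus>\<^bsub>R\<^esub> u) [^]\<^bsub>R\<^esub> l \<otimes>\<^bsub>R\<^esub> (\<one>\<^bsub>R\<^esub> \<oplus>\<^bsub>R\<^esub> u) [^]\<^bsub>R\<^esub> m"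
      using uc by (simp add: R.nat_pow_mult)
    also have "\<dots> \<doteq> tpow (of_nat l) u \<otimes>\<^bsub>R\<^esub> tpow (of_nat m) u"
      by (intro cong_J_mult cong_J_sym[OF tpow_of_nat] u)
    finally show "tpow (of_nat l + of_nat m) u \<doteq> tpow (of_nat l) u \<otimes>\<^bsub>R\<^esub> tpow (of_nat m) u" .
  qed (use that uc u in auto)
  have "tpow (b + a) u \<doteq> tpow b u \<otimes>\<^bsub>R\<^esub> tpow a u"
  proof (rule pmap_eq[OF pmap_tpow_shift pmap_mult_const[OF pmap_tpow]])
    fix m
    show "tpow (of_nat m + a) u \<doteq> tpow (of_nat m) u \<otimes>\<^bsub>R\<^esub> tpow a u"
      using nat_case[OF a, of m] tpow_closed[OF a u] tpow_closed[OF _ u, of "of_nat m"]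
      by (simp add: add.commute R.m_comm)
  qed (use a b uc u in auto)
  then show ?thesis using tpow_closed[OF a u] tpow_closed[OF b u] by (simp add: add.commute R.m_comm)
qed

text \<open>For a natural exponent this is the power of a product in a commutative ring;
  interpolation in \<open>a\<close> does the rest.\<close>

lemma tpow_mult:
  assumes u: "u \<in> A" and v: "v \<in> A" and w: "w \<in> A" and a: "a \<in> F"
    and eq: "\<one>\<^bsub>R\<^esub> \<oplus>\<^bsub>R\<^esub> w = (\<one>\<^bsub>R\<^esub> \<oplus>\<^bsub>R\<^esub> u) \<otimes>\<^bsub>R\<^esub> (\<one>\<^bsub>R\<^esub> \<oplus>\<^bsub>R\<^esub> v)"
  shows "tpow a w \<doteq> tpow a u \<otimes>\<^bsub>R\<^esub> tpow a v"
proof (rule pmap_eq[OF pmap_tpow pmap_tpow_mult[OF u v]])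
  have uc: "u \<in> carrier R" and vc: "v \<in> carrier R" using u v by (auto intro: A_carrier)
  fix m
  have "tpow (of_nat m) w \<doteq> (\<one>\<^bsub>R\<^esub> \<oplus>\<^bsub>R\<^esub> w) [^]\<^bsub>R\<^esub> m" by (rule tpow_of_nat[OF w])
  also have "\<dots> = (\<one>\<^bsub>R\<^esub> \<oplus>\<^bsub>R\<^esub> u) [^]\<^bsub>R\<^esub> m \<otimes>\<^bsub>R\<^esub> (\<one>\<^bsub>R\<^esub> \<oplus>\<^bsub>R\<^esub> v) [^]\<^bsub>R\<^esub> m"
    unfolding eq using uc vc by (intro R.pow_mult_distrib R.m_comm) auto
  also have "\<dots> \<doteq> tpow (of_nat m) u \<otimes>\<^bsub>R\<^esub> tpow (of_nat m) v"
    by (intro cong_J_mult cong_J_sym[OF tpow_of_nat] u v)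
  finally show "tpow (of_nat m) w \<doteq> tpow (of_nat m) u \<otimes>\<^bsub>R\<^esub> tpow (of_nat m) v" .
qed (use w a in \<open>auto intro: A_carrier\<close>)

lemma one_plus_minus_one: "x \<in> carrier R \<Longrightarrow> \<one>\<^bsub>R\<^esub> \<oplus>\<^bsub>R\<^esub> (x \<ominus>\<^bsub>R\<^esub> \<one>\<^bsub>R\<^esub>) = x"
  by (simp add: R_minus R_add)

text \<open>Interpolated in the outer exponent \<open>b\<close>. For natural \<open>b\<close> the
  left side is an ordinary power of \<open>tpow a u\<close>, which \<open>tpow_add\<close> turns
  into a multiple of the exponent \<open>a\<close>.\<close>

lemma tpow_tpow:
  assumes u: "u \<in> A" and a: "a \<in> F" and b: "b \<in> F"
  shows "tpow b (tpow a u \<ominus>\<^bsub>R\<^esub> \<one>\<^bsub>R\<^esub>) \<doteq> tpow (a * b) u"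
proof (rule pmap_eq[OF pmap_tpow pmap_tpow_scale])
  have uc: "u \<in> carrier R" using u by (rule A_carrier)
  fix m
  have "tpow (of_nat m) (tpow a u \<ominus>\<^bsub>R\<^esub> \<one>\<^bsub>R\<^esub>) \<doteq> tpow a u [^]\<^bsub>R\<^esub> m"
    using tpow_of_nat[OF tpow_minus_one[OF a u], of m] tpow_closed[OF a u] by (simp add: one_plus_minus_one)
  also have "tpow a u [^]\<^bsub>R\<^esub> m \<doteq> tpow (a * of_nat m) u"
  proof (induction m)
    case 0
    have "tpow (of_nat 0) u \<doteq> (\<one>\<^bsub>R\<^esub> \<oplus>\<^bsub>R\<^esub> u) [^]\<^bsub>R\<^esub> (0::nat)" by (rule tpow_of_nat[OF u])
    then show ?case by (simp add: cong_J_sym)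
  next
    case (Suc m)
    have "tpow a u [^]\<^bsub>R\<^esub> Suc m \<doteq> tpow (a * of_nat m) u \<otimes>\<^bsub>R\<^esub> tpow a u"
      using cong_J_mult[OF Suc cong_J_refl[OF tpow_closed[OF a u]]] by simp
    also have "\<dots> \<doteq> tpow (a * of_nat m + a) u"
      by (rule cong_J_sym[OF tpow_add]) (use u a in auto)
    finally show ?case by (simp add: algebra_simps)
  qed
  finally show "tpow (of_nat m) (tpow a u \<ominus>\<^bsub>R\<^esub> \<one>\<^bsub>R\<^esub>) \<doteq> tpow (a * of_nat m) u" .
qed (use u a b tpow_minus_one in \<open>auto intro: A_carrier\<close>)

text \<open>Makes scalar multiplication well defined on classes modulo \<open>A^k\<close>.\<close>

lemma tpow_cong:
  assumes "u \<doteq> v" "u \<in> A" "v \<in> A" "a \<in> F"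
  shows "tpow a u \<doteq> tpow a v"
proof -
  have "(\<lambda>g. \<Sum>i<p. trunc_binomial a i * ((u [^]\<^bsub>R\<^esub> i) g - (v [^]\<^bsub>R\<^esub> i) g)) \<in> J"
    using assms cong_J_pow[OF assms(1)]
    by (intro ideal_sum[OF ideal_J] ideal_smult[OF ideal_J]) (auto simp: cong_J_def)
  then have "(\<lambda>g. tpow a u g - tpow a v g) \<in> J"
    by (simp add: tpow_def sum_subtractf right_diff_distrib)
  then show ?thesis using assms by (auto simp: cong_J_def)
qed

lemma eq_cong_J_trans [trans]: "x = y \<Longrightarrow> y \<doteq> z \<Longrightarrow> x \<doteq> z"
  by simp

lemma cong_J_eq_trans [trans]: "x \<doteq> y \<Longrightarrow> y = z \<Longrightarrow> x \<doteq> z"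
  by simp

section \<open>Coordinates in the multiplicatively written vector space\<close>

lemma aug_one: "(\<Sum>g\<in>carrier G. \<one>\<^bsub>R\<^esub> g) = 1"
  using finite_G by (simp add: R_one group_ring_of_def)

lemma minus_one_A_iff:
  assumes "x \<in> carrier R"
  shows "x \<ominus>\<^bsub>R\<^esub> \<one>\<^bsub>R\<^esub> \<in> A \<longleftrightarrow> (\<Sum>g\<in>carrier G. x g) = 1"
proof -
  have "x \<ominus>\<^bsub>R\<^esub> \<one>\<^bsub>R\<^esub> \<in> carrier R" using assms by simp
  moreover have "(\<Sum>g\<in>carrier G. (x \<ominus>\<^bsub>R\<^esub> \<one>\<^bsub>R\<^esub>) g) = (\<Sum>g\<in>carrier G. x g) - 1"
    using assms by (simp add: R_minus sum_subtractf aug_one)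
  ultimately show ?thesis by (simp add: A_iff)
qed

lemma mult_minus_one_A:
  assumes "x \<in> carrier R" "y \<in> carrier R" "x \<ominus>\<^bsub>R\<^esub> \<one>\<^bsub>R\<^esub> \<in> A" "y \<ominus>\<^bsub>R\<^esub> \<one>\<^bsub>R\<^esub> \<in> A"
  shows "x \<otimes>\<^bsub>R\<^esub> y \<ominus>\<^bsub>R\<^esub> \<one>\<^bsub>R\<^esub> \<in> A"
  using assms by (simp add: minus_one_A_iff aug_mult)

lemma group_ring_of_minus_one:
  assumes "g \<in> carrier G" shows "group_ring_of g \<ominus>\<^bsub>R\<^esub> \<one>\<^bsub>R\<^esub> \<in> A"
  using assms finite_G by (simp add: minus_one_A_iff) (simp add: group_ring_of_def)

text \<open>In the multiplicative F-space (1 + A)/(1 + A^k) this is the linear combination, with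
  coefficients \<open>c\<close>, of the classes of the first \<open>m\<close> elements 1 + u
  i.\<close>

primrec tprod :: "(nat \<Rightarrow> 'b \<Rightarrow> 'a) \<Rightarrow> (nat \<Rightarrow> 'a) \<Rightarrow> nat \<Rightarrow> ('b \<Rightarrow> 'a)" where
  "tprod u c 0 = \<one>\<^bsub>R\<^esub>"
| "tprod u c (Suc m) = tprod u c m \<otimes>\<^bsub>R\<^esub> tpow (c (Suc m)) (u (Suc m))"

context
  fixes u :: "nat \<Rightarrow> 'b \<Rightarrow> 'a" and n :: nat
  assumes u: "\<And>i. i \<in> {1..n} \<Longrightarrow> u i \<in> A"
begin

lemma tprod_closed:
  assumes "\<And>i. i \<in> {1..n} \<Longrightarrow> c i \<in> F" "m \<le> n"
  shows "tprod u c m \<in> carrier R"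
  using assms(2) by (induction m) (auto intro!: tpow_closed u assms(1))

lemma tprod_minus_one:
  assumes "\<And>i. i \<in> {1..n} \<Longrightarrow> c i \<in> F" "m \<le> n"
  shows "tprod u c m \<ominus>\<^bsub>R\<^esub> \<one>\<^bsub>R\<^esub> \<in> A"
  using assms(2)
proof (induction m)
  case 0
  then show ?case using ideal_zero[OF ideal_A] by (simp add: R_minus)
next
  case (Suc m)
  then show ?case
    using assms(1) u unfolding tprod.simps
    by (intro mult_minus_one_A tpow_closed tpow_minus_one tprod_closed) auto
qed

lemma tprod_add:
  assumes c: "\<And>i. i \<in> {1..n} \<Longrightarrow> c i \<in> F" and d: "\<And>i. i \<in> {1..n} \<Longrightarrow> d i \<in> F" and "m \<le> n"
  shows "tprod u c m \<otimes>\<^bsub>R\<^esub> tprod u d m \<doteq> tprod u (\<lambda>i. c i + d i) m"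
  using assms(3)
proof (induction m)
  case 0
  then show ?case using cong_J_refl by simp
next
  case (Suc m)
  let ?s = "Suc m"
  have s: "?s \<in> {1..n}" using Suc.prems by simp
  have cl: "tprod u c m \<in> carrier R" "tprod u d m \<in> carrier R"
    "tpow (c ?s) (u ?s) \<in> carrier R" "tpow (d ?s) (u ?s) \<in> carrier R"
    using c d u s Suc.prems by (auto intro!: tprod_closed tpow_closed)
  have "tprod u c ?s \<otimes>\<^bsub>R\<^esub> tprod u d ?s
      = (tprod u c m \<otimes>\<^bsub>R\<^esub> tprod u d m) \<otimes>\<^bsub>R\<^esub> (tpow (c ?s) (u ?s) \<otimes>\<^bsub>R\<^esub> tpow (d ?s) (u ?s))"
    using cl by (simp add: R.m_ac)
  also have "\<dots> \<doteq> tprod u (\<lambda>i. c i + d i) m \<otimes>\<^bsub>R\<^esub> tpow (c ?s + d ?s) (u ?s)"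
    using Suc s c d u by (intro cong_J_mult cong_J_sym[OF tpow_add]) auto
  finally show ?case by (simp only: tprod.simps)
qed

lemma tprod_scale:
  assumes c: "\<And>i. i \<in> {1..n} \<Longrightarrow> c i \<in> F" and a: "a \<in> F" and "m \<le> n"
  shows "tpow a (tprod u c m \<ominus>\<^bsub>R\<^esub> \<one>\<^bsub>R\<^esub>) \<doteq> tprod u (\<lambda>i. c i * a) m"
  using assms(3)
proof (induction m)
  case 0
  have "tprod u c 0 \<ominus>\<^bsub>R\<^esub> \<one>\<^bsub>R\<^esub> = \<zero>\<^bsub>R\<^esub>" by (simp add: R_minus)
  moreover have "tpow a (\<zero>\<^bsub>R\<^esub>) = \<one>\<^bsub>R\<^esub>"
  proof
    fix g
    have "tpow a (\<zero>\<^bsub>R\<^esub>) g = (\<Sum>i<p. if i = 0 then \<one>\<^bsub>R\<^esub> g else 0)"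
      unfolding tpow_def
    proof (rule sum.cong)
      fix i show "trunc_binomial a i * (\<zero>\<^bsub>R\<^esub> [^]\<^bsub>R\<^esub> i) g = (if i = 0 then \<one>\<^bsub>R\<^esub> g else 0)"
        using R.nat_pow_zero[of i] by (cases "i = 0") auto
    qed simp
    then show "tpow a (\<zero>\<^bsub>R\<^esub>) g = \<one>\<^bsub>R\<^esub> g" using p_gt_0 by simp
  qed
  ultimately show ?case using cong_J_refl by simp
next
  case (Suc m)
  let ?s = "Suc m"
  have s: "?s \<in> {1..n}" using Suc.prems by simp
  have cl: "tprod u c m \<in> carrier R" "tpow (c ?s) (u ?s) \<in> carrier R" "tprod u c ?s \<in> carrier R"
    using c u s Suc.prems by (auto intro!: tprod_closed tpow_closed simp del: tprod.simps(2))
  have "tpow a (tprod u c ?s \<ominus>\<^bsub>R\<^esub> \<one>\<^bsub>R\<^esub>)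
      \<doteq> tpow a (tprod u c m \<ominus>\<^bsub>R\<^esub> \<one>\<^bsub>R\<^esub>) \<otimes>\<^bsub>R\<^esub> tpow a (tpow (c ?s) (u ?s) \<ominus>\<^bsub>R\<^esub> \<one>\<^bsub>R\<^esub>)"
  proof (rule tpow_mult)
    show "tprod u c m \<ominus>\<^bsub>R\<^esub> \<one>\<^bsub>R\<^esub> \<in> A" "tprod u c ?s \<ominus>\<^bsub>R\<^esub> \<one>\<^bsub>R\<^esub> \<in> A"
      "tpow (c ?s) (u ?s) \<ominus>\<^bsub>R\<^esub> \<one>\<^bsub>R\<^esub> \<in> A"
      using c u s Suc.prems by (auto intro!: tprod_minus_one tpow_minus_one simp del: tprod.simps(2))
    show "\<one>\<^bsub>R\<^esub> \<oplus>\<^bsub>R\<^esub> (tprod u c ?s \<ominus>\<^bsub>R\<^esub> \<one>\<^bsub>R\<^esub>) =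
      (\<one>\<^bsub>R\<^esub> \<oplus>\<^bsub>R\<^esub> (tprod u c m \<ominus>\<^bsub>R\<^esub> \<one>\<^bsub>R\<^esub>)) \<otimes>\<^bsub>R\<^esub> (\<one>\<^bsub>R\<^esub> \<oplus>\<^bsub>R\<^esub> (tpow (c ?s) (u ?s) \<ominus>\<^bsub>R\<^esub> \<one>\<^bsub>R\<^esub>))"
      using cl by (simp only: one_plus_minus_one tprod.simps)
  qed (rule a)
  also have "\<dots> \<doteq> tprod u (\<lambda>i. c i * a) m \<otimes>\<^bsub>R\<^esub> tpow (c ?s * a) (u ?s)"
    using Suc s c u a by (intro cong_J_mult tpow_tpow) auto
  finally show ?case by (simp only: tprod.simps)
qed

text \<open>By \<open>tprod_add\<close> and \<open>tprod_scale\<close> the classes of the form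
  \<open>tprod u c n\<close> are closed under both operations of the span, so it is enough that they
  contain the image of \<open>G\<close>.\<close>

theorem group_span_tprod:
  assumes gen: "\<And>g. g \<in> carrier G \<Longrightarrow> \<exists>c. (\<forall>i\<in>{1..n}. c i \<in> F) \<and> group_ring_of g \<doteq> tprod u c n"
    and "a \<in> group_span p F G k"
  shows "\<exists>c. (\<forall>i\<in>{1..n}. c i \<in> F) \<and> a = trunc_class F G k (tprod u c n)"
  using assms(2)
proof induction
  case (image g)
  obtain c where c: "\<And>i. i \<in> {1..n} \<Longrightarrow> c i \<in> F" "group_ring_of g \<doteq> tprod u c n"
    using gen[OF image] by blast
  then have "trunc_class F G k (group_ring_of g) = trunc_class F G k (tprod u c n)"
    using trunc_class_eq_iff[OF _ tprod_closed] image by simp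
  then show ?case using c by blast
next
  case (prod a b)
  obtain c where c: "\<And>i. i \<in> {1..n} \<Longrightarrow> c i \<in> F" "a = trunc_class F G k (tprod u c n)"
    using prod.IH(1) by blast
  obtain d where d: "\<And>i. i \<in> {1..n} \<Longrightarrow> d i \<in> F" "b = trunc_class F G k (tprod u d n)"
    using prod.IH(2) by blast
  have cl: "tprod u c n \<in> carrier R" "tprod u d n \<in> carrier R" "tprod u (\<lambda>i. c i + d i) n \<in> carrier R"
    using c d by (auto intro!: tprod_closed)
  have "a \<otimes>\<^bsub>trunc_ring F G k\<^esub> b = trunc_class F G k (tprod u (\<lambda>i. c i + d i) n)"
    unfolding c(2) d(2) using cl tprod_add[OF c(1) d(1)]
    by (simp add: trunc_class_mult trunc_class_eq_iff)
  then show ?case using c(1) d(1) by (intro exI[of _ "\<lambda>i. c i + d i"]) auto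
next
  case (scal \<gamma> a)
  obtain c where c: "\<And>i. i \<in> {1..n} \<Longrightarrow> c i \<in> F"
      "trunc_class F G k \<gamma> = trunc_class F G k (tprod u c n)"
    using scal.IH by blast
  have cl: "tprod u c n \<in> carrier R" "tprod u (\<lambda>i. c i * a) n \<in> carrier R"
    using c scal.hyps by (auto intro!: tprod_closed)
  have "\<gamma> \<doteq> tprod u c n"
    using c(2) scal.hyps(1) cl(1) by (simp add: trunc_class_eq_iff)
  then have "\<gamma> \<ominus>\<^bsub>R\<^esub> \<one>\<^bsub>R\<^esub> \<doteq> tprod u c n \<ominus>\<^bsub>R\<^esub> \<one>\<^bsub>R\<^esub>"
    by (auto simp: cong_J_def R_minus intro: minus_closed)
  then have "tpow a (\<gamma> \<ominus>\<^bsub>R\<^esub> \<one>\<^bsub>R\<^esub>) \<doteq> tpow a (tprod u c n \<ominus>\<^bsub>R\<^esub> \<one>\<^bsub>R\<^esub>)"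
    using scal.hyps c(1) by (intro tpow_cong tprod_minus_one) auto
  also have "\<dots> \<doteq> tprod u (\<lambda>i. c i * a) n"
    using c(1) scal.hyps by (intro tprod_scale) auto
  finally have "trunc_class F G k (trunc_power p F G \<gamma> a) = trunc_class F G k (tprod u (\<lambda>i. c i * a) n)"
    using trunc_class_eq_iff cl(2) by (auto simp: trunc_power_eq cong_J_def)
  then show ?case using c(1) scal.hyps by (intro exI[of _ "\<lambda>i. c i * a"]) auto
qed

end

text \<open>\<open>h m\<close> is the word in the first \<open>m\<close> generators with exponents
  \<open>e\<close>. Its coordinates are these exponents, read in the prime field.\<close>

lemma tprod_group_pow:
  fixes n :: nat
  assumes s: "\<And>i. i \<in> {1..n} \<Longrightarrow> s i \<in> carrier G"
    and u: "\<And>i. i \<in> {1..n} \<Longrightarrow> u i = group_ring_of (s i) \<ominus>\<^bsub>R\<^esub> \<one>\<^bsub>R\<^esub>"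
    and h: "h 0 = \<one>" "\<And>m. m < n \<Longrightarrow> h (Suc m) = h m \<otimes> s (Suc m) [^] (e (Suc m) :: nat)"
  shows "m \<le> n \<Longrightarrow> h m \<in> carrier G \<and> group_ring_of (h m) \<doteq> tprod u (\<lambda>i. of_nat (e i)) m"
proof (induction m)
  case 0
  then show ?case using cong_J_refl[of "\<one>\<^bsub>R\<^esub>"] by (simp add: h R_one[symmetric])
next
  case (Suc m)
  have sm: "s (Suc m) \<in> carrier G" using s Suc.prems by simp
  have pow: "group_ring_of (x [^] j) = group_ring_of x [^]\<^bsub>R\<^esub> j" if "x \<in> carrier G" for x and j :: nat
    using that by (induction j) (auto simp: R_one group_ring_of_mult[symmetric])
  have uA: "u (Suc m) \<in> A"
    using Suc.prems sm by (simp add: u group_ring_of_minus_one)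
  have "group_ring_of (h (Suc m)) = group_ring_of (h m) \<otimes>\<^bsub>R\<^esub> group_ring_of (s (Suc m)) [^]\<^bsub>R\<^esub> e (Suc m)"
    using h(2)[of m] Suc sm by (simp add: pow[symmetric] group_ring_of_mult)
  also have "group_ring_of (s (Suc m)) = \<one>\<^bsub>R\<^esub> \<oplus>\<^bsub>R\<^esub> u (Suc m)"
    using u[of "Suc m"] Suc.prems sm by (simp add: one_plus_minus_one)
  also have "group_ring_of (h m) \<otimes>\<^bsub>R\<^esub> (\<one>\<^bsub>R\<^esub> \<oplus>\<^bsub>R\<^esub> u (Suc m)) [^]\<^bsub>R\<^esub> e (Suc m)
      \<doteq> tprod u (\<lambda>i. of_nat (e i)) m \<otimes>\<^bsub>R\<^esub> tpow (of_nat (e (Suc m))) (u (Suc m))"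
    using Suc uA by (intro cong_J_mult cong_J_sym[OF tpow_of_nat]) auto
  finally show ?case using h(2)[of m] Suc sm by simp
qed

text \<open>A converse to \<open>group_span_tprod\<close> that allows any \<open>x i\<close> whose
  classes lie in the span, so that it applies to generators that do not come from
  \<open>G\<close>.\<close>

lemma group_span_tprodI:
  assumes "\<And>i. i \<in> {1..n} \<Longrightarrow> x i \<in> carrier R" "\<And>i. i \<in> {1..n} \<Longrightarrow> x i \<ominus>\<^bsub>R\<^esub> \<one>\<^bsub>R\<^esub> \<in> A"
    "\<And>i. i \<in> {1..n} \<Longrightarrow> trunc_class F G k (x i) \<in> group_span p F G k"
    "\<And>i. i \<in> {1..n} \<Longrightarrow> c i \<in> F" "m \<le> n"
  shows "trunc_class F G k (tprod (\<lambda>i. x i \<ominus>\<^bsub>R\<^esub> \<one>\<^bsub>R\<^esub>) c m) \<in> group_span p F G k"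
  using assms(5)
proof (induction m)
  case 0
  then show ?case using group_span.image[OF G.one_closed] by (simp add: R_one)
next
  case (Suc m)
  have "trunc_class F G k (trunc_power p F G (x (Suc m)) (c (Suc m))) \<in> group_span p F G k"
    using assms(1-4) Suc.prems by (intro group_span.scal) auto
  moreover have "tprod (\<lambda>i. x i \<ominus>\<^bsub>R\<^esub> \<one>\<^bsub>R\<^esub>) c m \<in> carrier R"
    using assms Suc.prems by (intro tprod_closed[where n = n]) auto
  moreover have "tpow (c (Suc m)) (x (Suc m) \<ominus>\<^bsub>R\<^esub> \<one>\<^bsub>R\<^esub>) \<in> carrier R"
    using assms Suc.prems by (intro tpow_closed) auto
  moreover have "trunc_class F G k (tprod (\<lambda>i. x i \<ominus>\<^bsub>R\<^esub> \<one>\<^bsub>R\<^esub>) c m) \<in> group_span p F G k"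
    using Suc by simp
  ultimately show ?case
    unfolding tprod.simps by (metis group_span.prod trunc_class_mult trunc_power_eq)
qed

lemma group_span_carrier_rep:
  assumes "a \<in> group_span p F G k"
  shows "\<exists>\<gamma>\<in>carrier R. a = trunc_class F G k \<gamma>"
  using assms
proof induction
  case (prod a b)
  then show ?case using trunc_class_mult by (metis R.m_closed)
next
  case (scal \<gamma> a)
  then show ?case using tpow_closed by (auto simp: trunc_power_eq)
qed auto

lemma mem_trunc_class:
  assumes "\<gamma> \<in> carrier R"
  shows "\<gamma>' \<in> trunc_class F G k \<gamma> \<longleftrightarrow> \<gamma>' \<doteq> \<gamma>"
proof
  assume "\<gamma>' \<in> trunc_class F G k \<gamma>"
  then obtain j where j: "j \<in> J" "\<gamma>' = j \<oplus>\<^bsub>R\<^esub> \<gamma>" by (auto simp: a_r_coset_def')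
  moreover have "(\<lambda>g. \<gamma>' g - \<gamma> g) = j" by (rule ext) (simp add: j R_add)
  ultimately show "\<gamma>' \<doteq> \<gamma>" using assms Apow_carrier[of j k] by (auto simp: cong_J_def)
next
  assume c: "\<gamma>' \<doteq> \<gamma>"
  then have "\<gamma>' = (\<lambda>g. \<gamma>' g - \<gamma> g) \<oplus>\<^bsub>R\<^esub> \<gamma>" by (simp add: R_add)
  then show "\<gamma>' \<in> trunc_class F G k \<gamma>" using c by (auto simp: a_r_coset_def' cong_J_def)
qed

lemma trunc_class_minus_one:
  assumes "\<gamma> \<in> carrier R"
  shows "trunc_class F G k \<gamma> \<ominus>\<^bsub>trunc_ring F G k\<^esub> \<one>\<^bsub>trunc_ring F G k\<^esub>
    = trunc_class F G k (\<gamma> \<ominus>\<^bsub>R\<^esub> \<one>\<^bsub>R\<^esub>)"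
proof -
  interpret h: ring_hom_ring R "trunc_ring F G k" "trunc_class F G k"
    by (rule ideal.rcos_ring_hom_ring[OF ideal_J])
  show ?thesis using assms by (simp add: a_minus_def)
qed

end

section \<open>Discrete valuations\<close>

locale valued =
  fixes w :: "'a::field \<Rightarrow> int"
  assumes w_mult: "x \<noteq> 0 \<Longrightarrow> y \<noteq> 0 \<Longrightarrow> w (x * y) = w x + w y"
    and w_add: "x \<noteq> 0 \<Longrightarrow> y \<noteq> 0 \<Longrightarrow> x + y \<noteq> 0 \<Longrightarrow> min (w x) (w y) \<le> w (x + y)"
begin

text \<open>Reads as v(x) >= m with v(0) infinite. The value \<open>w 0\<close> is left open, so
  estimates that may involve 0 go through this predicate.\<close>

definition vge :: "'a \<Rightarrow> int \<Rightarrow> bool" where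
  "vge x m \<longleftrightarrow> x = 0 \<or> m \<le> w x"

lemma w_1 [simp]: "w 1 = 0"
  using w_mult[of 1 1] by simp

lemma w_uminus [simp]: "w (- x) = w x"
proof (cases "x = 0")
  case False
  have "w (- 1) + w (- 1) = 0" using w_mult[of "- 1" "- 1"] by simp
  then show ?thesis using w_mult[of "- 1" x] False by simp
qed simp

lemma w_inverse: "x \<noteq> 0 \<Longrightarrow> w (inverse x) = - w x"
  using w_mult[of x "inverse x"] by simp

lemma w_divide: "x \<noteq> 0 \<Longrightarrow> y \<noteq> 0 \<Longrightarrow> w (x / y) = w x - w y"
  by (simp add: divide_inverse w_mult w_inverse)

lemma w_power: "x \<noteq> 0 \<Longrightarrow> w (x ^ m) = int m * w x"
  by (induction m) (auto simp: w_mult algebra_simps)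

lemma w_power_int: "x \<noteq> 0 \<Longrightarrow> w (x powi m) = m * w x"
  by (cases "m \<ge> 0") (auto simp: power_int_def w_power w_inverse power_inverse)

lemma w_prod:
  "finite I \<Longrightarrow> (\<And>i. i \<in> I \<Longrightarrow> f i \<noteq> 0) \<Longrightarrow> w (\<Prod>i\<in>I. f i) = (\<Sum>i\<in>I. w (f i))"
  by (induction I rule: finite_induct) (auto simp: w_mult)

lemma vge_0 [simp, intro]: "vge 0 m"
  by (simp add: vge_def)

lemma vge_w [simp, intro]: "vge x (w x)"
  by (simp add: vge_def)

lemma vge_iff: "x \<noteq> 0 \<Longrightarrow> vge x m \<longleftrightarrow> m \<le> w x"
  by (simp add: vge_def)

lemma vge_mono: "vge x m \<Longrightarrow> l \<le> m \<Longrightarrow> vge x l"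
  by (auto simp: vge_def)

lemma vge_uminus [simp]: "vge (- x) m \<longleftrightarrow> vge x m"
  by (simp add: vge_def)

lemma vge_add: "vge x m \<Longrightarrow> vge y m \<Longrightarrow> vge (x + y) m"
  using w_add[of x y] unfolding vge_def by (smt (verit) add.left_neutral add.right_neutral)

lemma vge_diff: "vge x m \<Longrightarrow> vge y m \<Longrightarrow> vge (x - y) m"
  using vge_add[of x m "- y"] by simp

lemma vge_mult: "vge x m \<Longrightarrow> vge y l \<Longrightarrow> vge (x * y) (m + l)"
  by (auto simp: vge_def w_mult)

lemma vge_sum: "(\<And>i. i \<in> I \<Longrightarrow> vge (f i) m) \<Longrightarrow> vge (\<Sum>i\<in>I. f i) m"
  by (induction I rule: infinite_finite_induct) (auto intro: vge_add)

lemma vge_power: "vge x m \<Longrightarrow> vge (x ^ l) (int l * m)"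
  by (induction l) (auto simp: algebra_simps vge_def w_mult)

lemma vge_prod:
  "finite I \<Longrightarrow> (\<And>i. i \<in> I \<Longrightarrow> vge (f i) (m i)) \<Longrightarrow> vge (\<Prod>i\<in>I. f i) (\<Sum>i\<in>I. m i)"
proof (induction I rule: finite_induct)
  case (insert i I)
  then show ?case by (simp add: vge_mult)
qed (simp add: vge_def)

lemma w_add_eq:
  assumes "x \<noteq> 0" "vge y (w x + 1)"
  shows "x + y \<noteq> 0" "w (x + y) = w x"
proof -
  show nz: "x + y \<noteq> 0"
  proof
    assume "x + y = 0"
    then have "y = - x" by (simp add: add_eq_0_iff)
    then show False using assms by (simp add: vge_def)
  qed
  have "vge (x + y) (w x)" using assms(2) by (intro vge_add) (auto intro: vge_mono)
  moreover have "\<not> vge (x + y) (w x + 1)"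
  proof
    assume "vge (x + y) (w x + 1)"
    then have "vge (x + y - y) (w x + 1)" using assms(2) by (rule vge_diff)
    then show False using assms(1) by (simp add: vge_def)
  qed
  ultimately show "w (x + y) = w x" using nz by (simp add: vge_iff)
qed

lemma w_sum_dominant:
  assumes "finite I" "i \<in> I" "f i \<noteq> 0" "\<And>j. j \<in> I \<Longrightarrow> j \<noteq> i \<Longrightarrow> vge (f j) (w (f i) + 1)"
  shows "(\<Sum>j\<in>I. f j) \<noteq> 0" "w (\<Sum>j\<in>I. f j) = w (f i)"
proof -
  have "(\<Sum>j\<in>I. f j) = f i + (\<Sum>j\<in>I-{i}. f j)" by (rule sum.remove[OF assms(1,2)])
  moreover have "vge (\<Sum>j\<in>I-{i}. f j) (w (f i) + 1)" using assms(4) by (intro vge_sum) auto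
  ultimately show "(\<Sum>j\<in>I. f j) \<noteq> 0" "w (\<Sum>j\<in>I. f j) = w (f i)"
    using w_add_eq[OF assms(3)] by simp_all
qed

text \<open>Nonzero terms with distinct valuations cannot cancel: the unique term of least valuation
  dominates the sum.\<close>

lemma sum_distinct:
  assumes "finite I" "\<And>i j. i \<in> I \<Longrightarrow> j \<in> I \<Longrightarrow> f i \<noteq> 0 \<Longrightarrow> f j \<noteq> 0 \<Longrightarrow> w (f i) = w (f j) \<Longrightarrow> i = j"
    and "\<exists>i\<in>I. f i \<noteq> 0"
  obtains i where "i \<in> I" "f i \<noteq> 0" "\<And>j. j \<in> I \<Longrightarrow> j \<noteq> i \<Longrightarrow> vge (f j) (w (f i) + 1)"
    "(\<Sum>j\<in>I. f j) \<noteq> 0" "w (\<Sum>j\<in>I. f j) = w (f i)"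
proof -
  let ?S = "{i\<in>I. f i \<noteq> 0}"
  have S: "finite ?S" "?S \<noteq> {}" using assms by auto
  obtain i where i: "i \<in> ?S" "\<And>j. j \<in> ?S \<Longrightarrow> w (f i) \<le> w (f j)"
    using S ex_min_if_finite[of "(\<lambda>i. w (f i)) ` ?S"] by (metis (no_types, lifting) arg_min_if_finite(1) arg_min_least)
  have dom: "vge (f j) (w (f i) + 1)" if "j \<in> I" "j \<noteq> i" for j
  proof (cases "f j = 0")
    case False
    then have "w (f i) \<le> w (f j)" "w (f i) \<noteq> w (f j)" using i that assms(2)[of i j] by auto
    then show ?thesis by (simp add: vge_def)
  qed simp
  show ?thesis using that[of i] i dom w_sum_dominant[OF assms(1), of i f] by auto
qed

text \<open>Dividing an integral polynomial by the linear factor of an integral root leaves an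
  integral quotient, and each factor contributes \<open>m\<close> at \<open>x\<close>. This feeds
  the contradiction in \<open>not_p_dvd_b\<close>.\<close>

lemma vge_poly_divide_roots:
  assumes "finite S" "\<And>i. vge (coeff f i) 0" "\<And>r. r \<in> S \<Longrightarrow> poly f r = 0" "\<And>r. r \<in> S \<Longrightarrow> vge r 0"
    and "vge x 0" "\<And>r. r \<in> S \<Longrightarrow> vge (x - r) m"
  shows "vge (poly f x) (int (card S) * m)"
proof -
  have poly0: "vge (poly g x) 0" if g: "\<And>i. vge (coeff g i) 0" for g
    unfolding poly_altdef using vge_mult[OF g vge_power[OF assms(5)]] by (intro vge_sum) simp
  show ?thesis using assms(1-4,6)
  proof (induction S arbitrary: f rule: finite_induct)
    case empty
    then show ?case using poly0 by simp
  next
    case (insert r S)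
    define q where "q = synthetic_div f r"
    have f: "f = [:- r, 1:] * q"
      using synthetic_div_correct'[of r f] insert.prems(2)[of r] by (simp add: q_def)
    have q: "vge (coeff q i) 0" for i
    \<comment> \<open>Downwards from the leading coefficient, since each coefficient of
      \<open>q\<close> is computed from the next higher one.\<close>
    proof (induction "Suc (degree q) - i" arbitrary: i)
      case 0
      then have "coeff q i = 0" by (intro coeff_eq_0) auto
      then show ?case by simp
    next
      case (Suc d)
      have "coeff f (Suc i) = coeff q i - r * coeff q (Suc i)" by (simp add: f)
      then have "coeff q i = coeff f (Suc i) + r * coeff q (Suc i)" by simp
      moreover have "vge (r * coeff q (Suc i)) 0"
        using vge_mult[of r 0 "coeff q (Suc i)" 0] insert.prems(3)[of r] Suc by auto
      ultimately show ?case using vge_add insert.prems(1) by metis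
    qed
    have roots: "poly q s = 0" if "s \<in> S" for s
    proof -
      have "s \<noteq> r" using that insert.hyps by auto
      moreover have "poly f s = 0" using insert.prems(2)[of s] that by simp
      ultimately show ?thesis unfolding f by auto
    qed
    have "vge (poly q x) (int (card S) * m)"
      using insert.prems q roots by (intro insert.IH) auto
    then have "vge ((x - r) * poly q x) (m + int (card S) * m)"
      using insert.prems(4) by (intro vge_mult) auto
    moreover have "poly f x = (x - r) * poly q x" by (subst f) (simp add: algebra_simps)
    moreover have "int (card (insert r S)) * m = m + int (card S) * m"
      using insert.hyps by (simp add: algebra_simps)
    ultimately show ?case by simp
  qed
qed

end

section \<open>Totally ramified Galois extensions\<close>

text \<open>What the argument uses of a totally ramified Galois extension, with integer valuations.
  Values on \<open>K\<close> are multiples of \<open>N\<close>, so the powers of \<pi> with exponent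
  below \<open>N\<close> have valuations that are distinct modulo those of \<open>K\<close>.\<close>

locale tot_ram_ext = valued w + K: subfield_of_type K + F: subfield_of_type F
  for w :: "'a::field \<Rightarrow> int" and K F :: "'a set" +
  fixes N :: nat and \<pi> :: 'a and G :: "('a \<Rightarrow> 'a) set"
  assumes N_pos: "N > 0"
    and F_subset_K: "F \<subseteq> K"
    and w_F: "x \<in> F \<Longrightarrow> x \<noteq> 0 \<Longrightarrow> w x = 0"
    and residue_K: "x \<in> K \<Longrightarrow> vge x 0 \<Longrightarrow> \<exists>c\<in>F. vge (x - c) 1"
    and w_K: "x \<in> K \<Longrightarrow> x \<noteq> 0 \<Longrightarrow> int N dvd w x"
    and ex_t: "\<exists>t\<in>K. t \<noteq> 0 \<and> w t = int N"
    and pi: "\<pi> \<noteq> 0" "w \<pi> = 1"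
    and span_pi: "\<exists>k. (\<forall>i. k i \<in> K) \<and> x = (\<Sum>i<N. k i * \<pi> ^ i)"
    and G_finite: "finite G"
    and G_add: "\<sigma> \<in> G \<Longrightarrow> \<sigma> (x + y) = \<sigma> x + \<sigma> y"
    and G_mult: "\<sigma> \<in> G \<Longrightarrow> \<sigma> (x * y) = \<sigma> x * \<sigma> y"
    and G_K: "\<sigma> \<in> G \<Longrightarrow> x \<in> K \<Longrightarrow> \<sigma> x = x"
    and G_id: "id \<in> G"
    and G_comp: "\<sigma> \<in> G \<Longrightarrow> \<tau> \<in> G \<Longrightarrow> \<sigma> \<circ> \<tau> \<in> G"
    and G_inv: "\<sigma> \<in> G \<Longrightarrow> \<exists>\<tau>\<in>G. \<tau> \<circ> \<sigma> = id \<and> \<sigma> \<circ> \<tau> = id"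
    and G_fixed: "(\<And>\<sigma>. \<sigma> \<in> G \<Longrightarrow> \<sigma> x = x) \<Longrightarrow> x \<in> K"
begin

lemma G_0 [simp]: "\<sigma> \<in> G \<Longrightarrow> \<sigma> 0 = 0" and G_1 [simp]: "\<sigma> \<in> G \<Longrightarrow> \<sigma> 1 = 1"
  by (auto simp: G_K)

lemma G_uminus: "\<sigma> \<in> G \<Longrightarrow> \<sigma> (- x) = - \<sigma> x"
  using G_add[of \<sigma> x "- x"] by (simp add: eq_neg_iff_add_eq_0 add.commute)

lemma G_diff: "\<sigma> \<in> G \<Longrightarrow> \<sigma> (x - y) = \<sigma> x - \<sigma> y"
  using G_add[of \<sigma> x "- y"] by (simp add: G_uminus)

lemma G_power: "\<sigma> \<in> G \<Longrightarrow> \<sigma> (x ^ m) = \<sigma> x ^ m"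
  by (induction m) (auto simp: G_mult)

lemma G_sum: "\<sigma> \<in> G \<Longrightarrow> \<sigma> (\<Sum>i\<in>I. f i) = (\<Sum>i\<in>I. \<sigma> (f i))"
  by (induction I rule: infinite_finite_induct) (auto simp: G_add)

lemma G_prod: "\<sigma> \<in> G \<Longrightarrow> \<sigma> (\<Prod>i\<in>I. f i) = (\<Prod>i\<in>I. \<sigma> (f i))"
  by (induction I rule: infinite_finite_induct) (auto simp: G_mult)

lemma G_inj: "\<sigma> \<in> G \<Longrightarrow> \<sigma> x = \<sigma> y \<Longrightarrow> x = y"
  using G_inv[of \<sigma>] by (metis comp_apply id_apply)

lemma G_eq_0_iff [simp]: "\<sigma> \<in> G \<Longrightarrow> \<sigma> x = 0 \<longleftrightarrow> x = 0"
  using G_inj[of \<sigma> x 0] by auto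

lemma w_pi_power [simp]: "w (\<pi> ^ i) = int i"
  using pi by (simp add: w_power)

lemma pi_terms_distinct:
  assumes "k i \<in> K" "k j \<in> K" "i < N" "j < N" "k i * \<pi> ^ i \<noteq> 0" "k j * \<pi> ^ j \<noteq> 0"
    "w (k i * \<pi> ^ i) = w (k j * \<pi> ^ j)"
  shows "i = j"
proof -
  have nz: "k i \<noteq> 0" "k j \<noteq> 0" using assms by auto
  have "int i - int j = w (k j) - w (k i)" using assms nz pi by (simp add: w_mult)
  moreover have "int N dvd w (k j) - w (k i)" using assms nz w_K by (intro dvd_diff) auto
  ultimately have "int N dvd int i - int j" by simp
  then have "int i mod int N = int j mod int N" by (simp add: mod_eq_dvd_iff)
  then show ?thesis using assms by (simp flip: zmod_int)
qed

lemma pi_dominant: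
  assumes k: "\<And>i. k i \<in> K" and ex: "\<exists>i\<in>{..<N}. k i * \<pi> ^ i \<noteq> 0"
  obtains i where "i \<in> {..<N}" "k i * \<pi> ^ i \<noteq> 0"
    "\<And>j. j \<in> {..<N} \<Longrightarrow> j \<noteq> i \<Longrightarrow> vge (k j * \<pi> ^ j) (w (k i * \<pi> ^ i) + 1)"
    "w (\<Sum>j<N. k j * \<pi> ^ j) = w (k i * \<pi> ^ i)"
proof -
  have d: "i = j" if "i \<in> {..<N}" "j \<in> {..<N}" "k i * \<pi> ^ i \<noteq> 0" "k j * \<pi> ^ j \<noteq> 0"
    "w (k i * \<pi> ^ i) = w (k j * \<pi> ^ j)" for i j
    using pi_terms_distinct[of k i j] k that by simp
  show ?thesis
  proof (rule sum_distinct[OF finite_lessThan d ex])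
    fix i assume i: "i \<in> {..<N}" "k i * \<pi> ^ i \<noteq> 0"
      "\<And>j. j \<in> {..<N} \<Longrightarrow> j \<noteq> i \<Longrightarrow> vge (k j * \<pi> ^ j) (w (k i * \<pi> ^ i) + 1)"
      "w (\<Sum>j<N. k j * \<pi> ^ j) = w (k i * \<pi> ^ i)"
    show ?thesis by (rule that[OF i])
  qed
qed

text \<open>A nonzero term of index \<open>j\<close> in the expansion has valuation congruent to
  \<open>j\<close> modulo \<open>N\<close>. So only the term of index 0 can have valuation 0, and
  the residue comes from an element of \<open>K\<close>.\<close>

lemma residue:
  assumes "vge x 0"
  shows "\<exists>c\<in>F. vge (x - c) 1"
proof (cases "x = 0")
  case True
  then show ?thesis by (intro bexI[of _ 0]) auto
next
  case nz: False
  obtain k where k: "\<And>i. k i \<in> K" and x: "x = (\<Sum>i<N. k i * \<pi> ^ i)" using span_pi by blast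
  let ?f = "\<lambda>i. k i * \<pi> ^ i"
  have ex: "\<exists>i\<in>{..<N}. ?f i \<noteq> 0" using nz x by (meson sum.neutral)
  obtain i where i: "i \<in> {..<N}" "?f i \<noteq> 0" "\<And>j. j \<in> {..<N} \<Longrightarrow> j \<noteq> i \<Longrightarrow> vge (?f j) (w (?f i) + 1)"
    "w (\<Sum>j<N. ?f j) = w (?f i)"
    by (rule pi_dominant[OF k(1) ex], rule that)
  have terms: "vge (?f j) 0" if "j < N" for j
    using i(3)[of j] i(4) assms that nz x by (cases "j = i") (auto simp: vge_def)
  have terms1: "vge (?f j) 1" if j: "j < N" "j > 0" for j
  proof (cases "k j = 0")
    case False
    then have wf: "w (?f j) = w (k j) + int j" using pi by (simp add: w_mult)
    have "w (?f j) \<noteq> 0"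
    proof
      assume "w (?f j) = 0"
      then have "int j = - w (k j)" using wf by simp
      moreover have "int N dvd - w (k j)" using w_K[OF k False] by simp
      ultimately have "int N dvd int j" by simp
      then show False using j by (auto dest: dvd_imp_le)
    qed
    then show ?thesis using terms[OF j(1)] False pi by (simp add: vge_def)
  qed simp
  have "vge (k 0) 0" using terms[of 0] N_pos by simp
  then obtain c where c: "c \<in> F" "vge (k 0 - c) 1" using residue_K k by blast
  have "x - c = (k 0 - c) + (\<Sum>j\<in>{..<N}-{0}. ?f j)"
    using N_pos sum.remove[of "{..<N}" 0 ?f] by (simp add: x)
  moreover have "vge (\<Sum>j\<in>{..<N}-{0}. ?f j) 1" using terms1 by (intro vge_sum) auto
  ultimately have "vge (x - c) 1" using vge_add[OF c(2)] by metis
  then show ?thesis using c by blast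
qed

lemma G_eqI: 
  assumes "\<sigma> \<in> G" "\<tau> \<in> G" "\<sigma> \<pi> = \<tau> \<pi>"
  shows "\<sigma> = \<tau>"
proof
  fix x
  obtain k where "\<And>i. k i \<in> K" "x = (\<Sum>i<N. k i * \<pi> ^ i)" using span_pi by blast
  then show "\<sigma> x = \<tau> x" using assms by (simp add: G_sum G_mult G_power G_K)
qed

text \<open>An automorphism is determined by the image of \<pi>, which is a root of the monic
  polynomial of degree \<open>N\<close> given by the expansion of \<open>\<pi> ^ N\<close>.\<close>

lemma card_G_le: "card G \<le> N"
proof -
  obtain k where k: "\<And>i. k i \<in> K" "\<pi> ^ N = (\<Sum>i<N. k i * \<pi> ^ i)" using span_pi by blast
  define Q where "Q = monom 1 N - (\<Sum>i<N. monom (k i) i)"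
  have "degree (\<Sum>i<N. monom (k i) i) < N" using N_pos
    by (intro le_less_trans[OF degree_sum_le[of _ _ "N - 1"]]) (auto intro: order_trans[OF degree_monom_le])
  then have dQ: "degree Q = N"
    unfolding Q_def diff_conv_add_uminus by (subst degree_add_eq_left) (simp_all add: degree_monom_eq)
  have Q0: "Q \<noteq> 0" using dQ N_pos by auto
  have roots: "poly Q (\<sigma> \<pi>) = 0" if "\<sigma> \<in> G" for \<sigma>
  proof -
    have "poly Q (\<sigma> \<pi>) = \<sigma> (\<pi> ^ N) - \<sigma> (\<Sum>i<N. k i * \<pi> ^ i)"
      using that k(1) by (simp add: Q_def poly_sum poly_monom G_power G_sum G_mult G_K)
    then show ?thesis using k(2) by simp
  qed
  have "card G = card ((\<lambda>\<sigma>. \<sigma> \<pi>) ` G)"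
    by (rule card_image[symmetric]) (auto intro: inj_onI G_eqI)
  also have "\<dots> \<le> card {x. poly Q x = 0}"
    by (intro card_mono poly_roots_finite Q0) (use roots in auto)
  also have "\<dots> \<le> N" using card_poly_roots_bound[OF Q0] dQ by simp
  finally show ?thesis .
qed

lemma G_bij: "\<tau> \<in> G \<Longrightarrow> bij_betw (\<lambda>\<sigma>. \<tau> \<circ> \<sigma>) G G"
proof -
  assume t: "\<tau> \<in> G"
  obtain \<rho> where r: "\<rho> \<in> G" "\<rho> \<circ> \<tau> = id" "\<tau> \<circ> \<rho> = id" using G_inv[OF t] by blast
  show ?thesis
    by (rule bij_betwI[of _ _ _ "\<lambda>\<sigma>. \<rho> \<circ> \<sigma>"])
      (use t r G_comp in \<open>auto simp: comp_assoc[symmetric]\<close>)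
qed

text \<open>Artin's argument: the product of all X - \<sigma> \<pi> has coefficients fixed by
  \<open>G\<close>, hence in \<open>K\<close>. If \<open>G\<close> had fewer than \<open>N\<close>
  elements, its vanishing at \<pi> would be a nontrivial relation between terms of distinct
  valuations.\<close>

lemma card_G_ge: "N \<le> card G"
proof (rule ccontr)
  assume less: "\<not> N \<le> card G"
  define P where "P S = (\<Prod>\<sigma>\<in>S. [:- \<sigma> \<pi>, 1:])" for S :: "('a \<Rightarrow> 'a) set"
  have lin: "coeff ([:- r, 1:] * q) i = - r * coeff q i + (if i = 0 then 0 else coeff q (i - 1))"
    for r :: 'a and q i by (cases i) (auto simp: algebra_simps)
  have map: "\<tau> (coeff (P S) i) = coeff (P ((\<lambda>\<sigma>. \<tau> \<circ> \<sigma>) ` S)) i" if t: "\<tau> \<in> G" and "finite S" "S \<subseteq> G" for \<tau> S i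
    using that(2,3)
  proof (induction S arbitrary: i rule: finite_induct)
    case empty
    then show ?case using t by (cases i) (auto simp: P_def)
  next
    case (insert \<sigma> S)
    have "\<tau> \<circ> \<sigma> \<notin> (\<lambda>\<sigma>. \<tau> \<circ> \<sigma>) ` S"
      using inj_on_image_mem_iff[OF bij_betw_imp_inj_on[OF G_bij[OF t]], of \<sigma> S] insert.hyps(2) insert.prems
      by simp
    then have "P ((\<lambda>\<sigma>. \<tau> \<circ> \<sigma>) ` insert \<sigma> S) = [:- \<tau> (\<sigma> \<pi>), 1:] * P ((\<lambda>\<sigma>. \<tau> \<circ> \<sigma>) ` S)"
      using insert.hyps by (simp add: P_def)
    moreover have "P (insert \<sigma> S) = [:- \<sigma> \<pi>, 1:] * P S" using insert.hyps by (simp add: P_def)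
    moreover have "\<tau> (coeff (P S) j) = coeff (P ((\<lambda>\<sigma>. \<tau> \<circ> \<sigma>) ` S)) j" for j
      by (rule insert.IH) (use insert.prems in simp)
    ultimately show ?case
      using t by (simp only: lin) (simp add: G_add G_diff G_mult G_uminus)
  qed
  have coeffK: "coeff (P G) i \<in> K" for i
  proof (rule G_fixed)
    fix \<tau> assume t: "\<tau> \<in> G"
    have "(\<lambda>\<sigma>. \<tau> \<circ> \<sigma>) ` G = G" using G_bij[OF t] by (simp add: bij_betw_def)
    then show "\<tau> (coeff (P G) i) = coeff (P G) i" using map[OF t G_finite order_refl, of i] by simp
  qed
  have deg: "degree (P G) = card G"
    unfolding P_def by (subst degree_prod_eq_sum_degree) auto
  have "poly (P G) \<pi> = 0"
    unfolding P_def poly_prod using G_id G_finite by (auto simp: prod_zero_iff intro!: bexI[of _ id])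
  then have z: "(\<Sum>i\<le>card G. coeff (P G) i * \<pi> ^ i) = 0" by (simp add: poly_altdef deg)
  have lc: "coeff (P G) (card G) \<noteq> 0"
    using deg leading_coeff_0_iff[of "P G"] G_finite by (auto simp: P_def prod_zero_iff)
  have ex: "\<exists>i\<in>{..card G}. coeff (P G) i * \<pi> ^ i \<noteq> 0"
    using lc pi by (intro bexI[of _ "card G"]) auto
  have d: "i = j" if "i \<in> {..card G}" "j \<in> {..card G}" "coeff (P G) i * \<pi> ^ i \<noteq> 0"
      "coeff (P G) j * \<pi> ^ j \<noteq> 0" "w (coeff (P G) i * \<pi> ^ i) = w (coeff (P G) j * \<pi> ^ j)" for i j
    using pi_terms_distinct[of "coeff (P G)" i j] that less coeffK by simp
  show False
    by (rule sum_distinct[OF finite_atMost d ex]) (use z in simp_all)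
qed

lemma card_G: "card G = N"
  using card_G_le card_G_ge by simp

text \<open>The relation that expresses \<open>\<pi> ^ N\<close> by lower powers is of Eisenstein
  type, and this forces valuation 1 on each of its roots.\<close>

lemma w_G_pi:
  assumes s: "\<sigma> \<in> G"
  shows "w (\<sigma> \<pi>) = 1"
proof -
  obtain k where k: "\<And>i. k i \<in> K" "\<pi> ^ N = (\<Sum>i<N. k i * \<pi> ^ i)" using span_pi by blast
  let ?f = "\<lambda>i. k i * \<pi> ^ i"
  have "\<pi> ^ N \<noteq> 0" using pi by simp
  then have nz0: "(\<Sum>i<N. ?f i) \<noteq> 0" by (simp only: k(2)[symmetric] not_False_eq_True)
  have ex: "\<exists>i\<in>{..<N}. ?f i \<noteq> 0"
  proof (rule ccontr)
    assume "\<not> (\<exists>i\<in>{..<N}. ?f i \<noteq> 0)"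
    then show False using nz0 sum.neutral[of "{..<N}" ?f] by blast
  qed
  obtain i where i: "i \<in> {..<N}" "?f i \<noteq> 0" "\<And>j. j \<in> {..<N} \<Longrightarrow> j \<noteq> i \<Longrightarrow> vge (?f j) (w (?f i) + 1)"
    "w (\<Sum>j<N. ?f j) = w (?f i)"
    by (rule pi_dominant[OF k(1) ex], rule that)
  have ki: "k i \<noteq> 0" using i by auto
  have "w (\<pi> ^ N) = w (?f i)" unfolding k(2) by (rule i(4))
  then have wi: "int N = w (k i) + int i" using ki pi by (simp add: w_mult)
  have "int N dvd int N - w (k i)" using w_K[OF k(1) ki] by (intro dvd_diff) auto
  then have "int N dvd int i" using wi by simp
  then have i0: "i = 0" using i(1) by (auto dest: dvd_imp_le)
  have k0: "k 0 \<noteq> 0" "w (k 0) = int N" using ki wi i0 by auto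
  have kj: "w (k j) \<ge> int N" if "k j \<noteq> 0" "j < N" "j > 0" for j
  proof -
    have "w (?f j) \<ge> int N + 1" using i(3)[of j] that pi i0 k0 by (simp add: vge_def)
    then have "w (k j) > 0" using that pi by (simp add: w_mult)
    then show ?thesis using w_K[OF k(1) that(1)] by (simp add: zdvd_imp_le)
  qed
  let ?c = "w (\<sigma> \<pi>)"
  have nz: "\<sigma> \<pi> \<noteq> 0" using s pi by simp
  have eq: "\<sigma> \<pi> ^ N = (\<Sum>i<N. k i * \<sigma> \<pi> ^ i)"
    using arg_cong[OF k(2), of \<sigma>] s k(1) by (simp add: G_power G_sum G_mult G_K)
  have wt: "vge (k j * \<sigma> \<pi> ^ j) (int N + int j * ?c)" if "j < N" for j
    using that kj[of j] k0 nz by (cases "j = 0"; cases "k j = 0") (auto simp: vge_def w_mult w_power)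
  \<comment> \<open>Otherwise every term of degree below \<open>N\<close> would have larger
    valuation than the \<open>N\<close>-th power.\<close>
  have c: "?c \<ge> 1"
  proof (rule ccontr)
    assume c: "\<not> ?c \<ge> 1"
    have "vge (\<Sum>j<N. k j * \<sigma> \<pi> ^ j) (int N * ?c + 1)"
    proof (rule vge_sum)
      fix j assume j: "j \<in> {..<N}"
      have "(int N - int j) * ?c \<le> 0" using c j by (intro mult_nonneg_nonpos) auto
      then have "int N * ?c + 1 \<le> int N + int j * ?c" using N_pos by (simp add: left_diff_distrib)
      then show "vge (k j * \<sigma> \<pi> ^ j) (int N * ?c + 1)" using wt[of j] j by (auto intro: vge_mono)
    qed
    then show False using eq[symmetric] nz by (simp add: vge_def w_power)
  qed
  \<comment> \<open>The constant term has valuation \<open>N\<close>, every other term at least N +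
    1.\<close>
  have "w (\<Sum>j<N. k j * \<sigma> \<pi> ^ j) = w (k 0 * \<sigma> \<pi> ^ 0)"
  proof (rule w_sum_dominant(2))
    fix j assume j: "j \<in> {..<N}" "j \<noteq> 0"
    have "int j * ?c \<ge> 1 * 1" using c j by (intro mult_mono) auto
    then show "vge (k j * \<sigma> \<pi> ^ j) (w (k 0 * \<sigma> \<pi> ^ 0) + 1)" using wt[of j] j k0 by (auto intro: vge_mono)
  qed (use N_pos k0 in auto)
  then have "int N * ?c = int N" using eq[symmetric] nz k0 by (simp add: w_power)
  then show ?thesis using N_pos by simp
qed

text \<open>The expansions of \<open>x\<close> and \<open>\<sigma> x\<close> have the same
  coefficients and, by \<open>w_G_pi\<close>, termwise the same valuations, so the same term
  dominates both.\<close>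

lemma w_G [simp]:
  assumes s: "\<sigma> \<in> G"
  shows "w (\<sigma> x) = w x"
proof (cases "x = 0")
  case nz: False
  obtain k where k: "\<And>i. k i \<in> K" and x: "x = (\<Sum>i<N. k i * \<pi> ^ i)" using span_pi by blast
  let ?f = "\<lambda>i. k i * \<pi> ^ i" and ?g = "\<lambda>i. k i * \<sigma> \<pi> ^ i"
  have ex: "\<exists>i\<in>{..<N}. ?f i \<noteq> 0" using nz x by (meson sum.neutral)
  obtain i where i: "i \<in> {..<N}" "?f i \<noteq> 0" "\<And>j. j \<in> {..<N} \<Longrightarrow> j \<noteq> i \<Longrightarrow> vge (?f j) (w (?f i) + 1)"
    "w (\<Sum>j<N. ?f j) = w (?f i)"
    by (rule pi_dominant[OF k(1) ex], rule that)
  have nzs: "\<sigma> \<pi> \<noteq> 0" using s pi by simp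
  have wfg: "w (?g j) = w (?f j)" and zfg: "?g j = 0 \<longleftrightarrow> ?f j = 0" for j
    using pi nzs w_G_pi[OF s] by (cases "k j = 0"; auto simp: w_mult w_power)+
  have "w (\<Sum>j<N. ?g j) = w (?g i)"
  proof (rule w_sum_dominant(2)[OF finite_lessThan i(1)])
    show "?g i \<noteq> 0" using i(2) zfg by blast
    fix j assume "j \<in> {..<N}" "j \<noteq> i"
    from i(3)[OF this] show "vge (?g j) (w (?g i) + 1)" unfolding vge_def wfg zfg .
  qed
  moreover have "\<sigma> x = (\<Sum>j<N. ?g j)" unfolding x using s k by (simp add: G_power G_sum G_mult G_K)
  ultimately show ?thesis using i(4) wfg x by simp
qed (use s in simp)

lemma vge_G [simp]: "\<sigma> \<in> G \<Longrightarrow> vge (\<sigma> x) m \<longleftrightarrow> vge x m"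
  by (simp add: vge_def)

end

section \<open>The prime field and the Frobenius map\<close>

context prime_char
begin

definition Fp :: "'a set" where "Fp = of_nat ` {..<p}"

lemma frob_add: "(x + y :: 'a) ^ (p ^ m) = x ^ (p ^ m) + y ^ (p ^ m)"
  using freshmans_dream'[of "p ^ m" m x y] char_p prime_p by simp

lemma frob_uminus: "(- x :: 'a) ^ (p ^ m) = - (x ^ (p ^ m))"
  using frob_add[of x "- x" m] p_gt_0 by (simp add: eq_neg_iff_add_eq_0 add.commute power_0_left)

lemma frob_diff: "(x - y :: 'a) ^ (p ^ m) = x ^ (p ^ m) - y ^ (p ^ m)"
  using frob_add[of x "- y" m] by (simp add: frob_uminus)

lemma frob_sum: "(\<Sum>i\<in>I. f i :: 'a) ^ (p ^ m) = (\<Sum>i\<in>I. f i ^ (p ^ m))"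
  using freshmans_dream_sum'[of "p ^ m" m f I] char_p prime_p by simp

lemmas frob_add1 = frob_add[where m = 1, simplified]
  and frob_diff1 = frob_diff[where m = 1, simplified]
  and frob_sum1 = frob_sum[where m = 1, simplified]

lemma card_Fp: "card Fp = p"
  by (simp add: Fp_def card_image[OF inj_of_nat])

lemma of_nat_frob: "(of_nat c :: 'a) ^ p = of_nat c"
  using p_gt_0 by (induction c) (auto simp: frob_add1)

lemma frob_fixed_iff: "c ^ p = c \<longleftrightarrow> c \<in> Fp"
proof -
  define Q where "Q = monom 1 p - [:0, 1 :: 'a:]"
  have dQ: "degree Q = p"
    unfolding Q_def diff_conv_add_uminus using p_gt_1
    by (subst degree_add_eq_left) (simp_all add: degree_monom_eq)
  have Q0: "Q \<noteq> 0" using dQ p_gt_0 by auto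
  have roots: "{c. poly Q c = 0} = {c. c ^ p = c}" by (simp add: Q_def poly_monom)
  have "Fp \<subseteq> {c. poly Q c = 0}" by (auto simp: roots Fp_def of_nat_frob)
  moreover have "card {c. poly Q c = 0} \<le> card Fp"
    using card_poly_roots_bound[OF Q0] dQ by (simp add: card_Fp)
  ultimately have "Fp = {c. poly Q c = 0}"
    using poly_roots_finite[OF Q0] by (intro card_seteq) auto
  then show ?thesis using roots by blast
qed

lemma Fp_Ints: "c \<in> Fp \<Longrightarrow> c \<in> \<int>"
  by (auto simp: Fp_def)

lemma Fp_0: "0 \<in> Fp" and Fp_1: "1 \<in> Fp"
  using p_gt_0 by (auto simp flip: frob_fixed_iff)

end

section \<open>Artin--Schreier data\<close>

text \<open>
  Here \<open>e\<close> is the positive part of \<open>- v\<^sub>K(\<epsilon>\<^sub>n)\<close>, and \<open>w\<close> is the valuation of the top field,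
  so that \<open>N = p\<^sup>n\<close> is the valuation of a uniformizer of \<open>K\<close>.
\<close>

locale as_ext = tot_ram_ext w K F N \<pi> G + prime_char p "TYPE('a)"
  for w :: "'a::field \<Rightarrow> int" and K F :: "'a set" and N :: nat and \<pi> :: 'a
    and G :: "('a \<Rightarrow> 'a) set" and p :: nat +
  fixes n b e :: nat and \<beta> :: 'a and \<omega> \<epsilon> x :: "nat \<Rightarrow> 'a"
  assumes card_G_eq: "card G = p ^ n" and n_ge_2: "n \<ge> 2" and b_pos: "b > 0"
    and perfect_F: "c \<in> F \<Longrightarrow> \<exists>d\<in>F. d ^ p = c"
    and \<beta>: "\<beta> \<in> K" "\<beta> \<noteq> 0" "w \<beta> = - int (b * N)"
    and \<omega>_F: "i \<in> {1..n} \<Longrightarrow> \<omega> i \<in> F"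
    and \<omega>_indep: "(\<And>i. i \<in> {1..n} \<Longrightarrow> a i \<in> \<int>) \<Longrightarrow> (\<Sum>i=1..n. a i * \<omega> i) = 0 \<Longrightarrow>
      i \<in> {1..n} \<Longrightarrow> a i = 0"
    and \<epsilon>_K: "i \<in> {1..n} \<Longrightarrow> \<epsilon> i \<in> K"
    and \<epsilon>_ge: "i \<in> {1..n} \<Longrightarrow> vge (\<epsilon> i) (- int (e * N))"
    and e_bound: "e * p ^ (n - 2) < b"
    and \<epsilon>_n: "e > 0 \<Longrightarrow> \<epsilon> n \<noteq> 0 \<and> w (\<epsilon> n) = - int (e * N) \<and> \<not> p dvd e"
    and \<epsilon>_less: "e > 0 \<Longrightarrow> i \<in> {1..n-1} \<Longrightarrow> vge (\<epsilon> i) (- int (e * N) + 1)"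
    and AS: "i \<in> {1..n} \<Longrightarrow> x i ^ p - x i = \<omega> i ^ (p ^ n) * \<beta> + \<epsilon> i"
    and \<omega>_1: "\<omega> 1 = 1" and \<epsilon>_1: "\<epsilon> 1 = 0"
    and faithful: "\<sigma> \<in> G \<Longrightarrow> (\<And>i. i \<in> {1..n} \<Longrightarrow> \<sigma> (x i) = x i) \<Longrightarrow> \<sigma> = id"
    and ram: "\<sigma> \<in> G \<Longrightarrow> vge (\<sigma> \<pi> - \<pi>) (int b + 1)"
begin

lemma N_eq: "N = p ^ n"
  using card_G card_G_eq by simp

lemma Fp_F: "c \<in> Fp \<Longrightarrow> c \<in> F"
  by (auto simp: Fp_def)

lemma \<omega>_K: "i \<in> {1..n} \<Longrightarrow> \<omega> i \<in> K"
  using \<omega>_F F_subset_K by blast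

text \<open>The character of \<open>G\<close> attached to \<open>x i\<close> by Artin--Schreier
  theory.\<close>

definition chi :: "nat \<Rightarrow> ('a \<Rightarrow> 'a) \<Rightarrow> 'a" where "chi i \<sigma> = \<sigma> (x i) - x i"

lemma chi_Fp:
  assumes "\<sigma> \<in> G" "i \<in> {1..n}"
  shows "chi i \<sigma> \<in> Fp"
proof -
  have "\<sigma> (x i ^ p - x i) = x i ^ p - x i"
    unfolding AS[OF assms(2)]
    by (intro G_K K.closed_add K.closed_mult K.closed_power assms \<beta> \<omega>_K \<epsilon>_K)
  then have "\<sigma> (x i) ^ p - x i ^ p = \<sigma> (x i) - x i"
    using assms by (simp add: G_diff G_power algebra_simps)
  then show ?thesis by (simp add: chi_def flip: frob_fixed_iff frob_diff1)
qed

lemma chi_F: "\<sigma> \<in> G \<Longrightarrow> i \<in> {1..n} \<Longrightarrow> chi i \<sigma> \<in> F"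
  using chi_Fp Fp_F by blast

lemma chi_comp:
  assumes "\<sigma> \<in> G" "\<tau> \<in> G" "i \<in> {1..n}"
  shows "chi i (\<sigma> \<circ> \<tau>) = chi i \<sigma> + chi i \<tau>"
proof -
  have "\<sigma> (chi i \<tau>) = chi i \<tau>"
    using chi_F[OF assms(2,3)] F_subset_K assms by (intro G_K) auto
  then show ?thesis using assms by (simp add: chi_def G_diff algebra_simps)
qed

lemma chi_inj:
  assumes "\<sigma> \<in> G" "\<tau> \<in> G" "\<And>i. i \<in> {1..n} \<Longrightarrow> chi i \<sigma> = chi i \<tau>"
  shows "\<sigma> = \<tau>"
proof -
  obtain \<rho> where r: "\<rho> \<in> G" "\<rho> \<circ> \<tau> = id" "\<tau> \<circ> \<rho> = id" using G_inv[OF assms(2)] by blast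
  have "\<rho> \<circ> \<sigma> = id"
  proof (rule faithful)
    fix i assume i: "i \<in> {1..n}"
    have "chi i (\<rho> \<circ> \<sigma>) = chi i (\<rho> \<circ> \<tau>)" 
      by (simp only: chi_comp[OF r(1) assms(1) i] chi_comp[OF r(1) assms(2) i] assms(3)[OF i])
    then show "(\<rho> \<circ> \<sigma>) (x i) = x i" unfolding r(2) by (simp add: chi_def)
  qed (use G_comp assms r in auto)
  then have "\<tau> \<circ> (\<rho> \<circ> \<sigma>) = \<tau>" by simp
  then show ?thesis using r(3) by (metis comp_assoc comp_id fun.map_id0 id_comp)
qed

lemma G_commute:
  assumes "\<sigma> \<in> G" "\<tau> \<in> G" shows "\<sigma> \<circ> \<tau> = \<tau> \<circ> \<sigma>"
  by (rule chi_inj) (use assms in \<open>auto simp: chi_comp G_comp\<close>)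

definition chi_vec :: "('a \<Rightarrow> 'a) \<Rightarrow> nat \<Rightarrow> 'a" where
  "chi_vec \<sigma> = restrict (\<lambda>i. chi i \<sigma>) {1..n}"

text \<open>Injective because the \<open>x i\<close> determine an automorphism, hence bijective by
  counting: both sides have \<open>p ^ n\<close> elements. So the characters can be given arbitrary
  values in the prime field, which is \<open>ex_chi\<close>.\<close>

lemma chi_vec_bij: "bij_betw chi_vec G (PiE {1..n} (\<lambda>_. Fp))"
proof -
  have inj: "inj_on chi_vec G"
  proof (rule inj_onI)
    fix \<sigma> \<tau> assume st: "\<sigma> \<in> G" "\<tau> \<in> G" "chi_vec \<sigma> = chi_vec \<tau>"
    show "\<sigma> = \<tau>"
    proof (rule chi_inj[OF st(1,2)])
      fix i assume "i \<in> {1..n}"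
      then show "chi i \<sigma> = chi i \<tau>" using fun_cong[OF st(3), of i] by (simp add: chi_vec_def)
    qed
  qed
  have fin: "finite (PiE {1..n} (\<lambda>_. Fp))" by (intro finite_PiE) (auto simp: Fp_def)
  have sub: "chi_vec ` G \<subseteq> PiE {1..n} (\<lambda>_. Fp)" by (auto simp: chi_vec_def chi_Fp)
  have "card (chi_vec ` G) = card (PiE {1..n} (\<lambda>_. Fp))"
    by (simp add: card_image[OF inj] card_G_eq card_PiE card_Fp)
  then have "chi_vec ` G = PiE {1..n} (\<lambda>_. Fp)" using card_subset_eq[OF fin sub] by simp
  then show ?thesis using inj by (simp add: bij_betw_def)
qed

lemma ex_chi:
  assumes "\<And>i. i \<in> {1..n} \<Longrightarrow> c i \<in> Fp"
  obtains \<sigma> where "\<sigma> \<in> G" "\<And>i. i \<in> {1..n} \<Longrightarrow> chi i \<sigma> = c i"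
proof -
  have "restrict c {1..n} \<in> chi_vec ` G"
    using chi_vec_bij assms by (auto simp: bij_betw_def)
  then obtain \<sigma> where s: "\<sigma> \<in> G" "restrict c {1..n} = chi_vec \<sigma>" by auto
  have "chi i \<sigma> = c i" if "i \<in> {1..n}" for i
    using fun_cong[OF s(2), of i] that by (simp add: chi_vec_def)
  then show ?thesis using that s(1) by blast
qed

lemma card_stabilizer: "card {\<tau> \<in> G. chi 1 \<tau> = 0} = p ^ (n - 1)"
proof -
  let ?B = "\<lambda>i::nat. if i = 1 then {0} else Fp"
  have "bij_betw chi_vec {\<tau> \<in> G. chi 1 \<tau> = 0} (PiE {1..n} ?B)"
    unfolding bij_betw_def
  proof
    show "inj_on chi_vec {\<tau> \<in> G. chi 1 \<tau> = 0}"
      using chi_vec_bij by (auto simp: bij_betw_def intro: inj_on_subset)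
    show "chi_vec ` {\<tau> \<in> G. chi 1 \<tau> = 0} = PiE {1..n} ?B"
    proof
      show "chi_vec ` {\<tau> \<in> G. chi 1 \<tau> = 0} \<subseteq> PiE {1..n} ?B"
        by (auto simp: chi_vec_def chi_Fp)
      show "PiE {1..n} ?B \<subseteq> chi_vec ` {\<tau> \<in> G. chi 1 \<tau> = 0}"
      proof
        fix f assume f: "f \<in> PiE {1..n} ?B"
        have "f \<in> PiE {1..n} (\<lambda>_. Fp)"
          by (rule PiE_mono[THEN subsetD, OF _ f]) (auto simp: Fp_0)
        then have "f \<in> chi_vec ` G" using chi_vec_bij by (simp only: bij_betw_def)
        then obtain \<sigma> where s: "\<sigma> \<in> G" "f = chi_vec \<sigma>" by blast
        have "f 1 = 0" using PiE_mem[OF f, of 1] n_ge_2 by simp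
        then have "chi 1 \<sigma> = 0" using s n_ge_2 by (simp add: chi_vec_def)
        then show "f \<in> chi_vec ` {\<tau> \<in> G. chi 1 \<tau> = 0}" using s by blast
      qed
    qed
  qed
  then have "card {\<tau> \<in> G. chi 1 \<tau> = 0} = (\<Prod>i\<in>{1..n}. card (?B i))"
    by (simp add: bij_betw_same_card card_PiE)
  also have "\<dots> = (\<Prod>i\<in>{2..n}. p)"
  proof -
    have "{1..n} = insert 1 {2..n}" using n_ge_2 by auto
    then have "(\<Prod>i\<in>{1..n}. card (?B i)) = (\<Prod>i\<in>{2..n}. card (?B i))" by simp
    also have "\<dots> = (\<Prod>i\<in>{2..n}. p)" by (intro prod.cong) (auto simp: card_Fp)
    finally show ?thesis .
  qed
  finally show ?thesis by simp
qed

lemma w_AS: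
  assumes "y ^ p - y = a" "a \<noteq> 0" "w a < 0"
  shows "y \<noteq> 0" "int p * w y = w a"
proof -
  show nz: "y \<noteq> 0" using assms p_gt_0 by auto
  have neg: "w y < 0"
  proof (rule ccontr)
    assume "\<not> w y < 0"
    then have "vge (y ^ p) 0" "vge y 0" using nz by (auto simp: vge_def w_power)
    then have "vge a 0" using vge_diff[of "y ^ p" 0 y] assms by simp
    then show False using assms by (simp add: vge_def)
  qed
  have "w y * int p < w y * 1" using neg p_gt_1 by (intro mult_strict_left_mono_neg) auto
  then have "vge (- y) (w (y ^ p) + 1)" using nz by (simp add: vge_def w_power mult.commute)
  then have "w (y ^ p + - y) = w (y ^ p)" using nz by (intro w_add_eq(2)) auto
  then show "int p * w y = w a" using nz assms(1) by (simp add: w_power)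
qed

lemma AS_1: "x 1 ^ p - x 1 = \<beta>"
  using AS[of 1] n_ge_2 \<omega>_1 \<epsilon>_1 by simp

lemma w_x1: "x 1 \<noteq> 0" "int p * w (x 1) = - int (b * N)"
  using w_AS[OF AS_1 \<beta>(2)] \<beta>(3) b_pos N_pos by auto

text \<open>If b = p b', scaling \<open>x 1\<close> by an element of \<open>K\<close> gives a unit
  \<open>y\<close>. An integral expansion of \<open>y\<close> in powers of \<pi> yields a polynomial
  that vanishes at the \<open>p ^ (n - 1)\<close> conjugates of \<pi> under the stabilizer of
  \<open>x 1\<close>. At another conjugate its value has valuation b p^(n-1), by the action on
  \<open>x 1\<close>, but also at least (b + 1) p^(n-1), because conjugates of \<pi> differ by
  valuation at least b + 1.\<close>

lemma not_p_dvd_b: "\<not> p dvd b"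
proof
  assume "p dvd b"
  then obtain b' where b': "b = p * b'" by blast
  obtain t where t: "t \<in> K" "t \<noteq> 0" "w t = int N" using ex_t by blast
  define y where "y = t ^ b' * x 1"
  have tK: "t ^ b' \<in> K" using t by auto
  have ynz: "y \<noteq> 0" using t w_x1 by (simp add: y_def)
  have "int p * w y = 0"
    using t w_x1 by (simp add: y_def w_mult w_power b' algebra_simps)
  then have wy: "w y = 0" using p_gt_0 by simp
  obtain k where k: "\<And>i. k i \<in> K" and y: "y = (\<Sum>i<N. k i * \<pi> ^ i)" using span_pi by blast
  have ex: "\<exists>i\<in>{..<N}. k i * \<pi> ^ i \<noteq> 0" using ynz y by (meson sum.neutral)
  obtain i where i: "i \<in> {..<N}" "k i * \<pi> ^ i \<noteq> 0"
    "\<And>j. j \<in> {..<N} \<Longrightarrow> j \<noteq> i \<Longrightarrow> vge (k j * \<pi> ^ j) (w (k i * \<pi> ^ i) + 1)"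
    "w (\<Sum>j<N. k j * \<pi> ^ j) = w (k i * \<pi> ^ i)"
    by (rule pi_dominant[OF k(1) ex], rule that)
  have wi: "w (k i * \<pi> ^ i) = 0" using i(4) wy y by simp
  \<comment> \<open>A term of valuation at least 0 and index below \<open>N\<close> has a
    coefficient of valuation above - N, and the valuation of the coefficient is a multiple of
    \<open>N\<close>.\<close>
  have kint: "vge (k j) 0" if j: "j < N" for j
  proof (cases "k j = 0")
    case False
    have "vge (k j * \<pi> ^ j) 0"
      using i(3)[of j] wi j by (cases "j = i") (auto simp: vge_def)
    then have "w (k j) \<ge> - int j" using False pi by (simp add: vge_def w_mult)
    moreover obtain d where d: "w (k j) = int N * d" using w_K[OF k False] by blast
    ultimately have "- int N < int N * d" using j by simp
    then have "int N * (- 1) < int N * d" by simp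
    then have "- 1 < d" using N_pos by (simp only: mult_less_cancel_left_pos of_nat_0_less_iff)
    then show ?thesis using d by (simp add: vge_def)
  qed simp
  define g where "g = (\<Sum>i<N. monom (k i) i) - [:y:]"
  have cg: "vge (coeff g j) 0" for j
  proof -
    have "coeff (\<Sum>i<N. monom (k i) i) j = (if j < N then k j else 0)"
      by (simp add: coeff_sum if_distrib cong: if_cong)
    moreover have "vge (coeff [:y:] j) 0" using wy by (cases j) (auto simp: vge_def)
    ultimately show ?thesis using kint unfolding g_def by (auto intro!: vge_diff)
  qed
  have pg: "poly g (\<tau> \<pi>) = \<tau> y - y" if "\<tau> \<in> G" for \<tau>
    using that k by (simp add: g_def poly_sum poly_monom y G_sum G_mult G_power G_K)
  define H where "H = {\<tau> \<in> G. chi 1 \<tau> = 0}"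
  define S where "S = (\<lambda>\<tau>. \<tau> \<pi>) ` H"
  have H: "\<tau> \<in> G" "\<tau> y = y" if "\<tau> \<in> H" for \<tau>
    using that tK by (auto simp: H_def chi_def y_def G_mult G_K)
  have "inj_on (\<lambda>\<tau>. \<tau> \<pi>) H" by (rule inj_onI) (rule G_eqI[OF H(1) H(1)])
  then have cS: "card S = p ^ (n - 1)"
    unfolding S_def using card_stabilizer by (simp add: card_image H_def)
  obtain \<sigma> where s: "\<sigma> \<in> G" "\<And>i. i \<in> {1..n} \<Longrightarrow> chi i \<sigma> = (if i = 1 then 1 else 0)"
    by (rule ex_chi[of "\<lambda>i. if i = 1 then 1 else 0"]) (auto simp: Fp_0 Fp_1)
  have s1: "\<sigma> (x 1) = x 1 + 1" using s(2)[of 1] n_ge_2 by (simp add: chi_def algebra_simps)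
  have "vge (poly g (\<sigma> \<pi>)) (int (card S) * (int b + 1))"
  proof (rule vge_poly_divide_roots)
    show "finite S" using G_finite by (simp add: S_def H_def)
    show "poly g r = 0" if "r \<in> S" for r using that H pg by (auto simp: S_def)
    show "vge r 0" if "r \<in> S" for r using that H pi by (auto simp: S_def vge_def)
    show "vge (\<sigma> \<pi>) 0" using s pi by (simp add: vge_def)
    show "vge (\<sigma> \<pi> - r) (int b + 1)" if rS: "r \<in> S" for r
    proof -
      obtain \<tau> where t: "\<tau> \<in> G" "r = \<tau> \<pi>" using rS H(1) unfolding S_def by blast
      obtain \<rho> where r: "\<rho> \<in> G" "\<rho> \<circ> \<tau> = id" "\<tau> \<circ> \<rho> = id" using G_inv[OF t(1)] by blast
      have "\<tau> ((\<rho> \<circ> \<sigma>) \<pi> - \<pi>) = \<sigma> \<pi> - r"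
        using t s r(3) by (simp add: G_diff) (metis comp_apply id_apply)
      then show ?thesis using ram[OF G_comp[OF r(1) s(1)]] vge_G[OF t(1)] by metis
    qed
  qed (rule cg)
  moreover have "poly g (\<sigma> \<pi>) = t ^ b'"
    using s(1) tK by (simp add: pg y_def G_mult G_K s1[simplified] algebra_simps)
  ultimately have "int (p ^ (n - 1)) * (int b + 1) \<le> int b' * int N"
    using t by (simp add: vge_def w_power cS)
  also have "int b' * int N = int (p ^ (n - 1)) * int b"
  proof -
    have "p ^ n = p * p ^ (n - 1)" using n_ge_2 by (simp flip: power_Suc)
    then show ?thesis by (simp add: N_eq b')
  qed
  finally show False using p_gt_0 by simp
qed

end

section \<open>Taylor estimates for powers\<close>

context valued
begin

text \<open>Splitting off y - a leaves sums of products of i - 1 factors, each of valuation at least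
  \<alpha>.\<close>

lemma vge_pow_diff:
  assumes "vge a \<alpha>" "vge (y - a) \<eta>" "\<alpha> \<le> \<eta>"
  shows "vge (y ^ i - a ^ i) ((int i - 1) * \<alpha> + \<eta>)"
proof (induction i)
  case (Suc i)
  have "vge (a + (y - a)) \<alpha>" using assms vge_mono[OF assms(2,3)] by (intro vge_add) auto
  then have y: "vge y \<alpha>" by simp
  have "y ^ Suc i - a ^ Suc i = y * (y ^ i - a ^ i) + (y - a) * a ^ i" by (simp add: algebra_simps)
  moreover have "vge (y * (y ^ i - a ^ i)) (\<alpha> + ((int i - 1) * \<alpha> + \<eta>))" by (intro vge_mult y Suc)
  moreover have "vge ((y - a) * a ^ i) (\<eta> + int i * \<alpha>)" by (intro vge_mult vge_power assms)
  moreover have "\<alpha> + ((int i - 1) * \<alpha> + \<eta>) = (int (Suc i) - 1) * \<alpha> + \<eta>"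
    "\<eta> + int i * \<alpha> = (int (Suc i) - 1) * \<alpha> + \<eta>"
    by (simp_all add: algebra_simps)
  ultimately show ?case by (simp only:) (intro vge_add)
qed simp

lemma vge_of_nat [simp, intro]: "vge (of_nat i) 0"
proof (induction i)
  case (Suc i)
  have "vge 1 0" by (simp add: vge_def)
  from vge_add[OF this Suc] show ?case by simp
qed simp

text \<open>The remainder after the linear term: each of its terms contains \<open>h\<close> at
  least twice, and integer coefficients do not lower valuations.\<close>

lemma vge_pow_diff2:
  assumes "vge a \<alpha>" "vge h \<eta>" "\<alpha> \<le> \<eta>"
  shows "vge ((a + h) ^ i - a ^ i - of_nat i * h * a ^ (i - 1)) ((int i - 2) * \<alpha> + 2 * \<eta>)"
proof (induction i)
  case (Suc i)
  show ?case
  proof (cases "i = 0")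
    case False
    then obtain l where l: "i = Suc l" using gr0_implies_Suc by blast
    have ah: "vge (a + h) \<alpha>" using assms vge_mono[OF assms(2,3)] by (intro vge_add) auto
    have "(a + h) ^ Suc i - a ^ Suc i - of_nat (Suc i) * h * a ^ (Suc i - 1)
        = (a + h) * ((a + h) ^ i - a ^ i - of_nat i * h * a ^ (i - 1)) + of_nat i * (h * h * a ^ l)"
      by (simp add: l algebra_simps)
    moreover have "vge ((a + h) * ((a + h) ^ i - a ^ i - of_nat i * h * a ^ (i - 1)))
        (\<alpha> + ((int i - 2) * \<alpha> + 2 * \<eta>))" by (intro vge_mult ah Suc)
    moreover have "vge (of_nat i * (h * h * a ^ l)) (0 + (\<eta> + \<eta> + int l * \<alpha>))"
      by (intro vge_mult vge_power assms vge_of_nat)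
    moreover have "\<alpha> + ((int i - 2) * \<alpha> + 2 * \<eta>) = (int (Suc i) - 2) * \<alpha> + 2 * \<eta>"
      "0 + (\<eta> + \<eta> + int l * \<alpha>) = (int (Suc i) - 2) * \<alpha> + 2 * \<eta>"
      by (simp_all add: l algebra_simps)
    ultimately show ?thesis by (simp only:) (intro vge_add)
  qed simp
qed simp

end

context as_ext
begin

section \<open>Moore determinants\<close>

text \<open>Row \<open>l\<close> of the Moore matrix with entries
  \<open>\<omega> i ^ (p ^ (n - l))\<close>, applied to the vector \<open>a\<close>. The exponents
  decrease with \<open>l\<close>, so raising \<open>a\<close> to p-th powers turns row l + 1 into
  row l, as in \<open>moore_frob\<close>.\<close>

definition moore :: "(nat \<Rightarrow> 'a) \<Rightarrow> nat \<Rightarrow> 'a" where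
  "moore a l = (\<Sum>i=1..n. a i * \<omega> i ^ (p ^ (n - l)))"

lemma moore_frob:
  assumes "l < n"
  shows "moore (\<lambda>i. a i ^ p) l = moore a (Suc l) ^ p"
proof -
  have "p ^ (n - l) = p ^ (n - Suc l) * p" using assms by (simp flip: power_Suc2 add: Suc_diff_Suc)
  then show ?thesis by (simp add: moore_def frob_sum1 power_mult_distrib power_mult)
qed

lemma moore_diff: "moore (\<lambda>i. a i - c i) l = moore a l - moore c l"
  by (simp add: moore_def left_diff_distrib sum_subtractf)

lemma moore_scale: "moore (\<lambda>i. s * a i) l = s * moore a l"
  by (simp add: moore_def sum_distrib_left mult.assoc)

text \<open>The leading Moore minors do not vanish. A nontrivial relation, scaled to have last
  coefficient 1, is fixed by Frobenius because d^p - d is a shorter relation. Its coefficients then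
  lie in the prime field, against the independence of the \<open>\<omega> i\<close>.\<close>

lemma moore_trivial:
  assumes "j \<le> n" "\<And>i. i \<notin> {1..j} \<Longrightarrow> a i = 0" "\<And>l. l \<in> {1..j} \<Longrightarrow> moore a l = 0"
  shows "a i = 0"
  using assms
proof (induction j arbitrary: a i)
  case (Suc j)
  show ?case
  proof (cases "a (Suc j) = 0")
    case True
    have z: "a i = 0" if "i \<notin> {1..j}" for i
      using that True Suc.prems(2)[of i] by (cases "i = Suc j") auto
    show ?thesis
    proof (rule Suc.IH[of a i])
      show "moore a l = 0" if "l \<in> {1..j}" for l using that by (intro Suc.prems(3)) simp
    qed (use Suc.prems(1) z in simp_all)
  next
    case False
    define d where "d i = inverse (a (Suc j)) * a i" for i
    have dz: "d i = 0" if "i \<notin> {1..Suc j}" for i using Suc.prems(2)[OF that] by (simp add: d_def)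
    have d1: "d (Suc j) = 1" using False by (simp add: d_def)
    have dm: "moore d l = 0" if "l \<in> {1..Suc j}" for l
      using Suc.prems(3)[OF that] unfolding d_def by (simp add: moore_scale)
    \<comment> \<open>The entry at \<open>Suc j\<close> cancels. Row \<open>l\<close> of the p-th
      powers is the p-th power of row l + 1 of \<open>d\<close>, so exactly one row is lost.\<close>
    have dfix: "d i ^ p - d i = 0" for i
    proof (rule Suc.IH[of "\<lambda>i. d i ^ p - d i" i])
      show "d i ^ p - d i = 0" if "i \<notin> {1..j}" for i
        using that dz[of i] d1 p_gt_0 by (cases "i = Suc j") (auto simp: power_0_left)
      show "moore (\<lambda>i. d i ^ p - d i) l = 0" if "l \<in> {1..j}" for l
        using that dm[of l] dm[of "Suc l"] Suc.prems(1) p_gt_0 by (simp add: moore_diff moore_frob)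
    qed (use Suc.prems in simp)
    have dFp: "d i \<in> Fp" for i using dfix[of i] by (simp flip: frob_fixed_iff)
    have "d i ^ (p ^ m) = d i" for i m
    proof (induction m)
      case (Suc m)
      then show ?case using dFp[of i] frob_fixed_iff[of "d i"] by (simp add: power_mult mult.commute)
    qed simp
    then have "(\<Sum>i=1..n. d i * \<omega> i) ^ (p ^ (n - 1)) = moore d 1"
      by (simp add: frob_sum moore_def power_mult_distrib)
    then have "(\<Sum>i=1..n. d i * \<omega> i) = 0" using dm[of 1] by simp
    then have "d (Suc j) = 0"
      using Suc.prems(1) by (intro \<omega>_indep[of d]) (auto intro: Fp_Ints dFp)
    then show ?thesis using d1 by simp
  qed
qed simp

text \<open>Gaussian elimination over \<open>F\<close>: row t + 1 is cleared by a multiple of the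
  vector already built for t + 1, which vanishes on the earlier rows but, by
  \<open>moore_trivial\<close>, not on this one.\<close>

lemma ex_triangular:
  "j \<in> {1..n} \<Longrightarrow> \<exists>a. (\<forall>i. a i \<in> F) \<and> (\<forall>i. i \<notin> {1..j} \<longrightarrow> a i = 0) \<and> a j = 1 \<and>
    (\<forall>l\<in>{1..<j}. moore a l = 0)"
proof (induction j rule: less_induct)
  case (less j)
  have "\<exists>a. (\<forall>i. a i \<in> F) \<and> (\<forall>i. i \<notin> {1..j} \<longrightarrow> a i = 0) \<and> a j = 1 \<and> (\<forall>l\<in>{1..t}. moore a l = 0)"
    if "t < j" for t
    using that
  proof (induction t)
    case 0
    show ?case by (rule exI[of _ "\<lambda>i. if i = j then 1 else 0"]) (use less.prems in auto)
  next
    case (Suc t)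
    obtain a where a: "\<And>i. a i \<in> F" "\<And>i. i \<notin> {1..j} \<Longrightarrow> a i = 0" "a j = 1"
      "\<And>l. l \<in> {1..t} \<Longrightarrow> moore a l = 0"
      using Suc.IH[OF Suc_lessD[OF Suc.prems]] by blast
    have St: "Suc t \<in> {1..n}" using Suc.prems less.prems by auto
    obtain c where c: "\<And>i. c i \<in> F" "\<And>i. i \<notin> {1..Suc t} \<Longrightarrow> c i = 0" "c (Suc t) = 1"
      "\<And>l. l \<in> {1..<Suc t} \<Longrightarrow> moore c l = 0"
      using less.IH[OF Suc.prems St] by blast
    have nz: "moore c (Suc t) \<noteq> 0"
    proof
      assume z: "moore c (Suc t) = 0"
      have "c (Suc t) = 0"
      proof (rule moore_trivial[of "Suc t" c "Suc t"])
        fix l assume "l \<in> {1..Suc t}"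
        then show "moore c l = 0" using c(4)[of l] z by (cases "l = Suc t") auto
      qed (use c(2) St in auto)
      then show False using c(3) by simp
    qed
    define s where "s = moore a (Suc t) / moore c (Suc t)"
    have mF: "moore f l \<in> F" if "\<And>i. f i \<in> F" for f l
      unfolding moore_def using that \<omega>_F by (intro F.closed_sum F.closed_mult F.closed_power) auto
    show ?case
    proof (intro exI[of _ "\<lambda>i. a i - s * c i"] conjI allI impI ballI)
      show "a i - s * c i \<in> F" for i using a c mF[of a] mF[of c] by (auto simp: s_def)
      show "a i - s * c i = 0" if "i \<notin> {1..j}" for i
        using a(2)[OF that] c(2)[of i] that Suc.prems by auto
      show "a j - s * c j = 1" using a(3) c(2)[of j] Suc.prems by simp
      show "moore (\<lambda>i. a i - s * c i) l = 0" if "l \<in> {1..Suc t}" for l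
      proof -
        have "moore (\<lambda>i. a i - s * c i) l = moore a l - s * moore c l"
          by (simp only: moore_diff moore_scale)
        then show ?thesis using that a(4)[of l] c(4)[of l] nz by (cases "l = Suc t") (auto simp: s_def)
      qed
    qed
  qed
  from this[of "j - 1"] less.prems show ?case
    by (auto simp: atLeastLessThanSuc_atLeastAtMost[symmetric])
qed

lemma moore_nonzero:
  assumes "j \<in> {1..n}" "\<And>i. i \<notin> {1..j} \<Longrightarrow> a i = 0" "a j = 1" "\<And>l. l \<in> {1..<j} \<Longrightarrow> moore a l = 0"
  shows "moore a j \<noteq> 0"
proof
  assume z: "moore a j = 0"
  have "a j = 0"
  proof (rule moore_trivial[of j a j])
    fix l assume "l \<in> {1..j}"
    then show "moore a l = 0" using assms(4)[of l] z by (cases "l = j") auto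
  qed (use assms in auto)
  then show False using assms(3) by simp
qed

section \<open>Valuations of linear combinations of the Artin--Schreier roots\<close>

lemma AS_iterate:
  assumes "i \<in> {1..n}"
  shows "x i ^ (p ^ j) = x i + (\<Sum>r<j. (\<omega> i ^ (p ^ n) * \<beta> + \<epsilon> i) ^ (p ^ r))"
proof (induction j)
  case (Suc j)
  have "x i ^ p = x i + (\<omega> i ^ (p ^ n) * \<beta> + \<epsilon> i)" using AS[OF assms] by (simp add: algebra_simps)
  then have "x i ^ (p ^ Suc j) = (x i + (\<omega> i ^ (p ^ n) * \<beta> + \<epsilon> i)) ^ (p ^ j)"
    by (simp add: power_mult mult.commute)
  then show ?case using Suc by (simp add: frob_add)
qed simp

text \<open>The coefficient of \<beta>^(p^r) is the p^j-th power of row j - r applied to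
  \<open>a\<close>, so the conditions on \<open>a\<close> leave only r = 0. The exponent of
  \<open>\<omega> i\<close> in the Artin--Schreier equations keeps all these rows within the Moore
  matrix.\<close>

lemma lin_comb_pow:
  assumes j: "j \<in> {1..n}" and m: "\<And>l. l \<in> {1..<j} \<Longrightarrow> moore a l = 0"
  shows "(\<Sum>i=1..n. a i * x i) ^ (p ^ j) = moore a j ^ (p ^ j) * \<beta>
    + ((\<Sum>i=1..n. a i ^ (p ^ j) * x i) + (\<Sum>r<j. \<Sum>i=1..n. a i ^ (p ^ j) * \<epsilon> i ^ (p ^ r)))"
proof -
  have mo: "(\<Sum>i=1..n. a i ^ (p ^ j) * \<omega> i ^ (p ^ (n + r))) = moore a (j - r) ^ (p ^ j)" if r: "r < j" for r
  proof -
    have "n - (j - r) + j = n + r" using r j by auto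
    then have "p ^ (n + r) = p ^ (n - (j - r)) * p ^ j" by (simp flip: power_add)
    then show ?thesis by (simp add: moore_def frob_sum power_mult_distrib power_mult)
  qed
  have sw: "(\<Sum>i=1..n. \<Sum>r<j. f i r) = (\<Sum>r<j. \<Sum>i=1..n. f i r)" for f :: "nat \<Rightarrow> nat \<Rightarrow> 'a"
    by (rule sum.swap)
  have "(\<Sum>i=1..n. a i * x i) ^ (p ^ j) = (\<Sum>i=1..n. a i ^ (p ^ j) * x i ^ (p ^ j))"
    by (simp add: frob_sum power_mult_distrib)
  also have "\<dots> = (\<Sum>i=1..n. a i ^ (p ^ j) * x i + (\<Sum>r<j. a i ^ (p ^ j) * \<omega> i ^ (p ^ (n + r)) * \<beta> ^ (p ^ r))
      + (\<Sum>r<j. a i ^ (p ^ j) * \<epsilon> i ^ (p ^ r)))"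
    by (intro sum.cong refl) (simp add: AS_iterate frob_add power_mult_distrib sum.distrib
      distrib_left sum_distrib_left mult.assoc power_add flip: power_mult)
  also have "\<dots> = (\<Sum>i=1..n. a i ^ (p ^ j) * x i)
      + (\<Sum>r<j. (\<Sum>i=1..n. a i ^ (p ^ j) * \<omega> i ^ (p ^ (n + r))) * \<beta> ^ (p ^ r))
      + (\<Sum>r<j. \<Sum>i=1..n. a i ^ (p ^ j) * \<epsilon> i ^ (p ^ r))"
    by (simp only: sum.distrib sum_distrib_right sw)
  also have "(\<Sum>r<j. (\<Sum>i=1..n. a i ^ (p ^ j) * \<omega> i ^ (p ^ (n + r))) * \<beta> ^ (p ^ r))
      = (\<Sum>r<j. if r = 0 then moore a j ^ (p ^ j) * \<beta> else 0)"
  proof (rule sum.cong)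
    fix r assume r: "r \<in> {..<j}"
    show "(\<Sum>i=1..n. a i ^ (p ^ j) * \<omega> i ^ (p ^ (n + r))) * \<beta> ^ (p ^ r)
        = (if r = 0 then moore a j ^ (p ^ j) * \<beta> else 0)"
    proof (cases "r = 0")
      case False
      then have "moore a (j - r) = 0" using r by (intro m) auto
      then show ?thesis using r False mo[of r] p_gt_0 by (simp add: power_0_left)
    qed (use mo[of r] r in simp)
  qed simp
  also have "\<dots> = moore a j ^ (p ^ j) * \<beta>" using j by simp
  finally show ?thesis by (simp add: algebra_simps)
qed

lemma vge_F: "c \<in> F \<Longrightarrow> vge c 0"
  using w_F by (auto simp: vge_def)

lemma e_less_b: "e < b"
proof -
  have "e * 1 \<le> e * p ^ (n - 2)" using p_gt_0 by (intro mult_le_mono order_refl) simp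
  then show ?thesis using e_bound by linarith
qed

lemma vge_AS:
  assumes "y ^ p - y = a" "vge a (- (int p * m))" "m \<ge> 0"
  shows "vge y (- m)"
proof (rule ccontr)
  assume "\<not> vge y (- m)"
  then have y: "y \<noteq> 0" "w y < - m" by (auto simp: vge_def)
  have "w y * int p < w y * 1" using y p_gt_1 assms(3) by (intro mult_strict_left_mono_neg) auto
  then have "vge (- y) (w (y ^ p) + 1)" using y by (simp add: vge_def w_power mult.commute)
  then have "a \<noteq> 0 \<and> w a = w (y ^ p)" using w_add_eq[of "y ^ p" "- y"] y assms(1) by simp
  moreover have "int p * w y < int p * (- m)" using y p_gt_0 by (intro mult_strict_left_mono) auto
  ultimately show False using assms(2) y by (simp add: vge_def w_power)
qed

lemma N_eq2: "N = p * p ^ (n - 1)"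
  using n_ge_2 by (simp add: N_eq flip: power_Suc)

lemma vge_x:
  assumes "i \<in> {1..n}"
  shows "vge (x i) (- int (b * p ^ (n - 1)))"
proof (rule vge_AS[OF AS[OF assms]])
  have "vge (\<omega> i ^ (p ^ n) * \<beta>) (0 + w \<beta>)"
    using \<omega>_F[OF assms] by (intro vge_mult vge_F) auto
  moreover have "vge (\<epsilon> i) (- int (b * N))"
    using \<epsilon>_ge[OF assms]
  proof (rule vge_mono)
    show "- int (b * N) \<le> - int (e * N)"
      using mult_le_mono1[OF less_imp_le[OF e_less_b], of N] by (simp flip: of_nat_mult)
  qed
  ultimately have "vge (\<omega> i ^ (p ^ n) * \<beta> + \<epsilon> i) (- int (b * N))" using \<beta> by (intro vge_add) auto
  then show "vge (\<omega> i ^ p ^ n * \<beta> + \<epsilon> i) (- (int p * int (b * p ^ (n - 1))))"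
    by (simp add: N_eq2 algebra_simps)
qed simp

text \<open>Here e < b / p^(n-2) enters: up to the exponent p^(n-2) all powers of the
  \<open>\<epsilon> i\<close> are dominated by \<beta>. The next exponent p^(n-1) occurs only in the
  power taken for \<open>y\<^sub>n\<close>.\<close>

lemma vge_eps_pow:
  assumes "i \<in> {1..n}" "r \<le> n - 2"
  shows "vge (\<epsilon> i ^ (p ^ r)) (- int (b * N) + 1)"
proof (rule vge_mono[OF vge_power[OF \<epsilon>_ge[OF assms(1)]]])
  have "e * p ^ r \<le> e * p ^ (n - 2)" using assms(2) p_gt_0 by (intro mult_le_mono power_increasing) auto
  then have "e * p ^ r + 1 \<le> b" using e_bound by linarith
  then have "(e * p ^ r + 1) * N \<le> b * N" by (rule mult_le_mono1)
  then have "e * p ^ r * N + 1 \<le> b * N" using N_pos by (simp add: algebra_simps)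
  then have "int (e * p ^ r * N) + 1 \<le> int (b * N)" by (metis of_nat_1 of_nat_add of_nat_le_iff)
  then show "- int (b * N) + 1 \<le> int (p ^ r) * - int (e * N)" by (simp add: algebra_simps)
qed

lemma vge_sum_x:
  assumes "\<And>i. c i \<in> F"
  shows "vge (\<Sum>i=1..n. c i * x i) (- int (b * N) + 1)"
proof (rule vge_sum)
  fix i assume i: "i \<in> {1..n}"
  have "vge (c i * x i) (0 + - int (b * p ^ (n - 1)))" using assms i by (intro vge_mult vge_x vge_F)
  moreover have "b * p ^ (n - 1) < b * N" using b_pos p_gt_1 by (simp add: N_eq2)
  then have "- int (b * N) + 1 \<le> 0 + - int (b * p ^ (n - 1))" by linarith
  ultimately show "vge (c i * x i) (- int (b * N) + 1)" by (rule vge_mono)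
qed

lemma w_lin_comb:
  assumes j: "j \<in> {1..n-1}" and a: "\<And>i. a i \<in> F" and m: "\<And>l. l \<in> {1..<j} \<Longrightarrow> moore a l = 0"
    and nz: "moore a j \<noteq> 0"
  shows "(\<Sum>i=1..n. a i * x i) \<noteq> 0" "w (\<Sum>i=1..n. a i * x i) = - int (b * p ^ (n - j))"
proof -
  let ?y = "\<Sum>i=1..n. a i * x i"
  have j': "j \<in> {1..n}" using j by auto
  have mF: "moore a j \<in> F"
    unfolding moore_def using a \<omega>_F by (intro F.closed_sum F.closed_mult F.closed_power) auto
  have wm: "w (moore a j ^ (p ^ j) * \<beta>) = - int (b * N)"
    using nz mF \<beta> w_F by (simp add: w_mult w_power)
  have "vge (\<Sum>r<j. \<Sum>i=1..n. a i ^ (p ^ j) * \<epsilon> i ^ (p ^ r)) (- int (b * N) + 1)"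
  proof (intro vge_sum)
    fix r i assume "r \<in> {..<j}" "i \<in> {1..n}"
    then have "vge (a i ^ (p ^ j) * \<epsilon> i ^ (p ^ r)) (0 + (- int (b * N) + 1))"
      using j a by (intro vge_mult vge_eps_pow vge_F) auto
    then show "vge (a i ^ (p ^ j) * \<epsilon> i ^ (p ^ r)) (- int (b * N) + 1)" by simp
  qed
  then have "vge ((\<Sum>i=1..n. a i ^ (p ^ j) * x i) + (\<Sum>r<j. \<Sum>i=1..n. a i ^ (p ^ j) * \<epsilon> i ^ (p ^ r)))
      (w (moore a j ^ (p ^ j) * \<beta>) + 1)"
    unfolding wm using a by (intro vge_add vge_sum_x) auto
  note small = this
  have nzm: "moore a j ^ (p ^ j) * \<beta> \<noteq> 0" using nz \<beta> by simp
  have eq: "?y ^ (p ^ j) = moore a j ^ (p ^ j) * \<beta>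
      + ((\<Sum>i=1..n. a i ^ (p ^ j) * x i) + (\<Sum>r<j. \<Sum>i=1..n. a i ^ (p ^ j) * \<epsilon> i ^ (p ^ r)))"
    by (rule lin_comb_pow[OF j' m])
  have y: "?y ^ (p ^ j) \<noteq> 0" "w (?y ^ (p ^ j)) = - int (b * N)"
    unfolding eq using w_add_eq[OF nzm small] wm by (simp_all only: not_False_eq_True)
  show y0: "?y \<noteq> 0"
  proof
    assume "?y = 0"
    then have "?y ^ (p ^ j) = 0" using p_gt_0 by (simp only: power_0_left) simp
    then show False using y(1) by simp
  qed
  have "int (p ^ j) * w ?y = - int (b * N)" using y y0 by (simp add: w_power)
  also have "\<dots> = int (p ^ j) * - int (b * p ^ (n - j))"
    using j' by (simp add: N_eq mult.left_commute flip: power_add)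
  finally show "w ?y = - int (b * p ^ (n - j))"
    by (simp only: mult_cancel_left) (use p_gt_0 in simp)
qed

section \<open>Approximation of inseparable roots inside the first layer\<close>

text \<open>The pole order of \<open>x 1\<close> in \<open>L\<close>.\<close>

definition h1 :: int where "h1 = int (b * p ^ (n - 1))"

lemma h1_pos: "h1 > 0"
  using b_pos p_gt_0 by (simp add: h1_def)

lemma bN_h1: "int (b * N) = int p * h1"
  by (simp add: h1_def N_eq2 algebra_simps)

lemma w_x1': "w (x 1) = - h1"
proof -
  have "int p * w (x 1) = int p * (- h1)" using w_x1(2) bN_h1 by simp
  then show ?thesis using p_gt_0 by (simp only: mult_cancel_left) simp
qed

text \<open>\<open>z\<close> is fixed by the stabilizer of \<open>x 1\<close> and has
  \<open>d\<close> as its derivative with respect to \<open>x 1\<close>, up to a second-order error.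
  \<open>s\<close> bounds the valuation of \<open>z\<close> from below, and each differentiation
  gains \<open>h1\<close>.\<close>

definition zder :: "'a \<Rightarrow> 'a \<Rightarrow> int \<Rightarrow> bool" where
  "zder z d s \<longleftrightarrow> (\<forall>\<sigma>\<in>G. vge (\<sigma> z - z - chi 1 \<sigma> * d) (s + 2 * h1)) \<and> vge z s \<and> vge d (s + h1) \<and>
    (\<forall>\<sigma>\<in>G. chi 1 \<sigma> = 0 \<longrightarrow> \<sigma> z = z)"

lemma zder_0: "zder 0 0 s"
  by (simp add: zder_def)

lemma zder_mono: "zder z d s \<Longrightarrow> s' \<le> s \<Longrightarrow> zder z d s'"
  by (auto simp: zder_def elim!: vge_mono)

lemma zder_add:
  assumes "zder z d s" "zder z' d' s"
  shows "zder (z + z') (d + d') s"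
  unfolding zder_def
proof (intro conjI ballI impI)
  fix \<sigma> assume s: "\<sigma> \<in> G"
  have "\<sigma> (z + z') - (z + z') - chi 1 \<sigma> * (d + d')
      = (\<sigma> z - z - chi 1 \<sigma> * d) + (\<sigma> z' - z' - chi 1 \<sigma> * d')"
    using s by (simp add: G_add algebra_simps)
  then show "vge (\<sigma> (z + z') - (z + z') - chi 1 \<sigma> * (d + d')) (s + 2 * h1)"
    using assms s by (simp only:) (intro vge_add, auto simp: zder_def)
  show "\<sigma> (z + z') = z + z'" if "chi 1 \<sigma> = 0"
  proof -
    have "\<sigma> z = z" "\<sigma> z' = z'" using assms s that unfolding zder_def by blast+
    then show ?thesis using s by (simp add: G_add)
  qed
qed (use assms in \<open>auto simp: zder_def intro: vge_add\<close>)

lemma chi1_F: "\<sigma> \<in> G \<Longrightarrow> chi 1 \<sigma> \<in> F"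
  using n_ge_2 by (intro chi_F) auto

lemma G_x1: "\<sigma> (x 1) = x 1 + chi 1 \<sigma>"
  by (simp add: chi_def)

lemma zder_term:
  assumes c: "c \<in> K" "c \<noteq> 0"
  shows "zder (c * x 1 ^ i) (of_nat i * c * x 1 ^ (i - 1)) (w c - int i * h1)"
  unfolding zder_def
proof (intro conjI ballI impI)
  fix \<sigma> assume s: "\<sigma> \<in> G"
  have sc: "\<sigma> (c * x 1 ^ i) = c * (x 1 + chi 1 \<sigma>) ^ i"
    using s c by (simp add: G_mult G_power G_K G_x1[of _, simplified])
  have "\<sigma> (c * x 1 ^ i) - c * x 1 ^ i - chi 1 \<sigma> * (of_nat i * c * x 1 ^ (i - 1))
      = c * ((x 1 + chi 1 \<sigma>) ^ i - x 1 ^ i - of_nat i * chi 1 \<sigma> * x 1 ^ (i - 1))"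
    unfolding sc by (simp add: algebra_simps)
  moreover have "vge (c * ((x 1 + chi 1 \<sigma>) ^ i - x 1 ^ i - of_nat i * chi 1 \<sigma> * x 1 ^ (i - 1)))
      (w c + ((int i - 2) * (- h1) + 2 * 0))"
    using h1_pos by (intro vge_mult vge_pow_diff2 vge_F chi1_F s) (auto simp: vge_def w_x1'[simplified])
  ultimately show "vge (\<sigma> (c * x 1 ^ i) - c * x 1 ^ i - chi 1 \<sigma> * (of_nat i * c * x 1 ^ (i - 1)))
      (w c - int i * h1 + 2 * h1)" by (simp add: algebra_simps)
  show "\<sigma> (c * x 1 ^ i) = c * x 1 ^ i" if "chi 1 \<sigma> = 0" using sc that by simp
next
  show "vge (c * x 1 ^ i) (w c - int i * h1)"
    using c w_x1(1) by (simp add: vge_def w_mult w_power w_x1'[simplified])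
  show "vge (of_nat i * c * x 1 ^ (i - 1)) (w c - int i * h1 + h1)"
  proof (cases i)
    case (Suc l)
    have "vge (of_nat i * c * x 1 ^ l) (0 + w c + int l * w (x 1))"
      by (intro vge_mult vge_power vge_of_nat vge_w)
    then show ?thesis by (simp add: Suc w_x1'[simplified] algebra_simps)
  qed simp
qed

text \<open>The valuation can be matched because p does not divide \<open>b\<close>, the residue
  because \<open>F\<close> is perfect. The last clause records that the exponent of \<beta> is 0
  only if p divides the valuation of \<zeta> in \<open>K\<close>.\<close>

lemma leading_term:
  assumes z: "\<zeta> \<in> K" "\<zeta> \<noteq> 0"
  obtains i c where "i < p" "c \<in> K" "c \<noteq> 0" "int p * (w c - int i * h1) = w \<zeta>"
    "vge (\<zeta> - c ^ p * \<beta> ^ i) (w \<zeta> + 1)" "i = 0 \<Longrightarrow> int (p * N) dvd w \<zeta>"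
proof -
  obtain k where k: "w \<zeta> = int N * k" using w_K[OF z] by blast
  have "coprime (int b) (int p)"
    using not_p_dvd_b prime_p by (metis coprime_commute coprime_int_iff prime_imp_coprime_nat)
  then obtain y where y: "[int b * y = 1] (mod int p)" using cong_solve_coprime_int by blast
  \<comment> \<open>Solves k + i b = 0 modulo p, so that the quotient of \<zeta> by
    \<open>\<beta> ^ i\<close> has valuation in \<open>K\<close> divisible by p.\<close>
  define i where "i = nat ((- k * y) mod int p)"
  have i: "int i = (- k * y) mod int p" "i < p" using p_gt_0 by (auto simp: i_def nat_less_iff)
  have "[k + int i * int b = k + (- k * y) * int b] (mod int p)"
    unfolding i(1) by (intro cong_add cong_mult) (auto simp: cong_def)
  also have "k + (- k * y) * int b = k - k * (int b * y)" by (simp add: algebra_simps)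
  also have "[k - k * (int b * y) = k - k * 1] (mod int p)" by (intro cong_diff cong_mult y) auto
  finally have "int p dvd k + int i * int b" by (simp add: cong_0_iff)
  then obtain l where l: "k + int i * int b = int p * l" by blast
  obtain t where t: "t \<in> K" "t \<noteq> 0" "w t = int N" using ex_t by blast
  define c0 where "c0 = t powi l"
  have c0: "c0 \<in> K" "c0 \<noteq> 0" "w c0 = int N * l"
  proof -
    show "c0 \<in> K" "c0 \<noteq> 0" using t by (auto simp: c0_def power_int_def)
    show "w c0 = int N * l" using w_power_int[OF t(2), of l] t(3) by (simp add: c0_def)
  qed
  have wc0: "int p * (w c0 - int i * h1) = w \<zeta>"
  proof -
    have "int p * (w c0 - int i * h1) = int N * (int p * l) - int i * (int p * h1)"
      by (simp add: c0 algebra_simps)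
    also have "\<dots> = int N * (k + int i * int b) - int i * int (b * N)" by (simp only: l bN_h1)
    also have "\<dots> = w \<zeta>" by (simp add: k algebra_simps)
    finally show ?thesis .
  qed
  define u where "u = \<zeta> / (c0 ^ p * \<beta> ^ i)"
  have wd: "w (c0 ^ p * \<beta> ^ i) = w \<zeta>"
  proof -
    have "w (c0 ^ p * \<beta> ^ i) = int p * w c0 - int i * int (b * N)"
      using c0 \<beta> by (simp add: w_mult w_power)
    then show ?thesis using wc0 unfolding bN_h1 by (simp add: algebra_simps)
  qed
  have dnz: "c0 ^ p * \<beta> ^ i \<noteq> 0" using c0 \<beta> by simp
  have u: "u \<in> K" "u \<noteq> 0" "w u = 0"
    using z c0 \<beta> dnz wd unfolding u_def by (auto simp: w_divide)
  then have "vge u 0" by (simp add: vge_def)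
  then obtain f where f: "f \<in> F" "vge (u - f) 1" using residue_K[OF u(1)] by blast
  have fnz: "f \<noteq> 0"
  proof
    assume "f = 0"
    then show False using f u by (simp add: vge_def)
  qed
  obtain g where g: "g \<in> F" "g ^ p = f" using perfect_F f by blast
  have gnz: "g \<noteq> 0" using g fnz p_gt_0 by (auto simp: power_0_left)
  have "\<zeta> - (g * c0) ^ p * \<beta> ^ i = (c0 ^ p * \<beta> ^ i) * (u - f)"
    using dnz by (simp add: u_def power_mult_distrib g right_diff_distrib mult_ac)
  moreover have "vge ((c0 ^ p * \<beta> ^ i) * (u - f)) (w \<zeta> + 1)"
    using vge_mult[OF vge_w f(2), of "c0 ^ p * \<beta> ^ i"] wd by simp
  ultimately have 1: "vge (\<zeta> - (g * c0) ^ p * \<beta> ^ i) (w \<zeta> + 1)" by simp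
  have "w (g * c0) = w c0" using gnz c0 w_F g by (simp add: w_mult)
  then have 2: "int p * (w (g * c0) - int i * h1) = w \<zeta>" using wc0 by simp
  have 3: "int (p * N) dvd w \<zeta>" if "i = 0"
    using that wc0 c0 by (simp flip: wc0)
  show ?thesis
    by (rule that[of i "g * c0"]) (use i g gnz c0 F_subset_K 1 2 3 in auto)
qed

text \<open>The p-th power of \<open>x 1\<close> is \<beta> + x 1. Replacing it by \<beta> costs a
  relative error of valuation p h1 - h1.\<close>

lemma vge_term_pow:
  assumes c: "c \<in> K" "c \<noteq> 0"
  shows "vge (c ^ p * \<beta> ^ i - (c * x 1 ^ i) ^ p) (int p * (w c - int i * h1) + int p * h1 - h1)"
proof -
  have xp: "x 1 ^ p - \<beta> = x 1" using AS_1 by (simp add: algebra_simps)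
  have "vge ((x 1 ^ p) ^ i - \<beta> ^ i) ((int i - 1) * (- (int p * h1)) + (- h1))"
  proof (rule vge_pow_diff)
    show "vge \<beta> (- (int p * h1))" using \<beta> bN_h1 by (simp add: vge_def)
    show "vge (x 1 ^ p - \<beta>) (- h1)" unfolding xp by (simp add: vge_def w_x1'[simplified])
    show "- (int p * h1) \<le> - h1" using h1_pos p_gt_0 by simp
  qed
  then have "vge (c ^ p * ((x 1 ^ p) ^ i - \<beta> ^ i)) (int p * w c + ((int i - 1) * (- (int p * h1)) + (- h1)))"
    by (intro vge_mult vge_power vge_w)
  then have "vge (- (c ^ p * ((x 1 ^ p) ^ i - \<beta> ^ i))) (int p * w c + ((int i - 1) * (- (int p * h1)) + (- h1)))"
    by simp
  moreover have "- (c ^ p * ((x 1 ^ p) ^ i - \<beta> ^ i)) = c ^ p * \<beta> ^ i - (c * x 1 ^ i) ^ p"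
  proof -
    have "(x 1 ^ i) ^ p = (x 1 ^ p) ^ i" by (simp only: power_mult[symmetric] mult.commute)
    then show ?thesis by (simp add: power_mult_distrib right_diff_distrib)
  qed
  moreover have "int p * w c + ((int i - 1) * (- (int p * h1)) + (- h1))
      = int p * (w c - int i * h1) + int p * h1 - h1"
    by (simp add: algebra_simps)
  ultimately show ?thesis by (simp only:)
qed

text \<open>On \<open>K\<close> all valuations are multiples of \<open>N\<close>, hence of p, so a
  strict inequality gains a full step.\<close>

lemma dvd_vge_step:
  assumes "\<zeta> \<in> K" "vge \<zeta> (int p * s + 1)"
  shows "vge \<zeta> (int p * (s + 1))"
proof (cases "\<zeta> = 0")
  case False
  have "int p dvd int N" by (simp add: N_eq2)
  then have "int p dvd w \<zeta>" using w_K[OF assms(1) False] by (rule dvd_trans)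
  then obtain k where k: "w \<zeta> = int p * k" by blast
  have "int p * s < int p * k" using assms(2) False k by (simp add: vge_def)
  then have "s < k" using p_gt_0 by simp
  then have "int p * (s + 1) \<le> int p * k" using p_gt_0 by (intro mult_left_mono) auto
  then show ?thesis using k by (simp add: vge_def)
qed simp

text \<open>Successive approximation: leading terms are removed one at a time, each with its own
  approximate p-th root, until the error reaches \<open>B\<close>. The bound on \<open>B\<close> is
  the precision that \<open>vge_term_pow\<close> allows; \<open>m\<close> bounds the number of steps
  left.\<close>

lemma approx_root:
  assumes "\<zeta> \<in> K" "vge \<zeta> (int p * s)" "B \<le> int p * s + int p * h1 - h1" "B - int p * s \<le> int m"
  shows "\<exists>z d. zder z d s \<and> vge (\<zeta> - z ^ p) B"
  using assms
proof (induction m arbitrary: \<zeta> s)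
  case 0
  then have "vge (\<zeta> - 0 ^ p) B" using p_gt_0 by (auto simp: power_0_left elim: vge_mono)
  then show ?case using zder_0 by blast
next
  case (Suc m)
  have next_bound: "B \<le> int p * (s + 1) + int p * h1 - h1" "B - int p * (s + 1) \<le> int m"
    using Suc.prems(3,4) p_gt_0 by (simp_all add: algebra_simps)
  show ?case
  proof (cases "vge \<zeta> (int p * s + 1)")
    case True
    then have "vge \<zeta> (int p * (s + 1))" using Suc.prems(1) by (intro dvd_vge_step)
    then obtain z d where "zder z d (s + 1)" "vge (\<zeta> - z ^ p) B"
      using Suc.IH[of \<zeta> "s + 1"] Suc.prems(1) next_bound by blast
    then show ?thesis using zder_mono[of z d "s + 1" s] by auto
  next
    case False
    then have nz: "\<zeta> \<noteq> 0" and wz: "w \<zeta> = int p * s"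
      using Suc.prems(2) by (auto simp: vge_def)
    obtain i c where ic: "c \<in> K" "c \<noteq> 0" "int p * (w c - int i * h1) = w \<zeta>"
        "vge (\<zeta> - c ^ p * \<beta> ^ i) (w \<zeta> + 1)"
      by (rule leading_term[OF Suc.prems(1) nz]) blast
    have s: "w c - int i * h1 = s" using ic(3) wz p_gt_0 by simp
    let ?\<zeta> = "\<zeta> - c ^ p * \<beta> ^ i"
    have zK: "?\<zeta> \<in> K" using Suc.prems(1) ic \<beta> by auto
    have "vge ?\<zeta> (int p * (s + 1))" using ic(4) wz zK by (intro dvd_vge_step) auto
    then obtain z d where z: "zder z d (s + 1)" "vge (?\<zeta> - z ^ p) B"
      using Suc.IH[of ?\<zeta> "s + 1"] zK next_bound by blast
    let ?T = "c * x 1 ^ i" and ?dT = "of_nat i * c * x 1 ^ (i - 1)"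
    have zd: "zder (?T + z) (?dT + d) s"
      using zder_add[of ?T ?dT s z d] zder_term[OF ic(1,2), of i] zder_mono[OF z(1), of s] s by simp
    have "\<zeta> - (?T + z) ^ p = (?\<zeta> - z ^ p) + (c ^ p * \<beta> ^ i - ?T ^ p)"
      by (simp add: frob_add1)
    moreover have "vge (c ^ p * \<beta> ^ i - ?T ^ p) B"
      using vge_term_pow[OF ic(1,2), of i] unfolding s by (rule vge_mono) (use Suc.prems(3) in simp)
    ultimately have "vge (\<zeta> - (?T + z) ^ p) B" using z(2) by (simp only:) (rule vge_add)
    then show ?thesis using zd by blast
  qed
qed

text \<open>If p does not divide the valuation of \<zeta> in \<open>K\<close>, the leading exponent
  lies strictly between 0 and p. The derivative of the leading term is then nonzero, and the
  valuations of \<open>z\<close> and \<open>d\<close> are exact.\<close>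

lemma approx_root_exact:
  assumes z: "\<zeta> \<in> K" "\<zeta> \<noteq> 0" "w \<zeta> = int p * s" "\<not> int (p * N) dvd w \<zeta>"
    and B: "B \<le> int p * s + int p * h1 - h1"
  shows "\<exists>z d. zder z d s \<and> vge (\<zeta> - z ^ p) B \<and> z \<noteq> 0 \<and> w z = s \<and> d \<noteq> 0 \<and> w d = s + h1"
proof -
  obtain i c where ic: "i < p" "c \<in> K" "c \<noteq> 0" "int p * (w c - int i * h1) = w \<zeta>"
      "vge (\<zeta> - c ^ p * \<beta> ^ i) (w \<zeta> + 1)" "i = 0 \<Longrightarrow> int (p * N) dvd w \<zeta>"
    by (rule leading_term[OF z(1,2)]) blast
  have i0: "i > 0" using ic(6) z(4) by blast
  have s: "w c - int i * h1 = s" using ic(4) z(3) p_gt_0 by simp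
  let ?\<zeta> = "\<zeta> - c ^ p * \<beta> ^ i"
  have zK: "?\<zeta> \<in> K" using z ic \<beta> by auto
  have v: "vge ?\<zeta> (int p * (s + 1))" using ic(5) z(3) zK by (intro dvd_vge_step) auto
  have "B \<le> int p * (s + 1) + int p * h1 - h1" using B p_gt_0 by (simp add: algebra_simps)
  moreover have "B - int p * (s + 1) \<le> int (nat (B - int p * (s + 1)))" by simp
  ultimately obtain z' d' where z': "zder z' d' (s + 1)" "vge (?\<zeta> - z' ^ p) B"
    using approx_root[OF zK v] by blast
  let ?T = "c * x 1 ^ i" and ?dT = "of_nat i * c * x 1 ^ (i - 1)"
  have x0: "x 1 \<noteq> 0" by (rule w_x1(1))
  have oi: "of_nat i \<noteq> (0::'a)" using i0 ic(1) by (rule of_nat_nonzero)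
  have woi: "w (of_nat i) = 0" using oi F.closed_of_nat w_F by blast
  have T: "?T \<noteq> 0" "w ?T = s" using ic x0 s by (auto simp: w_mult w_power w_x1'[simplified])
  have dT: "?dT \<noteq> 0" "w ?dT = s + h1"
  proof -
    show "?dT \<noteq> 0" using ic x0 oi by simp
    have "w ?dT = w c - int (i - 1) * h1" using ic x0 oi woi by (simp add: w_mult w_power w_x1'[simplified])
    also have "\<dots> = s + h1" using i0 s by (simp add: of_nat_diff algebra_simps)
    finally show "w ?dT = s + h1" .
  qed
  have zd: "zder (?T + z') (?dT + d') s"
    using zder_add[of ?T ?dT s z' d'] zder_term[OF ic(2,3), of i] zder_mono[OF z'(1), of s] s by simp
  have "\<zeta> - (?T + z') ^ p = (?\<zeta> - z' ^ p) + (c ^ p * \<beta> ^ i - ?T ^ p)"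
    by (simp add: frob_add1)
  moreover have "vge (c ^ p * \<beta> ^ i - ?T ^ p) B"
    using vge_term_pow[OF ic(2,3), of i] unfolding s by (rule vge_mono) (use B in simp)
  ultimately have v1: "vge (\<zeta> - (?T + z') ^ p) B" using z'(2) by (simp only:) (rule vge_add)
  have "vge z' (w ?T + 1)" "vge d' (w ?dT + 1)" using z'(1) T dT by (auto simp: zder_def algebra_simps)
  then show ?thesis using zd v1 w_add_eq[OF T(1)] w_add_eq[OF dT(1)] T dT by metis
qed

text \<open>For j < n the combinations are those of \<open>w_lin_comb\<close>. For j = n the only
  terms that could beat \<beta> add up to a power of one element \<zeta> of \<open>K\<close>, and
  \<open>z\<close> is an approximate p-th root of \<zeta>, or 0 if \<zeta> is already
  dominated.\<close>

lemma exists_scaffold: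
  "\<exists>a z d. (\<forall>j\<in>{1..n}. (\<forall>i. a j i \<in> F) \<and> (\<forall>i. i \<notin> {1..j} \<longrightarrow> a j i = 0) \<and> a j j = 1) \<and>
    (\<forall>j\<in>{1..n-1}. (\<Sum>i=1..n. a j i * x i) \<noteq> 0 \<and>
      w (\<Sum>i=1..n. a j i * x i) = - int (b * p ^ (n - j))) \<and>
    (\<Sum>i=1..n. a n i * x i) - z \<noteq> 0 \<and> w ((\<Sum>i=1..n. a n i * x i) - z) = - int b \<and>
    zder z d (- int (e * p ^ (n - 1))) \<and>
    (z = 0 \<and> d = 0 \<and> e * p ^ (n - 1) < b \<or>
     b < e * p ^ (n - 1) \<and> z \<noteq> 0 \<and> w z = - int (e * p ^ (n - 1)) \<and> d \<noteq> 0 \<and>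
       w d = - int (e * p ^ (n - 1)) + h1)"
proof -
  have "\<forall>j\<in>{1..n}. \<exists>a. (\<forall>i. a i \<in> F) \<and> (\<forall>i. i \<notin> {1..j} \<longrightarrow> a i = 0) \<and> a j = 1 \<and>
    (\<forall>l\<in>{1..<j}. moore a l = 0)" using ex_triangular by blast
  then obtain a where "\<forall>j\<in>{1..n}. (\<forall>i. a j i \<in> F) \<and> (\<forall>i. i \<notin> {1..j} \<longrightarrow> a j i = 0) \<and> a j j = 1 \<and>
    (\<forall>l\<in>{1..<j}. moore (a j) l = 0)" by (auto dest!: bchoice)
  then have aF: "\<And>j i. j \<in> {1..n} \<Longrightarrow> a j i \<in> F"
    and a0: "\<And>j i. j \<in> {1..n} \<Longrightarrow> i \<notin> {1..j} \<Longrightarrow> a j i = 0"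
    and a1: "\<And>j. j \<in> {1..n} \<Longrightarrow> a j j = 1"
    and am: "\<And>j l. j \<in> {1..n} \<Longrightarrow> l \<in> {1..<j} \<Longrightarrow> moore (a j) l = 0"
    by blast+
  have nz: "moore (a j) j \<noteq> 0" if "j \<in> {1..n}" for j
    by (rule moore_nonzero) (use that a0 a1 am in auto)
  have wy: "(\<Sum>i=1..n. a j i * x i) \<noteq> 0 \<and> w (\<Sum>i=1..n. a j i * x i) = - int (b * p ^ (n - j))"
    if j: "j \<in> {1..n-1}" for j
  proof -
    have j': "j \<in> {1..n}" using j by auto
    show ?thesis using w_lin_comb[OF j aF[OF j'] am[OF j'] nz[OF j']] by blast
  qed
  have nn: "n \<in> {1..n}" using n_ge_2 by simp
  \<comment> \<open>With these coefficients the summand r = n - 1 in \<open>lin_comb_pow\<close> is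
    exactly the p^(n-1)-th power of \<zeta>.\<close>
  define \<zeta> where "\<zeta> = (\<Sum>i=1..n. a n i ^ p * \<epsilon> i)"
  have aK: "a n i \<in> K" for i using aF[OF nn] F_subset_K by blast
  have zK: "\<zeta> \<in> K" unfolding \<zeta>_def using aK \<epsilon>_K by (intro K.closed_sum K.closed_mult K.closed_power) auto
  let ?s = "- int (e * p ^ (n - 1))"
  have pse: "int p * ?s = - int (e * N)" by (simp add: N_eq2 algebra_simps)
  have wz: "\<zeta> \<noteq> 0 \<and> w \<zeta> = - int (e * N)" if e: "e > 0"
  proof -
    have split: "{1..n} = insert n {1..n-1}" using n_ge_2 by auto
    have "\<zeta> = a n n ^ p * \<epsilon> n + (\<Sum>i\<in>{1..n-1}. a n i ^ p * \<epsilon> i)"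
      unfolding \<zeta>_def split using n_ge_2 by (subst sum.insert) auto
    then have "\<zeta> = \<epsilon> n + (\<Sum>i\<in>{1..n-1}. a n i ^ p * \<epsilon> i)" using a1[OF nn] by simp
    moreover have "vge (\<Sum>i\<in>{1..n-1}. a n i ^ p * \<epsilon> i) (w (\<epsilon> n) + 1)"
    proof (rule vge_sum)
      fix i assume i: "i \<in> {1..n-1}"
      have "vge (a n i ^ p * \<epsilon> i) (0 + (- int (e * N) + 1))"
        using e i aF[OF nn] by (intro vge_mult vge_F \<epsilon>_less) auto
      then show "vge (a n i ^ p * \<epsilon> i) (w (\<epsilon> n) + 1)" using \<epsilon>_n e by simp
    qed
    ultimately show ?thesis using w_add_eq[of "\<epsilon> n"] \<epsilon>_n e by simp
  qed
  \<comment> \<open>The precision is the one for which the error, raised to the power p^(n-1), has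
    larger valuation than \<beta>.\<close>
  have ex_z: "\<exists>z d. zder z d ?s \<and> vge (\<zeta> - z ^ p) (- int (b * p) + 1) \<and>
    (z = 0 \<and> d = 0 \<and> e * p ^ (n - 1) < b \<or>
     b < e * p ^ (n - 1) \<and> z \<noteq> 0 \<and> w z = ?s \<and> d \<noteq> 0 \<and> w d = ?s + h1)"
  proof (cases "e * p ^ (n - 1) < b")
    case True
    have "vge \<zeta> (- int (e * N))" unfolding \<zeta>_def
    proof (rule vge_sum)
      fix i assume i: "i \<in> {1..n}"
      have "vge (a n i ^ p * \<epsilon> i) (0 + - int (e * N))"
        using i aF[OF nn] by (intro vge_mult vge_F \<epsilon>_ge) auto
      then show "vge (a n i ^ p * \<epsilon> i) (- int (e * N))" by simp
    qed
    moreover have "e * N < b * p" using True p_gt_0 by (simp add: N_eq2 mult.left_commute mult.commute)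
    then have "- int (b * p) + 1 \<le> - int (e * N)" by linarith
    ultimately have "vge \<zeta> (- int (b * p) + 1)" by (rule vge_mono)
    then have "vge (\<zeta> - 0 ^ p) (- int (b * p) + 1)" using p_gt_0 by (simp add: power_0_left)
    then show ?thesis using zder_0 True by blast
  next
    case False
    have epos: "e > 0" using False b_pos by (cases e) auto
    have pn: "p ^ (n - 1) = p * p ^ (n - 2)" using n_ge_2
      by (metis Suc_1 Suc_diff_Suc Suc_le_eq One_nat_def power_Suc)
    \<comment> \<open>The borderline case is excluded because p does not divide
      \<open>b\<close>.\<close>
    have "b \<noteq> e * p ^ (n - 1)" using not_p_dvd_b pn by (metis dvd_mult dvd_triv_left)
    then have gt: "b < e * p ^ (n - 1)" using False by simp
    have nd: "\<not> int (p * N) dvd w \<zeta>"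
    proof
      assume "int (p * N) dvd w \<zeta>"
      then have "int (p * N) dvd int (e * N)" using wz[OF epos] by (simp only: dvd_minus_iff)
      then have "p * N dvd e * N" by (simp only: of_nat_dvd_iff)
      then have "p dvd e" using N_pos by simp
      then show False using \<epsilon>_n epos by blast
    qed
    \<comment> \<open>The precision that \<open>approx_root_exact\<close> attains covers the one
      required. This follows from e p^(n-2) < b; for n = 2 the second of the two estimates is an
      equality.\<close>
    have bound: "- int (b * p) + 1 \<le> int p * ?s + int p * h1 - h1"
    proof -
      have "e * N + 1 \<le> b * p ^ 2"
      proof -
        have "p ^ n = p ^ (n - 2) * p ^ 2" by (metis le_add_diff_inverse2 n_ge_2 power_add)
        then have "e * N = (e * p ^ (n - 2)) * p ^ 2" by (simp only: N_eq mult.assoc)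
        also have "\<dots> < b * p ^ 2" using e_bound p_gt_0 by simp
        finally show ?thesis by simp
      qed
      moreover have "b * p ^ 2 + b * p ^ (n - 1) \<le> b * p ^ n + b * p"
      proof (cases "n = 2")
        case False
        then have "p ^ 2 \<le> p ^ (n - 1)" using n_ge_2 p_gt_0 by (intro power_increasing) auto
        moreover have "2 * p ^ (n - 1) \<le> p * p ^ (n - 1)" using p_gt_1 by (intro mult_right_mono) auto
        moreover have "p * p ^ (n - 1) = p ^ n" using n_ge_2 by (simp flip: power_Suc)
        ultimately have "p ^ 2 + p ^ (n - 1) \<le> p ^ n + p" by linarith
        then have "b * (p ^ 2 + p ^ (n - 1)) \<le> b * (p ^ n + p)" by (rule mult_le_mono2)
        then show ?thesis by (simp add: algebra_simps)
      qed simp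
      ultimately have "e * N + 1 + b * p ^ (n - 1) \<le> b * N + b * p" by (simp add: N_eq)
      then have "int (e * N) + 1 + h1 \<le> int (b * N) + int (b * p)" unfolding h1_def by linarith
      then show ?thesis unfolding pse bN_h1 by simp
    qed
    have wz': "w \<zeta> = int p * ?s" unfolding pse using wz[OF epos] by blast
    have nz0: "\<zeta> \<noteq> 0" using wz[OF epos] by simp
    show ?thesis using approx_root_exact[OF zK nz0 wz' nd bound] gt by blast
  qed
  then obtain z d where z: "zder z d ?s" "vge (\<zeta> - z ^ p) (- int (b * p) + 1)"
    "z = 0 \<and> d = 0 \<and> e * p ^ (n - 1) < b \<or>
     b < e * p ^ (n - 1) \<and> z \<noteq> 0 \<and> w z = ?s \<and> d \<noteq> 0 \<and> w d = ?s + h1" by blast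
  let ?y = "\<Sum>i=1..n. a n i * x i"
  have n1: "Suc (n - 1) = n" using n_ge_2 by simp
  have "(?y - z) ^ (p ^ n) = ?y ^ (p ^ n) - z ^ (p ^ n)" by (rule frob_diff)
  also have "?y ^ (p ^ n) = moore (a n) n ^ (p ^ n) * \<beta>
      + ((\<Sum>i=1..n. a n i ^ (p ^ n) * x i) + (\<Sum>r<n. \<Sum>i=1..n. a n i ^ (p ^ n) * \<epsilon> i ^ (p ^ r)))"
    by (rule lin_comb_pow[OF nn]) (rule am[OF nn])
  also have "(\<Sum>r<n. \<Sum>i=1..n. a n i ^ (p ^ n) * \<epsilon> i ^ (p ^ r))
      = (\<Sum>r<n-1. \<Sum>i=1..n. a n i ^ (p ^ n) * \<epsilon> i ^ (p ^ r)) + \<zeta> ^ (p ^ (n - 1))"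
  proof -
    have pp: "p ^ n = p * p ^ (n - 1)" using n1 by (metis power_Suc)
    have "\<zeta> ^ (p ^ (n - 1)) = (\<Sum>i=1..n. a n i ^ (p ^ n) * \<epsilon> i ^ (p ^ (n - 1)))"
      unfolding \<zeta>_def frob_sum pp by (simp add: power_mult_distrib power_mult)
    then show ?thesis using sum.lessThan_Suc[of "\<lambda>r. \<Sum>i=1..n. a n i ^ (p ^ n) * \<epsilon> i ^ (p ^ r)" "n - 1"] n1
      by simp
  qed
  also have "z ^ (p ^ n) = (z ^ p) ^ (p ^ (n - 1))" using n1 by (metis power_Suc power_mult)
  finally have eq: "(?y - z) ^ (p ^ n) = moore (a n) n ^ (p ^ n) * \<beta>
      + ((\<Sum>i=1..n. a n i ^ (p ^ n) * x i) + (\<Sum>r<n-1. \<Sum>i=1..n. a n i ^ (p ^ n) * \<epsilon> i ^ (p ^ r))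
        + (\<zeta> - z ^ p) ^ (p ^ (n - 1)))"
    unfolding frob_diff by (simp add: algebra_simps)
  have mF: "moore (a n) n \<in> F"
    unfolding moore_def using aF[OF nn] \<omega>_F by (intro F.closed_sum F.closed_mult F.closed_power) auto
  have mnz: "moore (a n) n ^ (p ^ n) * \<beta> \<noteq> 0" using nz[OF nn] \<beta> by simp
  have wm: "w (moore (a n) n ^ (p ^ n) * \<beta>) = - int (b * N)"
    using nz[OF nn] mF \<beta> w_F by (simp add: w_mult w_power)
  have v2: "vge (\<Sum>r<n-1. \<Sum>i=1..n. a n i ^ (p ^ n) * \<epsilon> i ^ (p ^ r)) (- int (b * N) + 1)"
  proof (intro vge_sum)
    fix r i assume ri: "r \<in> {..<n-1}" "i \<in> {1..n}"
    have "vge (a n i ^ (p ^ n) * \<epsilon> i ^ (p ^ r)) (0 + (- int (b * N) + 1))"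
      using ri aF[OF nn] by (intro vge_mult vge_eps_pow vge_F) auto
    then show "vge (a n i ^ (p ^ n) * \<epsilon> i ^ (p ^ r)) (- int (b * N) + 1)" by simp
  qed
  have v3: "vge ((\<zeta> - z ^ p) ^ (p ^ (n - 1))) (- int (b * N) + 1)"
  proof (rule vge_mono[OF vge_power[OF z(2)]])
    have "int (p ^ (n - 1)) * (- int (b * p) + 1) = - int (b * N) + int (p ^ (n - 1))"
      by (simp add: N_eq2 algebra_simps)
    moreover have "int (p ^ (n - 1)) \<ge> 1" using p_gt_0 by simp
    ultimately show "- int (b * N) + 1 \<le> int (p ^ (n - 1)) * (- int (b * p) + 1)" by linarith
  qed
  have v1: "vge (\<Sum>i=1..n. a n i ^ (p ^ n) * x i) (- int (b * N) + 1)"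
    using aF[OF nn] by (intro vge_sum_x) auto
  have small: "vge ((\<Sum>i=1..n. a n i ^ (p ^ n) * x i) + (\<Sum>r<n-1. \<Sum>i=1..n. a n i ^ (p ^ n) * \<epsilon> i ^ (p ^ r))
        + (\<zeta> - z ^ p) ^ (p ^ (n - 1))) (w (moore (a n) n ^ (p ^ n) * \<beta>) + 1)"
    unfolding wm by (intro vge_add v1 v2 v3)
  have Y: "(?y - z) ^ (p ^ n) \<noteq> 0" "w ((?y - z) ^ (p ^ n)) = - int (b * N)"
    unfolding eq using w_add_eq[OF mnz small] wm by (simp_all only: not_False_eq_True)
  have y0: "?y - z \<noteq> 0"
  proof
    assume "?y - z = 0"
    then have "(?y - z) ^ (p ^ n) = 0" using p_gt_0 by (simp only: power_0_left) simp
    then show False using Y(1) by simp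
  qed
  have "int (p ^ n) * w (?y - z) = int (p ^ n) * (- int b)"
    using Y(2) y0 by (simp add: w_power N_eq)
  then have "w (?y - z) = - int b" by (simp only: mult_cancel_left) (use p_gt_0 in simp)
  then show ?thesis using aF a0 a1 wy y0 z(1,3) by blast
qed

end

section \<open>The group ring acting on the extension\<close>

text \<open>Fixes \<open>k\<close> and one choice of the data that \<open>exists_scaffold\<close>
  provides.\<close>

locale scaffold = as_ext w K F N \<pi> G p n b e \<beta> \<omega> \<epsilon> x
  for w :: "'a::field \<Rightarrow> int" and K F :: "'a set" and N :: nat and \<pi> :: 'a
    and G :: "('a \<Rightarrow> 'a) set" and p n b e :: nat and \<beta> :: 'a and \<omega> \<epsilon> x :: "nat \<Rightarrow> 'a" +
  fixes k :: nat and a :: "nat \<Rightarrow> nat \<Rightarrow> 'a" and z d :: 'a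
  assumes k_ge: "2 \<le> k" and k_le: "k \<le> p"
    and a_F: "j \<in> {1..n} \<Longrightarrow> a j i \<in> F"
    and a_upper: "j \<in> {1..n} \<Longrightarrow> i \<notin> {1..j} \<Longrightarrow> a j i = 0"
    and a_diag: "j \<in> {1..n} \<Longrightarrow> a j j = 1"
    and w_y: "j \<in> {1..n-1} \<Longrightarrow> (\<Sum>i=1..n. a j i * x i) \<noteq> 0 \<and>
      w (\<Sum>i=1..n. a j i * x i) = - int (b * p ^ (n - j))"
    and w_Yn: "(\<Sum>i=1..n. a n i * x i) - z \<noteq> 0 \<and> w ((\<Sum>i=1..n. a n i * x i) - z) = - int b"
    and zder: "zder z d (- int (e * p ^ (n - 1)))"
    and z_cases: "z = 0 \<and> d = 0 \<and> e * p ^ (n - 1) < b \<or>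
      b < e * p ^ (n - 1) \<and> z \<noteq> 0 \<and> w z = - int (e * p ^ (n - 1)) \<and> d \<noteq> 0 \<and>
       w d = - int (e * p ^ (n - 1)) + h1"
begin

definition GM :: "('a \<Rightarrow> 'a) monoid" where
  "GM = \<lparr>carrier = G, monoid.mult = (\<circ>), one = id\<rparr>"

lemma GM_simps [simp]: "carrier GM = G" "mult GM = (\<circ>)" "one GM = id"
  by (simp_all add: GM_def)

lemma comm_group_GM: "comm_group GM"
proof (rule group.group_comm_groupI)
  show "Group.group GM"
  proof (rule groupI)
    show "\<exists>\<tau>\<in>carrier GM. \<tau> \<otimes>\<^bsub>GM\<^esub> \<sigma> = \<one>\<^bsub>GM\<^esub>" if "\<sigma> \<in> carrier GM" for \<sigma>
      using G_inv that by auto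
  qed (auto simp: G_comp G_id comp_assoc)
qed (simp add: G_commute)

sublocale GA: trunc_group_algebra GM F p k
  by (intro trunc_group_algebra.intro group_algebra.intro group_algebra_axioms.intro
      trunc_group_algebra_axioms.intro comm_group_GM)
    (use G_finite k_ge k_le in \<open>auto intro: F.subfield_of_type_axioms prime_char_axioms\<close>)

definition act :: "(('a \<Rightarrow> 'a) \<Rightarrow> 'a) \<Rightarrow> 'a \<Rightarrow> 'a" where
  "act c y = (\<Sum>\<sigma>\<in>G. c \<sigma> * \<sigma> y)"

lemma act_add: "act c (y + y') = act c y + act c y'"
  by (simp add: act_def G_add distrib_left sum.distrib)

lemma act_0 [simp]: "act c 0 = 0"
  by (simp add: act_def)

lemma act_K: "s \<in> K \<Longrightarrow> act c (s * y) = s * act c y"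
  by (simp add: act_def G_mult G_K sum_distrib_left mult.left_commute)

lemma act_sum: "act c (\<Sum>i\<in>I. f i) = (\<Sum>i\<in>I. act c (f i))"
  by (induction I rule: infinite_finite_induct) (auto simp: act_add)

lemma act_coeff_add: "act (\<lambda>\<sigma>. c \<sigma> + c' \<sigma>) y = act c y + act c' y"
  by (simp add: act_def distrib_right sum.distrib)

lemma act_coeff_diff: "act (\<lambda>\<sigma>. c \<sigma> - c' \<sigma>) y = act c y - act c' y"
  by (simp add: act_def left_diff_distrib sum_subtractf)

lemma act_coeff_sum: "act (\<lambda>\<sigma>. \<Sum>i\<in>I. s i * c i \<sigma>) y = (\<Sum>i\<in>I. s i * act (c i) y)"
  unfolding act_def by (simp add: sum_distrib_right sum_distrib_left mult.assoc) (rule sum.swap)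

lemma act_of: "\<sigma> \<in> G \<Longrightarrow> act (group_ring_of \<sigma>) y = \<sigma> y"
proof -
  assume s: "\<sigma> \<in> G"
  have "act (group_ring_of \<sigma>) y = (\<Sum>\<tau>\<in>G. if \<tau> = \<sigma> then \<sigma> y else 0)"
    unfolding act_def group_ring_of_def by (intro sum.cong) auto
  then show ?thesis using s G_finite by simp
qed

lemma act_one [simp]: "act (\<one>\<^bsub>GA.R\<^esub>) y = y"
  using act_of[OF G_id] by (simp add: GA.R_one)

lemma inv_GM:
  assumes "\<sigma> \<in> G"
  shows "inv\<^bsub>GM\<^esub> \<sigma> \<in> G" "inv\<^bsub>GM\<^esub> \<sigma> \<circ> \<sigma> = id" "\<sigma> \<circ> inv\<^bsub>GM\<^esub> \<sigma> = id"
  using GA.G.inv_closed[of \<sigma>] GA.G.l_inv[of \<sigma>] GA.G.r_inv[of \<sigma>] assms by auto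

lemma R_coeff_K: "c \<in> carrier GA.R \<Longrightarrow> c \<sigma> \<in> K"
  using GA.R_in_F F_subset_K by blast

lemma act_mult:
  assumes "c \<in> carrier GA.R" "c' \<in> carrier GA.R"
  shows "act (c \<otimes>\<^bsub>GA.R\<^esub> c') y = act c (act c' y)"
proof -
  have "act (c \<otimes>\<^bsub>GA.R\<^esub> c') y = (\<Sum>\<sigma>\<in>G. \<Sum>\<tau>\<in>G. c \<tau> * c' (inv\<^bsub>GM\<^esub> \<tau> \<circ> \<sigma>) * \<sigma> y)"
    by (simp add: act_def GA.R_mult sum_distrib_right)
  also have "\<dots> = (\<Sum>\<tau>\<in>G. \<Sum>\<sigma>\<in>G. c \<tau> * c' (inv\<^bsub>GM\<^esub> \<tau> \<circ> \<sigma>) * \<sigma> y)" by (rule sum.swap)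
  also have "\<dots> = (\<Sum>\<tau>\<in>G. \<Sum>\<sigma>\<in>G. c \<tau> * (c' \<sigma> * \<tau> (\<sigma> y)))"
  proof (rule sum.cong)
    fix \<tau> assume t: "\<tau> \<in> G"
    show "(\<Sum>\<sigma>\<in>G. c \<tau> * c' (inv\<^bsub>GM\<^esub> \<tau> \<circ> \<sigma>) * \<sigma> y) = (\<Sum>\<sigma>\<in>G. c \<tau> * (c' \<sigma> * \<tau> (\<sigma> y)))"
    proof (rule sum.reindex_bij_witness[of _ "\<lambda>\<sigma>. \<tau> \<circ> \<sigma>" "\<lambda>\<sigma>. inv\<^bsub>GM\<^esub> \<tau> \<circ> \<sigma>"])
      fix \<sigma> assume s: "\<sigma> \<in> G"
      show i1: "\<tau> \<circ> (inv\<^bsub>GM\<^esub> \<tau> \<circ> \<sigma>) = \<sigma>" using inv_GM(3)[OF t] by (simp only: comp_assoc[symmetric] id_comp)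
      show "inv\<^bsub>GM\<^esub> \<tau> \<circ> \<sigma> \<in> G" by (intro G_comp inv_GM t s)
      show "inv\<^bsub>GM\<^esub> \<tau> \<circ> (\<tau> \<circ> \<sigma>) = \<sigma>" using inv_GM(2)[OF t] by (simp only: comp_assoc[symmetric] id_comp)
      show "\<tau> \<circ> \<sigma> \<in> G" by (intro G_comp t s)
      have "\<tau> ((inv\<^bsub>GM\<^esub> \<tau> \<circ> \<sigma>) y) = \<sigma> y" using fun_cong[OF i1, of y] by simp
      then show "c \<tau> * (c' (inv\<^bsub>GM\<^esub> \<tau> \<circ> \<sigma>) * \<tau> ((inv\<^bsub>GM\<^esub> \<tau> \<circ> \<sigma>) y)) = c \<tau> * c' (inv\<^bsub>GM\<^esub> \<tau> \<circ> \<sigma>) * \<sigma> y"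
        by (simp add: mult.assoc)
    qed
  qed simp
  also have "\<dots> = act c (act c' y)"
    unfolding act_def using assms
    by (intro sum.cong refl) (simp add: G_sum G_mult G_K[OF _ R_coeff_K] sum_distrib_left)
  finally show ?thesis .
qed

lemma act_pow:
  assumes "c \<in> carrier GA.R"
  shows "act (c [^]\<^bsub>GA.R\<^esub> (i::nat)) y = (act c ^^ i) y"
  using assms by (induction i arbitrary: y) (auto simp: act_mult funpow_swap1)

lemma act_tpow: "act (GA.tpow s u) y = (\<Sum>i<p. trunc_binomial s i * act (u [^]\<^bsub>GA.R\<^esub> i) y)"
  unfolding GA.tpow_def by (rule act_coeff_sum)

text \<open>Newton's formula: both sides are polynomials in \<open>s\<close> of degree below p, and
  at s = m in the prime field both equal the m-th iterate, since the binomial series of the m-th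
  power of \<gamma> ends before p.\<close>

lemma act_tpow_newton:
  assumes g: "\<gamma> \<in> carrier GA.R" and P: "degree P < p"
    and eq: "\<And>m. m < p \<Longrightarrow> (act \<gamma> ^^ m) y = poly P (of_nat m)"
  shows "act (GA.tpow s (\<gamma> \<ominus>\<^bsub>GA.R\<^esub> \<one>\<^bsub>GA.R\<^esub>)) y = poly P s"
proof -
  let ?u = "\<gamma> \<ominus>\<^bsub>GA.R\<^esub> \<one>\<^bsub>GA.R\<^esub>"
  have u: "?u \<in> carrier GA.R" using g by simp
  define Q where "Q = (\<Sum>i<p. smult (act (?u [^]\<^bsub>GA.R\<^esub> i) y) (tb_poly i))"
  have Q: "poly Q s = act (GA.tpow s ?u) y" for s
    by (simp add: Q_def poly_sum poly_tb_poly act_tpow mult.commute)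
  have "P = Q"
  proof (rule poly_eqI_degree[of "of_nat ` {..<p}"])
    have c: "card (of_nat ` {..<p} :: 'a set) = p" by (simp add: card_image[OF inj_of_nat])
    show "degree P < card (of_nat ` {..<p} :: 'a set)" using P c by simp
    have "degree Q \<le> p - 1" unfolding Q_def
    proof (rule degree_sum_le)
      fix i assume "i \<in> {..<p}"
      then show "degree (smult (act (?u [^]\<^bsub>GA.R\<^esub> i) y) (tb_poly i)) \<le> p - 1"
        using degree_tb_poly[of i] order_trans[OF degree_smult_le] by fastforce
    qed simp
    then show "degree Q < card (of_nat ` {..<p} :: 'a set)" using c p_gt_0 by simp
    fix t :: 'a assume "t \<in> of_nat ` {..<p}"
    then obtain m where m: "m < p" "t = of_nat m" by auto
    have "\<gamma> [^]\<^bsub>GA.R\<^esub> m = (\<lambda>g. \<Sum>i<p. of_nat (m choose i) * (?u [^]\<^bsub>GA.R\<^esub> i) g)"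
      using GA.one_plus_pow[OF u m(1)] g by (simp add: GA.one_plus_minus_one)
    then have "(act \<gamma> ^^ m) y = act (\<lambda>g. \<Sum>i<p. of_nat (m choose i) * (?u [^]\<^bsub>GA.R\<^esub> i) g) y"
      using act_pow[OF g, of m y] by simp
    also have "\<dots> = act (GA.tpow t ?u) y"
      unfolding act_tpow act_coeff_sum m(2) by (intro sum.cong) (auto simp: trunc_binomial_of_nat)
    finally show "poly P t = poly Q t" using eq[OF m(1)] m(2) by (simp add: Q)
  qed
  then show ?thesis using Q by simp
qed

section \<open>Operators shifting a single coordinate\<close>

definition y :: "nat \<Rightarrow> 'a" where "y j = (\<Sum>i=1..n. a j i * x i)"

text \<open>The intermediate field generated over \<open>K\<close> by the first \<open>j\<close> of
  the \<open>x i\<close>, described through its stabilizer in \<open>G\<close>.\<close>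

definition Kfix :: "nat \<Rightarrow> 'a set" where
  "Kfix j = {f. \<forall>\<sigma>\<in>G. (\<forall>i\<in>{1..j}. chi i \<sigma> = 0) \<longrightarrow> \<sigma> f = f}"

lemma Kfix_mono: "i \<le> j \<Longrightarrow> Kfix i \<subseteq> Kfix j"
  by (auto simp: Kfix_def)

lemma K_Kfix: "f \<in> K \<Longrightarrow> f \<in> Kfix j"
  by (auto simp: Kfix_def G_K)

lemma Kfix_add: "f \<in> Kfix j \<Longrightarrow> g \<in> Kfix j \<Longrightarrow> f + g \<in> Kfix j"
  and Kfix_mult: "f \<in> Kfix j \<Longrightarrow> g \<in> Kfix j \<Longrightarrow> f * g \<in> Kfix j"
  and Kfix_uminus: "f \<in> Kfix j \<Longrightarrow> - f \<in> Kfix j"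
  by (auto simp: Kfix_def G_add G_mult G_uminus)

lemma Kfix_1: "1 \<in> Kfix j" and Kfix_0: "0 \<in> Kfix j"
  by (auto intro: K_Kfix)

lemma Kfix_power: "f \<in> Kfix j \<Longrightarrow> f ^ m \<in> Kfix j"
  by (induction m) (auto intro: Kfix_mult Kfix_1)

lemma Kfix_sum: "(\<And>i. i \<in> I \<Longrightarrow> f i \<in> Kfix j) \<Longrightarrow> (\<Sum>i\<in>I. f i) \<in> Kfix j"
  by (induction I rule: infinite_finite_induct) (auto intro: Kfix_add Kfix_0)

lemma Kfix_prod: "(\<And>i. i \<in> I \<Longrightarrow> f i \<in> Kfix j) \<Longrightarrow> (\<Prod>i\<in>I. f i) \<in> Kfix j"
  by (induction I rule: infinite_finite_induct) (auto intro: Kfix_mult Kfix_1)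

lemma Kfix_poly: "(\<And>i. coeff P i \<in> Kfix j) \<Longrightarrow> f \<in> Kfix j \<Longrightarrow> poly P f \<in> Kfix j"
  unfolding poly_altdef by (intro Kfix_sum Kfix_mult Kfix_power) auto

lemma a_K: "j \<in> {1..n} \<Longrightarrow> a j i \<in> K"
  using a_F F_subset_K by blast

lemma G_y: "\<sigma> \<in> G \<Longrightarrow> j \<in> {1..n} \<Longrightarrow> \<sigma> (y j) = y j + (\<Sum>i=1..n. a j i * chi i \<sigma>)"
  by (simp add: y_def G_sum G_mult G_K[OF _ a_K] chi_def algebra_simps sum_subtractf flip: sum.distrib)

lemma y_Kfix: "j \<in> {1..n} \<Longrightarrow> y j \<in> Kfix j"
  unfolding Kfix_def
proof (intro CollectI ballI impI)
  fix \<sigma> assume s: "j \<in> {1..n}" "\<sigma> \<in> G" "\<forall>i\<in>{1..j}. chi i \<sigma> = 0"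
  have "a j i * chi i \<sigma> = 0" for i
    using s a_upper[OF s(1), of i] by (cases "i \<in> {1..j}") auto
  then have "(\<Sum>i=1..n. a j i * chi i \<sigma>) = 0" by (intro sum.neutral) blast
  then show "\<sigma> (y j) = y j" unfolding G_y[OF s(2,1)] by simp
qed

lemma ex_sg: "\<exists>\<sigma>\<in>G. \<forall>i\<in>{1..n}. chi i \<sigma> = (if i = j then 1 else 0)"
proof -
  obtain \<sigma> where "\<sigma> \<in> G" "\<And>i. i \<in> {1..n} \<Longrightarrow> chi i \<sigma> = (if i = j then 1 else 0)"
    by (rule ex_chi[of "\<lambda>i. if i = j then 1 else 0"]) (auto simp: Fp_0 Fp_1)
  then show ?thesis by blast
qed

definition sg :: "nat \<Rightarrow> 'a \<Rightarrow> 'a" where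
  "sg j = (SOME \<sigma>. \<sigma> \<in> G \<and> (\<forall>i\<in>{1..n}. chi i \<sigma> = (if i = j then 1 else 0)))"

lemma sg_G [simp]: "sg j \<in> G" and chi_sg: "i \<in> {1..n} \<Longrightarrow> chi i (sg j) = (if i = j then 1 else 0)"
proof -
  have "\<exists>\<sigma>. \<sigma> \<in> G \<and> (\<forall>i\<in>{1..n}. chi i \<sigma> = (if i = j then 1 else 0))" using ex_sg by blast
  from someI_ex[OF this] show "sg j \<in> G" "i \<in> {1..n} \<Longrightarrow> chi i (sg j) = (if i = j then 1 else 0)"
    unfolding sg_def[symmetric] by blast+
qed

lemma sg_y:
  assumes "l \<in> {1..n}" "j \<in> {1..n}" shows "sg j (y l) = y l + a l j"
proof -
  have "(\<Sum>i=1..n. a l i * chi i (sg j)) = (\<Sum>i=1..n. if i = j then a l j else 0)"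
    by (intro sum.cong) (auto simp: chi_sg)
  then show ?thesis using assms by (simp add: G_y)
qed

lemma sg_Kfix: "f \<in> Kfix i \<Longrightarrow> i < j \<Longrightarrow> j \<le> n \<Longrightarrow> sg j f = f"
  unfolding Kfix_def using chi_sg[of _ j] by auto

lemma G_poly: "\<sigma> \<in> G \<Longrightarrow> \<sigma> (poly P f) = poly (map_poly \<sigma> P) (\<sigma> f)"
  by (simp add: poly_altdef G_sum G_mult G_power coeff_map_poly degree_map_poly)

text \<open>On polynomials of degree below p in the later \<open>y l\<close>, with coefficients in
  \<open>Kfix j\<close>, such an operator acts like an automorphism that extends \<open>sg j\<close>
  and fixes these \<open>y l\<close>. In general no element of \<open>G\<close> does so, since the
  displacements \<open>a l j\<close> need not lie in the prime field.\<close>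

definition shift :: "nat \<Rightarrow> (('a \<Rightarrow> 'a) \<Rightarrow> 'a) \<Rightarrow> bool" where
  "shift j \<gamma> \<longleftrightarrow> (\<forall>f P. f \<in> Kfix j \<and> (\<forall>l\<in>{j+1..n}. degree (P l) < p \<and> (\<forall>i. coeff (P l) i \<in> Kfix j)) \<longrightarrow>
    act \<gamma> (f * (\<Prod>l=j+1..n. poly (P l) (y l))) =
      sg j f * (\<Prod>l=j+1..n. poly (map_poly (sg j) (P l)) (y l)))"

lemma shiftD:
  assumes "shift j \<gamma>" "f \<in> Kfix j" "\<And>l. l \<in> {j+1..n} \<Longrightarrow> degree (P l) < p"
    "\<And>l i. l \<in> {j+1..n} \<Longrightarrow> coeff (P l) i \<in> Kfix j"
  shows "act \<gamma> (f * (\<Prod>l=j+1..n. poly (P l) (y l))) =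
      sg j f * (\<Prod>l=j+1..n. poly (map_poly (sg j) (P l)) (y l))"
  using assms unfolding shift_def by blast

lemma map_poly_sg:
  assumes "\<And>i. coeff P i \<in> Kfix l" "l < j" "j \<le> n"
  shows "map_poly (sg j) P = P"
  using sg_Kfix[OF assms] by (intro poly_eqI) (simp add: coeff_map_poly)

text \<open>The m-th iterate of \<gamma> substitutes y j + m for y j. The result is polynomial in
  \<open>m\<close> of degree below p, so \<open>act_tpow_newton\<close> may replace \<open>m\<close>
  by \<open>s\<close>.\<close>

lemma shift_tpow:
  assumes sh: "shift j \<gamma>" and g: "\<gamma> \<in> carrier GA.R" and j: "j \<in> {1..n}"
    and f: "f \<in> Kfix (j - 1)" and dP: "\<And>l. l \<in> {j..n} \<Longrightarrow> degree (P l) < p"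
    and cP: "\<And>l i. l \<in> {j..n} \<Longrightarrow> coeff (P l) i \<in> Kfix (j - 1)"
  shows "act (GA.tpow s (\<gamma> \<ominus>\<^bsub>GA.R\<^esub> \<one>\<^bsub>GA.R\<^esub>)) (f * poly (P j) (y j) * (\<Prod>l=j+1..n. poly (P l) (y l)))
    = f * poly (P j) (y j + s) * (\<Prod>l=j+1..n. poly (P l) (y l))"
proof -
  let ?h = "\<Prod>l=j+1..n. poly (P l) (y l)"
  have jlt: "j - 1 < j" "j \<le> n" "j \<in> {j..n}" using j by auto
  have sub: "Kfix (j - 1) \<subseteq> Kfix j" by (rule Kfix_mono) simp
  have fj: "sg j f = f" by (rule sg_Kfix[OF f]) (use jlt in auto)
  have mP: "map_poly (sg j) (P l) = P l" if "l \<in> {j..n}" for l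
    by (rule map_poly_sg[OF cP[OF that] jlt(1,2)])
  have it: "(act \<gamma> ^^ m) (f * poly (P j) (y j) * ?h) = f * poly (P j) (y j + of_nat m) * ?h" for m
  proof (induction m)
    case (Suc m)
    have ym: "y j + of_nat m \<in> Kfix j" by (intro Kfix_add y_Kfix j K_Kfix) simp
    have F0: "f * poly (P j) (y j + of_nat m) \<in> Kfix j"
      using f sub ym cP[OF jlt(3)] by (intro Kfix_mult Kfix_poly) auto
    have "act \<gamma> (f * poly (P j) (y j + of_nat m) * ?h)
        = sg j (f * poly (P j) (y j + of_nat m)) * (\<Prod>l=j+1..n. poly (map_poly (sg j) (P l)) (y l))"
      using dP cP sub by (intro shiftD[OF sh F0]) auto
    also have "(\<Prod>l=j+1..n. poly (map_poly (sg j) (P l)) (y l)) = ?h"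
      by (intro prod.cong) (auto simp: mP)
    also have "sg j (f * poly (P j) (y j + of_nat m)) = f * poly (P j) (y j + of_nat (Suc m))"
      using j by (simp add: G_mult fj G_poly mP G_add sg_y a_diag G_K algebra_simps)
    finally show ?case using Suc by simp
  qed simp
  have "act (GA.tpow s (\<gamma> \<ominus>\<^bsub>GA.R\<^esub> \<one>\<^bsub>GA.R\<^esub>)) (f * poly (P j) (y j) * ?h)
     = poly (smult (f * ?h) (pcompose (P j) [:y j, 1:])) s"
  proof (rule act_tpow_newton[OF g])
    have "degree (pcompose (P j) [:y j, 1:]) \<le> degree (P j)"
      using degree_pcompose_le[of "P j" "[:y j, 1:]"] by simp
    then have "degree (smult (f * ?h) (pcompose (P j) [:y j, 1:])) \<le> degree (P j)"
      using degree_smult_le order_trans by blast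
    then show "degree (smult (f * ?h) (pcompose (P j) [:y j, 1:])) < p" using dP[OF jlt(3)] by simp
    show "(act \<gamma> ^^ m) (f * poly (P j) (y j) * ?h) = poly (smult (f * ?h) (pcompose (P j) [:y j, 1:])) (of_nat m)" for m
      unfolding it by (simp add: poly_pcompose mult_ac)
  qed
  then show ?thesis by (simp add: poly_pcompose mult_ac)
qed

lemma sg_shift_factor:
  assumes l: "l \<in> {1..n}" and j: "j \<in> {1..n}"
  shows "sg j (poly P (y l)) = poly (map_poly (sg j) P) (y l + a l j)"
  using sg_y[OF l j] by (simp add: G_poly)

lemma Kfix_pcompose:
  assumes "\<And>i. coeff Q i \<in> Kfix j" and H: "\<And>i. coeff H i \<in> Kfix j"
  shows "coeff (pcompose Q H) i \<in> Kfix j"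
  using assms(1)
proof (induction Q arbitrary: i)
  case (pCons c Q)
  have "coeff Q i \<in> Kfix j" for i using pCons.prems[of "Suc i"] by simp
  then have Q: "coeff (pcompose Q H) i \<in> Kfix j" for i by (rule pCons.IH)
  have c: "coeff [:c:] i \<in> Kfix j" using pCons.prems[of 0] Kfix_0 by (cases i) auto
  show ?case unfolding pcompose_pCons coeff_add coeff_mult
    by (intro Kfix_add Kfix_sum Kfix_mult Q H c)
qed (simp add: Kfix_0)

text \<open>\<open>sg j\<close> displaces each later \<open>y l\<close> by \<open>a l j\<close>. The
  truncated power of \<open>\<gamma> l\<close> with exponent \<open>- a l j\<close> cancels this
  displacement; \<open>r\<close> is the last index for which that has been done.\<close>

lemma ex_shift_from:
  assumes j: "j \<in> {1..n}" and \<gamma>: "\<And>i. i \<in> {j+1..n} \<Longrightarrow> \<gamma> i \<in> carrier GA.R"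
    "\<And>i. i \<in> {j+1..n} \<Longrightarrow> \<gamma> i \<ominus>\<^bsub>GA.R\<^esub> \<one>\<^bsub>GA.R\<^esub> \<in> GA.A"
    "\<And>i. i \<in> {j+1..n} \<Longrightarrow> trunc_class F GM k (\<gamma> i) \<in> group_span p F GM k"
    "\<And>i. i \<in> {j+1..n} \<Longrightarrow> shift i (\<gamma> i)"
  shows "r \<in> {j..n} \<Longrightarrow> \<exists>\<delta>\<in>carrier GA.R. \<delta> \<ominus>\<^bsub>GA.R\<^esub> \<one>\<^bsub>GA.R\<^esub> \<in> GA.A \<and>
    trunc_class F GM k \<delta> \<in> group_span p F GM k \<and>
    (\<forall>f P. f \<in> Kfix j \<and> (\<forall>l\<in>{j+1..n}. degree (P l) < p \<and> (\<forall>i. coeff (P l) i \<in> Kfix j)) \<longrightarrow>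
    act \<delta> (f * (\<Prod>l=j+1..n. poly (P l) (y l))) =
      sg j f * (\<Prod>l=j+1..n. poly (map_poly (sg j) (P l)) (y l + (if l \<le> r then 0 else a l j))))"
proof (induction "r - j" arbitrary: r)
  case 0
  then have r: "r = j" by simp
  show ?case
  proof (intro bexI[of _ "group_ring_of (sg j)"] conjI allI impI)
    show "group_ring_of (sg j) \<ominus>\<^bsub>GA.R\<^esub> \<one>\<^bsub>GA.R\<^esub> \<in> GA.A" by (rule GA.group_ring_of_minus_one) simp
    show "trunc_class F GM k (group_ring_of (sg j)) \<in> group_span p F GM k" by (rule group_span.image) simp
    fix f P assume "f \<in> Kfix j \<and> (\<forall>l\<in>{j + 1..n}. degree (P l) < p \<and> (\<forall>i. coeff (P l) i \<in> Kfix j))"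
    show "act (group_ring_of (sg j)) (f * (\<Prod>l=j+1..n. poly (P l) (y l))) =
      sg j f * (\<Prod>l=j+1..n. poly (map_poly (sg j) (P l)) (y l + (if l \<le> r then 0 else a l j)))"
    proof -
      have "(\<Prod>l=j+1..n. sg j (poly (P l) (y l)))
        = (\<Prod>l=j+1..n. poly (map_poly (sg j) (P l)) (y l + (if l \<le> r then 0 else a l j)))"
      proof (rule prod.cong)
        fix l assume l: "l \<in> {j+1..n}"
        then have "l \<in> {1..n}" "\<not> l \<le> r" using r by auto
        then show "sg j (poly (P l) (y l)) = poly (map_poly (sg j) (P l)) (y l + (if l \<le> r then 0 else a l j))"
          using sg_shift_factor[OF _ j] by simp
      qed simp
      then show ?thesis by (simp only: act_of[OF sg_G] G_mult[OF sg_G] G_prod[OF sg_G])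
    qed
  qed simp
next
  case (Suc m)
  define q where "q = r - 1"
  have q: "q \<in> {j..n}" "m = q - j" "r = Suc q" "r \<in> {j+1..n}" "r \<in> {1..n}" "q < r" "r \<le> n"
    using Suc(2,3) by (auto simp: q_def)
  obtain \<delta> where \<delta>: "\<delta> \<in> carrier GA.R" "\<delta> \<ominus>\<^bsub>GA.R\<^esub> \<one>\<^bsub>GA.R\<^esub> \<in> GA.A"
    "trunc_class F GM k \<delta> \<in> group_span p F GM k"
    "\<forall>f P. f \<in> Kfix j \<and> (\<forall>l\<in>{j+1..n}. degree (P l) < p \<and> (\<forall>i. coeff (P l) i \<in> Kfix j)) \<longrightarrow>
    act \<delta> (f * (\<Prod>l=j+1..n. poly (P l) (y l))) =
      sg j f * (\<Prod>l=j+1..n. poly (map_poly (sg j) (P l)) (y l + (if l \<le> q then 0 else a l j)))"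
    using Suc(1)[OF q(2,1)] by (elim bexE conjE) (rule that)
  let ?s = "- a r j"
  let ?T = "GA.tpow ?s (\<gamma> r \<ominus>\<^bsub>GA.R\<^esub> \<one>\<^bsub>GA.R\<^esub>)"
  have sF: "?s \<in> F" using a_F[OF q(5)] by auto
  have T: "?T \<in> carrier GA.R" "?T \<ominus>\<^bsub>GA.R\<^esub> \<one>\<^bsub>GA.R\<^esub> \<in> GA.A"
    using sF \<gamma>(2)[OF q(4)] by (auto intro: GA.tpow_closed GA.tpow_minus_one)
  have Tspan: "trunc_class F GM k ?T \<in> group_span p F GM k"
    using group_span.scal[OF \<gamma>(1,2,3)[OF q(4)] sF] by (simp add: GA.trunc_power_eq)
  show ?case
  proof (intro bexI[of _ "\<delta> \<otimes>\<^bsub>GA.R\<^esub> ?T"] conjI allI impI)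
    show "\<delta> \<otimes>\<^bsub>GA.R\<^esub> ?T \<in> carrier GA.R" using \<delta> T by simp
    show "\<delta> \<otimes>\<^bsub>GA.R\<^esub> ?T \<ominus>\<^bsub>GA.R\<^esub> \<one>\<^bsub>GA.R\<^esub> \<in> GA.A" by (intro GA.mult_minus_one_A \<delta> T)
    show "trunc_class F GM k (\<delta> \<otimes>\<^bsub>GA.R\<^esub> ?T) \<in> group_span p F GM k"
      using group_span.prod[OF \<delta>(3) Tspan] GA.trunc_class_mult[OF \<delta>(1) T(1)] by simp
    fix f P assume "f \<in> Kfix j \<and> (\<forall>l\<in>{j + 1..n}. degree (P l) < p \<and> (\<forall>i. coeff (P l) i \<in> Kfix j))"
    then have f: "f \<in> Kfix j" and dP: "\<And>l. l\<in>{j+1..n} \<Longrightarrow> degree (P l) < p"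
      and cP: "\<And>l i. l\<in>{j+1..n} \<Longrightarrow> coeff (P l) i \<in> Kfix j" by auto
    \<comment> \<open>The new factor acts by a substitution in the polynomial in \<open>y r\<close>.
      This preserves the degree bound and the field of coefficients, so the property of \<delta>
      applies to \<open>P'\<close>.\<close>
    define P' where "P' l = (if l = r then pcompose (P r) [:?s, 1:] else P l)" for l
    have jq: "Kfix j \<subseteq> Kfix q" using q by (intro Kfix_mono) auto
    have split: "(\<Prod>l=j+1..n. h l) = (\<Prod>l=j+1..q. h l) * h r * (\<Prod>l=r+1..n. h l)" for h :: "nat \<Rightarrow> 'a"
    proof -
      have "{j+1..n} = {j+1..q} \<union> {r..n}" using q by auto
      moreover have "{r..n} = insert r {r+1..n}" using q by auto
      moreover have "(\<Prod>l\<in>{j+1..q} \<union> {r..n}. h l) = (\<Prod>l=j+1..q. h l) * (\<Prod>l\<in>{r..n}. h l)"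
        using q by (intro prod.union_disjoint) auto
      ultimately show ?thesis by (simp add: mult.assoc)
    qed
    have "act ?T (f * (\<Prod>l=j+1..n. poly (P l) (y l)))
        = act ?T ((f * (\<Prod>l=j+1..q. poly (P l) (y l))) * poly (P r) (y r) * (\<Prod>l=r+1..n. poly (P l) (y l)))"
      unfolding split by (simp only: mult.assoc)
    also have "\<dots> = (f * (\<Prod>l=j+1..q. poly (P l) (y l))) * poly (P r) (y r + ?s) * (\<Prod>l=r+1..n. poly (P l) (y l))"
    proof (rule shift_tpow[OF \<gamma>(4)[OF q(4)] \<gamma>(1)[OF q(4)] q(5)])
      have rq: "r - 1 = q" using q by simp
      show "f * (\<Prod>l=j+1..q. poly (P l) (y l)) \<in> Kfix (r - 1)" unfolding rq
      proof (intro Kfix_mult Kfix_prod Kfix_poly)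
        show "f \<in> Kfix q" using f jq by blast
        fix l assume l: "l \<in> {j+1..q}"
        show "coeff (P l) i \<in> Kfix q" for i using cP[of l i] l q jq by auto
        show "y l \<in> Kfix q" using y_Kfix[of l] Kfix_mono[of l q] l q by auto
      qed
      show "degree (P l) < p" if "l \<in> {r..n}" for l using dP that q by auto
      show "coeff (P l) i \<in> Kfix (r - 1)" if "l \<in> {r..n}" for l i using cP[of l i] that q jq rq by auto
    qed
    also have "\<dots> = f * (\<Prod>l=j+1..n. poly (P' l) (y l))"
    proof -
      have "(\<Prod>l=j+1..q. poly (P' l) (y l)) = (\<Prod>l=j+1..q. poly (P l) (y l))"
        "(\<Prod>l=r+1..n. poly (P' l) (y l)) = (\<Prod>l=r+1..n. poly (P l) (y l))"
        using q(3) by (auto simp: P'_def intro!: prod.cong)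
      moreover have "poly (P' r) (y r) = poly (P r) (y r + ?s)" by (simp add: P'_def poly_pcompose add.commute)
      ultimately show ?thesis unfolding split by (simp only: mult.assoc)
    qed
    finally have "act (\<delta> \<otimes>\<^bsub>GA.R\<^esub> ?T) (f * (\<Prod>l=j+1..n. poly (P l) (y l)))
        = act \<delta> (f * (\<Prod>l=j+1..n. poly (P' l) (y l)))"
      using \<delta>(1) T(1) by (simp add: act_mult)
    also have "\<dots> = sg j f * (\<Prod>l=j+1..n. poly (map_poly (sg j) (P' l)) (y l + (if l \<le> q then 0 else a l j)))"
    proof (rule \<delta>(4)[rule_format], intro conjI ballI allI)
      show "f \<in> Kfix j" by (rule f)
      fix l assume l: "l \<in> {j+1..n}"
      have "degree (pcompose (P r) [:?s, 1:]) \<le> degree (P r)"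
        using degree_pcompose_le[of "P r" "[:?s, 1:]"] by simp
      then show "degree (P' l) < p" using dP[of r] dP[OF l] q by (auto simp: P'_def)
      have "coeff [:?s, 1:] i \<in> Kfix j" for i
        using Kfix_uminus[OF K_Kfix[OF a_K[OF q(5), of j]], of j] Kfix_0 Kfix_1
        by (cases i) (auto simp: coeff_pCons split: nat.split)
      then have "coeff (pcompose (P r) [:?s, 1:]) i \<in> Kfix j" for i
        by (intro Kfix_pcompose cP q)
      then show "coeff (P' l) i \<in> Kfix j" for i using cP[OF l] by (auto simp: P'_def)
    qed
    also have "(\<Prod>l=j+1..n. poly (map_poly (sg j) (P' l)) (y l + (if l \<le> q then 0 else a l j)))
      = (\<Prod>l=j+1..n. poly (map_poly (sg j) (P l)) (y l + (if l \<le> r then 0 else a l j)))"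
    proof (rule prod.cong)
      fix l assume l: "l \<in> {j+1..n}"
      show "poly (map_poly (sg j) (P' l)) (y l + (if l \<le> q then 0 else a l j))
        = poly (map_poly (sg j) (P l)) (y l + (if l \<le> r then 0 else a l j))"
      proof (cases "l = r")
        case True
        have "poly (map_poly (sg j) (P' r)) (y r + a r j) = sg j (poly (P' r) (y r))"
          using sg_shift_factor[OF q(5) j] by simp
        also have "\<dots> = sg j (poly (P r) (y r - a r j))" by (simp add: P'_def poly_pcompose)
        also have "\<dots> = poly (map_poly (sg j) (P r)) (y r)"
          using sg_y[OF q(5) j] a_K[OF q(5)] by (simp add: G_poly G_diff G_K)
        finally show ?thesis using True q by simp
      qed (use q in \<open>auto simp: P'_def\<close>)
    qed simp
    finally show "act (\<delta> \<otimes>\<^bsub>GA.R\<^esub> ?T) (f * (\<Prod>l=j+1..n. poly (P l) (y l))) =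
      sg j f * (\<Prod>l=j+1..n. poly (map_poly (sg j) (P l)) (y l + (if l \<le> r then 0 else a l j)))" .
  qed
qed

text \<open>Downward induction on \<open>j\<close>, because the construction for \<open>j\<close>
  uses the operators of larger index.\<close>

lemma ex_shift:
  "j \<in> {1..n} \<Longrightarrow> \<exists>\<gamma>. \<gamma> \<in> carrier GA.R \<and> \<gamma> \<ominus>\<^bsub>GA.R\<^esub> \<one>\<^bsub>GA.R\<^esub> \<in> GA.A \<and>
    trunc_class F GM k \<gamma> \<in> group_span p F GM k \<and> shift j \<gamma>"
proof (induction "n - j" arbitrary: j rule: less_induct)
  case less
  have "\<forall>i\<in>{j+1..n}. \<exists>\<gamma>. \<gamma> \<in> carrier GA.R \<and> \<gamma> \<ominus>\<^bsub>GA.R\<^esub> \<one>\<^bsub>GA.R\<^esub> \<in> GA.A \<and>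
    trunc_class F GM k \<gamma> \<in> group_span p F GM k \<and> shift i \<gamma>"
  proof
    fix i assume "i \<in> {j+1..n}"
    then have "n - i < n - j" "i \<in> {1..n}" by auto
    then show "\<exists>\<gamma>. \<gamma> \<in> carrier GA.R \<and> \<gamma> \<ominus>\<^bsub>GA.R\<^esub> \<one>\<^bsub>GA.R\<^esub> \<in> GA.A \<and>
      trunc_class F GM k \<gamma> \<in> group_span p F GM k \<and> shift i \<gamma>" by (rule less.hyps)
  qed
  from bchoice[OF this] obtain \<gamma> where g: "\<forall>i\<in>{j+1..n}. \<gamma> i \<in> carrier GA.R \<and> \<gamma> i \<ominus>\<^bsub>GA.R\<^esub> \<one>\<^bsub>GA.R\<^esub> \<in> GA.A \<and>
    trunc_class F GM k (\<gamma> i) \<in> group_span p F GM k \<and> shift i (\<gamma> i)"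
    by (rule exE)
  have g1: "\<gamma> i \<in> carrier GA.R" and g2: "\<gamma> i \<ominus>\<^bsub>GA.R\<^esub> \<one>\<^bsub>GA.R\<^esub> \<in> GA.A"
    and g3: "trunc_class F GM k (\<gamma> i) \<in> group_span p F GM k" and g4: "shift i (\<gamma> i)"
    if "i \<in> {j+1..n}" for i
    using bspec[OF g that] by blast+
  have nj: "n \<in> {j..n}" using less.prems by simp
  have "\<exists>\<delta>\<in>carrier GA.R. \<delta> \<ominus>\<^bsub>GA.R\<^esub> \<one>\<^bsub>GA.R\<^esub> \<in> GA.A \<and>
    trunc_class F GM k \<delta> \<in> group_span p F GM k \<and>
    (\<forall>f P. f \<in> Kfix j \<and> (\<forall>l\<in>{j+1..n}. degree (P l) < p \<and> (\<forall>i. coeff (P l) i \<in> Kfix j)) \<longrightarrow>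
    act \<delta> (f * (\<Prod>l=j+1..n. poly (P l) (y l))) =
      sg j f * (\<Prod>l=j+1..n. poly (map_poly (sg j) (P l)) (y l + (if l \<le> n then 0 else a l j))))"
    by (rule ex_shift_from[OF less.prems g1 g2 g3 g4 nj])
  then obtain \<delta> where \<delta>: "\<delta> \<in> carrier GA.R" "\<delta> \<ominus>\<^bsub>GA.R\<^esub> \<one>\<^bsub>GA.R\<^esub> \<in> GA.A"
    "trunc_class F GM k \<delta> \<in> group_span p F GM k"
    "\<forall>f P. f \<in> Kfix j \<and> (\<forall>l\<in>{j+1..n}. degree (P l) < p \<and> (\<forall>i. coeff (P l) i \<in> Kfix j)) \<longrightarrow>
    act \<delta> (f * (\<Prod>l=j+1..n. poly (P l) (y l))) =
      sg j f * (\<Prod>l=j+1..n. poly (map_poly (sg j) (P l)) (y l + (if l \<le> n then 0 else a l j)))"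
    by (elim bexE conjE) (rule that)
  have "(\<Prod>l=j+1..n. poly (map_poly (sg j) (P l)) (y l + (if l \<le> n then 0 else a l j)))
    = (\<Prod>l=j+1..n. poly (map_poly (sg j) (P l)) (y l))" for P
    by (rule prod.cong) auto
  then have "shift j \<delta>" unfolding shift_def using \<delta>(4) by (simp only:)
  then show ?case using \<delta> by blast
qed

definition \<gamma> :: "nat \<Rightarrow> ('a \<Rightarrow> 'a) \<Rightarrow> 'a" where
  "\<gamma> j = (SOME \<gamma>. \<gamma> \<in> carrier GA.R \<and> \<gamma> \<ominus>\<^bsub>GA.R\<^esub> \<one>\<^bsub>GA.R\<^esub> \<in> GA.A \<and>
    trunc_class F GM k \<gamma> \<in> group_span p F GM k \<and> shift j \<gamma>)"

lemma \<gamma>: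
  assumes "j \<in> {1..n}"
  shows \<gamma>_closed: "\<gamma> j \<in> carrier GA.R" and \<gamma>_minus_one: "\<gamma> j \<ominus>\<^bsub>GA.R\<^esub> \<one>\<^bsub>GA.R\<^esub> \<in> GA.A"
    and \<gamma>_span: "trunc_class F GM k (\<gamma> j) \<in> group_span p F GM k" and \<gamma>_shift: "shift j (\<gamma> j)"
  using someI_ex[OF ex_shift[OF assms]] unfolding \<gamma>_def[symmetric] by blast+

end

section \<open>Differences of products, base-p digits, power sums over the prime field\<close>

context valued
begin

lemma vge_prod_diff:
  assumes "finite I" "h \<ge> 0" "\<And>i. i \<in> I \<Longrightarrow> vge (f i) (m i)" "\<And>i. i \<in> I \<Longrightarrow> vge (g i - f i) (m i + h)"
  shows "vge ((\<Prod>i\<in>I. g i) - (\<Prod>i\<in>I. f i)) ((\<Sum>i\<in>I. m i) + h)"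
  using assms(1,3,4)
proof (induction I rule: finite_induct)
  case (insert i I)
  have IH: "vge ((\<Prod>i\<in>I. g i) - (\<Prod>i\<in>I. f i)) ((\<Sum>i\<in>I. m i) + h)" using insert by auto
  have g: "vge (g i) (m i)"
  proof -
    have "vge (f i + (g i - f i)) (m i)"
      using insert.prems[of i] assms(2) by (intro vge_add) (auto elim: vge_mono)
    then show ?thesis by simp
  qed
  have "vge (g i * ((\<Prod>i\<in>I. g i) - (\<Prod>i\<in>I. f i))) (m i + ((\<Sum>i\<in>I. m i) + h))"
    by (intro vge_mult g IH)
  moreover have "vge ((g i - f i) * (\<Prod>i\<in>I. f i)) ((m i + h) + (\<Sum>i\<in>I. m i))"
    using insert by (intro vge_mult vge_prod) auto
  ultimately have "vge (g i * ((\<Prod>i\<in>I. g i) - (\<Prod>i\<in>I. f i)) + (g i - f i) * (\<Prod>i\<in>I. f i))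
      (m i + (\<Sum>i\<in>I. m i) + h)"
    by (intro vge_add) (simp_all add: algebra_simps)
  then show ?case using insert.hyps by (simp add: algebra_simps)
qed simp

end

lemma digit_sum: "(\<Sum>i<n. (D div p ^ i mod p) * p ^ i) = D mod (p ^ n :: nat)"
proof (induction n)
  case (Suc n)
  then show ?case using mod_mult2_eq[of D "p ^ n" p] by (simp add: mult.commute)
qed simp

context prime_char
begin

text \<open>Scaling by a nonzero \<open>g\<close> permutes the prime field and multiplies the sum by
  g^i; for 0 < i < p - 1 some \<open>g\<close> has g^i different from 1. For i = 0 the sum is p,
  which is 0.\<close>

lemma sum_Fp_power:
  assumes "i < p"
  shows "(\<Sum>c\<in>Fp. c ^ i) = (if i = p - 1 then - 1 else 0)"
proof -
  have fin: "finite Fp" by (simp add: Fp_def)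
  consider "i = 0" | "0 < i" "i < p - 1" | "i = p - 1" "i > 0" using assms by linarith
  then show ?thesis
  proof cases
    case 1
    then show ?thesis using card_Fp p_gt_1 of_nat_eq_0_iff[of p] by simp
  next
    case 2
    define Q where "Q = monom 1 i - [:1 :: 'a:]"
    have dQ: "degree Q = i"
      unfolding Q_def diff_conv_add_uminus using 2
      by (subst degree_add_eq_left) (simp_all add: degree_monom_eq)
    have Q0: "Q \<noteq> 0" using dQ 2 by auto
    have "\<exists>g\<in>Fp - {0}. poly Q g \<noteq> 0"
    proof (rule ccontr)
      assume "\<not> ?thesis"
      then have "Fp - {0} \<subseteq> {c. poly Q c = 0}" by auto
      then have "card (Fp - {0}) \<le> card {c. poly Q c = 0}"
        by (intro card_mono poly_roots_finite Q0)
      also have "\<dots> \<le> i" using card_poly_roots_bound[OF Q0] dQ by simp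
      finally show False using 2 Fp_0 by (simp add: card_Fp card_Diff_singleton)
    qed
    then obtain g where g: "g \<in> Fp" "g \<noteq> 0" "g ^ i \<noteq> 1" by (auto simp: Q_def poly_monom)
    have mult: "c * c' \<in> Fp" if "c \<in> Fp" "c' \<in> Fp" for c c'
      using that by (simp add: power_mult_distrib flip: frob_fixed_iff)
    have inv: "inverse g \<in> Fp" using g by (simp add: power_inverse flip: frob_fixed_iff)
    have "(\<Sum>c\<in>Fp. (g * c) ^ i) = (\<Sum>c\<in>Fp. c ^ i)"
      by (rule sum.reindex_bij_witness[of _ "\<lambda>c. inverse g * c" "\<lambda>c. g * c"])
        (use g mult inv in \<open>auto simp: mult.assoc[symmetric]\<close>)
    then have "g ^ i * (\<Sum>c\<in>Fp. c ^ i) = (\<Sum>c\<in>Fp. c ^ i)" by (simp add: power_mult_distrib sum_distrib_left)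
    then have "(\<Sum>c\<in>Fp. c ^ i) = 0" using g(3) by simp
    then show ?thesis using 2 by simp
  next
    case 3
    have "c ^ i = 1" if "c \<in> Fp - {0}" for c
    proof -
      have "c * c ^ i = c * 1"
        using that 3 p_gt_1 frob_fixed_iff[of c] by (simp flip: power_Suc)
      then show ?thesis using that by simp
    qed
    then have "(\<Sum>c\<in>Fp - {0}. c ^ i) = of_nat (p - 1)"
      using fin Fp_0 by (simp add: card_Diff_singleton card_Fp)
    also have "(of_nat (p - 1) :: 'a) = - 1"
      using p_gt_1 of_nat_eq_0_iff[of p] by (simp add: of_nat_diff)
    moreover have "(\<Sum>c\<in>Fp. c ^ i) = 0 ^ i + (\<Sum>c\<in>Fp - {0}. c ^ i)"
      by (rule sum.remove[OF fin Fp_0])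
    ultimately show ?thesis using 3 by simp
  qed
qed

text \<open>In the expansion only c^(p-1) has a nonzero sum, so the result does not depend on
  \<open>y\<close>.\<close>

lemma sum_Fp_shift_power:
  assumes "m < p"
  shows "(\<Sum>c\<in>Fp. (y + c) ^ m) = (if m = p - 1 then - 1 else 0)"
proof -
  have "(\<Sum>c\<in>Fp. (y + c) ^ m) = (\<Sum>c\<in>Fp. \<Sum>i\<le>m. of_nat (m choose i) * y ^ (m - i) * c ^ i)"
    by (intro sum.cong refl) (subst add.commute, simp add: binomial_ring mult_ac)
  also have "\<dots> = (\<Sum>i\<le>m. of_nat (m choose i) * y ^ (m - i) * (\<Sum>c\<in>Fp. c ^ i))"
    by (subst sum.swap) (simp add: sum_distrib_left)
  also have "\<dots> = (\<Sum>i\<le>m. if i = p - 1 then - (of_nat (m choose i) * y ^ (m - i)) else 0)"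
    using assms by (intro sum.cong) (auto simp: sum_Fp_power)
  also have "\<dots> = (if m = p - 1 then - 1 else 0)"
    using assms by auto
  finally show ?thesis .
qed

end

context scaffold
begin

section \<open>A basis adapted to the valuation\<close>

text \<open>The correction \<open>z\<close> concerns the last coordinate only; as a family it lets
  all \<open>Y l\<close> be treated alike.\<close>

definition zz :: "nat \<Rightarrow> 'a" where "zz l = (if l = n then z else 0)"

definition Y :: "nat \<Rightarrow> 'a" where "Y l = y l - zz l"

definition mono :: "(nat \<Rightarrow> nat) \<Rightarrow> 'a" where "mono m = (\<Prod>l=1..n. Y l ^ m l)"

lemma one_le_n: "1 \<in> {1..n}" "n \<in> {1..n}" "n \<noteq> 1"
  using n_ge_2 by auto

lemma Y_nz: "l \<in> {1..n} \<Longrightarrow> Y l \<noteq> 0" and w_Y: "l \<in> {1..n} \<Longrightarrow> w (Y l) = - int (b * p ^ (n - l))"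
  using w_y[of l] w_Yn by (cases "l = n"; force simp: Y_def zz_def y_def)+

lemma y1: "y 1 = x 1"
proof -
  have "a 1 i * x i = (if i = 1 then x 1 else 0)" for i
    using a_upper[OF one_le_n(1), of i] a_diag[OF one_le_n(1)] by auto
  then show ?thesis using one_le_n(1) by (simp add: y_def)
qed

lemma mono_nz: "mono m \<noteq> 0"
  using Y_nz by (auto simp: mono_def)

lemma w_mono: "w (mono m) = - int (b * (\<Sum>l=1..n. m l * p ^ (n - l)))"
proof -
  have "w (mono m) = (\<Sum>l=1..n. int (m l) * - int (b * p ^ (n - l)))"
    unfolding mono_def using Y_nz by (subst w_prod) (auto simp: w_power w_Y)
  also have "\<dots> = - int (b * (\<Sum>l=1..n. m l * p ^ (n - l)))"
    by (simp add: sum_distrib_left sum_negf mult_ac)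
  finally show ?thesis .
qed

text \<open>The residue field of \<open>L\<close> is \<open>F\<close>, so a scalar from
  \<open>K\<close> that matches the valuation can be adjusted to match the residue as well.\<close>

lemma scale_approx:
  assumes "u \<noteq> 0" "v \<noteq> 0" "int N dvd w u - w v"
  obtains s where "s \<in> K" "s \<noteq> 0" "w (s * v) = w u" "vge (u - s * v) (w u + 1)"
proof -
  obtain q where q: "w u - w v = int N * q" using assms(3) by blast
  obtain t where t: "t \<in> K" "t \<noteq> 0" "w t = int N" using ex_t by blast
  define s0 where "s0 = t powi q"
  have s0: "s0 \<in> K" "s0 \<noteq> 0" using t by (auto simp: s0_def power_int_def)
  have "w s0 = int N * q" using w_power_int[OF t(2), of q] t(3) by (simp add: s0_def)
  then have wv: "w (s0 * v) = w u" using s0 assms q by (simp add: w_mult)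
  define r where "r = u / (s0 * v)"
  have rv: "u = r * (s0 * v)" "r \<noteq> 0" using assms s0 by (auto simp: r_def)
  have wr: "w r = 0" using assms s0 wv unfolding r_def by (simp add: w_divide)
  then have "vge r 0" by (simp add: vge_def)
  then obtain c where c: "c \<in> F" "vge (r - c) 1" using residue by blast
  have cnz: "c \<noteq> 0"
  proof
    assume "c = 0"
    then show False using c wr rv(2) by (simp add: vge_def)
  qed
  have wc: "w c = 0" using w_F c cnz by blast
  have "u - (c * s0) * v = (r - c) * (s0 * v)" using rv(1) by (simp add: algebra_simps)
  moreover have "vge ((r - c) * (s0 * v)) (1 + w (s0 * v))" by (intro vge_mult c vge_w)
  ultimately have "vge (u - (c * s0) * v) (w u + 1)" using wv by (simp add: add.commute)
  moreover have "w ((c * s0) * v) = w u" using cnz s0 assms wv wc by (simp add: w_mult)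
  ultimately show ?thesis
    using that[of "c * s0"] c cnz s0 F_subset_K by auto
qed

text \<open>Since p does not divide \<open>b\<close>, the congruence - b D = w u modulo N can be
  solved for D. The base-p digits of D are the exponents of a monomial of valuation - b D.\<close>

lemma leading_mono:
  assumes "u \<noteq> 0"
  obtains s m where "s \<in> K" "s \<noteq> 0" "\<And>l. m l < p" "w (s * mono m) = w u" "vge (u - s * mono m) (w u + 1)"
proof -
  have "coprime b p" using not_p_dvd_b prime_p by (metis coprime_commute prime_imp_coprime_nat)
  then have "coprime (int b) (int N)" by (simp add: N_eq coprime_int_iff)
  then obtain t where t: "[int b * t = 1] (mod int N)" using cong_solve_coprime_int by blast
  define D where "D = nat ((- w u * t) mod int N)"
  have D: "int D = (- w u * t) mod int N" "D < N" using N_pos by (auto simp: D_def nat_less_iff)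
  define m where "m l = D div p ^ (n - l) mod p" for l
  have "(\<Sum>l=1..n. m l * p ^ (n - l)) = (\<Sum>i<n. (D div p ^ i mod p) * p ^ i)"
    unfolding m_def
    by (rule sum.reindex_bij_witness[of _ "\<lambda>i. n - i" "\<lambda>l. n - l"]) auto
  also have "\<dots> = D" using D(2) by (simp add: digit_sum N_eq)
  finally have wm: "w (mono m) = - (int b * int D)" by (simp add: w_mono)
  have "[w u - w (mono m) = w u + int b * (- w u * t)] (mod int N)"
  proof -
    have "[int D = - w u * t] (mod int N)" by (simp add: D(1) cong_def)
    then show ?thesis unfolding wm diff_minus_eq_add by (intro cong_add cong_mult cong_refl)
  qed
  also have "w u + int b * (- w u * t) = w u - w u * (int b * t)" by simp
  also have "[w u - w u * (int b * t) = w u - w u * 1] (mod int N)"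
    by (intro cong_diff cong_mult t) auto
  finally have "int N dvd w u - w (mono m)" by (simp add: cong_0_iff)
  then obtain s where "s \<in> K" "s \<noteq> 0" "w (s * mono m) = w u" "vge (u - s * mono m) (w u + 1)"
    by (rule scale_approx[OF assms mono_nz])
  then show ?thesis using that[of s m] p_gt_0 by (simp add: m_def)
qed

text \<open>Reduces a bound on an additive operator to scaled monomials: leading terms are removed
  until the remainder has valuation at least c + h, where it suffices that the operator does not
  lower valuations.\<close>

lemma op_bound:
  assumes add: "\<And>u v. \<Phi> (u + v) = \<Phi> u + \<Phi> v" and pres: "\<And>u m. vge u m \<Longrightarrow> vge (\<Phi> u) m"
    and mono: "\<And>s m. s \<in> K \<Longrightarrow> s \<noteq> 0 \<Longrightarrow> (\<And>l. m l < p) \<Longrightarrow> vge (\<Phi> (s * mono m)) (w (s * mono m) + h)"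
    and u: "vge u c"
  shows "vge (\<Phi> u) (c + h)"
proof -
  have "\<Phi> 0 + \<Phi> 0 = \<Phi> 0 + 0" using add[of 0 0] by (simp only: add_0_left add_0_right)
  then have \<Phi>0: "\<Phi> 0 = 0" by (simp only: add_left_cancel)
  have "vge u c' \<Longrightarrow> c \<le> c' \<Longrightarrow> c + h - c' \<le> int t \<Longrightarrow> vge (\<Phi> u) (c + h)" for t u c'
  proof (induction t arbitrary: u c')
    case 0
    then show ?case using pres[OF 0(1)] by (auto elim: vge_mono)
  next
    case (Suc t)
    show ?case
    proof (cases "vge u (c' + 1)")
      case True
      then show ?thesis using Suc.prems by (intro Suc.IH[of u "c' + 1"]) auto
    next
      case False
      then have nz: "u \<noteq> 0" and wu: "w u = c'" using Suc.prems(1) by (auto simp: vge_def)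
      obtain s m where sm: "s \<in> K" "s \<noteq> 0" "\<And>l. m l < p" "w (s * mono m) = w u"
          "vge (u - s * mono m) (w u + 1)"
        by (rule leading_mono[OF nz], rule that)
      have "vge (\<Phi> (s * mono m)) (w (s * mono m) + h)" by (rule mono[OF sm(1,2)]) (rule sm(3))
      then have "vge (\<Phi> (s * mono m)) (c + h)"
        by (rule vge_mono) (use sm(4) wu Suc.prems in simp)
      moreover have "vge (\<Phi> (u - s * mono m)) (c + h)"
        using Suc.prems sm(5) wu by (intro Suc.IH[of _ "c' + 1"]) auto
      moreover have "\<Phi> u = \<Phi> (s * mono m) + \<Phi> (u - s * mono m)" using add[of "s * mono m" "u - s * mono m"] by simp
      ultimately show ?thesis by (simp add: vge_add)
    qed
  qed
  from this[of u c "nat h"] u show ?thesis by simp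
qed

section \<open>Lower bounds\<close>

lemma vge_act:
  assumes "c \<in> carrier GA.R" "vge u m"
  shows "vge (act c u) m"
  unfolding act_def
proof (rule vge_sum)
  fix \<sigma> assume s: "\<sigma> \<in> G"
  have "vge (\<sigma> u) m" using assms(2) s by simp
  from vge_mult[OF vge_F[OF GA.R_in_F[OF assms(1)]] this, of \<sigma>]
  show "vge (c \<sigma> * \<sigma> u) m" by simp
qed

text \<open>The operator valuation is at least \<open>h\<close>, in a form that also covers
  operators with a kernel.\<close>

definition vhat_ge :: "(('a \<Rightarrow> 'a) \<Rightarrow> 'a) \<Rightarrow> int \<Rightarrow> bool" where
  "vhat_ge c h \<longleftrightarrow> (\<forall>u m. vge u m \<longrightarrow> vge (act c u) (m + h))"

lemma vhat_geD: "vhat_ge c h \<Longrightarrow> vge u m \<Longrightarrow> vge (act c u) (m + h)"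
  by (auto simp: vhat_ge_def)

lemma vhat_ge_mono: "vhat_ge c h \<Longrightarrow> h' \<le> h \<Longrightarrow> vhat_ge c h'"
  unfolding vhat_ge_def by (meson add_left_mono vge_mono)

lemma act_minus_one: "c \<in> carrier GA.R \<Longrightarrow> act (c \<ominus>\<^bsub>GA.R\<^esub> \<one>\<^bsub>GA.R\<^esub>) u = act c u - u"
  by (simp add: GA.R_minus act_coeff_diff)

lemma vhat_ge_mult_minus_one:
  assumes c: "c \<in> carrier GA.R" "c' \<in> carrier GA.R"
    and "vhat_ge (c \<ominus>\<^bsub>GA.R\<^esub> \<one>\<^bsub>GA.R\<^esub>) h" "vhat_ge (c' \<ominus>\<^bsub>GA.R\<^esub> \<one>\<^bsub>GA.R\<^esub>) h"
  shows "vhat_ge (c \<otimes>\<^bsub>GA.R\<^esub> c' \<ominus>\<^bsub>GA.R\<^esub> \<one>\<^bsub>GA.R\<^esub>) h"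
  unfolding vhat_ge_def
proof (intro allI impI)
  fix u m assume u: "vge u m"
  have "act (c \<otimes>\<^bsub>GA.R\<^esub> c' \<ominus>\<^bsub>GA.R\<^esub> \<one>\<^bsub>GA.R\<^esub>) u
      = act (c \<ominus>\<^bsub>GA.R\<^esub> \<one>\<^bsub>GA.R\<^esub>) (act c' u) + act (c' \<ominus>\<^bsub>GA.R\<^esub> \<one>\<^bsub>GA.R\<^esub>) u"
    using c by (simp add: act_minus_one act_mult)
  then show "vge (act (c \<otimes>\<^bsub>GA.R\<^esub> c' \<ominus>\<^bsub>GA.R\<^esub> \<one>\<^bsub>GA.R\<^esub>) u) (m + h)"
    using vhat_geD[OF assms(3) vge_act[OF c(2) u]] vhat_geD[OF assms(4) u] by (simp add: vge_add)
qed

lemma vhat_ge_tpow: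
  assumes u: "u \<in> GA.A" and h: "vhat_ge u h" "h \<ge> 0" and s: "s \<in> F"
  shows "vhat_ge (GA.tpow s u \<ominus>\<^bsub>GA.R\<^esub> \<one>\<^bsub>GA.R\<^esub>) h"
  unfolding vhat_ge_def
proof (intro allI impI)
  fix v m assume v: "vge v m"
  have uc: "u \<in> carrier GA.R" using u by (rule GA.A_carrier)
  have shift: "(\<Sum>i<p. f i) = f 0 + (\<Sum>i<p - 1. f (Suc i))" for f :: "nat \<Rightarrow> 'a"
    by (metis One_nat_def Suc_pred p_gt_0 sum.lessThan_Suc_shift)
  have "act (GA.tpow s u \<ominus>\<^bsub>GA.R\<^esub> \<one>\<^bsub>GA.R\<^esub>) v
      = (\<Sum>i<p-1. trunc_binomial s (Suc i) * act (u [^]\<^bsub>GA.R\<^esub> Suc i) v)"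
    using GA.tpow_closed[OF s u] by (simp add: act_minus_one) (simp add: act_tpow shift)
  also have "vge \<dots> (m + h)"
  proof (rule vge_sum)
    fix i :: nat
    have "u [^]\<^bsub>GA.R\<^esub> i \<in> carrier GA.R" using uc by simp
    then have "vge (act (u [^]\<^bsub>GA.R\<^esub> i) (act u v)) (m + h)" by (rule vge_act[OF _ vhat_geD[OF h(1) v]])
    then have "vge (act (u [^]\<^bsub>GA.R\<^esub> Suc i) v) (m + h)" using uc by (simp add: act_mult)
    then have "vge (trunc_binomial s (Suc i) * act (u [^]\<^bsub>GA.R\<^esub> Suc i) v) (0 + (m + h))"
      using s by (intro vge_mult vge_F GA.trunc_binomial_closed)
    then show "vge (trunc_binomial s (Suc i) * act (u [^]\<^bsub>GA.R\<^esub> Suc i) v) (m + h)" by simp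
  qed
  finally show "vge (act (GA.tpow s u \<ominus>\<^bsub>GA.R\<^esub> \<one>\<^bsub>GA.R\<^esub>) v) (m + h)" .
qed

text \<open>The break belonging to coordinate \<open>j\<close>. If \<open>z\<close> is nonzero,
  \<open>\<gamma> 1\<close> moves \<open>Y n\<close> by an element whose valuation is that of
  \<open>d\<close>, namely h1 - e p^(n-1); relative to the valuation - b of \<open>Y n\<close> this
  gives the value at j = 1.\<close>

definition brk :: "nat \<Rightarrow> int" where
  "brk j = (if j = 1 then (if z = 0 then h1 else h1 - int (e * p ^ (n - 1)) + int b) else int (b * p ^ (n - j)))"

abbreviation sz :: int where "sz \<equiv> - int (e * p ^ (n - 1))"

lemma sz_h1: "sz + h1 > 0"
proof -
  have "e * p ^ (n - 1) < b * p ^ (n - 1)" using e_less_b p_gt_0 by simp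
  then have "int (e * p ^ (n - 1)) < int (b * p ^ (n - 1))" by (simp only: of_nat_less_iff)
  then show ?thesis by (simp add: h1_def)
qed

lemma z_nz: "z \<noteq> 0 \<Longrightarrow> sz < - int b"
proof -
  assume "z \<noteq> 0"
  then have "b < e * p ^ (n - 1)" using z_cases by blast
  then show ?thesis by linarith
qed

lemma brk_le: "j \<in> {1..n} \<Longrightarrow> brk j \<le> int (b * p ^ (n - j))"
  using z_nz by (auto simp: brk_def h1_def)

lemma brk_pos: "brk j > 0"
proof (cases "j = 1")
  case True
  have "brk 1 = (if z = 0 then h1 else h1 - int (e * p ^ (n - 1)) + int b)"
    unfolding brk_def by (simp only: refl if_True)
  also have "\<dots> > 0"
  proof (cases "z = 0")
    case True
    show ?thesis unfolding if_P[OF True] by (rule h1_pos)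
  next
    case False
    show ?thesis unfolding if_not_P[OF False] using sz_h1 by linarith
  qed
  finally show ?thesis using True by (simp only:)
next
  case False
  then show ?thesis using b_pos p_gt_0 by (simp add: brk_def)
qed

text \<open>This order lets the last nonzero coordinate decide. The substantial case is that the
  exceptional break is at least b p^(n-2), which rests on e p^(n-2) < b.\<close>

lemma brk_antimono:
  assumes "i \<in> {1..n}" "j \<in> {1..n}" "i \<le> j"
  shows "brk j \<le> brk i"
proof (cases "i = 1 \<and> j \<noteq> 1 \<and> z \<noteq> 0")
  case True
  then have j: "j \<ge> 2" using assms by auto
  have "p ^ (n - j) \<le> p ^ (n - 2)" using j p_gt_0 by (intro power_increasing) auto
  then have 1: "b * p ^ (n - j) \<le> b * p ^ (n - 2)" by simp
  have pn: "p ^ (n - 1) = p * p ^ (n - 2)"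
    using n_ge_2 by (metis Suc_1 Suc_diff_Suc Suc_le_eq One_nat_def power_Suc)
  have "e * p ^ (n - 2) + 1 \<le> b" using e_bound by simp
  then have "p * (e * p ^ (n - 2) + 1) \<le> p * b" by (rule mult_le_mono2)
  moreover have "p * (e * p ^ (n - 2) + 1) = e * p ^ (n - 1) + p"
    by (simp only: pn distrib_left mult.left_commute mult_1_right)
  ultimately have 2: "e * p ^ (n - 1) + p \<le> p * b" by (simp only:)
  \<comment> \<open>Equivalent to (p - 1) (p^(n-2) - 1) >= 0.\<close>
  have "p + p ^ (n - 2) \<le> p * p ^ (n - 2) + 1"
  proof -
    obtain q where q: "p = Suc q" using p_gt_0 gr0_implies_Suc by blast
    have "q * 1 \<le> q * p ^ (n - 2)" using p_gt_0 by (intro mult_le_mono2) simp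
    then show ?thesis by (simp add: q)
  qed
  then have "b * (p + p ^ (n - 2)) \<le> b * (p * p ^ (n - 2) + 1)" by (rule mult_le_mono2)
  moreover have "b * (p * p ^ (n - 2) + 1) = b * p ^ (n - 1) + b"
    by (simp only: pn distrib_left mult_1_right)
  ultimately have "b * p + b * p ^ (n - 2) \<le> b * p ^ (n - 1) + b" by (simp only: distrib_left)
  then have "b * p ^ (n - j) + e * p ^ (n - 1) \<le> b * p ^ (n - 1) + b" using 1 2 mult.commute[of p b] by linarith
  then have "int (b * p ^ (n - j)) + int (e * p ^ (n - 1)) \<le> h1 + int b" unfolding h1_def by linarith
  then show ?thesis using True by (simp add: brk_def)
next
  case False
  have "p ^ (n - j) \<le> p ^ (n - i)" using assms p_gt_0 by (intro power_increasing) auto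
  then have "b * p ^ (n - j) \<le> b * p ^ (n - i)" by simp
  then have "int (b * p ^ (n - j)) \<le> int (b * p ^ (n - i))" by (simp only: of_nat_le_iff)
  then show ?thesis using False assms by (auto simp: brk_def h1_def)
qed

lemma zz_Kfix1: "zz l \<in> Kfix 1"
  using zder Kfix_0 by (auto simp: zz_def zder_def Kfix_def)

lemma Kfix_n: "f \<in> Kfix n"
proof -
  have "\<sigma> f = f" if "\<sigma> \<in> G" "\<forall>i\<in>{1..n}. chi i \<sigma> = 0" for \<sigma>
  proof -
    have "\<sigma> = id" by (rule faithful) (use that in \<open>auto simp: chi_def\<close>)
    then show ?thesis by simp
  qed
  then show ?thesis by (simp add: Kfix_def)
qed

lemma Y_Kfix: "l \<in> {1..n} \<Longrightarrow> Y l \<in> Kfix l"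
proof (cases "l = n")
  case False
  then show "l \<in> {1..n} \<Longrightarrow> Y l \<in> Kfix l" using y_Kfix[of l] by (simp add: Y_def zz_def)
qed (simp add: Kfix_n)

lemma z_diff:
  assumes s: "\<sigma> \<in> G"
  shows "vge (\<sigma> z - z) (sz + h1)"
proof -
  have "vge (chi 1 \<sigma> * d) (0 + (sz + h1))"
    using zder s by (intro vge_mult vge_F chi1_F) (auto simp: zder_def)
  moreover have "vge (\<sigma> z - z - chi 1 \<sigma> * d) (sz + h1)"
  proof (rule vge_mono)
    show "vge (\<sigma> z - z - chi 1 \<sigma> * d) (sz + 2 * h1)" using zder s by (simp add: zder_def)
  qed (use h1_pos in simp)
  ultimately have "vge ((\<sigma> z - z - chi 1 \<sigma> * d) + chi 1 \<sigma> * d) (sz + h1)" by (intro vge_add) simp_all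
  then show ?thesis by simp
qed

text \<open>\<open>\<gamma> j\<close> shifts \<open>y j\<close> by 1 and fixes the later
  \<open>y l\<close>, but acts on \<open>zz l\<close> as \<open>sg j\<close> does. So a later
  \<open>Y l\<close> loses the displacement of \<open>zz l\<close>.\<close>

lemma act_\<gamma>_mono:
  assumes j: "j \<in> {1..n}" and s: "s \<in> K" and m: "\<And>l. m l < p"
  shows "act (\<gamma> j) (s * mono m) = s * (\<Prod>l=1..n. (if l = j then Y l + 1 else if j < l then Y l - (sg j (zz l) - zz l) else Y l) ^ m l)"
    (is "_ = s * (\<Prod>l=1..n. ?Y' l ^ m l)")
proof -
  \<comment> \<open>\<open>shift\<close> speaks of polynomials in \<open>y l\<close>, so each power
    of \<open>Y l\<close> is written as one, with \<open>zz l\<close> among the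
    coefficients.\<close>
  define P where "P l = pcompose (monom 1 (m l)) [:- zz l, 1:]" for l
  have pP: "poly (P l) v = (v - zz l) ^ m l" for l v by (simp add: P_def poly_pcompose poly_monom)
  have split: "(\<Prod>l=1..n. h l) = (\<Prod>l=1..j. h l) * (\<Prod>l=j+1..n. h l)" for h :: "nat \<Rightarrow> 'a"
  proof -
    have "{1..n} = {1..j} \<union> {j+1..n}" using j by auto
    then show ?thesis using prod.union_disjoint[of "{1..j}" "{j+1..n}" h] by auto
  qed
  have zj: "zz l \<in> Kfix j" for l using zz_Kfix1 Kfix_mono[of 1 j] j by auto
  have sz1: "sg j (zz l) = zz l" if "j \<noteq> 1" for l
    using sg_Kfix[OF zz_Kfix1, of j l] that j by auto
  have e0: "s * mono m = s * (\<Prod>l=1..j. Y l ^ m l) * (\<Prod>l=j+1..n. poly (P l) (y l))"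
    unfolding mono_def split pP Y_def by (simp add: mult.assoc)
  have e1: "act (\<gamma> j) (s * (\<Prod>l=1..j. Y l ^ m l) * (\<Prod>l=j+1..n. poly (P l) (y l))) = sg j (s * (\<Prod>l=1..j. Y l ^ m l)) * (\<Prod>l=j+1..n. poly (map_poly (sg j) (P l)) (y l))"
  proof (rule shiftD[OF \<gamma>_shift[OF j]])
    show "s * (\<Prod>l=1..j. Y l ^ m l) \<in> Kfix j"
    proof (intro Kfix_mult Kfix_prod Kfix_power)
      show "s \<in> Kfix j" using s by (rule K_Kfix)
      fix l assume "l \<in> {1..j}"
      then show "Y l \<in> Kfix j" using Y_Kfix[of l] Kfix_mono[of l j] j by auto
    qed
    fix l
    have "degree (P l) \<le> m l"
      using degree_pcompose_le[of "monom 1 (m l)" "[:- zz l, 1:]"] by (simp add: P_def degree_monom_eq)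
    then show "degree (P l) < p" using m[of l] by simp
    show "coeff (P l) i \<in> Kfix j" for i
      unfolding P_def
    proof (rule Kfix_pcompose)
      show "coeff (monom 1 (m l)) i \<in> Kfix j" for i using Kfix_0 Kfix_1 by simp
      show "coeff [:- zz l, 1:] i \<in> Kfix j" for i
        using Kfix_uminus[OF zj] Kfix_0 Kfix_1 by (auto simp: coeff_pCons split: nat.split)
    qed
  qed
  have e2: "sg j (s * (\<Prod>l=1..j. Y l ^ m l)) = s * (\<Prod>l=1..j. sg j (Y l) ^ m l)"
    by (simp only: G_mult[OF sg_G] G_prod[OF sg_G] G_power[OF sg_G] G_K[OF sg_G s])
  have e3: "(\<Prod>l=1..j. sg j (Y l) ^ m l) = (\<Prod>l=1..j. ?Y' l ^ m l)"
  proof (rule prod.cong)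
    fix l assume l: "l \<in> {1..j}"
    show "sg j (Y l) ^ m l = ?Y' l ^ m l"
    proof (cases "l = j")
      case True
      have "sg j (zz j) = zz j"
        using sz1[of j] one_le_n(3) by (cases "j = 1") (auto simp: zz_def)
      then have "sg j (Y j) = Y j + 1"
        using sg_y[OF j j] a_diag[OF j] by (simp add: Y_def G_diff[OF sg_G])
      then show ?thesis using True by simp
    next
      case False
      then show ?thesis using l j sg_Kfix[OF Y_Kfix[of l], of j] by auto
    qed
  qed simp
  have e4: "(\<Prod>l=j+1..n. poly (map_poly (sg j) (P l)) (y l)) = (\<Prod>l=j+1..n. ?Y' l ^ m l)"
  proof (rule prod.cong)
    fix l assume l: "l \<in> {j+1..n}"
    \<comment> \<open>The polynomial with conjugated coefficients is evaluated at \<open>y l\<close>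
      by writing \<open>y l\<close> as the image of its preimage under \<open>sg j\<close>.\<close>
    obtain \<rho> where r: "\<rho> \<in> G" "\<rho> \<circ> sg j = id" "sg j \<circ> \<rho> = id" using G_inv[OF sg_G] by blast
    have sr: "sg j (\<rho> (y l)) = y l" using fun_cong[OF r(3), of "y l"] by simp
    have "poly (map_poly (sg j) (P l)) (y l) = sg j (poly (P l) (\<rho> (y l)))" by (simp add: G_poly sr)
    also have "\<dots> = (y l - sg j (zz l)) ^ m l" by (simp add: pP G_power G_diff sr)
    also have "\<dots> = ?Y' l ^ m l" using l by (simp add: Y_def)
    finally show "poly (map_poly (sg j) (P l)) (y l) = ?Y' l ^ m l" .
  qed simp
  show ?thesis unfolding split e0 e1 e2 e3 e4 by (simp only: mult.assoc)
qed

text \<open>By \<open>op_bound\<close> it is enough to treat monomials, and there each changed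
  factor gains at least \<open>brk j\<close>.\<close>

lemma vhat_\<gamma>:
  assumes j: "j \<in> {1..n}"
  shows "vhat_ge (\<gamma> j \<ominus>\<^bsub>GA.R\<^esub> \<one>\<^bsub>GA.R\<^esub>) (brk j)"
  unfolding vhat_ge_def
proof (intro allI impI)
  fix u c assume u: "vge u c"
  have gc: "\<gamma> j \<ominus>\<^bsub>GA.R\<^esub> \<one>\<^bsub>GA.R\<^esub> \<in> carrier GA.R" using \<gamma>_closed[OF j] by simp
  show "vge (act (\<gamma> j \<ominus>\<^bsub>GA.R\<^esub> \<one>\<^bsub>GA.R\<^esub>) u) (c + brk j)"
  proof (rule op_bound[OF act_add vge_act[OF gc] _ u])
    fix s and m :: "nat \<Rightarrow> nat" assume s: "s \<in> K" "s \<noteq> 0" and m: "\<And>l. m l < p"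
    let ?Y' = "\<lambda>l. if l = j then Y l + 1 else if j < l then Y l - (sg j (zz l) - zz l) else Y l"
    have "vge ((\<Prod>l=1..n. ?Y' l ^ m l) - (\<Prod>l=1..n. Y l ^ m l)) ((\<Sum>l=1..n. int (m l) * w (Y l)) + brk j)"
    proof (rule vge_prod_diff)
      show "0 \<le> brk j" using brk_pos[of j] by simp
      fix l assume l: "l \<in> {1..n}"
      show "vge (Y l ^ m l) (int (m l) * w (Y l))" by (intro vge_power vge_w)
      have key: "vge (?Y' l ^ m l - Y l ^ m l) (int (m l) * w (Y l) + brk j)"
        if \<eta>: "vge (?Y' l - Y l) \<eta>" "w (Y l) \<le> \<eta>" "brk j \<le> \<eta> - w (Y l)" for \<eta>
      proof -
        have "vge (?Y' l ^ m l - Y l ^ m l) ((int (m l) - 1) * w (Y l) + \<eta>)"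
          by (rule vge_pow_diff[OF vge_w \<eta>(1,2)])
        then show ?thesis by (rule vge_mono) (use \<eta>(3) in \<open>simp add: algebra_simps\<close>)
      qed
      \<comment> \<open>Besides \<open>Y j\<close> only \<open>Y n\<close> can change, and only
        under \<open>\<gamma> 1\<close>, because \<open>z\<close> lies in
        \<open>Kfix 1\<close>.\<close>
      consider "l = j" | "l \<noteq> j" "?Y' l = Y l" | "j = 1" "l = n" "z \<noteq> 0"
      proof -
        assume 1: "l = j \<Longrightarrow> thesis" and 2: "l \<noteq> j \<Longrightarrow> ?Y' l = Y l \<Longrightarrow> thesis"
          and 3: "j = 1 \<Longrightarrow> l = n \<Longrightarrow> z \<noteq> 0 \<Longrightarrow> thesis"
        show thesis
        proof (cases "j < l \<and> \<not> (j = 1 \<and> l = n \<and> z \<noteq> 0)")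
          case True
          have "sg j (zz l) = zz l"
          proof (cases "j = 1")
            case j1: True
            then have "zz l = 0" using True by (auto simp: zz_def)
            then show ?thesis by simp
          next
            case False
            then show ?thesis using sg_Kfix[OF zz_Kfix1, of j l] j by auto
          qed
          then show thesis using True by (intro 2) auto
        next
          case False
          show thesis
          proof (cases "l = j")
            case False': False
            show thesis
            proof (cases "j < l")
              case True
              then show thesis using False by (intro 3) auto
            qed (use False' in \<open>intro 2, auto\<close>)
          qed (rule 1)
        qed
      qed
      then show "vge (?Y' l ^ m l - Y l ^ m l) (int (m l) * w (Y l) + brk j)"
      proof cases
        case 1
        show ?thesis by (rule key[of 0]) (use 1 brk_le[OF j] w_Y[OF j] in \<open>auto simp: vge_def\<close>)
      next
        case 2
        then show ?thesis by simp
      next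
        case 3
        show ?thesis
        proof (rule key[of "sz + h1"])
          have "vge (- (sg j z - z)) (sz + h1)" using z_diff[OF sg_G] by (simp only: vge_uminus)
          moreover have "?Y' l - Y l = - (sg j z - z)" using 3 n_ge_2 by (simp add: zz_def)
          ultimately show "vge (?Y' l - Y l) (sz + h1)" by (simp only:)
          have wY: "w (Y l) = - int b" using w_Y[OF l] 3 by simp
          then show "w (Y l) \<le> sz + h1" using sz_h1 by simp
          show "brk j \<le> sz + h1 - w (Y l)" using 3 wY by (simp add: brk_def)
        qed
      qed
    qed simp
    moreover have "(\<Sum>l=1..n. int (m l) * w (Y l)) = w (mono m)"
      unfolding mono_def using Y_nz by (subst w_prod) (auto simp: w_power)
    ultimately have "vge (s * ((\<Prod>l=1..n. ?Y' l ^ m l) - mono m)) (w s + (w (mono m) + brk j))"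
      unfolding mono_def by (intro vge_mult vge_w) simp
    moreover have "act (\<gamma> j \<ominus>\<^bsub>GA.R\<^esub> \<one>\<^bsub>GA.R\<^esub>) (s * mono m) = s * ((\<Prod>l=1..n. ?Y' l ^ m l) - mono m)"
      unfolding act_minus_one[OF \<gamma>_closed[OF j]] act_\<gamma>_mono[OF j s(1) m] by (simp add: right_diff_distrib)
    ultimately show "vge (act (\<gamma> j \<ominus>\<^bsub>GA.R\<^esub> \<one>\<^bsub>GA.R\<^esub>) (s * mono m)) (w (s * mono m) + brk j)"
      using s mono_nz by (simp add: w_mult add.assoc)
  qed
qed

section \<open>The trace\<close>

definition Stab :: "nat \<Rightarrow> ('a \<Rightarrow> 'a) set" where
  "Stab j = {\<sigma>\<in>G. \<forall>i\<in>{1..j}. chi i \<sigma> = 0}"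

text \<open>The trace from \<open>L\<close> down to \<open>Kfix j\<close>.\<close>

definition ptrace :: "nat \<Rightarrow> 'a \<Rightarrow> 'a" where
  "ptrace j u = (\<Sum>\<sigma>\<in>Stab j. \<sigma> u)"

lemma ptrace_n: "ptrace n u = u"
proof -
  have "Stab n = {id}"
  proof
    show "Stab n \<subseteq> {id}"
    proof
      fix \<sigma> assume "\<sigma> \<in> Stab n"
      then have "\<sigma> \<in> G" "\<And>i. i \<in> {1..n} \<Longrightarrow> \<sigma> (x i) = x i" by (auto simp: Stab_def chi_def)
      then have "\<sigma> = id" by (rule faithful)
      then show "\<sigma> \<in> {id}" by simp
    qed
    show "{id} \<subseteq> Stab n" using G_id by (simp add: Stab_def chi_def)
  qed
  then show ?thesis by (simp add: ptrace_def)
qed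

lemma ptrace_0: "ptrace 0 u = (\<Sum>\<sigma>\<in>G. \<sigma> u)"
  by (simp add: ptrace_def Stab_def)

lemma ex_sgc:
  assumes "c \<in> Fp" shows "\<exists>\<sigma>\<in>G. \<forall>i\<in>{1..n}. chi i \<sigma> = (if i = j then c else 0)"
proof -
  obtain \<sigma> where "\<sigma> \<in> G" "\<And>i. i \<in> {1..n} \<Longrightarrow> chi i \<sigma> = (if i = j then c else 0)"
    by (rule ex_chi[of "\<lambda>i. if i = j then c else 0"]) (auto simp: Fp_0 assms)
  then show ?thesis by blast
qed

definition sgc :: "nat \<Rightarrow> 'a \<Rightarrow> 'a \<Rightarrow> 'a" where
  "sgc j c = (SOME \<sigma>. \<sigma> \<in> G \<and> (\<forall>i\<in>{1..n}. chi i \<sigma> = (if i = j then c else 0)))"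

lemma sgc:
  assumes "c \<in> Fp"
  shows sgc_G: "sgc j c \<in> G" and chi_sgc: "\<And>i. i \<in> {1..n} \<Longrightarrow> chi i (sgc j c) = (if i = j then c else 0)"
proof -
  have "\<exists>\<sigma>. \<sigma> \<in> G \<and> (\<forall>i\<in>{1..n}. chi i \<sigma> = (if i = j then c else 0))" using ex_sgc[OF assms, of j] by blast
  from someI_ex[OF this]
  show "sgc j c \<in> G" "\<And>i. i \<in> {1..n} \<Longrightarrow> chi i (sgc j c) = (if i = j then c else 0)"
    unfolding sgc_def[symmetric] by blast+
qed

lemma Fp_uminus: "c \<in> Fp \<Longrightarrow> - c \<in> Fp"
  using frob_uminus[of c 1] by (simp flip: frob_fixed_iff)

text \<open>Transitivity of the trace: the elements \<open>sgc (Suc j) c\<close> represent the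
  cosets of \<open>Stab (Suc j)\<close> in \<open>Stab j\<close>.\<close>

lemma ptrace_step:
  assumes j: "Suc j \<in> {1..n}"
  shows "ptrace j u = (\<Sum>c\<in>Fp. sgc (Suc j) c (ptrace (Suc j) u))"
proof -
  have dist: "sgc (Suc j) c (ptrace (Suc j) u) = (\<Sum>\<tau>\<in>Stab (Suc j). sgc (Suc j) c (\<tau> u))" if "c \<in> Fp" for c
    unfolding ptrace_def by (rule G_sum[OF sgc_G[OF that]])
  have "ptrace j u = (\<Sum>q\<in>Fp \<times> Stab (Suc j). sgc (Suc j) (fst q) (snd q u))"
    unfolding ptrace_def
  proof (rule sum.reindex_bij_witness[of _ "\<lambda>q. sgc (Suc j) (fst q) \<circ> snd q"
        "\<lambda>\<sigma>. (chi (Suc j) \<sigma>, sgc (Suc j) (- chi (Suc j) \<sigma>) \<circ> \<sigma>)"])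
    fix \<sigma> assume s: "\<sigma> \<in> Stab j"
    let ?c = "chi (Suc j) \<sigma>"
    have sG: "\<sigma> \<in> G" and c: "?c \<in> Fp" and c': "- ?c \<in> Fp"
      using s chi_Fp[of \<sigma> "Suc j"] j Fp_uminus by (auto simp: Stab_def)
    note G1 = sgc_G[OF c, of "Suc j"] and G2 = sgc_G[OF c', of "Suc j"]
    have chi2: "chi i (sgc (Suc j) (- ?c) \<circ> \<sigma>) = (if i = Suc j then 0 else chi i \<sigma>)" if "i \<in> {1..n}" for i
      using chi_comp[OF G2 sG that] chi_sgc[OF c' that, of "Suc j"] by simp
    have "sgc (Suc j) ?c \<circ> (sgc (Suc j) (- ?c) \<circ> \<sigma>) = \<sigma>"
    proof (rule chi_inj)
      show "sgc (Suc j) ?c \<circ> (sgc (Suc j) (- ?c) \<circ> \<sigma>) \<in> G" by (intro G_comp G1 G2 sG)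
      fix i assume i: "i \<in> {1..n}"
      show "chi i (sgc (Suc j) ?c \<circ> (sgc (Suc j) (- ?c) \<circ> \<sigma>)) = chi i \<sigma>"
        using chi_comp[OF G1 G_comp[OF G2 sG] i] chi2[OF i] chi_sgc[OF c i, of "Suc j"] by simp
    qed (rule sG)
    then show inv: "sgc (Suc j) (fst (?c, sgc (Suc j) (- ?c) \<circ> \<sigma>)) \<circ> snd (?c, sgc (Suc j) (- ?c) \<circ> \<sigma>) = \<sigma>" by simp
    show "(?c, sgc (Suc j) (- ?c) \<circ> \<sigma>) \<in> Fp \<times> Stab (Suc j)"
    proof -
      have "chi i (sgc (Suc j) (- ?c) \<circ> \<sigma>) = 0" if "i \<in> {1..Suc j}" for i
        using chi2[of i] that j s by (cases "i = Suc j") (auto simp: Stab_def)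
      then show ?thesis using c G_comp[OF G2 sG] by (simp add: Stab_def)
    qed
    show "sgc (Suc j) (fst (?c, sgc (Suc j) (- ?c) \<circ> \<sigma>)) (snd (?c, sgc (Suc j) (- ?c) \<circ> \<sigma>) u) = \<sigma> u"
      using fun_cong[OF inv, of u] by simp
  next
    fix q assume q: "q \<in> Fp \<times> Stab (Suc j)"
    obtain c \<tau> where ct: "q = (c, \<tau>)" "c \<in> Fp" "\<tau> \<in> Stab (Suc j)" using q by auto
    have tG: "\<tau> \<in> G" and t0: "\<And>i. i \<in> {1..Suc j} \<Longrightarrow> chi i \<tau> = 0" using ct(3) by (auto simp: Stab_def)
    note G1 = sgc_G[OF ct(2), of "Suc j"]
    have chi1: "chi i (sgc (Suc j) c \<circ> \<tau>) = (if i = Suc j then c else chi i \<tau>)" if "i \<in> {1..n}" for i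
      using chi_comp[OF G1 tG that] chi_sgc[OF ct(2) that, of "Suc j"] t0[of i] by auto
    have cj: "chi (Suc j) (sgc (Suc j) c \<circ> \<tau>) = c" using chi1[OF j] by simp
    have c': "- c \<in> Fp" by (rule Fp_uminus[OF ct(2)])
    note G2 = sgc_G[OF c', of "Suc j"]
    have "sgc (Suc j) (- c) \<circ> (sgc (Suc j) c \<circ> \<tau>) = \<tau>"
    proof (rule chi_inj)
      show "sgc (Suc j) (- c) \<circ> (sgc (Suc j) c \<circ> \<tau>) \<in> G" by (intro G_comp G1 G2 tG)
      fix i assume i: "i \<in> {1..n}"
      show "chi i (sgc (Suc j) (- c) \<circ> (sgc (Suc j) c \<circ> \<tau>)) = chi i \<tau>"
        using chi_comp[OF G2 G_comp[OF G1 tG] i] chi1[OF i] chi_sgc[OF c' i, of "Suc j"] t0[of i] by auto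
    qed (rule tG)
    then show "(chi (Suc j) (sgc (Suc j) (fst q) \<circ> snd q),
        sgc (Suc j) (- chi (Suc j) (sgc (Suc j) (fst q) \<circ> snd q)) \<circ> (sgc (Suc j) (fst q) \<circ> snd q)) = q"
      using cj ct(1) by simp
    have "chi i (sgc (Suc j) c \<circ> \<tau>) = 0" if "i \<in> {1..j}" for i
      using chi1[of i] t0[of i] that j by auto
    then show "sgc (Suc j) (fst q) \<circ> snd q \<in> Stab j"
      using ct(1) G_comp[OF G1 tG] by (simp add: Stab_def)
  qed
  also have "\<dots> = (\<Sum>c\<in>Fp. \<Sum>\<tau>\<in>Stab (Suc j). sgc (Suc j) c (\<tau> u))"
    by (simp add: sum.cartesian_product split_def)
  also have "\<dots> = (\<Sum>c\<in>Fp. sgc (Suc j) c (ptrace (Suc j) u))"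
    by (rule sum.cong) (simp_all only: dist)
  finally show ?thesis .
qed

lemma sgc_Y:
  assumes l: "l \<in> {1..j}" and j: "j \<in> {1..n}" and c: "c \<in> Fp"
  shows "sgc j c (Y l) = (if l = j then Y l + c else Y l)"
proof -
  note s = sgc_G[OF c, of j]
  have ln: "l \<in> {1..n}" using l j by auto
  have "sgc j c (zz l) = zz l"
  proof (cases "j = 1")
    case True
    then have "zz l = 0" using l one_le_n(3) by (auto simp: zz_def)
    then show ?thesis using s by simp
  next
    case False
    have "chi 1 (sgc j c) = 0" using chi_sgc[OF c one_le_n(1), of j] False by simp
    then show ?thesis using zz_Kfix1[of l] s by (simp add: Kfix_def)
  qed
  moreover have "(\<Sum>i=1..n. a l i * chi i (sgc j c)) = (\<Sum>i=1..n. if i = j then a l j * c else 0)"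
    by (rule sum.cong) (use chi_sgc[OF c, of _ j] in auto)
  then have "sgc j c (y l) = y l + a l j * c" using G_y[OF s ln] j by simp
  moreover have "a l j = (if l = j then 1 else 0)"
    using a_diag[OF j] a_upper[OF ln, of j] l by auto
  ultimately show ?thesis by (simp add: Y_def G_diff[OF s])
qed

text \<open>Each step down sums a power of \<open>Y (Suc j) + c\<close> over the prime field, which
  annihilates all exponents below p - 1 and leaves a factor - 1 for the exponent p - 1.\<close>

lemma ptrace_mono:
  assumes m: "\<And>l. m l < p" and s: "s \<in> K"
  shows "j \<le> n \<Longrightarrow> ptrace j (s * mono m) =
    (if \<forall>l\<in>{j+1..n}. m l = p - 1 then (- 1) ^ (n - j) * s * (\<Prod>l=1..j. Y l ^ m l) else 0)"
proof (induction "n - j" arbitrary: j)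
  case 0
  then have jn: "j = n" by simp
  show ?case unfolding jn ptrace_n mono_def by simp
next
  case (Suc d)
  then have Sj: "Suc j \<in> {1..n}" and d: "d = n - Suc j" "Suc j \<le> n" by auto
  have n1: "n - j = Suc (n - Suc j)" using d by simp
  show ?case
  proof (cases "\<forall>l\<in>{Suc j+1..n}. m l = p - 1")
    case False
    then have "ptrace (Suc j) (s * mono m) = 0" using Suc(1)[OF d] by (simp only: if_False)
    then have "ptrace j (s * mono m) = 0" unfolding ptrace_step[OF Sj] using sgc_G by simp
    moreover have "\<not> (\<forall>l\<in>{j+1..n}. m l = p - 1)" using False by auto
    ultimately show ?thesis by (simp only: if_False)
  next
    case True
    let ?e = "(- 1) ^ (n - Suc j) * s * (\<Prod>l=1..j. Y l ^ m l)"
    have IH: "ptrace (Suc j) (s * mono m) = (- 1) ^ (n - Suc j) * s * (\<Prod>l=1..Suc j. Y l ^ m l)"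
      unfolding Suc(1)[OF d] by (rule if_P[OF True])
    have "sgc (Suc j) c (ptrace (Suc j) (s * mono m)) = ?e * (Y (Suc j) + c) ^ m (Suc j)" if c: "c \<in> Fp" for c
    proof -
      note S = sgc_G[OF c, of "Suc j"]
      have eK: "(- 1) ^ (n - Suc j) * s \<in> K" using s by auto
      have "sgc (Suc j) c (ptrace (Suc j) (s * mono m))
          = (- 1) ^ (n - Suc j) * s * (\<Prod>l=1..Suc j. sgc (Suc j) c (Y l) ^ m l)"
        unfolding IH by (simp only: G_mult[OF S, of "(- 1) ^ (n - Suc j) * s"] G_K[OF S eK] G_prod[OF S] G_power[OF S])
      also have "(\<Prod>l=1..Suc j. sgc (Suc j) c (Y l) ^ m l) = (\<Prod>l=1..j. Y l ^ m l) * (Y (Suc j) + c) ^ m (Suc j)"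
      proof -
        have "(\<Prod>l=1..Suc j. sgc (Suc j) c (Y l) ^ m l)
            = (\<Prod>l=1..j. sgc (Suc j) c (Y l) ^ m l) * sgc (Suc j) c (Y (Suc j)) ^ m (Suc j)"
          by simp
        also have "(\<Prod>l=1..j. sgc (Suc j) c (Y l) ^ m l) = (\<Prod>l=1..j. Y l ^ m l)"
          by (rule prod.cong) (use sgc_Y[OF _ Sj c] in auto)
        also have "sgc (Suc j) c (Y (Suc j)) = Y (Suc j) + c" using sgc_Y[OF _ Sj c, of "Suc j"] by simp
        finally show ?thesis .
      qed
      finally show ?thesis by (simp only: mult.assoc)
    qed
    then have "ptrace j (s * mono m) = ?e * (\<Sum>c\<in>Fp. (Y (Suc j) + c) ^ m (Suc j))"
      unfolding ptrace_step[OF Sj] sum_distrib_left by (intro sum.cong) auto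
    also have "\<dots> = ?e * (if m (Suc j) = p - 1 then - 1 else 0)"
      by (simp only: sum_Fp_shift_power[OF m])
    also have "\<dots> = (if \<forall>l\<in>{j+1..n}. m l = p - 1 then (- 1) ^ (n - j) * s * (\<Prod>l=1..j. Y l ^ m l) else 0)"
    proof (cases "m (Suc j) = p - 1")
      case True': True
      have "\<forall>l\<in>{j+1..n}. m l = p - 1"
      proof
        fix l assume "l \<in> {j+1..n}"
        then show "m l = p - 1" using True True' by (cases "l = Suc j") auto
      qed
      then show ?thesis using True' by (simp add: n1)
    next
      case False
      then have "\<not> (\<forall>l\<in>{j+1..n}. m l = p - 1)" using Sj by auto
      then show ?thesis using False by (simp only: if_False mult_zero_right)
    qed
    finally show ?thesis .
  qed
qed

definition Tr :: "'a \<Rightarrow> 'a" where "Tr u = (\<Sum>\<sigma>\<in>G. \<sigma> u)"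

text \<open>The gain of the trace in valuation: minus the valuation of the top monomial, the only
  one with nonzero trace among those with exponents below p.\<close>

definition Hb :: int where "Hb = int b * (int N - 1)"

lemma Tr_add: "Tr (u + v) = Tr u + Tr v"
  by (simp add: Tr_def G_add sum.distrib)

lemma w_mono_top: "w (mono (\<lambda>_. p - 1)) = - Hb"
proof -
  have "(\<Sum>l=1..n. (p - 1) * p ^ (n - l)) = (\<Sum>i<n. (p - 1) * p ^ i)"
    by (rule sum.reindex_bij_witness[of _ "\<lambda>i. n - i" "\<lambda>l. n - l"]) auto
  also have "int \<dots> = int N - 1"
  proof -
    obtain q where q: "p = Suc q" using p_gt_0 gr0_implies_Suc by blast
    have "(\<Sum>i<m. (p - 1) * p ^ i) + 1 = p ^ m" for m
      by (induction m) (simp_all add: q)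
    then have "int ((\<Sum>i<n. (p - 1) * p ^ i) + 1) = int N" by (simp only: N_eq)
    then show ?thesis by simp
  qed
  finally show ?thesis unfolding w_mono Hb_def by (simp only: of_nat_mult)
qed

lemma Tr_mono:
  assumes "\<And>l. m l < p" "s \<in> K"
  shows "Tr (s * mono m) = (if \<forall>l\<in>{1..n}. m l = p - 1 then (- 1) ^ n * s else 0)"
  using ptrace_mono[OF assms, of 0] by (simp add: ptrace_0 Tr_def)

lemma vge_Tr:
  assumes "vge u c" shows "vge (Tr u) (c + Hb)"
proof (rule op_bound[OF Tr_add _ _ assms])
  show "vge (Tr u) m" if "vge u m" for u m
    unfolding Tr_def by (rule vge_sum) (use that in simp)
  fix s and m :: "nat \<Rightarrow> nat" assume s: "s \<in> K" "s \<noteq> 0" and m: "\<And>l. m l < p"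
  show "vge (Tr (s * mono m)) (w (s * mono m) + Hb)"
  proof (cases "\<forall>l\<in>{1..n}. m l = p - 1")
    case True
    then have "mono m = mono (\<lambda>_. p - 1)" unfolding mono_def by (intro prod.cong) auto
    then have "w (s * mono m) + Hb = w s" using s mono_nz w_mono_top by (simp add: w_mult)
    moreover have "Tr (s * mono m) = (- 1) ^ n * s" unfolding Tr_mono[OF m s(1)] by (rule if_P[OF True])
    moreover have "w ((- 1) ^ n * s) = w s" using s by (simp add: w_mult w_power)
    ultimately show ?thesis by (simp add: vge_def)
  next
    case False
    then show ?thesis by (simp only: Tr_mono[OF m s(1)] if_False vge_0)
  qed
qed

lemma Hb_cong: "int N dvd Hb + int b"
  by (simp add: Hb_def algebra_simps)

text \<open>The top monomial has valuation - Hb, which is congruent to \<open>b\<close> modulo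
  \<open>N\<close>. So up to higher valuation \<open>u\<close> is a \<open>K\<close>-multiple of it,
  and the bound of \<open>vge_Tr\<close> is attained.\<close>

lemma w_Tr:
  assumes "u \<noteq> 0" "int N dvd w u - int b"
  shows "Tr u \<noteq> 0" "w (Tr u) = w u + Hb"
proof -
  have "int N dvd (w u - int b) + (Hb + int b)" using assms(2) Hb_cong by (rule dvd_add)
  then have "int N dvd w u - w (mono (\<lambda>_. p - 1))" unfolding w_mono_top by simp
  then obtain s where s: "s \<in> K" "s \<noteq> 0" "w (s * mono (\<lambda>_. p - 1)) = w u"
    "vge (u - s * mono (\<lambda>_. p - 1)) (w u + 1)"
    by (rule scale_approx[OF assms(1) mono_nz])
  let ?v = "s * mono (\<lambda>_. p - 1)"
  have T: "Tr ?v = (- 1) ^ n * s" using Tr_mono[of "\<lambda>_. p - 1" s] s p_gt_0 by simp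
  have Tnz: "Tr ?v \<noteq> 0" using T s by simp
  have "w (Tr ?v) = w s" using T s by (simp add: w_mult w_power)
  then have wT: "w (Tr ?v) = w u + Hb" using s mono_nz w_mono_top by (simp add: w_mult)
  have "vge (Tr (u - ?v)) (w (Tr ?v) + 1)" using vge_Tr[OF s(4)] wT by (simp add: algebra_simps)
  moreover have "Tr u = Tr ?v + Tr (u - ?v)" using Tr_add[of ?v "u - ?v"] by simp
  ultimately show "Tr u \<noteq> 0" "w (Tr u) = w u + Hb" using w_add_eq[OF Tnz] wT by simp_all
qed

section \<open>Upper bounds\<close>

text \<open>The adjoint of \<open>act D\<close> for the trace form: each automorphism is replaced by
  its inverse.\<close>

definition adj :: "(('a \<Rightarrow> 'a) \<Rightarrow> 'a) \<Rightarrow> 'a \<Rightarrow> 'a" where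
  "adj D u = (\<Sum>\<sigma>\<in>G. D \<sigma> * (inv\<^bsub>GM\<^esub> \<sigma>) u)"

lemma Tr_G: "\<sigma> \<in> G \<Longrightarrow> Tr (\<sigma> u) = Tr u"
proof -
  assume s: "\<sigma> \<in> G"
  have "Tr (\<sigma> u) = (\<Sum>\<tau>\<in>G. (\<sigma> \<circ> \<tau>) u)"
    unfolding Tr_def using s by (intro sum.cong refl) (metis G_commute comp_apply)
  also have "\<dots> = Tr u" unfolding Tr_def
    by (rule sum.reindex_bij_betw[OF G_bij[OF s], of "\<lambda>\<sigma>. \<sigma> u"])
  finally show ?thesis .
qed

lemma Tr_K: "s \<in> K \<Longrightarrow> Tr (s * u) = s * Tr u"
  by (simp add: Tr_def G_mult G_K sum_distrib_left)

lemma Tr_sum: "Tr (\<Sum>i\<in>I. f i) = (\<Sum>i\<in>I. Tr (f i))"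
proof (induction I rule: infinite_finite_induct)
  case (insert i I)
  then show ?case by (simp add: Tr_add)
qed (simp_all add: Tr_def)

lemma Tr_adj:
  assumes "D \<in> carrier GA.R"
  shows "Tr (u * act D v) = Tr (adj D u * v)"
proof -
  have "Tr (u * act D v) = (\<Sum>\<sigma>\<in>G. Tr (D \<sigma> * (u * \<sigma> v)))"
    unfolding act_def by (simp add: sum_distrib_left Tr_sum mult.left_commute)
  also have "\<dots> = (\<Sum>\<sigma>\<in>G. D \<sigma> * Tr (u * \<sigma> v))" by (simp add: Tr_K R_coeff_K[OF assms])
  also have "\<dots> = (\<Sum>\<sigma>\<in>G. D \<sigma> * Tr ((inv\<^bsub>GM\<^esub> \<sigma>) u * v))"
  proof (rule sum.cong)
    fix \<sigma> assume s: "\<sigma> \<in> G"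
    have "(inv\<^bsub>GM\<^esub> \<sigma>) (\<sigma> v) = v" using fun_cong[OF inv_GM(2)[OF s], of v] by simp
    then have "Tr (u * \<sigma> v) = Tr ((inv\<^bsub>GM\<^esub> \<sigma>) u * v)"
      using Tr_G[OF inv_GM(1)[OF s], of "u * \<sigma> v"] G_mult[OF inv_GM(1)[OF s], of u "\<sigma> v"] by simp
    then show "D \<sigma> * Tr (u * \<sigma> v) = D \<sigma> * Tr ((inv\<^bsub>GM\<^esub> \<sigma>) u * v)" by simp
  qed simp
  also have "\<dots> = (\<Sum>\<sigma>\<in>G. Tr (D \<sigma> * ((inv\<^bsub>GM\<^esub> \<sigma>) u * v)))" by (simp add: Tr_K R_coeff_K[OF assms])
  also have "\<dots> = Tr (adj D u * v)"
    unfolding adj_def by (simp add: sum_distrib_right Tr_sum mult.assoc)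
  finally show ?thesis .
qed

text \<open>The trace of adj D u times \<rho> has an exact valuation by \<open>w_Tr\<close>, since
  that product has valuation congruent to \<open>b\<close>. The same trace is that of u times act D
  \<rho>, where \<open>vge_Tr\<close> bounds it from below; so act D \<rho> cannot have too large a
  valuation.\<close>

lemma upper_bound:
  assumes D: "D \<in> carrier GA.R" and \<rho>: "\<rho> \<noteq> 0" "int N dvd w \<rho> - int b"
    and u: "u \<noteq> 0" "adj D u \<noteq> 0" "int N dvd w (adj D u)"
  shows "act D \<rho> \<noteq> 0" "w (act D \<rho>) \<le> w \<rho> + (w (adj D u) - w u)"
proof -
  have nz: "adj D u * \<rho> \<noteq> 0" using u \<rho> by simp
  have "int N dvd w (adj D u) + (w \<rho> - int b)" using u(3) \<rho>(2) by (rule dvd_add)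
  then have "int N dvd w (adj D u * \<rho>) - int b" using u \<rho> by (simp add: w_mult algebra_simps)
  note T = w_Tr[OF nz this]
  show anz: "act D \<rho> \<noteq> 0"
  proof
    assume "act D \<rho> = 0"
    then have "Tr (adj D u * \<rho>) = Tr 0" using Tr_adj[OF D, of u \<rho>] by simp
    then show False using T(1) by (simp add: Tr_def)
  qed
  have "vge (Tr (u * act D \<rho>)) (w (u * act D \<rho>) + Hb)" by (intro vge_Tr vge_w)
  then have "w u + w (act D \<rho>) + Hb \<le> w (adj D u * \<rho>) + Hb"
    using T u anz unfolding Tr_adj[OF D] by (simp add: vge_def w_mult)
  then show "w (act D \<rho>) \<le> w \<rho> + (w (adj D u) - w u)" using u \<rho> by (simp add: w_mult)
qed

section \<open>Coordinates of an operator, and a test element for each of them\<close>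

definition psi :: "nat \<Rightarrow> ('a \<Rightarrow> 'a) \<Rightarrow> 'a" where "psi j \<sigma> = \<sigma> (y j) - y j"

lemma psi_F: "\<sigma> \<in> G \<Longrightarrow> j \<in> {1..n} \<Longrightarrow> psi j \<sigma> \<in> F"
  unfolding psi_def using G_y[of \<sigma> j] chi_F a_F by (auto intro!: F.closed_sum)

lemma psi_inv:
  assumes "\<sigma> \<in> G" "j \<in> {1..n}" shows "psi j (inv\<^bsub>GM\<^esub> \<sigma>) = - psi j \<sigma>"
proof -
  note i = inv_GM[OF assms(1)]
  have "psi j \<sigma> \<in> K" using psi_F[OF assms] F_subset_K by blast
  then have "(inv\<^bsub>GM\<^esub> \<sigma>) (psi j \<sigma>) = psi j \<sigma>" by (rule G_K[OF i(1)])
  moreover have "(inv\<^bsub>GM\<^esub> \<sigma>) (\<sigma> (y j)) = y j" using fun_cong[OF i(2), of "y j"] by simp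
  ultimately have "y j - (inv\<^bsub>GM\<^esub> \<sigma>) (y j) = psi j \<sigma>" by (simp add: psi_def G_diff[OF i(1)])
  then show ?thesis by (simp add: psi_def algebra_simps)
qed

definition coord :: "nat \<Rightarrow> (('a \<Rightarrow> 'a) \<Rightarrow> 'a) \<Rightarrow> 'a" where "coord j D = act D (y j)"

context
  fixes D assumes D: "D \<in> GA.A"
begin

lemma D_carrier: "D \<in> carrier GA.R" and D_aug: "(\<Sum>\<sigma>\<in>G. D \<sigma>) = 0"
  using D by (auto simp: GA.A_iff)

lemma D_sum_diff: "(\<Sum>\<sigma>\<in>G. D \<sigma> * f \<sigma>) = (\<Sum>\<sigma>\<in>G. D \<sigma> * (f \<sigma> - c))"
  by (simp add: right_diff_distrib sum_subtractf sum_distrib_right[symmetric] D_aug)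

lemma coord_psi: "coord j D = (\<Sum>\<sigma>\<in>G. D \<sigma> * psi j \<sigma>)"
  unfolding coord_def act_def psi_def by (rule D_sum_diff)

lemma D_F: "D \<sigma> \<in> F"
  using GA.R_in_F[OF D_carrier] .

lemma coord_F: "j \<in> {1..n} \<Longrightarrow> coord j D \<in> F"
  unfolding coord_psi by (intro F.closed_sum F.closed_mult D_F psi_F)

lemma adj_psi: "j \<in> {1..n} \<Longrightarrow> (\<Sum>\<sigma>\<in>G. D \<sigma> * psi j (inv\<^bsub>GM\<^esub> \<sigma>)) = - coord j D"
  unfolding coord_psi sum_negf[symmetric] by (intro sum.cong) (auto simp: psi_inv)

lemma adj_diff: "adj D u = (\<Sum>\<sigma>\<in>G. D \<sigma> * ((inv\<^bsub>GM\<^esub> \<sigma>) u - u))"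
  unfolding adj_def by (rule D_sum_diff)

lemma vge_sum_D:
  assumes "\<And>\<sigma>. \<sigma> \<in> G \<Longrightarrow> vge (f \<sigma>) c"
  shows "vge (\<Sum>\<sigma>\<in>G. D \<sigma> * f \<sigma>) c"
proof (rule vge_sum)
  fix \<sigma> assume "\<sigma> \<in> G"
  from vge_mult[OF vge_F[OF D_F, of \<sigma>] assms[OF this]] show "vge (D \<sigma> * f \<sigma>) c" by simp
qed

text \<open>The test element is \<open>y j\<close>, which the adjoint sends to the nonzero constant
  - coord j D.\<close>

lemma upper_1:
  assumes j: "j \<in> {1..n}" "zz j = 0" "coord j D \<noteq> 0" and \<rho>: "\<rho> \<noteq> 0" "int N dvd w \<rho> - int b"
  shows "act D \<rho> \<noteq> 0" "w (act D \<rho>) \<le> w \<rho> + int (b * p ^ (n - j))"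
proof -
  have a: "adj D (y j) = - coord j D"
    unfolding adj_diff adj_psi[OF j(1), symmetric] psi_def ..
  have wc: "w (coord j D) = 0" using w_F coord_F j by blast
  have yY: "y j = Y j" using j by (simp add: Y_def)
  have "y j \<noteq> 0" "w (y j) = - int (b * p ^ (n - j))" unfolding yY using Y_nz w_Y j by blast+
  with upper_bound[OF D_carrier \<rho>, of "y j"] a wc j(3)
  show "act D \<rho> \<noteq> 0" "w (act D \<rho>) \<le> w \<rho> + int (b * p ^ (n - j))" by simp_all
qed

lemma adj_z: "vge (\<Sum>\<sigma>\<in>G. D \<sigma> * ((inv\<^bsub>GM\<^esub> \<sigma>) z - z)) 1"
proof (rule vge_sum_D)
  fix \<sigma> assume "\<sigma> \<in> G"
  from z_diff[OF inv_GM(1)[OF this]] show "vge ((inv\<^bsub>GM\<^esub> \<sigma>) z - z) 1"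
    by (rule vge_mono) (use sz_h1 in simp)
qed

text \<open>The test element is \<open>Y n\<close>. The motion of \<open>z\<close> only adds terms
  of positive valuation to the constant - coord n D, because e < b.\<close>

lemma upper_n:
  assumes c: "coord n D \<noteq> 0" and \<rho>: "\<rho> \<noteq> 0" "int N dvd w \<rho> - int b"
  shows "act D \<rho> \<noteq> 0" "w (act D \<rho>) \<le> w \<rho> + int b"
proof -
  have n: "n \<in> {1..n}" by (rule one_le_n)
  have zn: "zz n = z" by (simp add: zz_def)
  have "adj D (Y n) = (\<Sum>\<sigma>\<in>G. D \<sigma> * psi n (inv\<^bsub>GM\<^esub> \<sigma>) - D \<sigma> * ((inv\<^bsub>GM\<^esub> \<sigma>) z - z))"
    unfolding adj_diff by (intro sum.cong refl) (simp add: Y_def zn psi_def G_diff inv_GM(1) algebra_simps)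
  also have "\<dots> = - coord n D - (\<Sum>\<sigma>\<in>G. D \<sigma> * ((inv\<^bsub>GM\<^esub> \<sigma>) z - z))"
    by (simp only: sum_subtractf adj_psi[OF n])
  finally have a: "adj D (Y n) = - coord n D + - (\<Sum>\<sigma>\<in>G. D \<sigma> * ((inv\<^bsub>GM\<^esub> \<sigma>) z - z))" by simp
  have wc: "w (- coord n D) = 0" using w_F[OF coord_F[OF n] c] by simp
  have v: "vge (- (\<Sum>\<sigma>\<in>G. D \<sigma> * ((inv\<^bsub>GM\<^esub> \<sigma>) z - z))) (w (- coord n D) + 1)"
    unfolding wc vge_uminus using adj_z by simp
  have "- coord n D \<noteq> 0" using c by simp
  note A = w_add_eq[OF this v, folded a]
  have wY: "w (Y n) = - int b" using w_Y[OF n] by simp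
  have dv: "int N dvd w (adj D (Y n))" using A(2) wc by simp
  from upper_bound[OF D_carrier \<rho> Y_nz[OF n] A(1) dv]
  show "act D \<rho> \<noteq> 0" "w (act D \<rho>) \<le> w \<rho> + int b" using A(2) wc wY by simp_all
qed

text \<open>With the last coordinate zero, the adjoint image of \<open>Y n\<close> is governed by
  the motion of \<open>z\<close>, and its leading term is a multiple of \<open>d\<close>. The
  valuation of \<open>d\<close> need not be divisible by \<open>N\<close>. A power \<open>f\<close>
  of \<open>x 1\<close> repairs this and raises test element and leading term by the same
  amount.\<close>

lemma upper_star:
  assumes z: "z \<noteq> 0" and c1: "coord 1 D \<noteq> 0" and cn: "coord n D = 0"
    and \<rho>: "\<rho> \<noteq> 0" "int N dvd w \<rho> - int b"
  shows "act D \<rho> \<noteq> 0" "w (act D \<rho>) \<le> w \<rho> + brk 1"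
proof -
  have n: "n \<in> {1..n}" and n1: "1 \<in> {1..n}" using one_le_n by auto
  have zn: "zz n = z" by (simp add: zz_def)
  have dz: "d \<noteq> 0" "w d = sz + h1" using z_cases z by auto
  have "coprime (int b) (int p)"
    using not_p_dvd_b prime_p by (metis coprime_commute coprime_int_iff prime_imp_coprime_nat)
  then obtain t where t: "[int b * t = 1] (mod int p)" using cong_solve_coprime_int by blast
  \<comment> \<open>Chosen modulo p so that \<open>N\<close> divides the valuation of d times
    f.\<close>
  define i where "i = nat (((int b - int e) * t) mod int p)"
  have i: "int i = ((int b - int e) * t) mod int p" using p_gt_0 by (simp add: i_def)
  have "[int b - int e - int i * int b = int b - int e - (int b - int e) * t * int b] (mod int p)"
    unfolding i by (intro cong_diff cong_mult cong_refl) (simp add: cong_def)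
  also have "int b - int e - (int b - int e) * t * int b = (int b - int e) - (int b - int e) * (int b * t)"
    by (simp add: algebra_simps)
  also have "[(int b - int e) - (int b - int e) * (int b * t) = (int b - int e) - (int b - int e) * 1] (mod int p)"
    by (intro cong_diff cong_mult t) auto
  finally have "int p dvd int b - int e - int i * int b" by (simp add: cong_0_iff)
  then obtain q where q: "int b - int e - int i * int b = int p * q" by blast
  define f where "f = x 1 ^ i"
  have f: "f \<noteq> 0" "w f = - int i * h1" using w_x1(1) by (simp_all add: f_def w_power w_x1'[simplified])
  have Ndvd: "int N dvd w f + sz + h1"
  proof -
    have "w f + sz + h1 = (int b - int e - int i * int b) * int (p ^ (n - 1))"
      by (simp add: f h1_def algebra_simps)
    also have "\<dots> = int N * q" by (simp add: q N_eq2)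
    finally show ?thesis by simp
  qed
  have fd: "vge (\<tau> f - f) (w f + h1)" if "\<tau> \<in> G" for \<tau>
  proof -
    have "vge ((x 1 + chi 1 \<tau>) ^ i - x 1 ^ i) ((int i - 1) * (- h1) + 0)"
      by (rule vge_pow_diff) (use h1_pos vge_F[OF chi1_F[OF that]] in \<open>simp_all add: vge_def w_x1'[simplified]\<close>)
    moreover have "\<tau> f - f = (x 1 + chi 1 \<tau>) ^ i - x 1 ^ i"
      unfolding f_def G_power[OF that] G_x1[of \<tau>] ..
    moreover have "(int i - 1) * (- h1) + 0 = w f + h1" by (simp add: f(2) algebra_simps)
    ultimately show ?thesis by (simp only:)
  qed
  let ?i = "\<lambda>\<sigma>. inv\<^bsub>GM\<^esub> \<sigma>"
  let ?z = "\<lambda>\<sigma>. ?i \<sigma> z - z"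
  have psi1: "psi 1 \<tau> = chi 1 \<tau>" for \<tau> unfolding psi_def y1 chi_def ..
  \<comment> \<open>Product rule: \<open>?E1\<close>, \<open>?E2\<close> and \<open>?E3\<close>
    contain the displacement of \<open>f\<close>, and \<open>?E4\<close> the second-order error of
    \<open>z\<close>. \<open>?E1\<close> is of larger valuation than the main term because - b
    exceeds the valuation of \<open>z\<close>.\<close>
  let ?main = "coord 1 D * (d * f)"
  let ?E1 = "Y n * (\<Sum>\<sigma>\<in>G. D \<sigma> * (?i \<sigma> f - f))"
  let ?E2 = "\<Sum>\<sigma>\<in>G. D \<sigma> * (psi n (?i \<sigma>) * (?i \<sigma> f - f))"
  let ?E3 = "\<Sum>\<sigma>\<in>G. D \<sigma> * (?z \<sigma> * (?i \<sigma> f - f))"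
  let ?E4 = "(\<Sum>\<sigma>\<in>G. D \<sigma> * (?z \<sigma> - chi 1 (?i \<sigma>) * d)) * f"
  have "adj D (Y n * f) = (\<Sum>\<sigma>\<in>G. Y n * (D \<sigma> * (?i \<sigma> f - f)) + D \<sigma> * (psi n (?i \<sigma>) * (?i \<sigma> f - f))
      + D \<sigma> * psi n (?i \<sigma>) * f - D \<sigma> * (?z \<sigma> * (?i \<sigma> f - f))
      - D \<sigma> * (?z \<sigma> - chi 1 (?i \<sigma>) * d) * f - D \<sigma> * psi 1 (?i \<sigma>) * (d * f))"
    unfolding adj_diff
  proof (rule sum.cong)
    fix \<sigma> assume s: "\<sigma> \<in> G"
    have "?i \<sigma> (Y n) = Y n + psi n (?i \<sigma>) - ?z \<sigma>"
      by (simp add: Y_def zn psi_def G_diff[OF inv_GM(1)[OF s]])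
    then have "?i \<sigma> (Y n * f) = (Y n + psi n (?i \<sigma>) - ?z \<sigma>) * ?i \<sigma> f" by (simp only: G_mult[OF inv_GM(1)[OF s]])
    then show "D \<sigma> * (?i \<sigma> (Y n * f) - Y n * f) = Y n * (D \<sigma> * (?i \<sigma> f - f)) + D \<sigma> * (psi n (?i \<sigma>) * (?i \<sigma> f - f))
      + D \<sigma> * psi n (?i \<sigma>) * f - D \<sigma> * (?z \<sigma> * (?i \<sigma> f - f))
      - D \<sigma> * (?z \<sigma> - chi 1 (?i \<sigma>) * d) * f - D \<sigma> * psi 1 (?i \<sigma>) * (d * f)"
      unfolding psi1 by (simp only:) (simp add: algebra_simps)
  qed simp
  also have "\<dots> = ?E1 + ?E2 + (\<Sum>\<sigma>\<in>G. D \<sigma> * psi n (?i \<sigma>)) * f - ?E3 - ?E4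
      - (\<Sum>\<sigma>\<in>G. D \<sigma> * psi 1 (?i \<sigma>)) * (d * f)"
    by (simp only: sum.distrib sum_subtractf sum_distrib_left sum_distrib_right)
  also have "\<dots> = ?main + (?E1 + ?E2 - ?E3 - ?E4)"
    unfolding adj_psi[OF n] adj_psi[OF n1] cn by (simp add: algebra_simps)
  finally have eq: "adj D (Y n * f) = ?main + (?E1 + ?E2 - ?E3 - ?E4)" .
  have wm: "?main \<noteq> 0" "w ?main = w f + sz + h1"
    using c1 dz f w_F[OF coord_F[OF n1] c1] by (simp_all add: w_mult)
  have wY: "w (Y n) = - int b" using w_Y[OF n] by simp
  have v1: "vge ?E1 (w ?main + 1)"
  proof -
    have "vge ?E1 (w (Y n) + (w f + h1))"
      by (intro vge_mult vge_w vge_sum_D fd inv_GM(1))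
    then show ?thesis by (rule vge_mono) (use z_nz[OF z] wY wm in simp)
  qed
  have v2: "vge ?E2 (w ?main + 1)"
  proof (rule vge_sum_D)
    fix \<sigma> assume s: "\<sigma> \<in> G"
    have "vge (psi n (?i \<sigma>) * (?i \<sigma> f - f)) (0 + (w f + h1))"
      by (intro vge_mult vge_F psi_F fd inv_GM(1) s n)
    then show "vge (psi n (?i \<sigma>) * (?i \<sigma> f - f)) (w ?main + 1)"
      by (rule vge_mono) (use z_nz[OF z] b_pos wm in simp)
  qed
  have v3: "vge ?E3 (w ?main + 1)"
  proof (rule vge_sum_D)
    fix \<sigma> assume s: "\<sigma> \<in> G"
    have "vge (?z \<sigma> * (?i \<sigma> f - f)) ((sz + h1) + (w f + h1))"
      by (intro vge_mult z_diff fd inv_GM(1) s)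
    then show "vge (?z \<sigma> * (?i \<sigma> f - f)) (w ?main + 1)"
      by (rule vge_mono) (use h1_pos wm in simp)
  qed
  have v4: "vge ?E4 (w ?main + 1)"
  proof -
    have "vge ?E4 ((sz + 2 * h1) + w f)"
    proof (intro vge_mult vge_w vge_sum_D)
      fix \<sigma> assume s: "\<sigma> \<in> G"
      show "vge (?z \<sigma> - chi 1 (?i \<sigma>) * d) (sz + 2 * h1)" using zder inv_GM(1)[OF s] by (simp add: zder_def)
    qed
    then show ?thesis by (rule vge_mono) (use h1_pos wm in simp)
  qed
  have "vge (?E1 + ?E2 - ?E3 - ?E4) (w ?main + 1)" by (intro vge_add vge_diff v1 v2 v3 v4)
  note A = w_add_eq[OF wm(1) this, folded eq]
  have dv: "int N dvd w (adj D (Y n * f))" using A(2) wm(2) Ndvd by simp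
  have Yf: "Y n * f \<noteq> 0" using Y_nz[OF n] f by simp
  have wYf: "w (Y n * f) = - int b + w f" using Y_nz[OF n] f wY by (simp add: w_mult)
  have brk1: "brk 1 = sz + h1 + int b" using z by (simp add: brk_def)
  from upper_bound[OF D_carrier \<rho> Yf A(1) dv]
  show "act D \<rho> \<noteq> 0" "w (act D \<rho>) \<le> w \<rho> + brk 1"
    using A(2) wm(2) wYf brk1 by simp_all
qed

lemma upper:
  assumes j: "j \<in> {1..n}" "coord j D \<noteq> 0" "\<And>l. l \<in> {j+1..n} \<Longrightarrow> coord l D = 0"
    and \<rho>: "\<rho> \<noteq> 0" "int N dvd w \<rho> - int b"
  shows "act D \<rho> \<noteq> 0 \<and> w (act D \<rho>) \<le> w \<rho> + brk j"
proof -
  consider "j = n" | "j \<noteq> n" "j \<noteq> 1 \<or> z = 0" | "j = 1" "j \<noteq> n" "z \<noteq> 0" by blast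
  then show ?thesis
  proof cases
    case 1
    then show ?thesis using upper_n[OF _ \<rho>] j one_le_n(3) by (simp add: brk_def)
  next
    case 2
    then have "zz j = 0" by (simp add: zz_def)
    moreover have "brk j = int (b * p ^ (n - j))" using 2 by (auto simp: brk_def h1_def)
    ultimately show ?thesis using upper_1[OF j(1) _ j(2) \<rho>] by simp
  next
    case 3
    then have "coord n D = 0" using j(3)[of n] n_ge_2 by simp
    moreover have "coord 1 D \<noteq> 0" using 3 j(2) by simp
    ultimately show ?thesis using upper_star[OF 3(3) _ _ \<rho>] 3 by simp
  qed
qed

end

end

context trunc_group_algebra
begin

lemma tpow_0: "u \<in> carrier R \<Longrightarrow> tpow 0 u = \<one>\<^bsub>R\<^esub>"
proof
  fix g assume u: "u \<in> carrier R"
  have tb: "trunc_binomial 0 i = (if i = 0 then 1 else 0 :: 'a)" for i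
    by (induction i) (simp_all add: trunc_binomial_Suc)
  have "tpow 0 u g = (\<Sum>i<p. if i = 0 then \<one>\<^bsub>R\<^esub> g else 0)"
    unfolding tpow_def by (rule sum.cong) (simp_all add: tb)
  then show "tpow 0 u g = \<one>\<^bsub>R\<^esub> g" using p_gt_0 by simp
qed

lemma tprod_cong: "(\<And>i. i \<in> {1..m} \<Longrightarrow> c i = c' i) \<Longrightarrow> tprod u c m = tprod u c' m"
  by (induction m) auto

lemma cong_J_minus_one:
  assumes "x \<in> carrier R"
  shows "y \<doteq> x \<ominus>\<^bsub>R\<^esub> \<one>\<^bsub>R\<^esub> \<longleftrightarrow> (\<exists>x'. x' \<doteq> x \<and> y = x' \<ominus>\<^bsub>R\<^esub> \<one>\<^bsub>R\<^esub>)"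
proof
  assume y: "y \<doteq> x \<ominus>\<^bsub>R\<^esub> \<one>\<^bsub>R\<^esub>"
  then have yc: "y \<in> carrier R" by (simp add: cong_J_def)
  let ?x = "\<lambda>g. y g + \<one>\<^bsub>R\<^esub> g"
  have xc: "?x \<in> carrier R" using yc by (intro add_closed) auto
  have "?x \<doteq> x" using y xc assms by (simp add: cong_J_def R_minus algebra_simps)
  moreover have "y = ?x \<ominus>\<^bsub>R\<^esub> \<one>\<^bsub>R\<^esub>" using xc by (simp add: R_minus)
  ultimately show "\<exists>x'. x' \<doteq> x \<and> y = x' \<ominus>\<^bsub>R\<^esub> \<one>\<^bsub>R\<^esub>" by blast
next
  assume "\<exists>x'. x' \<doteq> x \<and> y = x' \<ominus>\<^bsub>R\<^esub> \<one>\<^bsub>R\<^esub>"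
  then obtain x' where x': "x' \<doteq> x" "y = x' \<ominus>\<^bsub>R\<^esub> \<one>\<^bsub>R\<^esub>" by blast
  then have "x' \<in> carrier R" by (simp add: cong_J_def)
  then show "y \<doteq> x \<ominus>\<^bsub>R\<^esub> \<one>\<^bsub>R\<^esub>" using x' assms by (auto simp: cong_J_def R_minus intro: minus_closed)
qed

lemma cong_J_minus_one_A:
  assumes "x \<doteq> y" "y \<ominus>\<^bsub>R\<^esub> \<one>\<^bsub>R\<^esub> \<in> A"
  shows "x \<ominus>\<^bsub>R\<^esub> \<one>\<^bsub>R\<^esub> \<in> A"
proof -
  have c: "x \<in> carrier R" "y \<in> carrier R" "(\<lambda>g. x g - y g) \<in> J" using assms by (auto simp: cong_J_def)
  have "J \<subseteq> Apow (Suc 0)" using k_gt_0 by (intro Apow_antimono) simp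
  then have "(\<lambda>g. x g - y g) \<in> A" using c(3) Apow_1 by blast
  then have "(\<Sum>g\<in>carrier G. x g) = (\<Sum>g\<in>carrier G. y g)" by (simp add: A_iff sum_subtractf)
  then show ?thesis using assms(2) c by (simp add: minus_one_A_iff)
qed

end

context scaffold
begin

section \<open>Classes in the truncated group ring\<close>

text \<open>Elements that \<open>G\<close> displaces by constants of \<open>F\<close>, such as the
  \<open>x i\<close> and the \<open>y i\<close>. \<open>A\<close> sends them into \<open>F\<close>
  and \<open>A^2\<close> sends them to 0; as k >= 2, elements of the group ring act on them through
  their classes.\<close>

definition transl :: "'a \<Rightarrow> bool" where "transl t \<longleftrightarrow> (\<forall>\<sigma>\<in>G. \<sigma> t - t \<in> F)"

lemma transl_x: "i \<in> {1..n} \<Longrightarrow> transl (x i)"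
  using chi_F by (auto simp: transl_def chi_def)

lemma transl_y: "i \<in> {1..n} \<Longrightarrow> transl (y i)"
  using psi_F by (auto simp: transl_def psi_def)

lemma act_A_transl:
  assumes "D \<in> GA.A" "transl t" shows "act D t \<in> F"
proof -
  have "act D t = (\<Sum>\<sigma>\<in>G. D \<sigma> * (\<sigma> t - t))" unfolding act_def by (rule D_sum_diff[OF assms(1)])
  also have "\<dots> \<in> F" using assms(2) by (intro F.closed_sum F.closed_mult D_F[OF assms(1)]) (auto simp: transl_def)
  finally show ?thesis .
qed

lemma act_A_const: "D \<in> GA.A \<Longrightarrow> s \<in> F \<Longrightarrow> act D s = 0"
proof -
  assume D: "D \<in> GA.A" and s: "s \<in> F"
  have "act D s = (\<Sum>\<sigma>\<in>G. D \<sigma> * s)"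
    unfolding act_def using s F_subset_K by (intro sum.cong) (auto simp: G_K)
  then show ?thesis by (simp add: sum_distrib_right[symmetric] D_aug[OF D])
qed

lemma act_J_transl:
  assumes "D \<in> GA.J" "transl t" shows "act D t = 0"
proof -
  have "D \<in> GA.Apow (Suc (Suc 0))" using assms(1) GA.Apow_antimono[of "Suc (Suc 0)" k] k_ge by auto
  then have "D \<in> ideal_prod GA.R (GA.Apow (Suc 0)) GA.A" by (simp only: GA.Apow_Suc)
  then show ?thesis
  proof (induction rule: ideal_prod.induct)
    case (prod i j)
    have i: "i \<in> GA.A" using prod GA.Apow_1 by blast
    then have "act (i \<otimes>\<^bsub>GA.R\<^esub> j) t = act i (act j t)"
      using prod by (intro act_mult) (auto intro: GA.A_carrier)
    also have "\<dots> = 0" by (rule act_A_const[OF i act_A_transl[OF prod(2) assms(2)]])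
    finally show ?case .
  next
    case (sum s1 s2)
    then show ?case by (simp add: GA.R_add act_coeff_add)
  qed
qed

lemma act_cong_transl: "GA.cong_J c c' \<Longrightarrow> transl t \<Longrightarrow> act c t = act c' t"
  using act_J_transl[of "\<lambda>g. c g - c' g" t] by (simp add: GA.cong_J_def act_coeff_diff)

definition unip :: "(('a \<Rightarrow> 'a) \<Rightarrow> 'a) \<Rightarrow> bool" where
  "unip c \<longleftrightarrow> c \<in> carrier GA.R \<and> c \<ominus>\<^bsub>GA.R\<^esub> \<one>\<^bsub>GA.R\<^esub> \<in> GA.A"

lemma act_unip_const: "unip c \<Longrightarrow> s \<in> F \<Longrightarrow> act c s = s"
  using act_A_const[of "c \<ominus>\<^bsub>GA.R\<^esub> \<one>\<^bsub>GA.R\<^esub>" s] by (simp add: unip_def act_minus_one)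

lemma act_unip_transl: "unip c \<Longrightarrow> transl t \<Longrightarrow> act c t - t \<in> F"
  using act_A_transl[of "c \<ominus>\<^bsub>GA.R\<^esub> \<one>\<^bsub>GA.R\<^esub>" t] by (simp add: unip_def act_minus_one)

lemma unip_mult: "unip c \<Longrightarrow> unip c' \<Longrightarrow> unip (c \<otimes>\<^bsub>GA.R\<^esub> c')"
  unfolding unip_def using GA.mult_minus_one_A by auto

text \<open>Displacement turns products into sums and, by \<open>act_tpow_transl\<close>, truncated
  powers into multiples. It is thus an F-linear form on the multiplicative vector space.\<close>

lemma act_mult_transl:
  assumes "unip c" "unip c'" "transl t"
  shows "act (c \<otimes>\<^bsub>GA.R\<^esub> c') t - t = (act c t - t) + (act c' t - t)"
proof -
  have "act (c \<otimes>\<^bsub>GA.R\<^esub> c') t = act c (act c' t)"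
    using assms by (intro act_mult) (auto simp: unip_def)
  also have "\<dots> = act c (t + (act c' t - t))" by simp
  also have "\<dots> = act c t + (act c' t - t)"
    unfolding act_add act_unip_const[OF assms(1) act_unip_transl[OF assms(2,3)]] ..
  finally show ?thesis by simp
qed

lemma act_tpow_transl:
  assumes c: "unip c" and t: "transl t"
  shows "act (GA.tpow s (c \<ominus>\<^bsub>GA.R\<^esub> \<one>\<^bsub>GA.R\<^esub>)) t - t = s * (act c t - t)"
proof -
  let ?k = "act c t - t"
  have k: "?k \<in> F" by (rule act_unip_transl[OF c t])
  have it: "(act c ^^ m) t = poly [:t, ?k:] (of_nat m)" for m
  proof (induction m)
    case (Suc m)
    have mk: "of_nat m * ?k \<in> F" using k by auto
    have "(act c ^^ Suc m) t = act c (t + of_nat m * ?k)" using Suc by simp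
    also have "\<dots> = act c t + of_nat m * ?k" unfolding act_add act_unip_const[OF c mk] ..
    finally show ?case by (simp add: algebra_simps)
  qed simp
  have "act (GA.tpow s (c \<ominus>\<^bsub>GA.R\<^esub> \<one>\<^bsub>GA.R\<^esub>)) t = poly [:t, ?k:] s"
    using c p_gt_1 by (intro act_tpow_newton it) (auto simp: unip_def)
  then show ?thesis by simp
qed

lemma act_tprod_transl:
  assumes v: "\<And>i. i \<in> {1..n} \<Longrightarrow> unip (v i)" and c: "\<And>i. i \<in> {1..n} \<Longrightarrow> c i \<in> F" and t: "transl t"
  shows "m \<le> n \<Longrightarrow> unip (GA.tprod (\<lambda>i. v i \<ominus>\<^bsub>GA.R\<^esub> \<one>\<^bsub>GA.R\<^esub>) c m) \<and>
    act (GA.tprod (\<lambda>i. v i \<ominus>\<^bsub>GA.R\<^esub> \<one>\<^bsub>GA.R\<^esub>) c m) t - t = (\<Sum>i=1..m. c i * (act (v i) t - t))"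
proof (induction m)
  case 0
  have "unip (\<one>\<^bsub>GA.R\<^esub>)" using GA.aug_one by (simp add: unip_def GA.minus_one_A_iff)
  then show ?case by simp
next
  case (Suc m)
  have Sm: "Suc m \<in> {1..n}" using Suc.prems by simp
  let ?T = "GA.tpow (c (Suc m)) (v (Suc m) \<ominus>\<^bsub>GA.R\<^esub> \<one>\<^bsub>GA.R\<^esub>)"
  have T: "unip ?T"
    using v[OF Sm] c[OF Sm] by (auto simp: unip_def intro: GA.tpow_closed GA.tpow_minus_one)
  let ?P = "GA.tprod (\<lambda>i. v i \<ominus>\<^bsub>GA.R\<^esub> \<one>\<^bsub>GA.R\<^esub>) c m"
  have IH: "unip ?P" "act ?P t - t = (\<Sum>i=1..m. c i * (act (v i) t - t))" using Suc by simp_all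
  show ?case
    unfolding GA.tprod.simps
    using unip_mult[OF IH(1) T] act_mult_transl[OF IH(1) T t] IH(2) act_tpow_transl[OF v[OF Sm] t]
    by simp
qed

lemma act_y: "j \<in> {1..n} \<Longrightarrow> act c (y j) - y j = (\<Sum>i=1..n. a j i * (act c (x i) - x i))"
  by (simp add: y_def act_sum act_K[OF a_K] sum_subtractf right_diff_distrib)

text \<open>The \<open>\<gamma> J\<close> are dual to the \<open>y l\<close>. \<open>shift\<close>
  is applied to \<open>y l\<close> alone, as a coefficient from \<open>Kfix J\<close> if l <= J and
  as a polynomial of degree 1 otherwise.\<close>

lemma act_\<gamma>_y:
  assumes J: "J \<in> {1..n}" and l: "l \<in> {1..n}"
  shows "act (\<gamma> J) (y l) - y l = (if l = J then 1 else 0)"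
proof (cases "l \<le> J")
  case True
  have "act (\<gamma> J) (y l * (\<Prod>i=J+1..n. poly 1 (y i))) =
      sg J (y l) * (\<Prod>i=J+1..n. poly (map_poly (sg J) 1) (y i))"
  proof (rule shiftD[OF \<gamma>_shift[OF J]])
    show "y l \<in> Kfix J" using y_Kfix[OF l] Kfix_mono[OF True] by blast
    show "coeff 1 i \<in> Kfix J" for i using Kfix_0 Kfix_1 by (cases i) auto
  qed (use p_gt_0 in simp)
  then have "act (\<gamma> J) (y l) = y l + a l J" using sg_y[OF l J] by (simp add: map_poly_1')
  moreover have "a l J = (if l = J then 1 else 0)" using a_diag[OF J] a_upper[OF l, of J] True by auto
  ultimately show ?thesis by simp
next
  case False
  define P where "P i = (if i = l then [:0, 1 :: 'a:] else 1)" for i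
  have mP: "map_poly (sg J) (P i) = P i" for i
    by (rule poly_eqI) (auto simp: P_def coeff_map_poly coeff_pCons split: nat.split)
  have "(\<Prod>i=J+1..n. poly (P i) (y i)) = (\<Prod>i=J+1..n. if i = l then y i else 1)"
    by (rule prod.cong) (auto simp: P_def)
  also have "\<dots> = y l" using False l by simp
  finally have pr: "(\<Prod>i=J+1..n. poly (P i) (y i)) = y l" .
  have "act (\<gamma> J) (1 * (\<Prod>i=J+1..n. poly (P i) (y i))) =
      sg J 1 * (\<Prod>i=J+1..n. poly (map_poly (sg J) (P i)) (y i))"
  proof (rule shiftD[OF \<gamma>_shift[OF J]])
    show "1 \<in> Kfix J" by (rule Kfix_1)
    show "degree (P i) < p" for i using p_gt_1 by (simp add: P_def)
    show "coeff (P i) r \<in> Kfix J" for i r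
      using Kfix_0 Kfix_1 by (auto simp: P_def coeff_pCons split: nat.split)
  qed
  then have "act (\<gamma> J) (y l) = y l" unfolding mP pr by simp
  then show ?thesis using False by simp
qed

abbreviation gen :: "nat \<Rightarrow> ('a \<Rightarrow> 'a) \<Rightarrow> 'a" where
  "gen \<equiv> \<lambda>i. group_ring_of (sg i) \<ominus>\<^bsub>GA.R\<^esub> \<one>\<^bsub>GA.R\<^esub>"

lemma unip_of: "\<sigma> \<in> G \<Longrightarrow> unip (group_ring_of \<sigma>)"
  by (simp add: unip_def GA.group_ring_of_minus_one)

lemma unip_\<gamma>: "j \<in> {1..n} \<Longrightarrow> unip (\<gamma> j)"
  by (simp add: unip_def \<gamma>_closed \<gamma>_minus_one)

lemma chi_id: "chi i id = 0"
  by (simp add: chi_def)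

text \<open>\<open>g\<close> is the product of the \<open>sg i\<close>, with natural exponents that
  represent the values \<open>chi i g\<close>.\<close>

lemma G_generated:
  assumes g: "g \<in> G"
  shows "\<exists>c. (\<forall>i\<in>{1..n}. c i \<in> F) \<and> GA.cong_J (group_ring_of g) (GA.tprod gen c n)"
proof -
  have "\<forall>i\<in>{1..n}. \<exists>m. chi i g = of_nat m"
    using chi_Fp[OF g] by (fastforce simp: Fp_def image_iff)
  from bchoice[OF this] obtain e where e: "\<And>i. i \<in> {1..n} \<Longrightarrow> chi i g = of_nat (e i)" by blast
  define h where "h m = rec_nat id (\<lambda>m r. r \<circ> (sg (Suc m) [^]\<^bsub>GM\<^esub> e (Suc m))) m" for m :: nat
  have h0: "h 0 = \<one>\<^bsub>GM\<^esub>" and hS: "h (Suc m) = h m \<otimes>\<^bsub>GM\<^esub> sg (Suc m) [^]\<^bsub>GM\<^esub> e (Suc m)" for m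
    by (simp_all add: h_def)
  have pG: "sg j [^]\<^bsub>GM\<^esub> (m::nat) \<in> G" for j m
    using GA.G.nat_pow_closed[of "sg j" m] by simp
  have chip: "chi i (sg j [^]\<^bsub>GM\<^esub> (m::nat)) = (if i = j then of_nat m else 0)" if "i \<in> {1..n}" for i j m
  proof (induction m)
    case 0
    have "sg j [^]\<^bsub>GM\<^esub> (0::nat) = id" by simp
    then show ?case using chi_id[of i] by (simp only: of_nat_0 if_cancel)
  next
    case (Suc m)
    have "sg j [^]\<^bsub>GM\<^esub> Suc m = (sg j [^]\<^bsub>GM\<^esub> m) \<circ> sg j" by simp
    then have eq: "chi i (sg j [^]\<^bsub>GM\<^esub> Suc m) = chi i (sg j [^]\<^bsub>GM\<^esub> m) + chi i (sg j)"
      using chi_comp[OF pG sg_G that, of j m j] by (simp only:)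
    show ?case unfolding eq chi_sg[OF that, of j] Suc by simp
  qed
  have hG: "h m \<in> G" for m
  proof (induction m)
    case 0
    show ?case unfolding h0 GM_simps by (rule G_id)
  next
    case (Suc m)
    show ?case unfolding hS GM_simps by (rule G_comp[OF Suc pG])
  qed
  have chih: "chi i (h m) = (if i \<le> m then of_nat (e i) else 0)" if "i \<in> {1..n}" for i m
  proof (induction m)
    case 0
    have "\<not> i \<le> 0" using that by simp
    then show ?case unfolding h0 GM_simps chi_id by (simp only: if_False)
  next
    case (Suc m)
    have "chi i (h (Suc m)) = chi i (h m) + chi i (sg (Suc m) [^]\<^bsub>GM\<^esub> e (Suc m))"
      unfolding hS GM_simps by (rule chi_comp[OF hG pG that])
    then show ?case using Suc chip[OF that] by auto
  qed
  have "h n = g" by (rule chi_inj[OF hG g]) (simp add: chih e)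
  moreover have "GA.cong_J (group_ring_of (h n)) (GA.tprod gen (\<lambda>i. of_nat (e i)) n)"
    using GA.tprod_group_pow[of n sg gen h e n] h0 hS by simp
  ultimately show ?thesis by (intro exI[of _ "\<lambda>i. of_nat (e i)"]) simp
qed

lemma triangular_inj:
  assumes "\<And>j. j \<in> {1..n} \<Longrightarrow> (\<Sum>i=1..n. a j i * c i) = (\<Sum>i=1..n. a j i * c' i)"
  shows "l \<in> {1..n} \<Longrightarrow> c l = c' l"
proof (induction l rule: less_induct)
  case (less l)
  have "(\<Sum>i=1..n. a l i * (c i - c' i)) = 0"
    using assms[OF less.prems] by (simp add: right_diff_distrib sum_subtractf)
  moreover have "a l i * (c i - c' i) = (if i = l then c l - c' l else 0)" if "i \<in> {1..n}" for i
  proof -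
    consider "i < l" | "i = l" | "i > l" by linarith
    then show ?thesis
      using less.IH[of i] that a_diag[OF less.prems] a_upper[OF less.prems, of i] by cases auto
  qed
  ultimately have "(\<Sum>i=1..n. if i = l then c l - c' l else 0) = 0" by simp
  then show ?case using less.prems by simp
qed

text \<open>A class of the span is rewritten in coordinates with respect to the
  \<open>\<gamma> i\<close>; the coordinates are the displacements of the \<open>y l\<close>.
  \<open>J\<close> is the largest index of a nonzero one. Factors of smaller index raise valuations
  by at least \<open>brk J\<close>, since the breaks decrease with the index.\<close>

lemma class_break:
  assumes sp: "A \<in> group_span p F GM k" and A1: "A \<noteq> trunc_class F GM k (\<one>\<^bsub>GA.R\<^esub>)"
  obtains J where "J \<in> {1..n}"
    "\<And>\<gamma>'. \<gamma>' \<in> A \<Longrightarrow> unip \<gamma>' \<and> act \<gamma>' (y J) \<noteq> y J \<and> (\<forall>l\<in>{J+1..n}. act \<gamma>' (y l) = y l)"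
    "\<exists>\<gamma>'\<in>A. vhat_ge (\<gamma>' \<ominus>\<^bsub>GA.R\<^esub> \<one>\<^bsub>GA.R\<^esub>) (brk J)"
proof -
  have genA: "gen i \<in> GA.A" for i by (simp add: GA.group_ring_of_minus_one)
  have "\<exists>c. (\<forall>i\<in>{1..n}. c i \<in> F) \<and> A = trunc_class F GM k (GA.tprod gen c n)"
    by (rule GA.group_span_tprod[OF genA _ sp]) (use G_generated in simp)
  then obtain c where c: "\<And>i. i \<in> {1..n} \<Longrightarrow> c i \<in> F" and Ac: "A = trunc_class F GM k (GA.tprod gen c n)" by blast
  let ?\<gamma>0 = "GA.tprod gen c n"
  have u: "unip (group_ring_of (sg i))" for i by (simp add: unip_of)
  have g0: "unip ?\<gamma>0" and g0x: "\<And>t. transl t \<Longrightarrow> act ?\<gamma>0 t - t = (\<Sum>i=1..n. c i * (sg i t - t))"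
    using act_tprod_transl[OF u c _ order_refl] transl_x[OF one_le_n(1)] by (simp_all add: act_of)
  define c' where "c' l = act ?\<gamma>0 (y l) - y l" for l
  have c'F: "c' l \<in> F" if "l \<in> {1..n}" for l
    unfolding c'_def by (rule act_unip_transl[OF g0 transl_y[OF that]])
  let ?\<delta> = "GA.tprod (\<lambda>i. \<gamma> i \<ominus>\<^bsub>GA.R\<^esub> \<one>\<^bsub>GA.R\<^esub>) c' n"
  have dl: "unip ?\<delta> \<and> act ?\<delta> t - t = (\<Sum>i=1..n. c' i * (act (\<gamma> i) t - t))" if "transl t" for t
    by (rule act_tprod_transl[where v = \<gamma> and c = c', OF _ _ that order_refl]) (use unip_\<gamma> c'F in auto)
  have d: "unip ?\<delta>" using dl[OF transl_x[OF one_le_n(1)]] by blast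
  have dy: "act ?\<delta> (y l) - y l = c' l" if l: "l \<in> {1..n}" for l
  proof -
    have "act ?\<delta> (y l) - y l = (\<Sum>i=1..n. c' i * (act (\<gamma> i) (y l) - y l))" using dl[OF transl_y[OF l]] by blast
    also have "\<dots> = (\<Sum>i=1..n. if i = l then c' l else 0)"
      by (rule sum.cong) (use act_\<gamma>_y l in auto)
    finally show ?thesis using l by simp
  qed
  \<comment> \<open>The two classes are compared through their coordinates with respect to the
    \<open>sg i\<close>, which are the displacements of the \<open>x i\<close>; so
    \<open>?\<delta>\<close> has to be expressed in these coordinates first.\<close>
  have dspan: "trunc_class F GM k ?\<delta> \<in> group_span p F GM k"
    by (rule GA.group_span_tprodI[where n = n and x = \<gamma> and c = c'])
      (use \<gamma>_closed \<gamma>_minus_one \<gamma>_span c'F in auto)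
  have "\<exists>c. (\<forall>i\<in>{1..n}. c i \<in> F) \<and> trunc_class F GM k ?\<delta> = trunc_class F GM k (GA.tprod gen c n)"
    by (rule GA.group_span_tprod[OF genA _ dspan]) (use G_generated in simp)
  then obtain b' where b': "\<And>i. i \<in> {1..n} \<Longrightarrow> b' i \<in> F"
    "trunc_class F GM k ?\<delta> = trunc_class F GM k (GA.tprod gen b' n)" by blast
  let ?\<gamma>1 = "GA.tprod gen b' n"
  have g1: "unip ?\<gamma>1" and g1x: "\<And>t. transl t \<Longrightarrow> act ?\<gamma>1 t - t = (\<Sum>i=1..n. b' i * (sg i t - t))"
    using act_tprod_transl[OF u b'(1) _ order_refl] transl_x[OF one_le_n(1)] by (simp_all add: act_of)
  have cg: "GA.cong_J ?\<delta> ?\<gamma>1"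
    using b'(2) GA.trunc_class_eq_iff[of ?\<delta> ?\<gamma>1] d g1 by (simp add: unip_def)
  have sgx: "(\<Sum>i=1..n. f i * (sg i (x l) - x l)) = f l" if "l \<in> {1..n}" for f l
  proof -
    have "(\<Sum>i=1..n. f i * (sg i (x l) - x l)) = (\<Sum>i=1..n. if i = l then f l else 0)"
      by (rule sum.cong) (use chi_sg[OF that] in \<open>auto simp: chi_def\<close>)
    then show ?thesis using that by simp
  qed
  have "(\<Sum>i=1..n. a j i * b' i) = (\<Sum>i=1..n. a j i * c i)" if j: "j \<in> {1..n}" for j
  proof -
    have "act ?\<gamma>1 (y j) - y j = act ?\<gamma>0 (y j) - y j"
      using act_cong_transl[OF cg transl_y[OF j]] dy[OF j] by (simp add: c'_def)
    moreover have "act ?\<gamma>1 (x i) - x i = b' i" "act ?\<gamma>0 (x i) - x i = c i" if "i \<in> {1..n}" for i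
      using g1x[OF transl_x[OF that]] g0x[OF transl_x[OF that]] sgx[OF that] by simp_all
    ultimately show ?thesis unfolding act_y[OF j]
      by (simp only: cong: sum.cong)
  qed
  then have "b' l = c l" if "l \<in> {1..n}" for l using triangular_inj[of b' c l] that by blast
  then have "?\<gamma>1 = ?\<gamma>0" by (rule GA.tprod_cong)
  then have Ad: "A = trunc_class F GM k ?\<delta>" using Ac b'(2) by simp
  have "\<exists>l\<in>{1..n}. c' l \<noteq> 0"
  proof (rule ccontr)
    assume "\<not> (\<exists>l\<in>{1..n}. c' l \<noteq> 0)"
    then have z: "c' l = 0" if "l \<in> {1..n}" for l using that by blast
    have "GA.tprod (\<lambda>i. \<gamma> i \<ominus>\<^bsub>GA.R\<^esub> \<one>\<^bsub>GA.R\<^esub>) c' m = \<one>\<^bsub>GA.R\<^esub>" if "m \<le> n" for m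
      using that
    proof (induction m)
      case (Suc m)
      then show ?case using z[of "Suc m"] \<gamma>_closed[of "Suc m"] by (simp add: GA.tpow_0)
    qed simp
    then show False using A1 Ad by simp
  qed
  then have fin: "finite {l\<in>{1..n}. c' l \<noteq> 0}" "{l\<in>{1..n}. c' l \<noteq> 0} \<noteq> {}" by auto
  define J where "J = Max {l\<in>{1..n}. c' l \<noteq> 0}"
  have J: "J \<in> {1..n}" "c' J \<noteq> 0" using Max_in[OF fin] by (auto simp: J_def)
  have Jmax: "l \<le> J" if "l \<in> {1..n}" "c' l \<noteq> 0" for l using Max_ge[OF fin(1)] that by (auto simp: J_def)
  show ?thesis
  proof (rule that[OF J(1)])
    fix \<gamma>' assume "\<gamma>' \<in> A"
    then have cg': "GA.cong_J \<gamma>' ?\<delta>" using Ad GA.mem_trunc_class d by (simp add: unip_def)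
    have "unip \<gamma>'"
      using cg' GA.cong_J_minus_one_A[OF cg'] d by (simp add: unip_def GA.cong_J_def)
    moreover have eq: "act \<gamma>' (y l) - y l = c' l" if "l \<in> {1..n}" for l
      using act_cong_transl[OF cg' transl_y[OF that]] dy[OF that] by simp
    moreover have "act \<gamma>' (y J) \<noteq> y J" using eq[OF J(1)] J(2) by auto
    moreover have "act \<gamma>' (y l) = y l" if l: "l \<in> {J+1..n}" for l
    proof -
      have "l \<in> {1..n}" "\<not> l \<le> J" using l by auto
      then have "c' l = 0" using Jmax[of l] by blast
      then show ?thesis using eq[OF \<open>l \<in> {1..n}\<close>] by simp
    qed
    ultimately show "unip \<gamma>' \<and> act \<gamma>' (y J) \<noteq> y J \<and> (\<forall>l\<in>{J+1..n}. act \<gamma>' (y l) = y l)" by blast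
  next
    have "vhat_ge (GA.tprod (\<lambda>i. \<gamma> i \<ominus>\<^bsub>GA.R\<^esub> \<one>\<^bsub>GA.R\<^esub>) c' m \<ominus>\<^bsub>GA.R\<^esub> \<one>\<^bsub>GA.R\<^esub>) (brk J)" if "m \<le> n" for m
      using that
    proof (induction m)
      case 0
      then show ?case by (simp add: vhat_ge_def act_minus_one)
    next
      case (Suc m)
      have Sm: "Suc m \<in> {1..n}" using Suc.prems by simp
      have T: "vhat_ge (GA.tpow (c' (Suc m)) (\<gamma> (Suc m) \<ominus>\<^bsub>GA.R\<^esub> \<one>\<^bsub>GA.R\<^esub>) \<ominus>\<^bsub>GA.R\<^esub> \<one>\<^bsub>GA.R\<^esub>) (brk J)"
      proof (cases "c' (Suc m) = 0")
        case True
        then have "GA.tpow (c' (Suc m)) (\<gamma> (Suc m) \<ominus>\<^bsub>GA.R\<^esub> \<one>\<^bsub>GA.R\<^esub>) = \<one>\<^bsub>GA.R\<^esub>"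
          using \<gamma>_closed[OF Sm] by (simp add: GA.tpow_0)
        then show ?thesis by (simp add: vhat_ge_def act_minus_one)
      next
        case False
        have "brk J \<le> brk (Suc m)" by (rule brk_antimono[OF Sm J(1) Jmax[OF Sm False]])
        moreover have "vhat_ge (GA.tpow (c' (Suc m)) (\<gamma> (Suc m) \<ominus>\<^bsub>GA.R\<^esub> \<one>\<^bsub>GA.R\<^esub>) \<ominus>\<^bsub>GA.R\<^esub> \<one>\<^bsub>GA.R\<^esub>) (brk (Suc m))"
          using brk_pos[of "Suc m"] by (intro vhat_ge_tpow \<gamma>_minus_one vhat_\<gamma> c'F Sm) simp
        ultimately show ?thesis by (rule vhat_ge_mono[rotated])
      qed
      have "GA.tprod (\<lambda>i. \<gamma> i \<ominus>\<^bsub>GA.R\<^esub> \<one>\<^bsub>GA.R\<^esub>) c' m \<in> carrier GA.R"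
        using act_tprod_transl[where v = \<gamma> and c = c' and t = "x 1" and m = m] unip_\<gamma> c'F transl_x[OF one_le_n(1)] Suc.prems
        by (simp add: unip_def)
      moreover have "GA.tpow (c' (Suc m)) (\<gamma> (Suc m) \<ominus>\<^bsub>GA.R\<^esub> \<one>\<^bsub>GA.R\<^esub>) \<in> carrier GA.R"
        by (intro GA.tpow_closed c'F \<gamma>_minus_one Sm)
      ultimately show ?case using Suc T unfolding GA.tprod.simps by (intro vhat_ge_mult_minus_one) auto
    qed
    moreover have "?\<delta> \<in> A" unfolding Ad using d GA.cong_J_refl[of ?\<delta>] by (simp add: GA.mem_trunc_class unip_def)
    ultimately show "\<exists>\<gamma>'\<in>A. vhat_ge (\<gamma>' \<ominus>\<^bsub>GA.R\<^esub> \<one>\<^bsub>GA.R\<^esub>) (brk J)" by blast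
  qed
qed

section \<open>From classes to the two kinds of refined breaks\<close>

definition val :: "'a \<Rightarrow> ereal" where "val u = (if u = 0 then \<infinity> else ereal (of_int (w u)))"

lemma vge_val: "vge u m \<longleftrightarrow> ereal (of_int m) \<le> val u"
  by (simp add: vge_def val_def)

lemma one_class: "\<one>\<^bsub>trunc_ring F GM k\<^esub> = trunc_class F GM k (\<one>\<^bsub>GA.R\<^esub>)"
  by (simp add: FactRing_def)

text \<open>One number that serves both kinds of breaks: no representative raises a valuation
  criterion element by more, and some representative raises every element by at least as
  much.\<close>

definition class_brk :: "(('a \<Rightarrow> 'a) \<Rightarrow> 'a) set \<Rightarrow> int \<Rightarrow> bool" where
  "class_brk A h \<longleftrightarrow>
     (\<forall>\<gamma>'\<in>A. \<forall>\<rho>. \<rho> \<noteq> 0 \<longrightarrow> int N dvd w \<rho> - int b \<longrightarrow>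
        act (\<gamma>' \<ominus>\<^bsub>GA.R\<^esub> \<one>\<^bsub>GA.R\<^esub>) \<rho> \<noteq> 0 \<and> w (act (\<gamma>' \<ominus>\<^bsub>GA.R\<^esub> \<one>\<^bsub>GA.R\<^esub>) \<rho>) \<le> w \<rho> + h) \<and>
     (\<exists>\<gamma>'\<in>A. vhat_ge (\<gamma>' \<ominus>\<^bsub>GA.R\<^esub> \<one>\<^bsub>GA.R\<^esub>) h)"

lemma class_brkI:
  assumes J: "J \<in> {1..n}"
    and A: "\<And>\<gamma>'. \<gamma>' \<in> A \<Longrightarrow> unip \<gamma>' \<and> act \<gamma>' (y J) \<noteq> y J \<and> (\<forall>l\<in>{J+1..n}. act \<gamma>' (y l) = y l)"
    and v: "\<exists>\<gamma>'\<in>A. vhat_ge (\<gamma>' \<ominus>\<^bsub>GA.R\<^esub> \<one>\<^bsub>GA.R\<^esub>) (brk J)"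
  shows "class_brk A (brk J)"
  unfolding class_brk_def
proof (intro conjI ballI allI impI v)
  fix \<gamma>' \<rho> assume g: "\<gamma>' \<in> A" and \<rho>: "\<rho> \<noteq> 0" "int N dvd w \<rho> - int b"
  have c: "\<gamma>' \<in> carrier GA.R" "\<gamma>' \<ominus>\<^bsub>GA.R\<^esub> \<one>\<^bsub>GA.R\<^esub> \<in> GA.A" using A[OF g] by (simp_all add: unip_def)
  have "coord J (\<gamma>' \<ominus>\<^bsub>GA.R\<^esub> \<one>\<^bsub>GA.R\<^esub>) \<noteq> 0"
    "\<And>l. l \<in> {J+1..n} \<Longrightarrow> coord l (\<gamma>' \<ominus>\<^bsub>GA.R\<^esub> \<one>\<^bsub>GA.R\<^esub>) = 0"
    using A[OF g] by (simp_all add: coord_def act_minus_one[OF c(1)])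
  from upper[OF c(2) J this \<rho>]
  show "act (\<gamma>' \<ominus>\<^bsub>GA.R\<^esub> \<one>\<^bsub>GA.R\<^esub>) \<rho> \<noteq> 0" "w (act (\<gamma>' \<ominus>\<^bsub>GA.R\<^esub> \<one>\<^bsub>GA.R\<^esub>) \<rho>) \<le> w \<rho> + brk J"
    by blast+
qed

lemma class_brk_exists:
  assumes "A \<in> group_span p F GM k" "A \<noteq> \<one>\<^bsub>trunc_ring F GM k\<^esub>"
  shows "\<exists>J\<in>{1..n}. class_brk A (brk J)"
proof (rule class_break[OF assms(1)])
  show "A \<noteq> trunc_class F GM k (\<one>\<^bsub>GA.R\<^esub>)" using assms(2) unfolding one_class .
next
  fix J assume J: "J \<in> {1..n}"
    "\<And>\<gamma>'. \<gamma>' \<in> A \<Longrightarrow> unip \<gamma>' \<and> act \<gamma>' (y J) \<noteq> y J \<and> (\<forall>l\<in>{J+1..n}. act \<gamma>' (y l) = y l)"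
    "\<exists>\<gamma>'\<in>A. vhat_ge (\<gamma>' \<ominus>\<^bsub>GA.R\<^esub> \<one>\<^bsub>GA.R\<^esub>) (brk J)"
  show "\<exists>J\<in>{1..n}. class_brk A (brk J)" using class_brkI[OF J] J(1) by blast
qed

text \<open>The class of \<open>\<gamma> J\<close> works: it displaces \<open>y J\<close> by 1 and
  leaves the other \<open>y l\<close> in place.\<close>

lemma class_brk_surj:
  assumes J: "J \<in> {1..n}"
  shows "\<exists>A\<in>group_span p F GM k. A \<noteq> \<one>\<^bsub>trunc_ring F GM k\<^esub> \<and> class_brk A (brk J)"
proof -
  let ?A = "trunc_class F GM k (\<gamma> J)"
  have gc: "\<gamma> J \<in> carrier GA.R" by (rule \<gamma>_closed[OF J])
  have ne: "?A \<noteq> trunc_class F GM k (\<one>\<^bsub>GA.R\<^esub>)"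
  proof
    assume "?A = trunc_class F GM k (\<one>\<^bsub>GA.R\<^esub>)"
    then have "GA.cong_J (\<gamma> J) (\<one>\<^bsub>GA.R\<^esub>)" using GA.trunc_class_eq_iff[OF gc, of "\<one>\<^bsub>GA.R\<^esub>"] by simp
    then have "act (\<gamma> J) (y J) = y J" using act_cong_transl[OF _ transl_y[OF J]] by fastforce
    then show False using act_\<gamma>_y[OF J J] by simp
  qed
  have "class_brk ?A (brk J)"
  proof (rule class_break[OF \<gamma>_span[OF J] ne])
    fix I assume I: "I \<in> {1..n}"
      "\<And>\<gamma>'. \<gamma>' \<in> ?A \<Longrightarrow> unip \<gamma>' \<and> act \<gamma>' (y I) \<noteq> y I \<and> (\<forall>l\<in>{I+1..n}. act \<gamma>' (y l) = y l)"
      "\<exists>\<gamma>'\<in>?A. vhat_ge (\<gamma>' \<ominus>\<^bsub>GA.R\<^esub> \<one>\<^bsub>GA.R\<^esub>) (brk I)"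
    have "\<gamma> J \<in> ?A" using GA.mem_trunc_class[OF gc] GA.cong_J_refl[OF gc] by blast
    then have "act (\<gamma> J) (y I) \<noteq> y I" using I(2) by blast
    then have "I = J" using act_\<gamma>_y[OF J I(1)] by (cases "I = J") auto
    then show ?thesis using class_brkI[OF I] by simp
  qed
  then show ?thesis using \<gamma>_span[OF J] ne one_class by metis
qed

context
  assumes Gal: "Gal K = GM"
begin

lemma group_ring_act_eq: "group_ring_act K c u = act c u"
  by (simp add: group_ring_act_def act_def Gal)

lemma vc_element_iff: "vc_element p n b val \<rho> \<longleftrightarrow> \<rho> \<noteq> 0 \<and> int N dvd w \<rho> - int b"
  by (auto simp: vc_element_def val_def cong_iff_dvd_diff N_eq)

lemma vc_element_exists: "\<exists>\<rho>. vc_element p n b val \<rho>"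
  using pi by (intro exI[of _ "\<pi> ^ b"]) (simp add: vc_element_iff)

lemma vc_index_eq:
  assumes A: "class_brk A h" and \<rho>: "vc_element p n b val \<rho>"
  shows "vc_index F K val \<rho> A - val \<rho> = ereal (of_int h)"
proof -
  have r: "\<rho> \<noteq> 0" "int N dvd w \<rho> - int b" using \<rho> by (simp_all add: vc_element_iff)
  have "(SUP \<gamma>'\<in>A. val (act (\<gamma>' \<ominus>\<^bsub>GA.R\<^esub> \<one>\<^bsub>GA.R\<^esub>) \<rho>)) = ereal (of_int (w \<rho> + h))"
  proof (rule antisym)
    show "(SUP \<gamma>'\<in>A. val (act (\<gamma>' \<ominus>\<^bsub>GA.R\<^esub> \<one>\<^bsub>GA.R\<^esub>) \<rho>)) \<le> ereal (of_int (w \<rho> + h))"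
    proof (rule SUP_least)
      fix \<gamma>' assume "\<gamma>' \<in> A"
      then have "act (\<gamma>' \<ominus>\<^bsub>GA.R\<^esub> \<one>\<^bsub>GA.R\<^esub>) \<rho> \<noteq> 0 \<and> w (act (\<gamma>' \<ominus>\<^bsub>GA.R\<^esub> \<one>\<^bsub>GA.R\<^esub>) \<rho>) \<le> w \<rho> + h"
        using A r unfolding class_brk_def by blast
      then show "val (act (\<gamma>' \<ominus>\<^bsub>GA.R\<^esub> \<one>\<^bsub>GA.R\<^esub>) \<rho>) \<le> ereal (of_int (w \<rho> + h))"
        unfolding val_def ereal_less_eq(3) of_int_le_iff by (simp only: if_False ereal_less_eq(3) of_int_le_iff)
    qed
    obtain \<gamma>' where g: "\<gamma>' \<in> A" "vhat_ge (\<gamma>' \<ominus>\<^bsub>GA.R\<^esub> \<one>\<^bsub>GA.R\<^esub>) h"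
      using A unfolding class_brk_def by blast
    show "ereal (of_int (w \<rho> + h)) \<le> (SUP \<gamma>'\<in>A. val (act (\<gamma>' \<ominus>\<^bsub>GA.R\<^esub> \<one>\<^bsub>GA.R\<^esub>) \<rho>))"
      by (rule SUP_upper2[OF g(1)]) (use vhat_geD[OF g(2) vge_w] in \<open>simp only: vge_val\<close>)
  qed
  then have "vc_index F K val \<rho> A = ereal (of_int (w \<rho> + h))"
    unfolding vc_index_def Let_def Gal group_ring_act_eq .
  then show ?thesis using r by (simp add: val_def)
qed

lemma vc_set_eq:
  assumes \<rho>: "vc_element p n b val \<rho>"
  shows "vc_set p F K val k \<rho> = (\<lambda>j. ereal (of_int (brk j))) ` {1..n}"
proof (intro equalityI subsetI)
  fix h assume "h \<in> vc_set p F K val k \<rho>"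
  then obtain A where A: "h = vc_index F K val \<rho> A - val \<rho>"
    "A \<in> group_span p F GM k" "A \<noteq> \<one>\<^bsub>trunc_ring F GM k\<^esub>"
    unfolding vc_set_def Gal by blast
  then show "h \<in> (\<lambda>j. ereal (of_int (brk j))) ` {1..n}"
    using class_brk_exists[OF A(2,3)] vc_index_eq[OF _ \<rho>] by (metis imageI)
next
  fix h assume "h \<in> (\<lambda>j. ereal (of_int (brk j))) ` {1..n}"
  then obtain J where J: "J \<in> {1..n}" "h = ereal (of_int (brk J))" by blast
  obtain A where A: "A \<in> group_span p F GM k" "A \<noteq> \<one>\<^bsub>trunc_ring F GM k\<^esub>" "class_brk A (brk J)"
    using class_brk_surj[OF J(1)] by blast
  have "h = vc_index F K val \<rho> A - val \<rho>" using vc_index_eq[OF A(3) \<rho>] J(2) by simp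
  then show "h \<in> vc_set p F K val k \<rho>" unfolding vc_set_def Gal using A by blast
qed

lemma class_minus_one:
  assumes "A \<in> group_span p F GM k"
  shows "A \<ominus>\<^bsub>trunc_ring F GM k\<^esub> \<one>\<^bsub>trunc_ring F GM k\<^esub> = (\<lambda>\<gamma>'. \<gamma>' \<ominus>\<^bsub>GA.R\<^esub> \<one>\<^bsub>GA.R\<^esub>) ` A"
proof -
  obtain c where c: "c \<in> carrier GA.R" "A = trunc_class F GM k c"
    using GA.group_span_carrier_rep[OF assms] by blast
  have c1: "c \<ominus>\<^bsub>GA.R\<^esub> \<one>\<^bsub>GA.R\<^esub> \<in> carrier GA.R" using c(1) by simp
  show ?thesis
    unfolding c(2) GA.trunc_class_minus_one[OF c(1)]
    using GA.mem_trunc_class[OF c1] GA.mem_trunc_class[OF c(1)] GA.cong_J_minus_one[OF c(1)] by blast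
qed

lemma op_valuation_ge: "vhat_ge D h \<Longrightarrow> ereal (of_int h) \<le> op_valuation K val D"
  unfolding op_valuation_def group_ring_act_eq
proof (rule INF_greatest)
  fix u :: 'a assume D: "vhat_ge D h" and u: "u \<in> UNIV - {0}"
  have "ereal (of_int (w u + h)) \<le> val (act D u)" using vhat_geD[OF D vge_w, of u] by (simp only: vge_val)
  then show "ereal (of_int h) \<le> val (act D u) - val u"
    using u by (auto simp: val_def)
qed

lemma class_valuation_eq:
  assumes sp: "A \<in> group_span p F GM k" and A: "class_brk A h"
  shows "class_valuation K val (A \<ominus>\<^bsub>trunc_ring F GM k\<^esub> \<one>\<^bsub>trunc_ring F GM k\<^esub>) = ereal (of_int h)"
  unfolding class_valuation_def class_minus_one[OF sp] image_image
proof (rule antisym)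
  obtain \<rho> where "vc_element p n b val \<rho>" using vc_element_exists by blast
  then have r: "\<rho> \<noteq> 0" "int N dvd w \<rho> - int b" by (simp_all add: vc_element_iff)
  show "(SUP \<gamma>'\<in>A. op_valuation K val (\<gamma>' \<ominus>\<^bsub>GA.R\<^esub> \<one>\<^bsub>GA.R\<^esub>)) \<le> ereal (of_int h)"
  proof (rule SUP_least)
    fix \<gamma>' assume "\<gamma>' \<in> A"
    then have a: "act (\<gamma>' \<ominus>\<^bsub>GA.R\<^esub> \<one>\<^bsub>GA.R\<^esub>) \<rho> \<noteq> 0" "w (act (\<gamma>' \<ominus>\<^bsub>GA.R\<^esub> \<one>\<^bsub>GA.R\<^esub>) \<rho>) \<le> w \<rho> + h"
      using A r unfolding class_brk_def by blast+
    show "op_valuation K val (\<gamma>' \<ominus>\<^bsub>GA.R\<^esub> \<one>\<^bsub>GA.R\<^esub>) \<le> ereal (of_int h)"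
      unfolding op_valuation_def group_ring_act_eq
    proof (rule INF_lower2)
      show "\<rho> \<in> UNIV - {0}" using r by simp
      have "val (act (\<gamma>' \<ominus>\<^bsub>GA.R\<^esub> \<one>\<^bsub>GA.R\<^esub>) \<rho>) = ereal (of_int (w (act (\<gamma>' \<ominus>\<^bsub>GA.R\<^esub> \<one>\<^bsub>GA.R\<^esub>) \<rho>)))"
        unfolding val_def using a(1) by (simp only: if_False)
      moreover have "real_of_int (w (act (\<gamma>' \<ominus>\<^bsub>GA.R\<^esub> \<one>\<^bsub>GA.R\<^esub>) \<rho>)) - real_of_int (w \<rho>) \<le> real_of_int h"
        using a(2) by linarith
      ultimately show "val (act (\<gamma>' \<ominus>\<^bsub>GA.R\<^esub> \<one>\<^bsub>GA.R\<^esub>) \<rho>) - val \<rho> \<le> ereal (of_int h)"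
        using r(1) by (simp add: val_def)
    qed
  qed
  obtain \<gamma>' where g: "\<gamma>' \<in> A" "vhat_ge (\<gamma>' \<ominus>\<^bsub>GA.R\<^esub> \<one>\<^bsub>GA.R\<^esub>) h"
    using A unfolding class_brk_def by blast
  show "ereal (of_int h) \<le> (SUP \<gamma>'\<in>A. op_valuation K val (\<gamma>' \<ominus>\<^bsub>GA.R\<^esub> \<one>\<^bsub>GA.R\<^esub>))"
    using op_valuation_ge[OF g(2)] by (rule SUP_upper2[OF g(1)])
qed

lemma class_valuation_one:
  assumes sp: "\<one>\<^bsub>trunc_ring F GM k\<^esub> \<in> group_span p F GM k"
  shows "ereal (of_int h) \<le> class_valuation K val
    (\<one>\<^bsub>trunc_ring F GM k\<^esub> \<ominus>\<^bsub>trunc_ring F GM k\<^esub> \<one>\<^bsub>trunc_ring F GM k\<^esub>)"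
  unfolding class_valuation_def class_minus_one[OF sp] image_image
proof (rule SUP_upper2)
  show "\<one>\<^bsub>GA.R\<^esub> \<in> \<one>\<^bsub>trunc_ring F GM k\<^esub>" unfolding one_class
    using GA.mem_trunc_class[of "\<one>\<^bsub>GA.R\<^esub>"] GA.cong_J_refl[of "\<one>\<^bsub>GA.R\<^esub>"] by simp
  show "ereal (of_int h) \<le> op_valuation K val (\<one>\<^bsub>GA.R\<^esub> \<ominus>\<^bsub>GA.R\<^esub> \<one>\<^bsub>GA.R\<^esub>)"
    by (rule op_valuation_ge) (simp add: vhat_ge_def act_minus_one)
qed

text \<open>A class other than 1 with break h' belongs to exactly the levels up to h', and the class
  1 to all levels. So a level changes precisely at a number \<open>brk J\<close>.\<close>

lemma ss_breaks_eq: "ss_breaks p F K val k = brk ` {1..n}"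
proof -
  have mem: "A \<in> ss_filtration p F K val k h \<longleftrightarrow> A \<in> group_span p F GM k \<and>
      (A = \<one>\<^bsub>trunc_ring F GM k\<^esub> \<or> h \<le> h')"
    if "A \<noteq> \<one>\<^bsub>trunc_ring F GM k\<^esub> \<Longrightarrow> A \<in> group_span p F GM k \<Longrightarrow> class_brk A h'" for A h h'
    unfolding ss_filtration_def Let_def Gal mem_Collect_eq
    using that class_valuation_eq[of A h'] class_valuation_one[of h]
    by (cases "A = \<one>\<^bsub>trunc_ring F GM k\<^esub>") auto
  show ?thesis
  proof (intro equalityI subsetI)
    fix h assume "h \<in> ss_breaks p F K val k"
    then obtain A where A: "A \<in> ss_filtration p F K val k (h + 1) \<longleftrightarrow> A \<notin> ss_filtration p F K val k h"
      unfolding ss_breaks_def by blast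
    then have sp: "A \<in> group_span p F GM k" unfolding ss_filtration_def Let_def Gal by blast
    have "A \<noteq> \<one>\<^bsub>trunc_ring F GM k\<^esub>" using A mem[of A h] mem[of A "h + 1"] sp by blast
    from class_brk_exists[OF sp this] obtain J where J: "J \<in> {1..n}" "class_brk A (brk J)" by blast
    have "h + 1 \<le> brk J \<longleftrightarrow> \<not> h \<le> brk J"
      using A mem[OF J(2), of h] mem[OF J(2), of "h + 1"] sp \<open>A \<noteq> _\<close> by blast
    then have "h = brk J" by linarith
    then show "h \<in> brk ` {1..n}" using J by blast
  next
    fix h assume "h \<in> brk ` {1..n}"
    then obtain J where J: "J \<in> {1..n}" "h = brk J" by blast
    obtain A where A: "A \<in> group_span p F GM k" "A \<noteq> \<one>\<^bsub>trunc_ring F GM k\<^esub>" "class_brk A (brk J)"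
      using class_brk_surj[OF J(1)] by blast
    have "A \<in> ss_filtration p F K val k h" "A \<notin> ss_filtration p F K val k (h + 1)"
      using mem[OF A(3)] A(1,2) J(2) by auto
    then show "h \<in> ss_breaks p F K val k"
      using brk_pos[of J] J(2) unfolding ss_breaks_def by auto
  qed
qed

lemma refined_breaks:
  assumes "B = (\<lambda>j. ereal (of_int (brk j))) ` {1..n}"
  shows "vc_breaks_defined p n b F K val k \<and> vc_breaks p n b F K val k = B \<and>
    (\<lambda>h. ereal (of_int h)) ` ss_breaks p F K val k = B"
proof (intro conjI)
  show "vc_breaks_defined p n b F K val k"
    unfolding vc_breaks_defined_def using vc_set_eq by simp
  show "vc_breaks p n b F K val k = B"
    unfolding vc_breaks_def
  proof (rule the_equality)
    show "\<forall>\<rho>. vc_element p n b val \<rho> \<longrightarrow> vc_set p F K val k \<rho> = B" using vc_set_eq assms by simp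
    show "C = B" if "\<forall>\<rho>. vc_element p n b val \<rho> \<longrightarrow> vc_set p F K val k \<rho> = C" for C
      using vc_element_exists vc_set_eq assms that by metis
  qed
  show "(\<lambda>h. ereal (of_int h)) ` ss_breaks p F K val k = B"
    unfolding ss_breaks_eq assms image_image ..
qed

end

text \<open>z = 0 goes with e p^(n-1) < b and z nonzero with e p^(n-1) > b, and this comparison
  decides the minimum.\<close>

lemma brk_1: "brk 1 = min (h1 - int (e * p ^ (n - 1)) + int b) h1"
proof (cases "z = 0")
  case True
  then have "int (e * p ^ (n - 1)) < int b" using z_cases by (auto simp del: of_nat_mult of_nat_power)
  then show ?thesis unfolding brk_def using True by (simp add: min_def del: of_nat_mult of_nat_power)
next
  case False
  then have "int b < int (e * p ^ (n - 1))" using z_cases by (auto simp del: of_nat_mult of_nat_power)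
  then show ?thesis unfolding brk_def using False by (simp add: min_def del: of_nat_mult of_nat_power)
qed

lemma brk_image:
  "(\<lambda>j. ereal (of_int (brk j))) ` {1..n} =
    {ereal (real b * real p ^ i) | i. i \<le> n - 2} \<union> {ereal (of_int (brk 1))}"
proof -
  have "{1..n} = insert 1 ((\<lambda>i. n - i) ` {..n-2})"
  proof (intro equalityI subsetI)
    fix j assume j: "j \<in> {1..n}"
    show "j \<in> insert 1 ((\<lambda>i. n - i) ` {..n-2})"
    proof (cases "j = 1")
      case False
      then have "j = n - (n - j)" "n - j \<in> {..n-2}" using j by auto
      then show ?thesis by blast
    qed simp
  qed (use n_ge_2 in auto)
  moreover have "ereal (of_int (brk (n - i))) = ereal (real b * real p ^ i)" if "i \<le> n - 2" for i
  proof -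
    have "n - i \<noteq> 1" "n - (n - i) = i" using that n_ge_2 by auto
    then show ?thesis by (simp add: brk_def)
  qed
  ultimately show ?thesis by (auto simp: image_image)
qed

end

section \<open>The given extension\<close>

lemma combine_eq_sum:
  "ring.combine top_field Ks Us = (\<Sum>i<min (length Ks) (length Us). Ks ! i * (Us ! i :: 'a::field))"
proof -
  interpret T: ring "top_field :: 'a ring" by (rule ring_from_type_algebra)
  show ?thesis
    by (induction Ks Us rule: T.combine.induct)
      (simp_all add: sum.lessThan_Suc_shift del: sum.lessThan_Suc)
qed

lemma carrier_Gal:
  "\<sigma> \<in> carrier (Gal K) \<longleftrightarrow> bij \<sigma> \<and> (\<forall>x y. \<sigma> (x + y) = \<sigma> x + \<sigma> y) \<and>
    (\<forall>x y. \<sigma> (x * y) = \<sigma> x * \<sigma> y) \<and> \<sigma> 1 = 1 \<and> (\<forall>x\<in>K. \<sigma> x = x)"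
  by (auto simp: Gal_def ring_iso_def ring_hom_def)

lemma Gal_inv:
  assumes "\<sigma> \<in> carrier (Gal K)"
  shows "inv_into UNIV \<sigma> \<in> carrier (Gal K)"
proof -
  have s: "bij \<sigma>" "\<And>x y. \<sigma> (x + y) = \<sigma> x + \<sigma> y" "\<And>x y. \<sigma> (x * y) = \<sigma> x * \<sigma> y" "\<sigma> 1 = 1"
    "\<And>x. x \<in> K \<Longrightarrow> \<sigma> x = x"
    using assms by (auto simp: carrier_Gal)
  have si: "\<sigma> (inv_into UNIV \<sigma> x) = x" for x using s(1) by (simp add: bij_is_surj surj_f_inv_f)
  have eqI: "inv_into UNIV \<sigma> x = y" if "x = \<sigma> y" for x y using s(1) that by (simp add: bij_is_inj)
  show ?thesis
    unfolding carrier_Gal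
    by (intro conjI allI ballI bij_imp_bij_inv s(1) eqI) (simp_all add: s si)
qed

lemma card_elementary_abelian:
  assumes "p > 0" "G \<cong> product_group {1..n} (\<lambda>_. integer_mod_group p)"
  shows "finite (carrier G)" "card (carrier G) = p ^ n"
proof -
  have fin: "finite (carrier (product_group {1..n} (\<lambda>_. integer_mod_group p)))"
    "card (carrier (product_group {1..n} (\<lambda>_. integer_mod_group p))) = p ^ n"
    using assms(1) by (simp_all add: carrier_integer_mod_group card_PiE finite_PiE)
  obtain h where "bij_betw h (carrier G) (carrier (product_group {1..n} (\<lambda>_. integer_mod_group p)))"
    using assms(2) by (auto simp: is_iso_def iso_def)
  then show "finite (carrier G)" "card (carrier G) = p ^ n"
    using fin bij_betw_finite bij_betw_same_card by metis+
qed

lemma generate_field_fixed: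
  assumes s: "\<sigma> \<in> carrier (Gal K)" and H: "\<And>x. x \<in> H \<Longrightarrow> \<sigma> x = x"
    and u: "u \<in> generate_field top_field H"
  shows "\<sigma> u = u"
proof -
  have hom: "\<sigma> (x + y) = \<sigma> x + \<sigma> y" "\<sigma> (x * y) = \<sigma> x * \<sigma> y" "\<sigma> 1 = 1" for x y
    using s by (auto simp: carrier_Gal)
  have "\<sigma> 0 + \<sigma> 0 = \<sigma> 0 + 0" using hom(1)[of 0 0] by (simp only: add_0_right)
  then have s0: "\<sigma> 0 = 0" by (simp only: add_left_cancel)
  from u show ?thesis
  proof induction
    case (a_inv h)
    have "\<sigma> h + \<sigma> (- h) = 0" using hom(1)[of h "- h"] s0 by simp
    then show ?case using a_inv by (simp add: add_eq_0_iff)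
  next
    case (m_inv h)
    then have h: "h \<noteq> 0" by simp
    have "h * \<sigma> (inverse h) = 1" using hom(2)[of h "inverse h"] hom(3) h m_inv.IH by simp
    from inverse_unique[OF this] show ?case unfolding top_field_inv[OF h] by (rule sym)
  qed (use H hom in simp_all)
qed

text \<open>The powers of \<pi> with exponent below \<open>N\<close> are independent over
  \<open>K\<close> because their valuations differ modulo \<open>N\<close>, and their number is the
  degree.\<close>

lemma (in valued) powers_span:
  assumes K: "subfield K top_field" "ring.finite_dimension top_field K UNIV"
    and N: "N = ring.dim top_field K UNIV"
    and wK: "\<And>u. u \<in> K \<Longrightarrow> u \<noteq> 0 \<Longrightarrow> int N dvd w u" and pi: "\<pi> \<noteq> 0" "w \<pi> = 1"
  shows "N > 0" "\<exists>k. (\<forall>i. k i \<in> K) \<and> x = (\<Sum>i<N. k i * \<pi> ^ i)"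
proof -
  interpret T: ring "top_field :: 'a ring" by (rule ring_from_type_algebra)
  interpret K: subfield_of_type K by (rule subfield_of_type.intro) (rule K(1))
  have dim: "T.dimension N K UNIV"
    using T.finite_dimensionE[OF K] by (simp add: N over_def)
  show N0: "N > 0"
  proof (rule ccontr)
    assume "\<not> N > 0"
    then have "(UNIV :: 'a set) = {0}" using T.dimension_zero[OF K(1), of UNIV] dim by simp
    then have "(1::'a) \<in> {0}" by (rule subst) (rule UNIV_I)
    then show False by simp
  qed
  let ?Us = "map (\<lambda>i. \<pi> ^ i) [0..<N]"
  have indep: "T.independent K ?Us"
  proof (rule T.trivial_combine_imp_independent[OF K(1)])
    fix Ks assume Ks: "set Ks \<subseteq> K" "T.combine Ks ?Us = \<zero>\<^bsub>top_field\<^esub>"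
    let ?I = "{..<min (length Ks) N}" and ?f = "\<lambda>i. Ks ! i * \<pi> ^ i"
    have KsK: "Ks ! i \<in> K" if "i \<in> ?I" for i using Ks(1) that by (auto dest: nth_mem)
    have s0: "(\<Sum>i\<in>?I. ?f i) = 0" using Ks(2) by (simp add: combine_eq_sum)
    have z: "?f i = 0" if "i \<in> ?I" for i
    proof (rule ccontr)
      assume ne: "?f i \<noteq> 0"
      have dist: "i = j" if ij: "i \<in> ?I" "j \<in> ?I" "?f i \<noteq> 0" "?f j \<noteq> 0" "w (?f i) = w (?f j)" for i j
      proof -
        have nz: "Ks ! i \<noteq> 0" "Ks ! j \<noteq> 0" using ij by auto
        have "int i - int j = w (Ks ! j) - w (Ks ! i)" using ij(5) nz pi by (simp add: w_mult w_power)
        then have "int N dvd int i - int j" using wK KsK ij nz by (simp add: dvd_diff)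
        then have "[int i = int j] (mod int N)" by (simp add: cong_iff_dvd_diff)
        then show ?thesis using ij(1,2) by (simp add: cong_int_iff cong_less_modulus_unique_nat)
      qed
      have ex: "\<exists>i\<in>?I. ?f i \<noteq> 0" using ne that by blast
      show False
      proof (rule sum_distinct[OF _ _ ex])
        show "finite ?I" by simp
      next
        assume "sum ?f ?I \<noteq> 0"
        then show False using s0 by simp
      qed (rule dist)
    qed
    then have "Ks ! i = 0" if "i < length Ks" "i < N" for i using that pi by fastforce
    then show "set (take (length ?Us) Ks) \<subseteq> {\<zero>\<^bsub>top_field\<^esub>}" by (auto simp: in_set_conv_nth)
  qed simp
  have "T.Span K ?Us = UNIV"
    using T.independent_length_eq_dimension[OF K(1) dim indep] by simp
  then have "x \<in> T.Span K ?Us" by simp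
  then obtain Ks where Ks: "length Ks = N" "set Ks \<subseteq> K" "x = T.combine Ks ?Us"
    using T.Span_eq_combine_set_length_version[OF K(1), of ?Us] by auto
  have "x = (\<Sum>i<N. (if i < N then Ks ! i else 0) * \<pi> ^ i)"
    unfolding Ks(3) combine_eq_sum using Ks(1) by (intro sum.cong) simp_all
  moreover have "(if i < N then Ks ! i else 0) \<in> K" for i
    using Ks(1,2) by (auto dest: nth_mem)
  ultimately show "\<exists>k. (\<forall>i. k i \<in> K) \<and> x = (\<Sum>i<N. k i * \<pi> ^ i)"
    by (intro exI[of _ "\<lambda>i. if i < N then Ks ! i else 0"]) simp
qed

text \<open>For a normalized valuation the floor is taken of a number that is already an integer,
  except at 0, where the result is a default value.\<close>

definition int_val :: "('a::field \<Rightarrow> ereal) \<Rightarrow> 'a \<Rightarrow> int" where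
  "int_val v x = \<lfloor>real_of_ereal (v x)\<rfloor>"

lemma int_val:
  assumes "normalized_valuation K v" "x \<in> K"
  shows "v x = (if x = 0 then \<infinity> else ereal (of_int (int_val v x)))"
proof (cases "x = 0")
  case True
  then show ?thesis using assms by (simp add: normalized_valuation_def)
next
  case False
  then obtain m where "v x = ereal (of_int m)" using assms by (auto simp: normalized_valuation_def)
  then show ?thesis using False by (simp add: int_val_def)
qed

lemma valued_int_val:
  assumes v: "normalized_valuation UNIV v"
  shows "valued (int_val v)"
proof
  note iv = int_val[OF v UNIV_I]
  show "int_val v (x * y) = int_val v x + int_val v y" if "x \<noteq> 0" "y \<noteq> 0" for x y
  proof -
    have "v (x * y) = v x + v y" using v by (simp add: normalized_valuation_def)
    then have "real_of_int (int_val v (x * y)) = real_of_int (int_val v x) + real_of_int (int_val v y)"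
      using that by (simp add: iv)
    then show ?thesis by linarith
  qed
  show "min (int_val v x) (int_val v y) \<le> int_val v (x + y)" if "x \<noteq> 0" "y \<noteq> 0" "x + y \<noteq> 0" for x y
  proof -
    have "min (v x) (v y) \<le> v (x + y)" using v by (simp add: normalized_valuation_def)
    then show ?thesis using that by (simp add: iv min_def split: if_splits)
  qed
qed

lemma tot_ram_ext_Gal:
  assumes K: "local_field K vK" and F: "residue_field_in F K vK" and gal: "finite_galois K"
    and L: "normalized_valuation UNIV vL" and tr: "totally_ramified K vK vL"
    and fin: "finite (carrier (Gal K))" and pi: "vL \<pi> = 1"
  shows "tot_ram_ext (int_val vL) K F (ring.dim top_field K UNIV) \<pi> (carrier (Gal K))"
    and "\<And>x. x \<in> K \<Longrightarrow> x \<noteq> 0 \<Longrightarrow> int_val vL x = int (ring.dim top_field K UNIV) * int_val vK x"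
    and "ring.dim top_field K UNIV > 0"
proof -
  let ?N = "ring.dim top_field K UNIV"
  interpret valued "int_val vL" by (rule valued_int_val[OF L])
  interpret K: subfield_of_type K by (rule subfield_of_type.intro) (use K in \<open>simp add: local_field_def\<close>)
  interpret F: subfield_of_type F by (rule subfield_of_type.intro) (use F in \<open>simp add: residue_field_in_def\<close>)
  have nK: "normalized_valuation K vK" using K by (simp add: local_field_def)
  note iK = int_val[OF nK] and iL = int_val[OF L UNIV_I]
  show wK: "int_val vL x = int ?N * int_val vK x" if "x \<in> K" "x \<noteq> 0" for x
  proof -
    have "vL x = ereal (of_nat ?N) * vK x" using tr that by (simp add: totally_ramified_def)
    then have "real_of_int (int_val vL x) = real ?N * real_of_int (int_val vK x)"
      using that by (simp add: iL iK)
    then have "real_of_int (int_val vL x) = real_of_int (int ?N * int_val vK x)" by simp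
    then show ?thesis by (simp only: of_int_eq_iff)
  qed
  have FK: "F \<subseteq> K" using F by (simp add: residue_field_in_def)
  have p0: "\<pi> \<noteq> 0" using pi iL[of \<pi>] by auto
  have p1: "int_val vL \<pi> = 1" using pi by (simp add: int_val_def)
  have fd: "ring.finite_dimension top_field K UNIV" using gal by (simp add: finite_galois_def)
  note sp = powers_span[OF K.subfield_top fd refl _ p0 p1]
  show N0: "?N > 0" by (rule sp(1)) (simp add: wK)
  have pos: "vK x \<ge> 0 \<longleftrightarrow> vge x 0" "vK x > 0 \<longleftrightarrow> vge x 1" if "x \<in> K" for x
  proof -
    have "0 < int ?N * int_val vK x \<longleftrightarrow> 0 < int_val vK x" "0 \<le> int ?N * int_val vK x \<longleftrightarrow> 0 \<le> int_val vK x"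
      using N0 by (simp_all add: zero_less_mult_iff zero_le_mult_iff)
    then show "vK x \<ge> 0 \<longleftrightarrow> vge x 0" "vK x > 0 \<longleftrightarrow> vge x 1"
      using that wK[OF that] by (auto simp: vge_def iK int_one_le_iff_zero_less)
  qed
  have gs: "bij \<sigma>" "\<sigma> (x + y) = \<sigma> x + \<sigma> y" "\<sigma> (x * y) = \<sigma> x * \<sigma> y" "\<sigma> 1 = 1" "x \<in> K \<Longrightarrow> \<sigma> x = x"
    if "\<sigma> \<in> carrier (Gal K)" for \<sigma> x y using that by (auto simp: carrier_Gal)
  show "tot_ram_ext (int_val vL) K F ?N \<pi> (carrier (Gal K))"
  proof
    show "int_val vL x = 0" if x: "x \<in> F" "x \<noteq> 0" for x
    proof -
      have "vge y 0" if "y \<in> F" for y using F FK pos that by (auto simp: residue_field_in_def)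
      from this[OF x(1)] this[OF F.closed_inverse[OF x(1)]] x show ?thesis
        by (simp add: vge_def w_inverse)
    qed
    show "\<exists>c\<in>F. vge (x - c) 1" if x: "x \<in> K" "vge x 0" for x
    proof -
      have "\<forall>x\<in>K. vK x \<ge> 0 \<longrightarrow> (\<exists>c\<in>F. vK (x - c) > 0)"
        using F unfolding residue_field_in_def by (elim conjE)
      then have "\<exists>c\<in>F. vK (x - c) > 0" using x(1) pos(1)[OF x(1)] x(2) by simp
      then show ?thesis
      proof (rule bexE)
        fix c assume c: "c \<in> F" "vK (x - c) > 0"
        have "x - c \<in> K" using c(1) FK x(1) by (intro K.closed_diff) auto
        then show "\<exists>c\<in>F. vge (x - c) 1" using pos(2)[of "x - c"] c by (intro bexI[OF _ c(1)]) simp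
      qed
    qed
    show "\<exists>t\<in>K. t \<noteq> 0 \<and> int_val vL t = int ?N"
    proof -
      obtain t where t: "t \<in> K" "vK t = 1" using nK by (auto simp: normalized_valuation_def)
      then have "t \<noteq> 0" "int_val vK t = 1" using iK[OF t(1)] by (auto simp: int_val_def)
      then show ?thesis using t wK by auto
    qed
    show "\<exists>k. (\<forall>i. k i \<in> K) \<and> x = (\<Sum>i<?N. k i * \<pi> ^ i)" for x
      by (rule sp(2)) (simp add: wK)
    show "id \<in> carrier (Gal K)" by (simp add: carrier_Gal)
    show "\<sigma> \<circ> \<tau> \<in> carrier (Gal K)" if "\<sigma> \<in> carrier (Gal K)" "\<tau> \<in> carrier (Gal K)" for \<sigma> \<tau>
      using that by (auto simp: carrier_Gal bij_comp)
    show "\<exists>\<tau>\<in>carrier (Gal K). \<tau> \<circ> \<sigma> = id \<and> \<sigma> \<circ> \<tau> = id" if "\<sigma> \<in> carrier (Gal K)" for \<sigma>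
      using Gal_inv[OF that] gs(1)[OF that]
      by (intro bexI[of _ "inv_into UNIV \<sigma>"]) (simp_all add: bij_is_inj bij_is_surj surj_iff[symmetric])
    show "x \<in> K" if "\<And>\<sigma>. \<sigma> \<in> carrier (Gal K) \<Longrightarrow> \<sigma> x = x" for x
      using gal that by (auto simp: finite_galois_def)
  qed (use N0 FK p0 p1 fin wK gs in auto)
qed

text \<open>No index from -1 to b - 1 is a break, so the ramification group remains the whole Galois
  group up to index \<open>b\<close>.\<close>

lemma lower_ram_group_break:
  assumes br: "lower_ram_breaks K vL = {int b}" and G1: "lower_ram_group K vL (- 1) = carrier (Gal K)"
  shows "lower_ram_group K vL (int b) = carrier (Gal K)"
proof -
  \<comment> \<open>The shift by 1 lets the induction over natural numbers start at the index
    -1.\<close>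
  have "lower_ram_group K vL (int m - 1) = carrier (Gal K)" if "m \<le> b + 1" for m
    using that
  proof (induction m)
    case (Suc m)
    have "int m - 1 \<notin> lower_ram_breaks K vL" using br Suc.prems by simp
    then show ?case using Suc by (simp add: lower_ram_breaks_def)
  qed (use G1 in simp)
  from this[of "b + 1"] show ?thesis by simp
qed

theorem theorem4p5:
  fixes K F :: "'a::field set"
    and vK vL :: "'a \<Rightarrow> ereal"
    and p n b k :: nat
    and \<beta> :: 'a
    and \<omega> \<epsilon> :: "nat \<Rightarrow> 'a"
    and e :: "nat \<Rightarrow> ereal"
    and b_star :: ereal
    and B1 :: "ereal set"
  assumes "Factorial_Ring.prime p" and "CHAR('a) = p"
    and "local_field K vK"
    and "residue_field_in F K vK" and "perfect_char p F"
    and "n \<ge> 2"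
    and "finite_galois K"
    and "Gal K \<cong> product_group {1..n} (\<lambda>_. integer_mod_group p)"
    and "normalized_valuation UNIV vL"
    and "totally_ramified K vK vL"
    and "b > 0" and "lower_ram_breaks K vL = {int b}"
    and "artin_schreier_data p n b F K vK \<beta> \<omega> \<epsilon>"
    and "\<omega> 1 = 1" and "\<epsilon> 1 = 0"
    and "\<And>i. i \<in> {2..n} \<Longrightarrow> e i = - vK (\<epsilon> i)"
    and "e n < ereal (real b / real p ^ (n - 2))"
    and "\<And>i. i \<in> {2..n-1} \<Longrightarrow> e i < e n"
    and "b_star = min ((ereal (real b) - e n) * ereal (real p ^ (n - 1)) + ereal (real b))
                      (ereal (real b * real p ^ (n - 1)))"
    and "B1 = {ereal (real b * real p ^ i) | i. i \<le> n - 2} \<union> {b_star}"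
    and "2 \<le> k" and "k \<le> p"
  shows "vc_breaks_defined p n b F K vL k \<and> vc_breaks p n b F K vL k = B1 \<and>
         (\<lambda>h. ereal (of_int h)) ` ss_breaks p F K vL k = B1"
proof -
  note prime = assms(1) and char = assms(2) and K = assms(3) and F = assms(4) and perfect = assms(5)
    and n2 = assms(6) and gal = assms(7) and iso = assms(8) and L = assms(9) and tr = assms(10)
    and b0 = assms(11) and br = assms(12) and asd = assms(13) and om1 = assms(14) and ep1 = assms(15)
    and e_def = assms(16) and e_bd = assms(17) and e_less = assms(18)
  let ?w = "int_val vL" and ?N = "ring.dim top_field K UNIV" and ?G = "carrier (Gal K)"
  interpret P: prime_char p "TYPE('a)" by (rule prime_char.intro[OF prime char])
  note G = card_elementary_abelian[OF P.p_gt_0 iso]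
  obtain \<pi> where pi: "vL \<pi> = 1" using L by (auto simp: normalized_valuation_def)
  note tre = tot_ram_ext_Gal[OF K F gal L tr G(1) pi]
  interpret T: tot_ram_ext ?w K F ?N \<pi> ?G by (rule tre(1))
  have nK: "normalized_valuation K vK" using K by (simp add: local_field_def)
  note iK = int_val[OF nK] and iL = int_val[OF L UNIV_I]
  have vge_vL: "T.vge u m \<longleftrightarrow> ereal (of_int m) \<le> vL u" for u m
    by (simp add: T.vge_def iL)
  have vge_K: "T.vge u (int ?N * m) \<longleftrightarrow> (u \<noteq> 0 \<longrightarrow> m \<le> int_val vK u)" if "u \<in> K" for u m
    using tre(2)[OF that] tre(3) by (auto simp: T.vge_def)

  have "lower_ram_group K vL (- 1) = ?G"
  proof -
    have "0 \<le> vL (\<sigma> u - u)" if "\<sigma> \<in> ?G" "0 \<le> vL u" for \<sigma> u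
    proof -
      have "T.vge u 0" using that(2) vge_vL[of u 0] by (simp flip: zero_ereal_def)
      moreover have "T.vge (\<sigma> u) 0" using \<open>T.vge u 0\<close> that(1) by (auto simp: T.vge_def)
      ultimately have "T.vge (\<sigma> u - u) 0" by (intro T.vge_diff)
      then show ?thesis using vge_vL[of "\<sigma> u - u" 0] by (simp flip: zero_ereal_def)
    qed
    then show ?thesis by (auto simp: lower_ram_group_def simp flip: zero_ereal_def)
  qed
  then have Gb: "lower_ram_group K vL (int b) = ?G" by (rule lower_ram_group_break[OF br])
  have ram: "T.vge (\<sigma> \<pi> - \<pi>) (int b + 1)" if "\<sigma> \<in> ?G" for \<sigma>
  proof -
    have "\<sigma> \<in> lower_ram_group K vL (int b)" using that Gb by simp
    then show ?thesis unfolding vge_vL lower_ram_group_def using pi by simp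
  qed

  have be: "\<beta> \<in> K" "vK \<beta> = - ereal (of_nat b)" and om_F: "\<And>i. i \<in> {1..n} \<Longrightarrow> \<omega> i \<in> F"
    and om_indep: "\<And>c. (\<forall>i\<in>{1..n}. c i \<in> \<int>) \<and> (\<Sum>i=1..n. c i * \<omega> i) = 0 \<longrightarrow> (\<forall>i\<in>{1..n}. c i = 0)"
    and ep_K: "\<And>i. i \<in> {1..n} \<Longrightarrow> \<epsilon> i \<in> K"
    and ep: "\<And>i. i \<in> {1..n} \<Longrightarrow>
      (\<exists>m::int. vK (\<epsilon> i) = ereal (of_int m) \<and> m < 0 \<and> \<not> int p dvd m) \<or> \<epsilon> i \<in> F"
    using asd unfolding artin_schreier_data_def by simp_all
  have "\<exists>x :: nat \<Rightarrow> 'a. (\<forall>i\<in>{1..n}. x i ^ p - x i = \<omega> i ^ (p ^ n) * \<beta> + \<epsilon> i) \<and>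
      generate_field top_field (K \<union> x ` {1..n}) = UNIV"
    using asd unfolding artin_schreier_data_def by (elim conjE)
  then obtain x where AS': "\<forall>i\<in>{1..n}. x i ^ p - x i = \<omega> i ^ (p ^ n) * \<beta> + \<epsilon> i"
    and gen: "generate_field top_field (K \<union> x ` {1..n}) = UNIV"
    by (elim exE conjE) (rule that)
  note AS = bspec[OF AS']
  have be0: "\<beta> \<noteq> 0" using be iK[of \<beta>] by auto
  have wbe: "?w \<beta> = - int (b * ?N)"
  proof -
    have "real_of_int (int_val vK \<beta>) = real_of_int (- int b)" using be(2) iK[OF be(1)] be0 by simp
    then have "int_val vK \<beta> = - int b" by (simp only: of_int_eq_iff)
    then show ?thesis using tre(2)[OF be(1) be0] by simp
  qed

  have nn: "n \<in> {1..n}" using n2 by simp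
  have en: "e n = - vK (\<epsilon> n)" using e_def n2 by simp
  have lt: "vK (\<epsilon> n) < vK (\<epsilon> i)" if "i \<in> {2..n-1}" for i
    using e_less[OF that] e_def[of i] that en by auto
  have i_cases: "i = n \<or> i \<in> {2..n-1}" if "i \<in> {1..n}" "\<epsilon> i \<noteq> 0" for i
  proof -
    have "i \<noteq> 1" using that(2) ep1 by auto
    then show ?thesis using that(1) by auto
  qed
  have i_in: "i \<in> {1..n}" if "i \<in> {2..n-1}" for i using that by auto
  let ?P = "real p ^ (n - 1)"
  have P0: "?P > 0" using P.p_gt_0 by simp

  \<comment> \<open>\<open>E\<close> is the positive part of e n. It is 0 when
    \<open>\<epsilon> n\<close> is a constant; then e n is 0 or, if \<open>\<epsilon> n\<close> is
    0, minus infinity.\<close>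
  obtain E :: nat where E1: "E * p ^ (n - 2) < b"
    and E2: "\<And>i. i \<in> {1..n} \<Longrightarrow> \<epsilon> i \<noteq> 0 \<Longrightarrow> - int E \<le> int_val vK (\<epsilon> i)"
    and E3: "E > 0 \<Longrightarrow> \<epsilon> n \<noteq> 0 \<and> int_val vK (\<epsilon> n) = - int E \<and> \<not> p dvd E"
    and E4: "\<And>i. E > 0 \<Longrightarrow> i \<in> {1..n-1} \<Longrightarrow> \<epsilon> i \<noteq> 0 \<Longrightarrow> - int E + 1 \<le> int_val vK (\<epsilon> i)"
    and E5: "b_star = ereal (of_int (min (int (b * p ^ (n - 1)) - int (E * p ^ (n - 1)) + int b) (int (b * p ^ (n - 1)))))"
    using ep[OF nn]
  proof
    assume "\<exists>m::int. vK (\<epsilon> n) = ereal (of_int m) \<and> m < 0 \<and> \<not> int p dvd m"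
    then obtain m :: int where m: "vK (\<epsilon> n) = ereal (of_int m)" "m < 0" "\<not> int p dvd m" by blast
    define E where "E = nat (- m)"
    have mE: "m = - int E" and E0: "E > 0" using m(2) by (simp_all add: E_def)
    have ne: "\<epsilon> n \<noteq> 0" using m(1) iK[OF ep_K[OF nn]] by auto
    have "int_val vK (\<epsilon> n) = m" using m(1) by (simp add: int_val_def)
    then have iv: "int_val vK (\<epsilon> n) = - int E" using mE by simp
    have enE: "e n = ereal (real E)" unfolding en m(1) mE by simp
    have less: "- int E < int_val vK (\<epsilon> i)" if "i \<in> {2..n-1}" "\<epsilon> i \<noteq> 0" for i
    proof -
      have "ereal (of_int m) < ereal (of_int (int_val vK (\<epsilon> i)))"
        using lt[OF that(1)] that(2) m(1) iK[OF ep_K[OF i_in[OF that(1)]]] by simp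
      then have "m < int_val vK (\<epsilon> i)" by simp
      then show ?thesis using mE by simp
    qed
    show ?thesis
    proof (rule that)
      have "real E * real p ^ (n - 2) < real b"
        using e_bd P.p_gt_0 unfolding enE by (simp add: less_divide_eq)
      then have "real (E * p ^ (n - 2)) < real b" by simp
      then show "E * p ^ (n - 2) < b" by (simp only: of_nat_less_iff)
      show "- int E \<le> int_val vK (\<epsilon> i)" if "i \<in> {1..n}" "\<epsilon> i \<noteq> 0" for i
        using i_cases[OF that] less[OF _ that(2)] iv by auto
      show "\<epsilon> n \<noteq> 0 \<and> int_val vK (\<epsilon> n) = - int E \<and> \<not> p dvd E"
        using ne iv m(3) mE by simp
      show "- int E + 1 \<le> int_val vK (\<epsilon> i)" if "i \<in> {1..n-1}" "\<epsilon> i \<noteq> 0" for i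
      proof -
        have "i \<in> {1..n}" "i \<noteq> n" using that(1) by auto
        then have "i \<in> {2..n-1}" using i_cases[OF _ that(2)] by blast
        from less[OF this that(2)] show ?thesis by simp
      qed
      have "b_star = ereal (min ((real b - real E) * ?P + real b) (real b * ?P))"
        unfolding assms(19) enE by (simp add: min_def)
      also have "min ((real b - real E) * ?P + real b) (real b * ?P) =
          of_int (min (int (b * p ^ (n - 1)) - int (E * p ^ (n - 1)) + int b) (int (b * p ^ (n - 1))))"
        by (simp add: of_int_min left_diff_distrib)
      finally show "b_star = ereal (of_int (min (int (b * p ^ (n - 1)) - int (E * p ^ (n - 1)) + int b) (int (b * p ^ (n - 1)))))" .
    qed
  next
    assume eF: "\<epsilon> n \<in> F"
    have v0: "0 \<le> vK (\<epsilon> n)" using F eF by (simp add: residue_field_in_def)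
    then have e0: "e n \<le> 0" unfolding en by (simp add: ereal_uminus_le_reorder)
    show ?thesis
    proof (rule that[of 0])
      \<comment> \<open>Since e i < e n <= 0 for the other indices, all the
        \<open>\<epsilon> i\<close> are integral.\<close>
      show "- int 0 \<le> int_val vK (\<epsilon> i)" if i: "i \<in> {1..n}" "\<epsilon> i \<noteq> 0" for i
      proof -
        have "0 \<le> vK (\<epsilon> i)" using i_cases[OF i] v0 lt[of i] by auto
        then show ?thesis using iK[OF ep_K[OF i(1)]] i(2) by simp
      qed
      \<comment> \<open>With e n <= 0 the second entry of the minimum is the smaller one, as it is
        for E = 0, so the formulas for the exceptional break agree.\<close>
      have "ereal (real b * ?P) \<le> (ereal (real b) - e n) * ereal ?P + ereal (real b)"
      proof (cases "e n")
        case (real r)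
        then have "r \<le> 0" using e0 by simp
        then have "r * ?P \<le> 0" using P0 by (intro mult_nonpos_nonneg) auto
        then show ?thesis unfolding real by (simp add: left_diff_distrib)
      next
        case PInf
        then show ?thesis using e0 by simp
      next
        case MInf
        then show ?thesis using P0 P.p_gt_0 by simp
      qed
      then have "b_star = ereal (real b * ?P)" unfolding assms(19) by (simp add: min_def)
      then show "b_star = ereal (of_int (min (int (b * p ^ (n - 1)) - int (0 * p ^ (n - 1)) + int b) (int (b * p ^ (n - 1)))))"
        by (simp add: min_def)
    qed (use b0 in simp_all)
  qed

  interpret A: as_ext ?w K F ?N \<pi> ?G p n b E \<beta> \<omega> \<epsilon> x
  proof (intro as_ext.intro as_ext_axioms.intro T.tot_ram_ext_axioms P.prime_char_axioms)
    show "\<exists>d\<in>F. d ^ p = c" if "c \<in> F" for c using perfect that by (simp add: perfect_char_def)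
    show "a i = 0" if "\<And>i. i \<in> {1..n} \<Longrightarrow> a i \<in> \<int>" "(\<Sum>i=1..n. a i * \<omega> i) = 0" "i \<in> {1..n}" for a i
      using om_indep[of a] that by blast
    show "T.vge (\<epsilon> i) (- int (E * ?N))" if "i \<in> {1..n}" for i
      using vge_K[OF ep_K[OF that], of "- int E"] E2[OF that] by (simp add: mult.commute)
    show "\<epsilon> n \<noteq> 0 \<and> ?w (\<epsilon> n) = - int (E * ?N) \<and> \<not> p dvd E" if "E > 0"
      using E3[OF that] tre(2)[OF ep_K[OF nn]] by simp
    show "T.vge (\<epsilon> i) (- int (E * ?N) + 1)" if "E > 0" "i \<in> {1..n-1}" for i
    proof -
      have i: "i \<in> {1..n}" using that by auto
      have "T.vge (\<epsilon> i) (int ?N * (- int E + 1))" using vge_K[OF ep_K[OF i]] E4[OF that] by blast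
      then show ?thesis by (rule T.vge_mono) (use tre(3) in \<open>simp add: algebra_simps\<close>)
    qed
    show "\<sigma> = id" if s: "\<sigma> \<in> ?G" "\<And>i. i \<in> {1..n} \<Longrightarrow> \<sigma> (x i) = x i" for \<sigma>
    proof
      fix u
      have "\<sigma> u = u"
      proof (rule generate_field_fixed[OF s(1)])
        show "\<sigma> v = v" if "v \<in> K \<union> x ` {1..n}" for v using that s T.G_K by auto
      qed (use gen in simp)
      then show "\<sigma> u = id u" by simp
    qed
  qed (fact G(2) n2 b0 be(1) be0 wbe om_F ep_K E1 AS om1 ep1 ram)+

  from A.exists_scaffold obtain a z d where
    sc1: "\<forall>j\<in>{1..n}. (\<forall>i. a j i \<in> F) \<and> (\<forall>i. i \<notin> {1..j} \<longrightarrow> a j i = 0) \<and> a j j = 1" and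
    sc2: "\<forall>j\<in>{1..n-1}. (\<Sum>i=1..n. a j i * x i) \<noteq> 0 \<and>
      ?w (\<Sum>i=1..n. a j i * x i) = - int (b * p ^ (n - j))" and
    sc3: "(\<Sum>i=1..n. a n i * x i) - z \<noteq> 0" "?w ((\<Sum>i=1..n. a n i * x i) - z) = - int b" and
    sc4: "A.zder z d (- int (E * p ^ (n - 1)))" and
    sc5: "z = 0 \<and> d = 0 \<and> E * p ^ (n - 1) < b \<or>
     b < E * p ^ (n - 1) \<and> z \<noteq> 0 \<and> ?w z = - int (E * p ^ (n - 1)) \<and> d \<noteq> 0 \<and>
       ?w d = - int (E * p ^ (n - 1)) + A.h1"
    by (elim exE conjE) (rule that)
  interpret S: scaffold ?w K F ?N \<pi> ?G p n b E \<beta> \<omega> \<epsilon> x k a z d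
  proof (intro scaffold.intro A.as_ext_axioms scaffold_axioms.intro)
    show "a j i \<in> F" "a j j = 1" if "j \<in> {1..n}" for i j using sc1 that by blast+
    show "a j i = 0" if "j \<in> {1..n}" "i \<notin> {1..j}" for i j using sc1 that by blast
    show "(\<Sum>i=1..n. a j i * x i) \<noteq> 0 \<and> ?w (\<Sum>i=1..n. a j i * x i) = - int (b * p ^ (n - j))"
      if "j \<in> {1..n-1}" for j using sc2 that by blast
  qed (fact assms(21,22) conjI[OF sc3] sc4 sc5)+
  have GM: "Gal K = S.GM" unfolding S.GM_def by (simp add: Gal_def)
  have val: "S.val = vL" by (rule ext) (simp add: S.val_def iL)
  have "b_star = ereal (of_int (S.brk 1))" unfolding S.brk_1 A.h1_def by (rule E5)
  then have "B1 = (\<lambda>j. ereal (of_int (S.brk j))) ` {1..n}" unfolding S.brk_image assms(20) by simp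
  from S.refined_breaks[OF GM this] show ?thesis unfolding val .
qed

end
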